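(* Let $\varphi,\psi$ be Hilbert functions of degree $n$ such that $(\varphi,\psi)$ has type zero. Then $H_{\varphi}\subset\overline{H_{\psi}}$, where the closure is taken in $\operatorname{Hilb}_n(\mathbb{P}^2)$.
   Context: $k$ is an algebraically closed field of characteristic zero, $A=k[x,y,z]$ with the standard grading, and $\operatorname{Hilb}_n(\mathbb{P}^2)$ is the Hilbert scheme of zero-dimensional subschemes of length $n$ in $\mathbb{P}^2=\mathbb{P}^2_k$. For $X\in\operatorname{Hilb}_n(\mathbb{P}^2)$ with ideal sheaf $\mathcal{I}_X$, put $I_X=\bigoplus_m H^0(\mathbb{P}^2,\mathcal{I}_X(m))\subset A$ and let $h_X$ be the Hilbert function of $A/I_X$. A Hilbert function of degree $n$ is a function of the form $h_X$ with $X\in\operatorname{Hilb}_n(\mathbb{P}^2)$. For such a function $\varphi$ put $H_{\varphi}=\{X\in\operatorname{Hilb}_n(\mathbb{P}^2)\mid h_X=\varphi\}$, and let $s_\varphi(m)=\varphi(m)-\varphi(m-1)$ be the associated Castelnuovo function, visualized as a staircase diagram with $s_\varphi(m)$ unit squares in column $m$. The pair $(\varphi,\psi)$ has type zero if the diagram of $\psi$ is obtained from that of $\varphi$ by moving one square two columns to the left, in the following configuration: there are integers $u\ge 2$ and $h\ge 1$ such that, with $s=s_{\varphi}$, $$s(u-2)=s(u-1)\ge h+1,\qquad s(u)=s(u+1)=s(u+2)=h,\qquad s(u+3)=s(u+4)=h-1,$$ and $s_{\psi}(u)=s(u)+1$, $s_{\psi}(u+2)=s(u+2)-1$, and $s_{\psi}(m)=s(m)$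 for all $m\ne u,u+2$. *)

theory Defs
  imports
    "HOL-Library.Poly_Mapping"
    "HOL-Analysis.Abstract_Topology"
    "Jordan_Normal_Form.Determinant"
begin

type_synonym 'v mon = "'v \<Rightarrow>\<^sub>0 nat"
type_synonym ('v, 'k) mpoly = "'v mon \<Rightarrow>\<^sub>0 'k"

text \<open>
  The variables \<open>x\<close>, \<open>y\<close>, \<open>z\<close>; thus \<open>'k coord_ring\<close> is the ring \<open>A = k[x,y,z]\<close>.
\<close>
datatype var = VX | VY | VZ

type_synonym 'k coord_ring = "(var, 'k) mpoly"

definition mon_degree :: "'v mon \<Rightarrow> nat" where
  "mon_degree t = (\<Sum>v\<in>Poly_Mapping.keys t. Poly_Mapping.lookup t v)"

definition mpoly_var :: "'v \<Rightarrow> ('v, 'k :: field) mpoly" where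
  "mpoly_var v = Poly_Mapping.single (Poly_Mapping.single v 1) 1"

definition mpoly_scale :: "'k :: field \<Rightarrow> ('v, 'k) mpoly \<Rightarrow> ('v, 'k) mpoly" where
  "mpoly_scale c f = Poly_Mapping.single 0 c * f"

definition mpoly_eval :: "('v \<Rightarrow> 'k) \<Rightarrow> ('v, 'k :: field) mpoly \<Rightarrow> 'k" where
  "mpoly_eval p f = (\<Sum>t\<in>Poly_Mapping.keys f. Poly_Mapping.lookup f t *
                      (\<Prod>v\<in>Poly_Mapping.keys t. p v ^ Poly_Mapping.lookup t v))"

definition homogeneous_part :: "nat \<Rightarrow> ('v, 'k :: field) mpoly set" where
  "homogeneous_part d = {f. \<forall>t\<in>Poly_Mapping.keys f. mon_degree t = d}"

definition homogeneous_component :: "nat \<Rightarrow> ('v, 'k :: field) mpoly \<Rightarrow> ('v, 'k) mpoly" where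
  "homogeneous_component d f =
     (\<Sum>t | t \<in> Poly_Mapping.keys f \<and> mon_degree t = d.
        Poly_Mapping.single t (Poly_Mapping.lookup f t))"

text \<open>
  Two structures on polynomials: the \<open>k\<close>-vector space (\<open>kvec.subspace\<close>, \<open>kvec.dim\<close>) and the
  regular module, whose submodules (\<open>ideal.subspace\<close>) are the ideals.
\<close>
interpretation kvec: vector_space "mpoly_scale :: 'k :: field \<Rightarrow> ('v, 'k) mpoly \<Rightarrow> ('v, 'k) mpoly"
  by unfold_locales
     (simp_all add: mpoly_scale_def distrib_left distrib_right single_add mult_single
        flip: mult.assoc)

interpretation ideal: Modules.module "(*) :: 'a :: comm_ring_1 \<Rightarrow> 'a \<Rightarrow> 'a"
  by unfold_locales (simp_all add: algebra_simps)

text \<open>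
  Let \<open>J\<close> be a homogeneous ideal of \<open>A\<close> with associated ideal sheaf \<open>J~\<close> on the plane. A form
  \<open>f \<in> A\<^sub>m = H\<^sup>0(O(m))\<close> is a section of \<open>J~(m)\<close> iff for each variable \<open>v\<close> it lies in the
  localisation \<open>J\<^sub>v\<close>, i.e. iff some \<open>v\<^sup>N f\<close> lies in \<open>J\<close>. Hence \<open>saturation J\<close> is the direct sum
  of all \<open>H\<^sup>0(J~(m))\<close>.
\<close>
definition saturation :: "'k :: field coord_ring set \<Rightarrow> 'k coord_ring set" where
  "saturation J = {f. \<forall>v. \<exists>N. mpoly_var v ^ N * f \<in> J}"

definition homogeneous_ideal :: "'k :: field coord_ring set \<Rightarrow> bool" where
  "homogeneous_ideal J \<longleftrightarrow>
     ideal.subspace J \<and> (\<forall>f\<in>J. \<forall>d. homogeneous_component d f \<in> J)"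

text \<open>The Hilbert function \<open>m \<mapsto> dim (A/J)\<^sub>m\<close>; all spaces involved are finite-dimensional.\<close>
definition hilbert_function :: "'k :: field coord_ring set \<Rightarrow> nat \<Rightarrow> nat" where
  "hilbert_function J m =
     kvec.dim (homogeneous_part m :: 'k coord_ring set) - kvec.dim (J \<inter> homogeneous_part m)"

text \<open>
  A closed subscheme \<open>X\<close> of the plane is represented by its ideal \<open>I\<^sub>X\<close>, the direct sum of all
  \<open>H\<^sup>0(I\<^sub>X(m))\<close>. This is the usual bijection between closed subschemes and homogeneous ideals
  \<open>I\<close> with \<open>saturation I = I\<close>. \<open>X\<close> is zero-dimensional of length \<open>n\<close> (empty if \<open>n = 0\<close>) iff its
  Hilbert polynomial is the constant \<open>n\<close>. Only the closed points of the Hilbert scheme are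
  considered, i.e. the subschemes defined over the algebraically closed field \<open>k\<close> itself.
\<close>
definition Hilb :: "nat \<Rightarrow> 'k :: field coord_ring set set" where
  "Hilb n = {I. homogeneous_ideal I \<and> saturation I = I \<and>
                (\<exists>m0. \<forall>m\<ge>m0. hilbert_function I m = n)}"

definition Hilb_stratum :: "nat \<Rightarrow> (nat \<Rightarrow> nat) \<Rightarrow> 'k :: field coord_ring set set" where
  "Hilb_stratum n \<phi> = {X \<in> Hilb n. hilbert_function X = \<phi>}"

definition grassmannian :: "nat \<Rightarrow> nat \<Rightarrow> 'k :: field coord_ring set set" where
  "grassmannian n m = {W. kvec.subspace W \<and> W \<subseteq> homogeneous_part m \<and>
     kvec.dim (homogeneous_part m :: 'k coord_ring set) = kvec.dim W + n}"

text \<open>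
  Let \<open>W\<close> be a subspace of \<open>A\<^sub>m\<close> of codimension \<open>n\<close>, written as the common kernel of linear forms
  \<open>l 0, \<dots>, l (n - 1)\<close>. The Pluecker coordinates of \<open>W\<close> are the maximal minors of the matrix of
  these forms with respect to the monomial basis. They are indexed by lists of \<open>n\<close> monomials of
  degree \<open>m\<close>, in any order and with repetitions allowed (so they are alternating in the index);
  at other indices the coordinate is set to 0. A different choice of the \<open>l i\<close> multiplies all
  coordinates by a common non-zero factor.
\<close>
definition plucker_coords ::
    "nat \<Rightarrow> nat \<Rightarrow> 'k :: field coord_ring set \<Rightarrow> (var mon list \<Rightarrow> 'k) \<Rightarrow> bool" where
  "plucker_coords n m W p \<longleftrightarrow>
     (\<exists>l :: nat \<Rightarrow> 'k coord_ring \<Rightarrow> 'k.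
        (\<forall>i<n. Vector_Spaces.linear mpoly_scale (*) (l i)) \<and>
        W = {f \<in> homogeneous_part m. \<forall>i<n. l i f = 0} \<and>
        p = (\<lambda>ts. if length ts = n \<and> (\<forall>t\<in>set ts. mon_degree t = m)
                  then Determinant.det (mat n n (\<lambda>(i, j). l i (Poly_Mapping.single (ts ! j) 1)))
                  else 0))"

text \<open>
  The basic open sets of the Zariski topology are the non-vanishing loci of homogeneous polynomials
  in the Pluecker coordinates. By homogeneity the choice of \<open>p\<close> does not matter.
\<close>
definition grassmannian_topology :: "nat \<Rightarrow> nat \<Rightarrow> 'k :: field coord_ring set topology" where
  "grassmannian_topology n m = topology_generated_by
     {{W \<in> grassmannian n m. \<exists>p. plucker_coords n m W p \<and> mpoly_eval p F \<noteq> 0}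
        | F :: (var mon list, 'k) mpoly. \<exists>d. F \<in> homogeneous_part d}"

text \<open>
  The Hilbert scheme of \<open>n\<close> points is constructed as a closed subscheme of a Grassmannian, a point
  \<open>I\<close> being sent to \<open>I\<^sub>m\<close>, where \<open>m\<close> is any integer that is at least the Gotzmann number of the
  Hilbert polynomial; for the constant polynomial \<open>n\<close> this number is \<open>n\<close>.
\<close>
definition Hilb_topology :: "nat \<Rightarrow> 'k :: field coord_ring set topology" where
  "Hilb_topology n =
     pullback_topology (Hilb n) (\<lambda>I. I \<inter> homogeneous_part n) (grassmannian_topology n n)"

text \<open>Hilbert functions are zero in negative degrees, whence the case \<open>m = 0\<close>.\<close>
definition castelnuovo :: "(nat \<Rightarrow> nat) \<Rightarrow> nat \<Rightarrow> int" where
  "castelnuovo \<phi> m = int (\<phi> m) - (if m = 0 then 0 else int (\<phi> (m - 1)))"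

definition type_zero :: "(nat \<Rightarrow> nat) \<Rightarrow> (nat \<Rightarrow> nat) \<Rightarrow> bool" where
  "type_zero \<phi> \<psi> \<longleftrightarrow>
     (\<exists>(u :: nat) (h :: int). u \<ge> 2 \<and> h \<ge> 1 \<and>
        castelnuovo \<phi> (u - 2) = castelnuovo \<phi> (u - 1) \<and>
        castelnuovo \<phi> (u - 1) \<ge> h + 1 \<and>
        castelnuovo \<phi> u = h \<and> castelnuovo \<phi> (u + 1) = h \<and> castelnuovo \<phi> (u + 2) = h \<and>
        castelnuovo \<phi> (u + 3) = h - 1 \<and> castelnuovo \<phi> (u + 4) = h - 1 \<and>
        castelnuovo \<psi> u = castelnuovo \<phi> u + 1 \<and>
        castelnuovo \<psi> (u + 2) = castelnuovo \<phi> (u + 2) - 1 \<and>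
        (\<forall>m. m \<noteq> u \<and> m \<noteq> u + 2 \<longrightarrow> castelnuovo \<psi> m = castelnuovo \<phi> m))"

end

theory Submission
  imports Defs "Jordan_Normal_Form.Char_Poly"
begin

text \<open>
  Choose the line at infinity disjoint from \<open>X\<close>, and let \<open>\<aa> \<subseteq> k[x,y]\<close> be the affine ideal of \<open>X\<close>,
  filtered by the total degree. It is the direct sum of \<open>k[x,y] f\<close>, where \<open>f\<close> is monic in \<open>x\<close> of
  degree \<open>\<alpha>\<close>, and of the \<open>k[y] q\<^sub>i\<close> for \<open>i < \<alpha>\<close>, where \<open>q\<^sub>i\<close> has degree \<open>e\<^sub>i\<close> and the leading forms of
  the \<open>q\<^sub>i\<close> are independent. The numbers \<open>\<alpha>\<close> and \<open>e\<^sub>i\<close> determine the Hilbert function. Writing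
  \<open>x q = T q + f \<delta>\<close> with a matrix \<open>T\<close> over \<open>k[y]\<close>, one has \<open>f = det (x - T)\<close>, and Cramer's rule
  gives \<open>q\<close>; hence \<open>X\<close> can be deformed by perturbing \<open>T\<close> within the degree bounds.

  For \<open>(\<phi>, \<psi>)\<close> of type zero the value \<open>u\<close> occurs among the \<open>e\<^sub>i\<close>, the value \<open>u + 3\<close> occurs exactly
  once, for \<open>i = r\<close>, and \<open>u - 1\<close>, \<open>u + 1\<close>, \<open>u + 2\<close>, \<open>u + 4\<close> do not occur; the numbers for \<open>\<psi>\<close> arise
  by replacing one \<open>u\<close>, at \<open>i = p\<close> say, and \<open>u + 3\<close> by \<open>u + 1\<close> and \<open>u + 2\<close>. After a general
  perturbation of \<open>T\<close> and a base change among the \<open>q\<^sub>i\<close> of degree \<open>u\<close> there is a value \<open>a\<close> of \<open>y\<close> for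
  which the \<open>p\<close>-th unit vector is an eigenvector, with eigenvalue \<open>T\<^sub>r\<^sub>r(a)\<close>, of the block of \<open>T(a)\<close> that
  belongs to the degrees at most \<open>u\<close>, and \<open>T\<^sub>r\<^sub>p(a)\<close> is non-zero. The ideal is then the limit at \<open>\<tau> = 0\<close> of an explicit
  family with Hilbert function \<open>\<psi>\<close>. In that family the elements of degree \<open>u + 1\<close> and \<open>u + 2\<close> tend
  to multiples of \<open>q\<^sub>p\<close>, so that a combination of them can be divided by \<open>\<tau>\<close>; the quotient tends
  to \<open>q\<^sub>r\<close>.
\<close>

text \<open>Two demands shape the family: its matrix must be polynomial in \<tau> within the degree
  bounds, and at \<tau> = 0 its characteristic polynomial must be \<open>f\<close> again. Put
  \<open>l = y - a\<close>. In the limit the generators of degrees u + 1 and u + 2 are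
  \<open>l q_p\<close> and \<open>lam q_p\<close>. They satisfy a system with diagonal entries
  \<open>T p p\<close> and \<open>T r r\<close> only if l divides column p in the other rows of
  degree at most u, and divides \<open>T p p - T r r\<close>; this is the eigenvector condition at y
  = a. Such an a exists because the block of degree u is at most linear in y: its pencil is singular
  somewhere once the perturbation makes the leading coefficient of the determinant nonzero. In the
  relation for \<open>q_r\<close>, recovered after division by \<tau>, \<open>lam\<close> occurs
  twice, so its square must be \<open>T r p\<close> at a. The gaps in the degrees act through one
  fact: \<open>T i j = 0\<close> if e j > e i + 1, which makes T block triangular. Closures are
  treated without limits of subspaces. It suffices to lift each element of degree at most n
  polynomially in \<tau>: the dimensions in degree n agree, and Pluecker coordinates then become
  polynomial in \<tau>.\<close>

section \<open>Total degree and polynomial families\<close>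

text \<open>
  As a simplification rule, this instance of \<open>a * (b * x) = (a * b) * x\<close> would loop with
  \<open>algebra_simps\<close>.
\<close>
declare ideal.scale_scale [simp del]

text \<open>
  Elements of \<open>'k poly poly\<close> are polynomials in \<open>x\<close>, the outer variable, and \<open>y\<close>. The degree bound is
  an integer, since the differences that bound the entries of \<open>T\<close> can be negative.
\<close>
definition tdeg_le :: "int \<Rightarrow> 'k :: zero poly poly \<Rightarrow> bool" where
  "tdeg_le d p \<longleftrightarrow> (\<forall>i j. coeff (coeff p i) j \<noteq> 0 \<longrightarrow> int i + int j \<le> d)"

lemma tdeg_leD: "tdeg_le d p \<Longrightarrow> coeff (coeff p i) j \<noteq> 0 \<Longrightarrow> int i + int j \<le> d"
  by (auto simp: tdeg_le_def)

lemma tdeg_le_coeff_eq_0: "tdeg_le d p \<Longrightarrow> d < int i + int j \<Longrightarrow> coeff (coeff p i) j = 0"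
  by (force simp: tdeg_le_def)

lemma tdeg_le_0 [simp]: "tdeg_le d 0"
  by (simp add: tdeg_le_def)

lemma tdeg_le_mono: "tdeg_le d p \<Longrightarrow> d \<le> d' \<Longrightarrow> tdeg_le d' p"
  by (force simp: tdeg_le_def)

lemma tdeg_le_add: "tdeg_le d p \<Longrightarrow> tdeg_le d q \<Longrightarrow> tdeg_le d (p + q)"
  for p :: "'k :: comm_monoid_add poly poly"
  unfolding tdeg_le_def coeff_add by (metis add.right_neutral)

lemma tdeg_le_minus: "tdeg_le d p \<Longrightarrow> tdeg_le d (- p)" for p :: "'k :: ab_group_add poly poly"
  by (simp add: tdeg_le_def)

lemma tdeg_le_diff: "tdeg_le d p \<Longrightarrow> tdeg_le d q \<Longrightarrow> tdeg_le d (p - q)"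
  for p :: "'k :: ab_group_add poly poly"
  using tdeg_le_add[of d p "- q"] tdeg_le_minus[of d q] by simp

lemma tdeg_le_sum: "(\<And>i. i \<in> A \<Longrightarrow> tdeg_le d (g i)) \<Longrightarrow> tdeg_le d (sum g A)"
  for g :: "'a \<Rightarrow> 'k :: comm_monoid_add poly poly"
  by (induction A rule: infinite_finite_induct) (auto intro: tdeg_le_add)

lemma tdeg_le_mult:
  fixes p q :: "'k :: comm_semiring_0 poly poly"
  assumes "tdeg_le d p" "tdeg_le d' q"
  shows "tdeg_le (d + d') (p * q)"
  unfolding tdeg_le_def
proof (intro allI impI)
  fix i j assume "coeff (coeff (p * q) i) j \<noteq> 0"
  then have "(\<Sum>k\<le>i. \<Sum>l\<le>j. coeff (coeff p k) l * coeff (coeff q (i - k)) (j - l)) \<noteq> 0"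
    by (simp add: coeff_mult coeff_sum)
  then obtain k where k: "k \<le> i" "(\<Sum>l\<le>j. coeff (coeff p k) l * coeff (coeff q (i - k)) (j - l)) \<noteq> 0"
    by (meson atMost_iff sum.not_neutral_contains_not_neutral)
  then obtain l where l: "l \<le> j" "coeff (coeff p k) l * coeff (coeff q (i - k)) (j - l) \<noteq> 0"
    by (meson atMost_iff sum.not_neutral_contains_not_neutral)
  then have "coeff (coeff p k) l \<noteq> 0" "coeff (coeff q (i - k)) (j - l) \<noteq> 0"
    by auto
  then have "int k + int l \<le> d" "int (i - k) + int (j - l) \<le> d'"
    using assms tdeg_leD by blast+
  with k l show "int i + int j \<le> d + d'" by simp
qed

lemma tdeg_le_const: "tdeg_le d [:b:] \<longleftrightarrow> (\<forall>j. coeff b j \<noteq> 0 \<longrightarrow> int j \<le> d)"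
  by (auto simp: tdeg_le_def coeff_pCons split: nat.splits)

lemma tdeg_le_1: "tdeg_le 0 (1 :: 'k :: comm_semiring_1 poly poly)"
  unfolding one_pCons tdeg_le_const by (auto simp: coeff_pCons split: nat.splits)

lemma tdeg_le_scalar: "0 \<le> d \<Longrightarrow> tdeg_le d [:[:c:]:]"
  unfolding tdeg_le_const by (auto simp: coeff_pCons split: nat.splits)

lemma tdeg_le_x: "1 \<le> d \<Longrightarrow> tdeg_le d ([:0, 1:] :: 'k :: comm_semiring_1 poly poly)"
  by (auto simp: tdeg_le_def one_pCons coeff_pCons split: nat.splits)

lemma tdeg_le_y: "1 \<le> d \<Longrightarrow> tdeg_le d [:[:c, c':]:]"
  unfolding tdeg_le_const by (auto simp: coeff_pCons split: nat.splits)

lemma tdeg_le_prod: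
  fixes g :: "'a \<Rightarrow> 'k :: comm_semiring_1 poly poly"
  assumes "\<And>i. i \<in> A \<Longrightarrow> tdeg_le (d i) (g i)"
  shows "tdeg_le (sum d A) (prod g A)"
  using assms
  by (induction A rule: infinite_finite_induct) (auto intro: tdeg_le_mult simp: tdeg_le_1)

text \<open>With row weights r and column weights c all terms of the Leibniz expansion obey the same
  bound, because a permutation does not change the sum of the column weights.\<close>

lemma tdeg_le_det:
  fixes A :: "'k :: comm_ring_1 poly poly mat"
  assumes A: "A \<in> carrier_mat n n"
    and deg: "\<And>i j. i < n \<Longrightarrow> j < n \<Longrightarrow> tdeg_le (r i - c j) (A $$ (i, j))"
  shows "tdeg_le ((\<Sum>i<n. r i) - (\<Sum>j<n. c j)) (det A)"
  unfolding det_def'[OF A]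
proof (rule tdeg_le_sum)
  fix p assume "p \<in> {p. p permutes {0..<n}}"
  then have p: "p permutes {0..<n}" by simp
  have "tdeg_le (\<Sum>i = 0..<n. r i - c (p i)) (\<Prod>i = 0..<n. A $$ (i, p i))"
    using p by (intro tdeg_le_prod deg) (auto simp: permutes_in_image)
  moreover have "(\<Sum>i = 0..<n. r i - c (p i)) = (\<Sum>i<n. r i) - (\<Sum>j<n. c j)"
    using sum.permute[OF p, of c] by (simp add: sum_subtractf lessThan_atLeast0 o_def)
  ultimately show "tdeg_le ((\<Sum>i<n. r i) - (\<Sum>j<n. c j)) (signof p * (\<Prod>i = 0..<n. A $$ (i, p i)))"
    by (auto simp: sign_def intro: tdeg_le_minus)
qed

section \<open>Families over \<open>k[x,y]\<close> that are polynomial in a parameter\<close>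

definition poly_family :: "('k :: field \<Rightarrow> 'k poly poly) \<Rightarrow> bool" where
  "poly_family F \<longleftrightarrow> (\<exists>P. \<forall>\<tau>. F \<tau> = poly P [:[:\<tau>:]:])"

lemma poly_familyI: "(\<And>\<tau>. F \<tau> = poly P [:[:\<tau>:]:]) \<Longrightarrow> poly_family F"
  by (auto simp: poly_family_def)

lemma poly_family_const [intro]: "poly_family (\<lambda>\<tau>. p)"
  by (rule poly_familyI[of _ "[:p:]"]) simp

lemma poly_family_param [intro]: "poly_family (\<lambda>\<tau>. [:[:\<tau>:]:])"
  by (rule poly_familyI[of _ "[:0, 1:]"]) simp

lemma poly_family_add [intro]: "poly_family F \<Longrightarrow> poly_family G \<Longrightarrow> poly_family (\<lambda>\<tau>. F \<tau> + G \<tau>)"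
  unfolding poly_family_def by (metis poly_add)

lemma poly_family_diff [intro]: "poly_family F \<Longrightarrow> poly_family G \<Longrightarrow> poly_family (\<lambda>\<tau>. F \<tau> - G \<tau>)"
  unfolding poly_family_def by (metis poly_diff)

lemma poly_family_mult [intro]: "poly_family F \<Longrightarrow> poly_family G \<Longrightarrow> poly_family (\<lambda>\<tau>. F \<tau> * G \<tau>)"
  unfolding poly_family_def by (metis poly_mult)

lemma poly_family_sum [intro]:
  "(\<And>i. i \<in> A \<Longrightarrow> poly_family (F i)) \<Longrightarrow> poly_family (\<lambda>\<tau>. \<Sum>i\<in>A. F i \<tau>)"
  by (induction A rule: infinite_finite_induct) auto

lemma poly_family_prod [intro]:
  "(\<And>i. i \<in> A \<Longrightarrow> poly_family (F i)) \<Longrightarrow> poly_family (\<lambda>\<tau>. \<Prod>i\<in>A. F i \<tau>)"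
  by (induction A rule: infinite_finite_induct) auto

lemma poly_family_det:
  assumes A: "\<And>\<tau>. A \<tau> \<in> carrier_mat n n"
    and fam: "\<And>i j. i < n \<Longrightarrow> j < n \<Longrightarrow> poly_family (\<lambda>\<tau>. A \<tau> $$ (i, j))"
  shows "poly_family (\<lambda>\<tau>. det (A \<tau>))"
  unfolding det_def'[OF A]
proof (intro poly_family_sum poly_family_mult poly_family_const poly_family_prod)
  fix p i assume "p \<in> {p. p permutes {0..<n}}" "i \<in> {0..<n}"
  then show "poly_family (\<lambda>\<tau>. A \<tau> $$ (i, p i))"
    using permutes_in_image by (intro fam) fastforce+
qed

text \<open>The quotient is again polynomial and therefore has a value at 0. The limits
  \<open>gg 0\<close> and \<open>ww 0\<close> below arise in this way.\<close>

lemma poly_family_divide: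
  assumes "poly_family F" "F 0 = 0"
  obtains G where "poly_family G" "\<And>\<tau>. F \<tau> = [:[:\<tau>:]:] * G \<tau>"
proof -
  obtain P where P: "\<And>\<tau>. F \<tau> = poly P [:[:\<tau>:]:]"
    using assms by (auto simp: poly_family_def)
  then have "poly P 0 = 0" using assms(2) by (metis pCons_0_0)
  then have "[:-0, 1:] dvd P" by (simp add: dvd_iff_poly_eq_0)
  then obtain Q where "P = [:0, 1:] * Q" by auto
  then show ?thesis
    using P by (intro that[of "\<lambda>\<tau>. poly Q [:[:\<tau>:]:]"]) (auto simp: poly_family_def)
qed

text \<open>The field is infinite, so the difference of the two representing polynomials has
  infinitely many roots. Identities that hold for nonzero parameters thus extend to the special
  fibre.\<close>

lemma poly_family_eqI:
  fixes F G :: "'k :: field_char_0 \<Rightarrow> 'k poly poly"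
  assumes "poly_family F" "poly_family G" "\<And>\<tau>. \<tau> \<noteq> 0 \<Longrightarrow> F \<tau> = G \<tau>"
  shows "F \<tau> = G \<tau>"
proof -
  obtain P Q where P: "\<And>\<tau>. F \<tau> = poly P [:[:\<tau>:]:]" and Q: "\<And>\<tau>. G \<tau> = poly Q [:[:\<tau>:]:]"
    using assms by (auto simp: poly_family_def)
  have "(\<lambda>\<tau>. [:[:\<tau>:]:]) ` (UNIV - {0}) \<subseteq> {x. poly (P - Q) x = 0}"
    using assms(3) P Q by auto
  moreover have "infinite ((\<lambda>\<tau> :: 'k. [:[:\<tau>:]:]) ` (UNIV - {0}))"
    using infinite_UNIV_char_0 by (subst finite_image_iff) (auto simp: inj_on_def)
  ultimately have "infinite {x. poly (P - Q) x = 0}"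
    by (meson finite_subset)
  then have "P - Q = 0" using poly_roots_finite by blast
  then show ?thesis using P Q by simp
qed

lemma poly_family_cancel:
  fixes F G :: "'k :: field_char_0 \<Rightarrow> 'k poly poly"
  assumes "poly_family F" "poly_family G" "\<And>\<tau>. [:[:\<tau>:]:] * F \<tau> = [:[:\<tau>:]:] * G \<tau>"
  shows "F \<tau> = G \<tau>"
proof (rule poly_family_eqI[OF assms(1,2)])
  fix \<tau> :: 'k assume "\<tau> \<noteq> 0"
  then show "F \<tau> = G \<tau>" using assms(3)[of \<tau>] mult_left_cancel[of "[:[:\<tau>:]:]"] by force
qed

section \<open>Scalar polynomial functions of the parameter\<close>

definition poly_fun :: "('k :: field \<Rightarrow> 'k) \<Rightarrow> bool" where
  "poly_fun h \<longleftrightarrow> (\<exists>p. \<forall>\<tau>. h \<tau> = poly p \<tau>)"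

lemma poly_funI: "(\<And>\<tau>. h \<tau> = poly p \<tau>) \<Longrightarrow> poly_fun h"
  by (auto simp: poly_fun_def)

lemma poly_fun_const [intro]: "poly_fun (\<lambda>\<tau>. c)"
  by (rule poly_funI[of _ "[:c:]"]) simp

lemma poly_fun_id [intro]: "poly_fun (\<lambda>\<tau>. \<tau>)"
  by (rule poly_funI[of _ "[:0, 1:]"]) simp

lemma poly_fun_add [intro]: "poly_fun F \<Longrightarrow> poly_fun G \<Longrightarrow> poly_fun (\<lambda>\<tau>. F \<tau> + G \<tau>)"
  unfolding poly_fun_def by (metis poly_add)

lemma poly_fun_mult [intro]: "poly_fun F \<Longrightarrow> poly_fun G \<Longrightarrow> poly_fun (\<lambda>\<tau>. F \<tau> * G \<tau>)"
  unfolding poly_fun_def by (metis poly_mult)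

lemma poly_fun_power [intro]: "poly_fun F \<Longrightarrow> poly_fun (\<lambda>\<tau>. F \<tau> ^ n)"
  by (induction n) auto

lemma poly_fun_sum [intro]:
  "(\<And>i. i \<in> A \<Longrightarrow> poly_fun (F i)) \<Longrightarrow> poly_fun (\<lambda>\<tau>. \<Sum>i\<in>A. F i \<tau>)"
  by (induction A rule: infinite_finite_induct) auto

lemma poly_fun_prod [intro]:
  "(\<And>i. i \<in> A \<Longrightarrow> poly_fun (F i)) \<Longrightarrow> poly_fun (\<lambda>\<tau>. \<Prod>i\<in>A. F i \<tau>)"
  by (induction A rule: infinite_finite_induct) auto

lemma poly_fun_det:
  assumes A: "\<And>\<tau>. A \<tau> \<in> carrier_mat n n"
    and fam: "\<And>i j. i < n \<Longrightarrow> j < n \<Longrightarrow> poly_fun (\<lambda>\<tau>. A \<tau> $$ (i, j))"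
  shows "poly_fun (\<lambda>\<tau>. det (A \<tau>))"
  unfolding det_def'[OF A]
proof (intro poly_fun_sum poly_fun_mult poly_fun_const poly_fun_prod)
  fix p i assume "p \<in> {p. p permutes {0..<n}}" "i \<in> {0..<n}"
  then show "poly_fun (\<lambda>\<tau>. A \<tau> $$ (i, p i))"
    using permutes_in_image by (intro fam) fastforce+
qed

text \<open>One nonzero value suffices since a nonzero polynomial has finitely many roots. General
  parameters are rendered by the cofinite filter throughout.\<close>

lemma poly_fun_cofinite:
  assumes "poly_fun h" "h a \<noteq> 0"
  shows "\<forall>\<^sub>F \<tau> in cofinite. h \<tau> \<noteq> 0"
proof -
  obtain p where p: "\<And>\<tau>. h \<tau> = poly p \<tau>" using assms by (auto simp: poly_fun_def)
  then have "p \<noteq> 0" using assms(2) by auto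
  then show ?thesis using poly_roots_finite[of p] p by (simp add: eventually_cofinite)
qed

lemma poly_fun_coeff:
  assumes "poly_family F"
  shows "poly_fun (\<lambda>\<tau>. coeff (coeff (F \<tau>) i) j)"
proof -
  obtain P where P: "\<And>\<tau>. F \<tau> = poly P [:[:\<tau>:]:]"
    using assms by (auto simp: poly_family_def)
  have "[:[:\<tau>:]:] ^ n = [:[:\<tau> ^ n:]:]" for \<tau> :: 'a and n
    by (simp add: poly_const_pow)
  then have "coeff (coeff (F \<tau>) i) j = (\<Sum>n\<le>degree P. coeff (coeff (coeff P n) i) j * \<tau> ^ n)" for \<tau>
    unfolding P poly_altdef by (simp add: coeff_sum mult.commute)
  then show ?thesis
    by (simp only: poly_fun_sum poly_fun_mult poly_fun_const poly_fun_power poly_fun_id)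
qed

section \<open>Characteristic matrices over \<open>k[y]\<close>\<close>

text \<open>\<open>T\<close> and \<open>\<delta>\<close> describe the multiplication by \<open>x\<close> on the \<open>k[y]\<close>-span of \<open>f\<close> and the \<open>q i\<close>.\<close>
definition companion :: "nat \<Rightarrow> 'k :: comm_ring_1 poly poly \<Rightarrow> (nat \<Rightarrow> 'k poly poly) \<Rightarrow>
    (nat \<Rightarrow> nat \<Rightarrow> 'k poly) \<Rightarrow> (nat \<Rightarrow> 'k poly) \<Rightarrow> bool" where
  "companion \<alpha> f q T \<delta> \<longleftrightarrow>
     (\<forall>i<\<alpha>. [:0, 1:] * q i = (\<Sum>j<\<alpha>. [:T i j:] * q j) + [:\<delta> i:] * f)"

definition char_mat :: "nat \<Rightarrow> (nat \<Rightarrow> nat \<Rightarrow> 'k :: comm_ring_1 poly) \<Rightarrow> 'k poly poly mat" where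
  "char_mat \<alpha> T = mat \<alpha> \<alpha> (\<lambda>(i, j). (if i = j then [:0, 1:] else 0) - [:T i j:])"

definition char_pol :: "nat \<Rightarrow> (nat \<Rightarrow> nat \<Rightarrow> 'k :: comm_ring_1 poly) \<Rightarrow> 'k poly poly" where
  "char_pol \<alpha> T = det (char_mat \<alpha> T)"

text \<open>The Cramer numerators: in the system \<open>(x - T) q = f \<delta>\<close> with f the
  characteristic polynomial, the factor f cancels the denominator.\<close>

definition char_sol :: "nat \<Rightarrow> (nat \<Rightarrow> nat \<Rightarrow> 'k :: comm_ring_1 poly) \<Rightarrow> (nat \<Rightarrow> 'k poly) \<Rightarrow>
    nat \<Rightarrow> 'k poly poly" where
  "char_sol \<alpha> T \<delta> i = det (replace_col (char_mat \<alpha> T) (vec \<alpha> (\<lambda>j. [:\<delta> j:])) i)"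

lemma char_mat_carrier [simp]: "char_mat \<alpha> T \<in> carrier_mat \<alpha> \<alpha>"
  by (simp add: char_mat_def)

lemma dim_char_mat [simp]: "dim_row (char_mat \<alpha> T) = \<alpha>" "dim_col (char_mat \<alpha> T) = \<alpha>"
  by (simp_all add: char_mat_def)

lemma char_mat_index:
  "i < \<alpha> \<Longrightarrow> j < \<alpha> \<Longrightarrow> char_mat \<alpha> T $$ (i, j) = (if i = j then [:0, 1:] else 0) - [:T i j:]"
  by (simp add: char_mat_def)

lemma char_pol_monic: "degree (char_pol \<alpha> T) = \<alpha>" "coeff (char_pol \<alpha> T) \<alpha> = 1"
proof -
  have "char_mat \<alpha> T = char_poly_matrix (mat \<alpha> \<alpha> (\<lambda>(i, j). T i j))"
    by (rule eq_matI) (auto simp: char_mat_def char_poly_matrix_def)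
  then have "char_pol \<alpha> T = char_poly (mat \<alpha> \<alpha> (\<lambda>(i, j). T i j))"
    by (simp add: char_pol_def char_poly_def)
  then show "degree (char_pol \<alpha> T) = \<alpha>" "coeff (char_pol \<alpha> T) \<alpha> = 1"
    using degree_monic_char_poly[of "mat \<alpha> \<alpha> (\<lambda>(i, j). T i j)" \<alpha>] by auto
qed

lemma char_mat_mult:
  "i < \<alpha> \<Longrightarrow> (char_mat \<alpha> T *\<^sub>v vec \<alpha> v) $ i = [:0, 1:] * v i - (\<Sum>j<\<alpha>. [:T i j:] * v j)"
proof -
  assume i: "i < \<alpha>"
  have "(char_mat \<alpha> T *\<^sub>v vec \<alpha> v) $ i
      = (\<Sum>j = 0..<\<alpha>. ((if i = j then [:0, 1:] else 0) - [:T i j:]) * v j)"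
    using i by (simp add: char_mat_def scalar_prod_def)
  also have "\<dots> = (\<Sum>j = 0..<\<alpha>. (if i = j then [:0, 1:] * v j else 0) - [:T i j:] * v j)"
    by (rule sum.cong) (auto simp: left_diff_distrib)
  also have "\<dots> = [:0, 1:] * v i - (\<Sum>j<\<alpha>. [:T i j:] * v j)"
    using i by (simp add: sum_subtractf lessThan_atLeast0)
  finally show ?thesis .
qed

text \<open>Expand along the replaced column, whose cofactors do not involve that column. This is
  Cramer's rule without inverses.\<close>

lemma det_replace_col:
  assumes A: "A \<in> carrier_mat n n" and b: "b \<in> carrier_vec n" and k: "k < n"
  shows "det (replace_col A b k) = (adj_mat A *\<^sub>v b) $ k"
proof -
  have Ab: "replace_col A b k \<in> carrier_mat n n"
    using A by (auto simp: replace_col_def)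
  have "det (replace_col A b k) = (\<Sum>i<n. replace_col A b k $$ (i, k) * cofactor (replace_col A b k) i k)"
    by (rule laplace_expansion_column[OF Ab k])
  also have "\<dots> = (\<Sum>i<n. b $ i * cofactor A i k)"
  proof (rule sum.cong[OF refl])
    fix i assume i: "i \<in> {..<n}"
    have "mat_delete (replace_col A b k) i k = mat_delete A i k"
      using A k i by (intro eq_matI) (auto simp: mat_delete_def replace_col_def)
    then show "replace_col A b k $$ (i, k) * cofactor (replace_col A b k) i k = b $ i * cofactor A i k"
      using A i k by (simp add: replace_col_def cofactor_def)
  qed
  also have "\<dots> = (adj_mat A *\<^sub>v b) $ k"
    using A b k by (simp add: adj_mat_def scalar_prod_def lessThan_atLeast0 mult.commute)
  finally show ?thesis by simp
qed

text \<open>Apply \<open>(x - T) adj (x - T) = det (x - T)\<close> to the vector \<delta>.\<close>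

lemma companion_char_sol: "companion \<alpha> (char_pol \<alpha> T) (char_sol \<alpha> T \<delta>) T \<delta>"
  unfolding companion_def
proof (intro allI impI)
  fix i assume i: "i < \<alpha>"
  let ?M = "char_mat \<alpha> T" and ?d = "vec \<alpha> (\<lambda>j. [:\<delta> j:])"
  have "vec \<alpha> (char_sol \<alpha> T \<delta>) = adj_mat ?M *\<^sub>v ?d"
    using adj_mat(1)[of ?M \<alpha>]
    by (intro eq_vecI) (auto simp: char_sol_def det_replace_col[of _ \<alpha>])
  then have "?M *\<^sub>v vec \<alpha> (char_sol \<alpha> T \<delta>) = (?M * adj_mat ?M) *\<^sub>v ?d"
    using adj_mat(1)[of ?M \<alpha>] by (simp add: assoc_mult_mat_vec[of _ \<alpha> \<alpha> _ \<alpha>])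
  also have "\<dots> = (char_pol \<alpha> T \<cdot>\<^sub>m 1\<^sub>m \<alpha>) *\<^sub>v ?d"
    by (simp add: adj_mat(2)[of ?M \<alpha>] char_pol_def)
  also have "\<dots> = char_pol \<alpha> T \<cdot>\<^sub>v (1\<^sub>m \<alpha> *\<^sub>v ?d)"
    by auto
  also have "\<dots> = char_pol \<alpha> T \<cdot>\<^sub>v ?d" by simp
  finally have "(?M *\<^sub>v vec \<alpha> (char_sol \<alpha> T \<delta>)) $ i = char_pol \<alpha> T * [:\<delta> i:]"
    using i by simp
  then show "[:0, 1:] * char_sol \<alpha> T \<delta> i
      = (\<Sum>j<\<alpha>. [:T i j:] * char_sol \<alpha> T \<delta> j) + [:\<delta> i:] * char_pol \<alpha> T"
    unfolding char_mat_mult[OF i] by (simp add: algebra_simps)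
qed

text \<open>
  Multiplication by the outer variable raises the degree in it, while multiplication by
  \<open>T i j\<close> does not. This bounds every solution of the linear system.
\<close>
lemma companion_degree_less:
  fixes q :: "nat \<Rightarrow> 'k :: idom poly poly"
  assumes eq: "\<And>i. i < \<alpha> \<Longrightarrow> [:0, 1:] * q i = (\<Sum>j<\<alpha>. [:T i j:] * q j) + g i"
    and g: "\<And>i. i < \<alpha> \<Longrightarrow> degree (g i) \<le> d" and d: "i < \<alpha>" "q i \<noteq> 0"
  shows "degree (q i) < d"
proof -
  define S where "S = {k. k < \<alpha> \<and> q k \<noteq> 0}"
  have S: "finite S" "i \<in> S" using d by (auto simp: S_def)
  define D where "D = Max ((\<lambda>k. degree (q k)) ` S)"
  have "D \<in> (\<lambda>k. degree (q k)) ` S"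
    unfolding D_def using S by (intro Max_in) auto
  then obtain k where k: "k < \<alpha>" "q k \<noteq> 0" "degree (q k) = D"
    by (auto simp: S_def)
  have le: "degree (q j) \<le> D" if "j < \<alpha>" for j
    using that S(1) by (cases "q j = 0") (auto simp: D_def S_def intro!: Max_ge)
  have "degree (\<Sum>j<\<alpha>. [:T k j:] * q j) \<le> D"
    by (intro degree_sum_le) (auto intro: order.trans[OF degree_smult_le] le)
  moreover have "degree ([:0, 1:] * q k) = D + 1"
    using k by (subst degree_mult_eq) auto
  moreover have "degree ([:0, 1:] * q k) \<le> max (degree (\<Sum>j<\<alpha>. [:T k j:] * q j)) (degree (g k))"
    unfolding eq[OF k(1)] by (rule degree_add_le_max)
  ultimately have "D + 1 \<le> max D d"
    using g[OF k(1)] by linarith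
  then show ?thesis using le[OF d(1)] by simp
qed

text \<open>The difference of two solutions solves the homogeneous system; if it were nonzero, its
  degree in x would be below 0.\<close>

lemma companion_unique:
  fixes q :: "nat \<Rightarrow> 'k :: idom poly poly"
  assumes "\<And>i. i < \<alpha> \<Longrightarrow> [:0, 1:] * q i = (\<Sum>j<\<alpha>. [:T i j:] * q j) + g i"
    and "\<And>i. i < \<alpha> \<Longrightarrow> [:0, 1:] * q' i = (\<Sum>j<\<alpha>. [:T i j:] * q' j) + g i"
    and "i < \<alpha>"
  shows "q i = q' i"
proof (rule ccontr)
  assume neq: "q i \<noteq> q' i"
  have "[:0, 1:] * (q i - q' i) = (\<Sum>j<\<alpha>. [:T i j:] * (q j - q' j)) + 0" if "i < \<alpha>" for i
    unfolding right_diff_distrib sum_subtractf assms(1,2)[OF that] by (simp only: algebra_simps add_0_left)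
  from companion_degree_less[of \<alpha> "\<lambda>i. q i - q' i" T "\<lambda>i. 0", OF this _ assms(3)]
  have "degree (q i - q' i) < 0"
    using neq by (simp only: degree_0 le_refl right_minus_eq simp_thms)
  then show False by simp
qed

lemma degree_char_sol:
  fixes T :: "nat \<Rightarrow> nat \<Rightarrow> 'k :: idom poly"
  assumes "i < \<alpha>"
  shows "degree (char_sol \<alpha> T \<delta> i) < \<alpha>"
proof (cases "char_sol \<alpha> T \<delta> i = 0")
  case False
  have "degree ([:\<delta> j:] * char_pol \<alpha> T) \<le> \<alpha>" for j
    using degree_smult_le[of "\<delta> j" "char_pol \<alpha> T"] by (simp add: char_pol_monic)
  with False show ?thesis
    using assms companion_char_sol[of \<alpha> T \<delta>, unfolded companion_def, rule_format]
      companion_degree_less[of \<alpha> "char_sol \<alpha> T \<delta>" T "\<lambda>i. [:\<delta> i:] * char_pol \<alpha> T" \<alpha> i]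
    by blast
qed (use assms in auto)

text \<open>The bounds make each row of the system consistent with the degrees: \<open>x q_i\<close>
  has degree e i + 1, \<open>q_j\<close> has degree e j and f has degree \<alpha>. A negative bound
  forces the entry to be 0.\<close>

definition fits :: "nat \<Rightarrow> (nat \<Rightarrow> nat) \<Rightarrow> (nat \<Rightarrow> nat \<Rightarrow> 'k :: zero poly) \<Rightarrow> (nat \<Rightarrow> 'k poly) \<Rightarrow> bool"
  where "fits \<alpha> e T \<delta> \<longleftrightarrow>
    (\<forall>i<\<alpha>. (\<forall>j<\<alpha>. tdeg_le (int (e i) + 1 - int (e j)) [:T i j:]) \<and>
           tdeg_le (int (e i) + 1 - int \<alpha>) [:\<delta> i:])"

lemma tdeg_le_char_mat:
  assumes "fits \<alpha> e T \<delta>" "i < \<alpha>" "j < \<alpha>"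
  shows "tdeg_le (int (e i) + 1 - int (e j)) (char_mat \<alpha> T $$ (i, j))"
  unfolding char_mat_index[OF assms(2,3)]
  using assms by (intro tdeg_le_diff) (simp_all add: fits_def tdeg_le_x)

lemma tdeg_le_char_pol:
  assumes "fits \<alpha> e T \<delta>"
  shows "tdeg_le (int \<alpha>) (char_pol \<alpha> T)"
proof -
  have "tdeg_le ((\<Sum>i<\<alpha>. int (e i) + 1) - (\<Sum>j<\<alpha>. int (e j))) (char_pol \<alpha> T)"
    unfolding char_pol_def using tdeg_le_char_mat[OF assms]
    by (intro tdeg_le_det) auto
  then show ?thesis by (simp add: sum.distrib)
qed

text \<open>Replacing column i, of weight e i, by a column of weight \<alpha> changes the bound
  \<alpha> for the determinant into e i.\<close>

lemma tdeg_le_char_sol: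
  assumes "fits \<alpha> e T \<delta>" "i < \<alpha>"
  shows "tdeg_le (int (e i)) (char_sol \<alpha> T \<delta> i)"
proof -
  let ?c = "\<lambda>j. if j = i then int \<alpha> else int (e j)"
  have "tdeg_le ((\<Sum>i<\<alpha>. int (e i) + 1) - (\<Sum>j<\<alpha>. ?c j)) (char_sol \<alpha> T \<delta> i)"
    unfolding char_sol_def
  proof (intro tdeg_le_det)
    show "replace_col (char_mat \<alpha> T) (vec \<alpha> (\<lambda>j. [:\<delta> j:])) i \<in> carrier_mat \<alpha> \<alpha>"
      by (simp add: replace_col_def)
    fix k j assume kj: "k < \<alpha>" "j < \<alpha>"
    show "tdeg_le (int (e k) + 1 - ?c j)
        (replace_col (char_mat \<alpha> T) (vec \<alpha> (\<lambda>j. [:\<delta> j:])) i $$ (k, j))"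
      using kj tdeg_le_char_mat[OF assms(1), of k j] assms
      by (auto simp: replace_col_def fits_def)
  qed
  moreover have "(\<Sum>j<\<alpha>. ?c j) = (\<Sum>j<\<alpha>. int (e j)) + int \<alpha> - int (e i)"
    using assms(2) by (simp add: sum.remove[of "{..<\<alpha>}" i])
  ultimately show ?thesis by (simp add: sum.distrib)
qed

lemma poly_family_char_mat:
  assumes "\<And>i j. i < \<alpha> \<Longrightarrow> j < \<alpha> \<Longrightarrow> poly_family (\<lambda>\<tau>. [:T \<tau> i j:])" "i < \<alpha>" "j < \<alpha>"
  shows "poly_family (\<lambda>\<tau>. char_mat \<alpha> (T \<tau>) $$ (i, j))"
  unfolding char_mat_index[OF assms(2,3)]
  by (rule poly_family_diff[OF poly_family_const assms(1)[OF assms(2,3)]])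

lemma poly_family_char_pol:
  assumes "\<And>i j. i < \<alpha> \<Longrightarrow> j < \<alpha> \<Longrightarrow> poly_family (\<lambda>\<tau>. [:T \<tau> i j:])"
  shows "poly_family (\<lambda>\<tau>. char_pol \<alpha> (T \<tau>))"
  unfolding char_pol_def
proof (rule poly_family_det[of _ \<alpha>])
  fix i j assume "i < \<alpha>" "j < \<alpha>"
  from poly_family_char_mat[OF assms this]
  show "poly_family (\<lambda>\<tau>. char_mat \<alpha> (T \<tau>) $$ (i, j))" .
qed simp

lemma poly_family_char_sol:
  assumes T: "\<And>i j. i < \<alpha> \<Longrightarrow> j < \<alpha> \<Longrightarrow> poly_family (\<lambda>\<tau>. [:T \<tau> i j:])"
    and \<delta>: "\<And>i. i < \<alpha> \<Longrightarrow> poly_family (\<lambda>\<tau>. [:\<delta> \<tau> i:])"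
  shows "poly_family (\<lambda>\<tau>. char_sol \<alpha> (T \<tau>) (\<delta> \<tau>) i)"
  unfolding char_sol_def
proof (rule poly_family_det[of _ \<alpha>])
  fix k j assume kj: "k < \<alpha>" "j < \<alpha>"
  show "poly_family (\<lambda>\<tau>. replace_col (char_mat \<alpha> (T \<tau>)) (vec \<alpha> (\<lambda>j. [:\<delta> \<tau> j:])) i $$ (k, j))"
  proof (cases "j = i")
    case True
    with kj \<delta>[OF kj(1)] show ?thesis by (simp add: replace_col_def)
  next
    case False
    have "poly_family (\<lambda>\<tau>. char_mat \<alpha> (T \<tau>) $$ (k, j))"
      by (rule poly_family_char_mat[OF T kj])
    with False kj show ?thesis by (simp add: replace_col_def)
  qed
qed (simp add: replace_col_def)

section \<open>Adapted generators of an ideal\<close>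

text \<open>Coefficient of \<open>x^j y^(d-j)\<close>, that is, of \<open>x^j\<close> in the form of
  degree d after setting y = 1. In this way leading forms of different degrees become comparable
  vectors.\<close>

definition lead :: "nat \<Rightarrow> 'k :: zero poly poly \<Rightarrow> nat \<Rightarrow> 'k" where
  "lead d p j = (if j \<le> d then coeff (coeff p j) (d - j) else 0)"

definition lead_independent :: "nat \<Rightarrow> (nat \<Rightarrow> nat) \<Rightarrow> (nat \<Rightarrow> 'k :: field poly poly) \<Rightarrow> bool" where
  "lead_independent \<alpha> e q \<longleftrightarrow>
    (\<forall>\<beta>. (\<forall>j<\<alpha>. (\<Sum>i<\<alpha>. \<beta> i * lead (e i) (q i) j) = 0) \<longrightarrow> (\<forall>i<\<alpha>. \<beta> i = 0))"

definition adapted :: "nat \<Rightarrow> (nat \<Rightarrow> nat) \<Rightarrow> 'k :: field poly poly \<Rightarrow> (nat \<Rightarrow> 'k poly poly) \<Rightarrow> bool"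
  where "adapted \<alpha> e f q \<longleftrightarrow>
    degree f = \<alpha> \<and> coeff f \<alpha> = 1 \<and> tdeg_le (int \<alpha>) f \<and>
    (\<forall>i<\<alpha>. \<alpha> \<le> e i \<and> degree (q i) < \<alpha> \<and> tdeg_le (int (e i)) (q i)) \<and>
    lead_independent \<alpha> e q"

text \<open>The \<open>q i\<close> have coefficients in \<open>k[y]\<close> only; closure under
  multiplication by x comes from \<open>companion\<close>.\<close>

definition gen_ideal :: "nat \<Rightarrow> 'k :: comm_ring_1 poly poly \<Rightarrow> (nat \<Rightarrow> 'k poly poly) \<Rightarrow> 'k poly poly set" where
  "gen_ideal \<alpha> f q = {a * f + (\<Sum>i<\<alpha>. [:b i:] * q i) | a b. True}"

lemma tdeg_le_neg: "tdeg_le d p \<Longrightarrow> d < 0 \<Longrightarrow> p = 0"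
  by (intro poly_eqI) (auto intro: tdeg_le_coeff_eq_0)

text \<open>The hypothesis concerns only the powers \<open>x^i\<close> with i at least \<alpha>,
  where a remainder of smaller x-degree cannot interfere. The top coefficient of a reappears in
  \<open>a * f\<close> at \<open>x^(d + \<alpha>)\<close> and hence obeys the bound; it is removed
  and the induction continues with the rest.\<close>

lemma tdeg_le_monic_mult:
  fixes a f :: "'k :: idom poly poly"
  assumes f: "degree f = \<alpha>" "coeff f \<alpha> = 1" "tdeg_le (int \<alpha>) f"
    and "\<And>i j. \<alpha> \<le> i \<Longrightarrow> coeff (coeff (a * f) i) j \<noteq> 0 \<Longrightarrow> int i + int j \<le> m"
  shows "tdeg_le (m - int \<alpha>) a"
  using assms(4)
proof (induction "degree a" arbitrary: a rule: less_induct)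
  case less
  show ?case
  proof (cases "a = 0")
    case False
    define d where "d = degree a"
    have top: "coeff (a * f) (d + \<alpha>) = coeff a d"
      using coeff_mult_degree_sum[of a f] f by (simp add: d_def)
    have "tdeg_le (m - int \<alpha>) (Polynomial.monom (coeff a d) d)"
      unfolding tdeg_le_def using less.prems[of "d + \<alpha>"] top by (force split: if_splits)
    then have mf: "tdeg_le m (Polynomial.monom (coeff a d) d * f)"
      using tdeg_le_mult[OF _ f(3)] by fastforce
    define a' where "a' = a - Polynomial.monom (coeff a d) d"
    have "tdeg_le (m - int \<alpha>) a'"
    proof (cases "a' = 0")
      case False
      have "degree a' \<le> d"
        unfolding a'_def d_def by (intro degree_diff_le) (auto simp: degree_monom_le)
      moreover have "coeff a' d = 0" by (simp add: a'_def)
      ultimately have "degree a' < d"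
        using False by (metis le_neq_implies_less leading_coeff_0_iff)
      then show ?thesis
      proof (intro less.hyps)
        fix i j assume ij: "\<alpha> \<le> i" "coeff (coeff (a' * f) i) j \<noteq> 0"
        have "coeff (coeff (a' * f) i) j
            = coeff (coeff (a * f) i) j - coeff (coeff (Polynomial.monom (coeff a d) d * f) i) j"
          by (simp add: a'_def left_diff_distrib)
        with ij(2) have "coeff (coeff (a * f) i) j \<noteq> 0 \<or>
            coeff (coeff (Polynomial.monom (coeff a d) d * f) i) j \<noteq> 0" by auto
        then show "int i + int j \<le> m"
          using less.prems[OF ij(1)] tdeg_leD[OF mf] by blast
      qed (simp add: d_def)
    qed simp
    then have "tdeg_le (m - int \<alpha>) (a' + Polynomial.monom (coeff a d) d)"
      using \<open>tdeg_le (m - int \<alpha>) (Polynomial.monom (coeff a d) d)\<close> by (rule tdeg_le_add)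
    then show ?thesis by (simp add: a'_def)
  qed simp
qed

text \<open>At the extreme weight D only the product of the two top coefficients survives.\<close>

lemma coeff_mult_top:
  fixes b c :: "'k :: comm_semiring_0 poly"
  assumes b: "\<And>l. coeff b l \<noteq> 0 \<Longrightarrow> l + e \<le> D" and c: "\<And>l. coeff c l \<noteq> 0 \<Longrightarrow> l + j \<le> e"
    and j: "j \<le> D"
  shows "coeff (b * c) (D - j) = (if e \<le> D \<and> j \<le> e then coeff b (D - e) * coeff c (e - j) else 0)"
proof -
  have *: "coeff b l * coeff c (D - j - l)
      = (if l = D - e \<and> e \<le> D \<and> j \<le> e then coeff b (D - e) * coeff c (e - j) else 0)"
    if "l \<le> D - j" for l
  proof (cases "coeff b l * coeff c (D - j - l) = 0")
    case True
    then show ?thesis using j that by auto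
  next
    case False
    then have "coeff b l \<noteq> 0" "coeff c (D - j - l) \<noteq> 0" by auto
    from b[OF this(1)] c[OF this(2)] that j have "l = D - e" "e \<le> D" "j \<le> e" "D - j - l = e - j"
      by auto
    then show ?thesis by auto
  qed
  have "coeff (b * c) (D - j) = (\<Sum>l\<le>D - j.
      if l = D - e \<and> e \<le> D \<and> j \<le> e then coeff b (D - e) * coeff c (e - j) else 0)"
    unfolding coeff_mult using * by (intro sum.cong) auto
  then show ?thesis by (auto simp: sum.delta)
qed

lemma adaptedD:
  assumes "adapted \<alpha> e f q"
  shows "degree f = \<alpha>" "coeff f \<alpha> = 1" "tdeg_le (int \<alpha>) f"
    "i < \<alpha> \<Longrightarrow> \<alpha> \<le> e i" "i < \<alpha> \<Longrightarrow> degree (q i) < \<alpha>" "i < \<alpha> \<Longrightarrow> tdeg_le (int (e i)) (q i)"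
    "(\<And>j. j < \<alpha> \<Longrightarrow> (\<Sum>i<\<alpha>. \<beta> i * lead (e i) (q i) j) = 0) \<Longrightarrow> i < \<alpha> \<Longrightarrow> \<beta> i = 0"
  using assms by (auto simp: adapted_def lead_independent_def)

text \<open>Leading forms cannot cancel: if D is the largest degree of some
  \<open>[:b i:] * q i\<close> and D > m, the coefficients of the \<open>b i\<close> belonging to
  degree D form a linear relation between the independent leading forms.\<close>

lemma adapted_tdeg_le_sum:
  assumes ad: "adapted \<alpha> e f q" and m: "tdeg_le m (\<Sum>i<\<alpha>. [:b i:] * q i)" and i: "i < \<alpha>"
  shows "tdeg_le (m - int (e i)) [:b i:]"
proof (rule ccontr)
  assume neg: "\<not> tdeg_le (m - int (e i)) [:b i:]"
  define S where "S = (\<Union>i<\<alpha>. (\<lambda>j. j + e i) ` {j. coeff (b i) j \<noteq> 0})"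
  have fin: "finite {j. coeff (b i) j \<noteq> 0}" for i
    using MOST_coeff_eq_0[of "b i"] by (simp add: MOST_iff_cofinite)
  then have S: "finite S" by (auto simp: S_def)
  from neg obtain j where j: "coeff (b i) j \<noteq> 0" "int (j + e i) > m"
    unfolding tdeg_le_const by force
  then have jS: "j + e i \<in> S" using i by (auto simp: S_def)
  define D where "D = Max S"
  have "D \<in> S" unfolding D_def using S jS by (intro Max_in) auto
  then obtain i0 j0 where ij0: "i0 < \<alpha>" "coeff (b i0) j0 \<noteq> 0" "D = j0 + e i0"
    by (auto simp: S_def)
  have D: "j + e k \<le> D" if "k < \<alpha>" "coeff (b k) j \<noteq> 0" for k j
    using that S unfolding D_def by (intro Max_ge) (auto simp: S_def)
  have mD: "m < int D" using D[OF i j(1)] j(2) by linarith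
  define \<beta> where "\<beta> k = (if e k \<le> D then coeff (b k) (D - e k) else 0)" for k
  have "(\<Sum>k<\<alpha>. \<beta> k * lead (e k) (q k) j) = 0" if j: "j < \<alpha>" for j
  proof (cases "j \<le> D")
    case True
    have "coeff (b k * coeff (q k) j) (D - j) = \<beta> k * lead (e k) (q k) j" if k: "k < \<alpha>" for k
    proof -
      have "coeff (coeff (q k) j) l \<noteq> 0 \<Longrightarrow> l + j \<le> e k" for l
        using tdeg_leD[OF adaptedD(6)[OF ad k]] by fastforce
      from coeff_mult_top[of "b k" "e k" D "coeff (q k) j" j, OF D[OF k] this True] show ?thesis
        by (simp add: \<beta>_def lead_def)
    qed
    then have "(\<Sum>k<\<alpha>. \<beta> k * lead (e k) (q k) j) = coeff (coeff (\<Sum>i<\<alpha>. [:b i:] * q i) j) (D - j)"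
      by (simp add: coeff_sum)
    also have "\<dots> = 0"
      using m mD True by (intro tdeg_le_coeff_eq_0) auto
    finally show ?thesis .
  next
    case False
    then show ?thesis by (intro sum.neutral) (auto simp: \<beta>_def lead_def)
  qed
  from adaptedD(7)[OF ad this ij0(1)] have "\<beta> i0 = 0" .
  then show False using ij0 by (simp add: \<beta>_def)
qed

lemma coeff_adapted_sum:
  assumes "adapted \<alpha> e f q" "\<alpha> \<le> k"
  shows "coeff (\<Sum>i<\<alpha>. [:b i:] * q i) k = 0"
proof -
  have "coeff (q i) k = 0" if "i < \<alpha>" for i
    using adaptedD(5)[OF assms(1) that] assms(2) by (intro coeff_eq_0) simp
  then show ?thesis by (simp add: coeff_sum)
qed

text \<open>In x-degrees at least \<alpha> only \<open>a * f\<close> is visible, which bounds a;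
  subtracting it leaves the sum of the \<open>q i\<close>. Adapted generators thus behave like a
  standard basis for the total degree.\<close>

lemma adapted_tdeg_le:
  assumes ad: "adapted \<alpha> e f q" and m: "tdeg_le m (a * f + (\<Sum>i<\<alpha>. [:b i:] * q i))"
  shows "tdeg_le (m - int \<alpha>) a" "i < \<alpha> \<Longrightarrow> tdeg_le (m - int (e i)) [:b i:]"
proof -
  show a: "tdeg_le (m - int \<alpha>) a"
  proof (rule tdeg_le_monic_mult[OF adaptedD(1-3)[OF ad]])
    fix i j assume "\<alpha> \<le> i" "coeff (coeff (a * f) i) j \<noteq> 0"
    then have "coeff (coeff (a * f + (\<Sum>i<\<alpha>. [:b i:] * q i)) i) j \<noteq> 0"
      unfolding coeff_add coeff_adapted_sum[OF ad \<open>\<alpha> \<le> i\<close>] by simp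
    then show "int i + int j \<le> m" using m tdeg_leD by blast
  qed
  have "tdeg_le m (a * f)"
    using tdeg_le_mult[OF a adaptedD(3)[OF ad]] by simp
  from tdeg_le_diff[OF m this] have "tdeg_le m (\<Sum>i<\<alpha>. [:b i:] * q i)"
    by simp
  from adapted_tdeg_le_sum[OF ad this] show "i < \<alpha> \<Longrightarrow> tdeg_le (m - int (e i)) [:b i:]" .
qed

text \<open>The zero polynomial has total degree at most -1, so all bounds for the coefficients
  become negative.\<close>

lemma adapted_independent:
  assumes ad: "adapted \<alpha> e f q" and 0: "a * f + (\<Sum>i<\<alpha>. [:b i:] * q i) = 0"
  shows "a = 0" "i < \<alpha> \<Longrightarrow> b i = 0"
proof -
  have *: "tdeg_le (-1) (a * f + (\<Sum>i<\<alpha>. [:b i:] * q i))" unfolding 0 by (rule tdeg_le_0)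
  from adapted_tdeg_le(1)[OF ad *] show "a = 0" by (rule tdeg_le_neg) simp
  assume "i < \<alpha>"
  from adapted_tdeg_le(2)[OF ad * this] have "[:b i:] = 0" by (rule tdeg_le_neg) simp
  then show "b i = 0" by simp
qed

text \<open>The coefficient matrix P of the \<open>q i\<close> is nonsingular by independence over
  \<open>k[y]\<close>, and \<open>adj P\<close> applied to the first unit vector expresses
  \<open>det P\<close> by the \<open>q i\<close>. Geometrically, the scheme lies over finitely many
  values of y.\<close>

lemma adapted_const:
  assumes ad: "adapted \<alpha> e f q" and \<alpha>: "0 < \<alpha>"
  obtains b D where "D \<noteq> 0" "[:D:] = (\<Sum>i<\<alpha>. [:b i:] * q i)"
proof -
  define P where "P = mat \<alpha> \<alpha> (\<lambda>(j, i). coeff (q i) j)"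
  have P: "P \<in> carrier_mat \<alpha> \<alpha>" by (simp add: P_def)
  have Pv: "coeff (\<Sum>i<\<alpha>. [:v $ i:] * q i) j = (P *\<^sub>v v) $ j" if "v \<in> carrier_vec \<alpha>" "j < \<alpha>" for v j
    using that by (simp add: P_def coeff_sum scalar_prod_def lessThan_atLeast0 mult.commute)
  have "det P \<noteq> 0"
  proof
    assume "det P = 0"
    then obtain v where v: "v \<in> carrier_vec \<alpha>" "v \<noteq> 0\<^sub>v \<alpha>" "P *\<^sub>v v = 0\<^sub>v \<alpha>"
      using det_0_iff_vec_prod_zero[OF P] by blast
    have "(\<Sum>i<\<alpha>. [:v $ i:] * q i) = 0"
    proof (rule poly_eqI)
      fix j show "coeff (\<Sum>i<\<alpha>. [:v $ i:] * q i) j = coeff 0 j"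
      proof (cases "j < \<alpha>")
        case True
        then show ?thesis unfolding Pv[OF v(1) True] v(3) by simp
      next
        case False
        then show ?thesis using coeff_adapted_sum[OF ad, of j "\<lambda>i. v $ i"] by simp
      qed
    qed
    then have "0 * f + (\<Sum>i<\<alpha>. [:v $ i:] * q i) = 0" by simp
    from adapted_independent(2)[OF ad this] have "v = 0\<^sub>v \<alpha>"
      using v(1) by (intro eq_vecI) auto
    with v(2) show False by simp
  qed
  moreover have "[:det P:] = (\<Sum>i<\<alpha>. [:(adj_mat P *\<^sub>v unit_vec \<alpha> 0) $ i:] * q i)"
  proof (rule poly_eqI)
    let ?v = "adj_mat P *\<^sub>v unit_vec \<alpha> 0"
    have v: "?v \<in> carrier_vec \<alpha>" using adj_mat(1)[OF P] by auto
    have "P *\<^sub>v ?v = (P * adj_mat P) *\<^sub>v unit_vec \<alpha> 0"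
      using P adj_mat(1)[OF P] by (simp add: assoc_mult_mat_vec[of _ \<alpha> \<alpha> _ \<alpha>])
    also have "\<dots> = det P \<cdot>\<^sub>v (1\<^sub>m \<alpha> *\<^sub>v unit_vec \<alpha> 0)"
      unfolding adj_mat(2)[OF P] using unit_vec_carrier[of \<alpha> 0] by auto
    also have "\<dots> = det P \<cdot>\<^sub>v unit_vec \<alpha> 0" by simp
    finally have Pv': "P *\<^sub>v ?v = det P \<cdot>\<^sub>v unit_vec \<alpha> 0" .
    fix j show "coeff [:det P:] j = coeff (\<Sum>i<\<alpha>. [:?v $ i:] * q i) j"
    proof (cases "j < \<alpha>")
      case True
      then show ?thesis unfolding Pv[OF v True] Pv' using \<alpha>
        by (auto simp: unit_vec_def coeff_pCons split: nat.splits)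
    next
      case False
      then have "coeff [:det P:] j = 0" using \<alpha> by (auto simp: coeff_pCons split: nat.splits)
      then show ?thesis using False coeff_adapted_sum[OF ad, of j "\<lambda>i. ?v $ i"] by simp
    qed
  qed
  ultimately show ?thesis using that by blast
qed

text \<open>
  Both monic polynomials annihilate the quotient of the ideal by \<open>f\<close>, so their difference,
  multiplied by a non-zero constant of the ideal, is a multiple of \<open>f\<close> of smaller degree.
\<close>
lemma adapted_char_pol:
  assumes ad: "adapted \<alpha> e f q" and com: "companion \<alpha> f q T \<delta>" and \<alpha>: "0 < \<alpha>"
  shows "f = char_pol \<alpha> T" "i < \<alpha> \<Longrightarrow> q i = char_sol \<alpha> T \<delta> i"
proof -
  let ?\<chi> = "char_pol \<alpha> T" and ?s = "char_sol \<alpha> T \<delta>"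
  note com' = com[unfolded companion_def, rule_format]
    companion_char_sol[of \<alpha> T \<delta>, unfolded companion_def, rule_format]
  have *: "?\<chi> * q i = f * ?s i" if "i < \<alpha>" for i
  proof (rule companion_unique[OF _ _ that, of _ T "\<lambda>i. f * [:\<delta> i:] * ?\<chi>"])
    fix i assume i: "i < \<alpha>"
    have "[:0, 1:] * (?\<chi> * q i) = ?\<chi> * ([:0, 1:] * q i)" by (simp only: ac_simps)
    then show "[:0, 1:] * (?\<chi> * q i) = (\<Sum>j<\<alpha>. [:T i j:] * (?\<chi> * q j)) + f * [:\<delta> i:] * ?\<chi>"
      unfolding com'(1)[OF i] by (simp only: distrib_left sum_distrib_left ac_simps)
    have "[:0, 1:] * (f * ?s i) = f * ([:0, 1:] * ?s i)" by (simp only: ac_simps)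
    then show "[:0, 1:] * (f * ?s i) = (\<Sum>j<\<alpha>. [:T i j:] * (f * ?s j)) + f * [:\<delta> i:] * ?\<chi>"
      unfolding com'(2)[OF i] by (simp only: distrib_left sum_distrib_left ac_simps)
  qed
  obtain b D where D: "D \<noteq> 0" "[:D:] = (\<Sum>i<\<alpha>. [:b i:] * q i)"
    using adapted_const[OF ad \<alpha>] .
  have "f dvd (?\<chi> - f) * q i" if "i < \<alpha>" for i
    using *[OF that] by (simp add: left_diff_distrib)
  then have "f dvd (\<Sum>i<\<alpha>. [:b i:] * ((?\<chi> - f) * q i))"
    by (intro dvd_sum) (simp only: lessThan_iff dvd_mult)
  also have "\<dots> = (?\<chi> - f) * [:D:]"
    unfolding D(2) by (simp only: sum_distrib_left ac_simps)
  finally have dvd: "f dvd (?\<chi> - f) * [:D:]" .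
  show "f = ?\<chi>"
  proof (rule ccontr)
    assume "f \<noteq> ?\<chi>"
    then have ne: "?\<chi> - f \<noteq> 0" by simp
    have "degree (?\<chi> - f) \<le> \<alpha>"
      using adaptedD(1)[OF ad] by (intro degree_diff_le) (auto simp: char_pol_monic)
    moreover have "coeff (?\<chi> - f) \<alpha> = 0"
      using adaptedD(2)[OF ad] by (simp add: char_pol_monic)
    ultimately have "degree (?\<chi> - f) < \<alpha>"
      using ne by (metis le_neq_implies_less leading_coeff_0_iff)
    moreover have "degree ((?\<chi> - f) * [:D:]) = degree (?\<chi> - f)"
      using ne D(1) by (simp add: degree_mult_eq)
    moreover have "degree f \<le> degree ((?\<chi> - f) * [:D:])"
      using dvd ne D(1) by (intro dvd_imp_degree_le) auto
    ultimately show False using adaptedD(1)[OF ad] by simp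
  qed
  with * have "f * q i = f * ?s i" if "i < \<alpha>" for i using that by simp
  moreover have "f \<noteq> 0" using adaptedD(2)[OF ad] by auto
  ultimately show "i < \<alpha> \<Longrightarrow> q i = ?s i" by simp
qed

section \<open>Deformations\<close>

lemma lead_add: "lead d (p + q) j = lead d p j + lead d q j"
  by (simp add: lead_def)

lemma lead_diff: "lead d (p - q) j = lead d p j - lead d q j" for p :: "'k :: ab_group_add poly poly"
  by (simp add: lead_def)

lemma lead_scalar: "lead d ([:[:c:]:] * p) j = c * lead d p j"
  by (simp add: lead_def)

lemma lead_eq_0: "tdeg_le d' p \<Longrightarrow> d' < int d \<Longrightarrow> lead d p j = 0"
  by (auto simp: lead_def intro: tdeg_le_coeff_eq_0)

text \<open>The constant c contributes nothing in degree d + 1, so the top form is y times that of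
  p; setting y = 1 gives the same vector.\<close>

lemma lead_y_mult:
  fixes p :: "'k :: comm_ring_1 poly poly"
  assumes "tdeg_le (int d) p"
  shows "lead (Suc d) ([:[:c, 1:]:] * p) j = lead d p j"
proof -
  have "coeff ([:c, 1:] * coeff p j) (Suc d - j) = (if j \<le> d then coeff (coeff p j) (d - j) else 0)"
    if "j \<le> Suc d"
  proof (cases "j \<le> d")
    case True
    then have "Suc d - j = Suc (d - j)" by simp
    moreover have "coeff (coeff p j) (Suc (d - j)) = 0"
      using True by (intro tdeg_le_coeff_eq_0[OF assms]) auto
    ultimately show ?thesis using True by simp
  next
    case False
    have "coeff (coeff p j) 0 = 0" using False by (intro tdeg_le_coeff_eq_0[OF assms]) auto
    with False that show ?thesis by simp
  qed
  moreover have "coeff ([:[:c, 1:]:] * p) j = [:c, 1:] * coeff p j" by simp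
  ultimately show ?thesis unfolding lead_def by (metis le_SucI)
qed

lemma poly_fun_lead: "poly_family F \<Longrightarrow> poly_fun (\<lambda>\<tau>. lead d (F \<tau>) j)"
  unfolding lead_def by (cases "j \<le> d") (simp_all add: poly_fun_coeff poly_fun_const)

lemma lead_independent_iff_det:
  "lead_independent \<alpha> e q \<longleftrightarrow> det (mat \<alpha> \<alpha> (\<lambda>(j, i). lead (e i) (q i) j)) \<noteq> 0"
proof -
  let ?V = "mat \<alpha> \<alpha> (\<lambda>(j, i). lead (e i) (q i) j)"
  have V: "?V \<in> carrier_mat \<alpha> \<alpha>" by simp
  have Vv: "(?V *\<^sub>v v) $ j = (\<Sum>i<\<alpha>. v $ i * lead (e i) (q i) j)"
    if "v \<in> carrier_vec \<alpha>" "j < \<alpha>" for v j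
    using that by (simp add: scalar_prod_def lessThan_atLeast0 mult.commute)
  show ?thesis
  proof
    assume ind: "lead_independent \<alpha> e q"
    show "det ?V \<noteq> 0"
    proof
      assume "det ?V = 0"
      then obtain v where v: "v \<in> carrier_vec \<alpha>" "v \<noteq> 0\<^sub>v \<alpha>" "?V *\<^sub>v v = 0\<^sub>v \<alpha>"
        using det_0_iff_vec_prod_zero[OF V] by blast
      have "(\<Sum>i<\<alpha>. v $ i * lead (e i) (q i) j) = 0" if "j < \<alpha>" for j
        using Vv[OF v(1) that] v(3) that by simp
      with ind have "v $ i = 0" if "i < \<alpha>" for i
        using that unfolding lead_independent_def by blast
      with v(1,2) show False by (metis carrier_vecD eq_vecI index_zero_vec)
    qed
  next
    assume det: "det ?V \<noteq> 0"
    show "lead_independent \<alpha> e q"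
      unfolding lead_independent_def
    proof (intro allI impI)
      fix \<beta> i assume 0: "\<forall>j<\<alpha>. (\<Sum>i<\<alpha>. \<beta> i * lead (e i) (q i) j) = 0" and i: "i < \<alpha>"
      have "?V *\<^sub>v vec \<alpha> \<beta> = 0\<^sub>v \<alpha>"
        using 0 Vv[of "vec \<alpha> \<beta>"] by (intro eq_vecI) auto
      then have "vec \<alpha> \<beta> = 0\<^sub>v \<alpha>"
        using det det_0_iff_vec_prod_zero[OF V] vec_carrier by blast
      then show "\<beta> i = 0" using i by (metis index_vec index_zero_vec(1))
    qed
  qed
qed

text \<open>Independence is the nonvanishing of a determinant that is polynomial in the
  parameter.\<close>

lemma lead_independent_cofinite:
  fixes q :: "'k :: field \<Rightarrow> nat \<Rightarrow> 'k poly poly"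
  assumes "\<And>i. i < \<alpha> \<Longrightarrow> poly_family (\<lambda>\<tau>. q \<tau> i)" "lead_independent \<alpha> e (q \<tau>0)"
  shows "\<forall>\<^sub>F \<tau> in cofinite. lead_independent \<alpha> e (q \<tau>)"
proof -
  have "poly_fun (\<lambda>\<tau>. det (mat \<alpha> \<alpha> (\<lambda>(j, i). lead (e i) (q \<tau> i) j)))"
    using assms(1) by (intro poly_fun_det[of _ \<alpha>]) (auto intro: poly_fun_lead)
  from poly_fun_cofinite[OF this, of \<tau>0] show ?thesis
    using assms(2) by (simp add: lead_independent_iff_det)
qed

lemma lead_independent_cong:
  "(\<And>i j. i < \<alpha> \<Longrightarrow> j < \<alpha> \<Longrightarrow> lead (e i) (q i) j = lead (e' i) (q' i) j) \<Longrightarrow>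
    lead_independent \<alpha> e q \<longleftrightarrow> lead_independent \<alpha> e' q'"
  unfolding lead_independent_def by simp

lemma adapted_char:
  assumes "fits \<alpha> e T \<delta>" "\<And>i. i < \<alpha> \<Longrightarrow> \<alpha> \<le> e i" "lead_independent \<alpha> e (char_sol \<alpha> T \<delta>)"
  shows "adapted \<alpha> e (char_pol \<alpha> T) (char_sol \<alpha> T \<delta>)"
  using assms tdeg_le_char_pol[OF assms(1)] tdeg_le_char_sol[OF assms(1)]
  by (simp add: adapted_def char_pol_monic degree_char_sol)

section \<open>The ideal spanned by adapted generators and its deformations\<close>

lemma gen_idealI: "a * f + (\<Sum>i<\<alpha>. [:b i:] * q i) \<in> gen_ideal \<alpha> f q"
  by (auto simp: gen_ideal_def)

lemma gen_ideal_add: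
  assumes "s \<in> gen_ideal \<alpha> f q" "t \<in> gen_ideal \<alpha> f q"
  shows "s + t \<in> gen_ideal \<alpha> f q"
proof -
  obtain a b a' b' where "s = a * f + (\<Sum>i<\<alpha>. [:b i:] * q i)" "t = a' * f + (\<Sum>i<\<alpha>. [:b' i:] * q i)"
    using assms by (auto simp: gen_ideal_def)
  then have "s + t = (a + a') * f + (\<Sum>i<\<alpha>. [:b i + b' i:] * q i)"
    by (simp add: distrib_right sum.distrib smult_add_left)
  then show ?thesis by (auto simp: gen_ideal_def)
qed

lemma gen_ideal_const_mult:
  assumes "s \<in> gen_ideal \<alpha> f q"
  shows "[:c:] * s \<in> gen_ideal \<alpha> f q"
proof -
  obtain a b where s: "s = a * f + (\<Sum>i<\<alpha>. [:b i:] * q i)"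
    using assms by (auto simp: gen_ideal_def)
  have "[:c:] * ([:b i:] * q i) = ([:c:] * [:b i:]) * q i" for i
    by (simp only: ac_simps)
  moreover have "[:c:] * [:b i:] = [:c * b i:]" for i by simp
  ultimately have *: "[:c:] * ([:b i:] * q i) = [:c * b i:] * q i" for i
    by (simp only:)
  have "[:c:] * s = ([:c:] * a) * f + (\<Sum>i<\<alpha>. [:c * b i:] * q i)"
    unfolding s distrib_left sum_distrib_left * by (simp only: ac_simps)
  then show ?thesis by (simp only: gen_idealI)
qed

lemma gen_ideal_gen: "i < \<alpha> \<Longrightarrow> q i \<in> gen_ideal \<alpha> f q"
  using gen_idealI[of 0 f "\<lambda>j. if j = i then 1 else 0" q \<alpha>]
  by (simp add: if_distrib[of "\<lambda>x. smult x _"] cong: if_cong)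

lemma gen_ideal_f: "a * f \<in> gen_ideal \<alpha> f q"
  using gen_idealI[of a f "\<lambda>i. 0" q \<alpha>] by simp

lemma gen_ideal_0: "0 \<in> gen_ideal \<alpha> f q"
  using gen_ideal_f[of 0] by simp

lemma gen_ideal_sum: "(\<And>i. i \<in> A \<Longrightarrow> g i \<in> gen_ideal \<alpha> f q) \<Longrightarrow> sum g A \<in> gen_ideal \<alpha> f q"
  by (induction A rule: infinite_finite_induct) (auto intro: gen_ideal_add gen_ideal_0)

lemma gen_ideal_x_mult:
  assumes com: "companion \<alpha> f q T \<delta>" and s: "s \<in> gen_ideal \<alpha> f q"
  shows "[:0, 1:] * s \<in> gen_ideal \<alpha> f q"
proof -
  obtain a b where s: "s = a * f + (\<Sum>i<\<alpha>. [:b i:] * q i)"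
    using s by (auto simp: gen_ideal_def)
  have xs: "[:0, 1:] * s = ([:0, 1:] * a) * f + (\<Sum>i<\<alpha>. [:b i:] * ([:0, 1:] * q i))"
    unfolding s distrib_left sum_distrib_left by (simp only: ac_simps)
  have "[:0, 1:] * q i \<in> gen_ideal \<alpha> f q" if "i < \<alpha>" for i
    using com[unfolded companion_def, rule_format, OF that]
      gen_idealI[of "[:\<delta> i:]" f "T i" q \<alpha>] by (simp only: add.commute)
  then have "(\<Sum>i<\<alpha>. [:b i:] * ([:0, 1:] * q i)) \<in> gen_ideal \<alpha> f q"
    by (intro gen_ideal_sum gen_ideal_const_mult) blast
  from gen_ideal_add[OF gen_ideal_f this] show ?thesis
    unfolding xs .
qed

lemma gen_ideal_mult:
  assumes com: "companion \<alpha> f q T \<delta>" and s: "s \<in> gen_ideal \<alpha> f q"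
  shows "p * s \<in> gen_ideal \<alpha> f q"
proof (induction p)
  case 0
  then show ?case using gen_ideal_0 by simp
next
  case (pCons c p)
  have "pCons c p * s = [:c:] * s + [:0, 1:] * (p * s)"
    by simp
  then show ?case
    by (simp only: gen_ideal_add gen_ideal_const_mult[OF s] gen_ideal_x_mult[OF com pCons.IH])
qed

text \<open>An algebraic substitute for a flat limit: in degrees up to n, \<aa> lies in the limit of
  the \<open>\<bb> \<tau>\<close>. Once the dimensions in degree n agree it is that limit.\<close>

definition deforms :: "nat \<Rightarrow> 'k :: field poly poly set \<Rightarrow> ('k \<Rightarrow> 'k poly poly set) \<Rightarrow> bool" where
  "deforms n \<aa> \<bb> \<longleftrightarrow> (\<forall>p\<in>\<aa>. tdeg_le (int n) p \<longrightarrow>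
    (\<exists>F. poly_family F \<and> F 0 = p \<and> (\<forall>\<^sub>F \<tau> in cofinite. F \<tau> \<in> \<bb> \<tau> \<and> tdeg_le (int n) (F \<tau>))))"

text \<open>An element is lifted by keeping its coefficients and moving the generators. The
  coefficients are bounded by \<open>adapted_tdeg_le\<close>, and the degrees of the generators do
  not grow since \<open>fits\<close> is stable under linear combinations.\<close>

lemma adapted_deforms:
  assumes T: "fits \<alpha> e T \<delta>" and T': "fits \<alpha> e T' \<delta>'"
    and ad: "adapted \<alpha> e (char_pol \<alpha> T) (char_sol \<alpha> T \<delta>)"
  defines "TT \<equiv> \<lambda>\<tau> i j. T i j + Polynomial.smult \<tau> (T' i j)"
    and "\<delta>\<delta> \<equiv> \<lambda>\<tau> i. \<delta> i + Polynomial.smult \<tau> (\<delta>' i)"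
  shows "fits \<alpha> e (TT \<tau>) (\<delta>\<delta> \<tau>)"
    and "\<forall>\<^sub>F \<tau> in cofinite. adapted \<alpha> e (char_pol \<alpha> (TT \<tau>)) (char_sol \<alpha> (TT \<tau>) (\<delta>\<delta> \<tau>))"
    and "deforms n (gen_ideal \<alpha> (char_pol \<alpha> T) (char_sol \<alpha> T \<delta>))
      (\<lambda>\<tau>. gen_ideal \<alpha> (char_pol \<alpha> (TT \<tau>)) (char_sol \<alpha> (TT \<tau>) (\<delta>\<delta> \<tau>)))"
proof -
  have const: "[:b + Polynomial.smult \<tau> b':] = [:b:] + [:[:\<tau>:]:] * [:b':]" for b b' :: "'a poly" and \<tau>
    by simp
  have const_le: "tdeg_le d [:b + Polynomial.smult \<tau> b':]"
    if "tdeg_le d [:b:]" "tdeg_le d [:b':]" for b b' :: "'a poly" and d \<tau>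
    unfolding const using that tdeg_le_mult[OF tdeg_le_scalar[of 0 \<tau>] that(2)]
    by (intro tdeg_le_add) auto
  show fits: "fits \<alpha> e (TT \<tau>) (\<delta>\<delta> \<tau>)" for \<tau>
    using T T' by (auto simp: fits_def TT_def \<delta>\<delta>_def intro: const_le)
  have 0: "TT 0 = T" "\<delta>\<delta> 0 = \<delta>" by (simp_all add: TT_def \<delta>\<delta>_def)
  have famT: "poly_family (\<lambda>\<tau>. [:TT \<tau> i j:])" and fam\<delta>: "poly_family (\<lambda>\<tau>. [:\<delta>\<delta> \<tau> i:])" for i j
    unfolding TT_def \<delta>\<delta>_def const
    by (intro poly_family_add poly_family_mult poly_family_const poly_family_param)+
  note famf = poly_family_char_pol[of \<alpha> TT, OF famT]
  note famq = poly_family_char_sol[of \<alpha> TT \<delta>\<delta>, OF famT fam\<delta>]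
  have "\<forall>\<^sub>F \<tau> in cofinite. lead_independent \<alpha> e (char_sol \<alpha> (TT \<tau>) (\<delta>\<delta> \<tau>))"
    using lead_independent_cofinite[of \<alpha> "\<lambda>\<tau>. char_sol \<alpha> (TT \<tau>) (\<delta>\<delta> \<tau>)" e 0] famq ad
    by (simp add: 0 adapted_def)
  then show ev: "\<forall>\<^sub>F \<tau> in cofinite. adapted \<alpha> e (char_pol \<alpha> (TT \<tau>)) (char_sol \<alpha> (TT \<tau>) (\<delta>\<delta> \<tau>))"
    by eventually_elim (use fits ad in \<open>auto intro: adapted_char simp: adaptedD(4)\<close>)
  show "deforms n (gen_ideal \<alpha> (char_pol \<alpha> T) (char_sol \<alpha> T \<delta>))
      (\<lambda>\<tau>. gen_ideal \<alpha> (char_pol \<alpha> (TT \<tau>)) (char_sol \<alpha> (TT \<tau>) (\<delta>\<delta> \<tau>)))"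
    unfolding deforms_def
  proof (intro ballI impI)
    fix p assume "p \<in> gen_ideal \<alpha> (char_pol \<alpha> T) (char_sol \<alpha> T \<delta>)" and n: "tdeg_le (int n) p"
    then obtain a b where p: "p = a * char_pol \<alpha> T + (\<Sum>i<\<alpha>. [:b i:] * char_sol \<alpha> T \<delta> i)"
      by (auto simp: gen_ideal_def)
    define F where "F = (\<lambda>\<tau>. a * char_pol \<alpha> (TT \<tau>) + (\<Sum>i<\<alpha>. [:b i:] * char_sol \<alpha> (TT \<tau>) (\<delta>\<delta> \<tau>) i))"
    have bounds: "tdeg_le (int n - int \<alpha>) a" "i < \<alpha> \<Longrightarrow> tdeg_le (int n - int (e i)) [:b i:]" for i
      using adapted_tdeg_le[OF ad, of "int n" a b] n p by auto
    have "tdeg_le (int n) (F \<tau>)" for \<tau>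
      unfolding F_def
    proof (intro tdeg_le_add tdeg_le_sum)
      show "tdeg_le (int n) (a * char_pol \<alpha> (TT \<tau>))"
        using tdeg_le_mult[OF bounds(1) tdeg_le_char_pol[OF fits]] by simp
      show "tdeg_le (int n) ([:b i:] * char_sol \<alpha> (TT \<tau>) (\<delta>\<delta> \<tau>) i)" if "i \<in> {..<\<alpha>}" for i
        using tdeg_le_mult[OF bounds(2) tdeg_le_char_sol[OF fits]] that by fastforce
    qed
    moreover have "F \<tau> \<in> gen_ideal \<alpha> (char_pol \<alpha> (TT \<tau>)) (char_sol \<alpha> (TT \<tau>) (\<delta>\<delta> \<tau>))" for \<tau>
      unfolding F_def by (rule gen_idealI)
    moreover have "poly_family F"
      unfolding F_def by (intro poly_family_add poly_family_mult poly_family_sum poly_family_const famf famq)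
    moreover have "F 0 = p"
      by (simp add: F_def p 0)
    ultimately show "\<exists>F. poly_family F \<and> F 0 = p \<and> (\<forall>\<^sub>F \<tau> in cofinite.
        F \<tau> \<in> gen_ideal \<alpha> (char_pol \<alpha> (TT \<tau>)) (char_sol \<alpha> (TT \<tau>) (\<delta>\<delta> \<tau>)) \<and> tdeg_le (int n) (F \<tau>))"
      by auto
  qed
qed

text \<open>A permutation with nonzero contribution never increases \<open>bl\<close>. As it
  preserves the sum of \<open>bl\<close>, it preserves \<open>bl\<close> itself, so only entries of
  the diagonal blocks matter.\<close>

lemma det_cong_blocks:
  fixes A B :: "'a :: comm_ring_1 mat" and bl :: "nat \<Rightarrow> nat"
  assumes A: "A \<in> carrier_mat n n" and B: "B \<in> carrier_mat n n"
    and eq: "\<And>i j. i < n \<Longrightarrow> j < n \<Longrightarrow> bl i = bl j \<Longrightarrow> A $$ (i, j) = B $$ (i, j)"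
    and 0: "\<And>i j. i < n \<Longrightarrow> j < n \<Longrightarrow> bl i < bl j \<Longrightarrow> A $$ (i, j) = 0 \<and> B $$ (i, j) = 0"
  shows "det A = det B"
  unfolding det_def'[OF A] det_def'[OF B]
proof (rule sum.cong[OF refl])
  fix p assume "p \<in> {p. p permutes {0..<n}}"
  then have p: "p permutes {0..<n}" by simp
  then have p_less: "p i < n" if "i < n" for i using that permutes_in_image[OF p, of i] by simp
  have "(\<Prod>i = 0..<n. A $$ (i, p i)) = (\<Prod>i = 0..<n. B $$ (i, p i))"
  proof (cases "\<exists>i<n. bl i < bl (p i)")
    case True
    then obtain i where "i < n" "bl i < bl (p i)" by blast
    then have "A $$ (i, p i) = 0" "B $$ (i, p i) = 0" using 0 p_less by blast+
    with \<open>i < n\<close> have "(\<Prod>i = 0..<n. A $$ (i, p i)) = 0" "(\<Prod>i = 0..<n. B $$ (i, p i)) = 0"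
      by (auto intro!: prod_zero)
    then show ?thesis by simp
  next
    case False
    then have le: "bl (p i) \<le> bl i" if "i \<in> {0..<n}" for i using that by (meson atLeastLessThan_iff not_less)
    have "(\<Sum>i = 0..<n. bl (p i)) = (\<Sum>i = 0..<n. bl i)"
      using sum.permute[OF p, of bl] by (simp add: o_def)
    then have "bl (p i) = bl i" if "i \<in> {0..<n}" for i
      using sum_mono_inv[of "\<lambda>i. bl (p i)" "{0..<n}" bl i] le that by auto
    then show ?thesis using eq p_less by (intro prod.cong) auto
  qed
  then show "signof p * (\<Prod>i = 0..<n. A $$ (i, p i)) = signof p * (\<Prod>i = 0..<n. B $$ (i, p i))"
    by simp
qed

text \<open>A nonzero quotient forces b to be nonconstant, so the bound d - 1 is correct for every
  d.\<close>

lemma tdeg_le_synthetic_div: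
  fixes b :: "'k :: field poly"
  assumes "tdeg_le d [:b:]"
  shows "tdeg_le (d - 1) [:synthetic_div b a:]"
  unfolding tdeg_le_const
proof (intro allI impI)
  fix j assume j: "coeff (synthetic_div b a) j \<noteq> 0"
  then have "synthetic_div b a \<noteq> 0" by auto
  then have b: "degree b \<noteq> 0" by (simp add: synthetic_div_eq_0_iff)
  then have "coeff b (degree b) \<noteq> 0" by auto
  then have "int (degree b) \<le> d" using assms unfolding tdeg_le_const by blast
  moreover have "j \<le> degree b - 1" using le_degree[OF j] by (simp add: degree_synthetic_div)
  ultimately show "int j \<le> d - 1" using b by linarith
qed

section \<open>The family of type zero\<close>

text \<open>Opaque names for constants of \<open>k[y]\<close> and for x. Simplification then does
  not turn products into \<open>smult\<close> or \<open>pCons\<close>, and the long identities below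
  remain plain ring identities.\<close>

definition cst :: "'a :: comm_ring_1 poly \<Rightarrow> 'a poly poly" where "cst b = [:b:]"
definition outer :: "'a :: comm_ring_1 poly poly" where "outer = [:0, 1:]"

lemma cst_ring:
  "cst (b + c) = cst b + cst c" "cst (b - c) = cst b - cst c" "cst (b * c) = cst b * cst c"
  "cst (Polynomial.smult t b) = cst [:t:] * cst b" "cst 0 = 0" "cst 1 = 1"
  "cst [:s * t:] = cst [:s:] * cst [:t:]"
  by (simp_all add: cst_def one_pCons)

lemma companion_cst:
  "companion \<alpha> f q T \<delta> \<longleftrightarrow>
    (\<forall>i<\<alpha>. outer * q i = (\<Sum>j<\<alpha>. cst (T i j) * q j) + cst (\<delta> i) * f)"
  unfolding companion_def cst_def outer_def ..

lemma companion_unique_cst: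
  fixes q q' :: "nat \<Rightarrow> 'k :: idom poly poly"
  assumes "\<And>i. i < \<alpha> \<Longrightarrow> outer * q i = (\<Sum>j<\<alpha>. cst (T i j) * q j) + g i"
    and "\<And>i. i < \<alpha> \<Longrightarrow> outer * q' i = (\<Sum>j<\<alpha>. cst (T i j) * q' j) + g i"
    and "i < \<alpha>"
  shows "q i = q' i"
  using companion_unique[of \<alpha> q T g q' i] assms unfolding cst_def outer_def by blast

text \<open>By \<open>col\<close> and \<open>diag\<close> the p-th unit vector is, at y = a, an
  eigenvector of the block of degrees at most u with eigenvalue \<open>T r r\<close>. The gaps in
  \<open>others\<close> make T block triangular. \<open>lam\<close> is a square root because
  \<open>T r p\<close> at a arises as the product of the limit \<open>lam q_p\<close> of one
  generator and the coefficient \<open>lam\<close> with which that generator enters the relation for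
  \<open>q_r\<close>.\<close>

locale type_zero_data =
  fixes \<alpha> :: nat and e :: "nat \<Rightarrow> nat" and f :: "'k :: field_char_0 poly poly"
    and q :: "nat \<Rightarrow> 'k poly poly" and T :: "nat \<Rightarrow> nat \<Rightarrow> 'k poly" and \<delta> :: "nat \<Rightarrow> 'k poly"
    and u p r :: nat and a lam :: 'k
  assumes ad: "adapted \<alpha> e f q" and com: "companion \<alpha> f q T \<delta>" and fits: "fits \<alpha> e T \<delta>"
    and p: "p < \<alpha>" "e p = u" and r: "r < \<alpha>" "e r = u + 3"
    and others: "\<And>i. i < \<alpha> \<Longrightarrow> i \<noteq> r \<Longrightarrow> e i \<le> u \<or> u + 5 \<le> e i"
    and col: "\<And>i. i < \<alpha> \<Longrightarrow> e i \<le> u \<Longrightarrow> i \<noteq> p \<Longrightarrow> poly (T i p) a = 0"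
    and diag: "poly (T p p) a = poly (T r r) a"
    and lam: "lam \<noteq> 0" "lam\<^sup>2 = poly (T r p) a"
begin

abbreviation sd :: "'k poly \<Rightarrow> 'k poly" where "sd b \<equiv> synthetic_div b a"
abbreviation ev :: "'k poly \<Rightarrow> 'k" where "ev b \<equiv> poly b a"
definition lin :: "'k poly" where "lin = [:- a, 1:]"

definition K :: "nat set" where "K = {i. i < \<alpha> \<and> e i \<le> u \<and> i \<noteq> p}"
definition W :: "nat set" where "W = {i. i < \<alpha> \<and> u + 5 \<le> e i}"

text \<open>
  \<open>TT\<close> and \<open>\<delta>\<delta>\<close> are chosen such that \<open>q i\<close> for \<open>i \<in> K\<close>, \<open>lin * q p\<close>, \<open>lam * q p\<close> and \<open>0\<close> for \<open>i \<in> W\<close> solve the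
  system at \<open>\<tau> = 0\<close>. The combination of the solutions \<open>ss \<tau> p\<close>, \<open>ss \<tau> r\<close> that vanishes there is divisible by
  \<open>\<tau>\<close>, and so are the solutions for \<open>i \<in> W\<close>; the quotients \<open>gg \<tau>\<close> and \<open>ww \<tau> i\<close> tend to \<open>q r\<close> and
  \<open>q i\<close>. The terms of first order in \<open>\<tau>\<close> are forced by this.
\<close>
definition TT :: "'k \<Rightarrow> nat \<Rightarrow> nat \<Rightarrow> 'k poly" where
  "TT \<tau> i j =
    (if i \<in> W then
       if j \<in> W then T i j
       else if j = p then Polynomial.smult \<tau> (sd (T i p)) + Polynomial.smult lam (T i r)
       else if j = r then [:\<tau> * (ev (T i p) / lam):] - lin * T i r
       else Polynomial.smult \<tau> (T i j)
     else if i = p then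
       if j = p then T p p + [:\<tau> * (ev (sd (T r p)) / lam):]
       else if j = r then [:\<tau>:]
       else lin * T p j + [:\<tau> * (ev (T r j) / lam):]
     else if i = r then
       if j = p then Polynomial.smult lam (sd (T p p - T r r)) - Polynomial.smult \<tau> (sd (sd (T r p)))
       else if j = r then T r r
       else Polynomial.smult lam (T p j) - Polynomial.smult \<tau> (sd (T r j))
     else if j = p then sd (T i p) else if j = r then 0 else T i j)"

definition \<delta>\<delta> :: "'k \<Rightarrow> nat \<Rightarrow> 'k poly" where
  "\<delta>\<delta> \<tau> i =
    (if i \<in> W then Polynomial.smult \<tau> (\<delta> i)
     else if i = p then lin * \<delta> p + [:\<tau> * (ev (\<delta> r) / lam):]
     else if i = r then Polynomial.smult lam (\<delta> p) - Polynomial.smult \<tau> (sd (\<delta> r))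
     else \<delta> i)"

definition e' :: "nat \<Rightarrow> nat" where "e' = e(p := u + 1, r := u + 2)"

definition ff :: "'k \<Rightarrow> 'k poly poly" where "ff \<tau> = char_pol \<alpha> (TT \<tau>)"
definition ss :: "'k \<Rightarrow> nat \<Rightarrow> 'k poly poly" where "ss \<tau> = char_sol \<alpha> (TT \<tau>) (\<delta>\<delta> \<tau>)"

lemma decomp: "b = lin * sd b + [:ev b:]"
  using synthetic_div_correct'[of a b] by (simp add: lin_def)

lemma pr: "p \<noteq> r" "p \<notin> W" "r \<notin> W" "p \<notin> K" "r \<notin> K" "K \<inter> W = {}" "finite K" "finite W"
  using p r by (auto simp: W_def K_def)

lemma index_cases:
  assumes "i < \<alpha>"
  obtains "i \<in> K" "i \<noteq> p" "i \<noteq> r" "i \<notin> W" "e i \<le> u" | "i = p" | "i = r"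
    | "i \<in> W" "i \<noteq> p" "i \<noteq> r" "i \<notin> K" "u + 5 \<le> e i"
proof -
  consider "i = r" | "i = p" | "i \<noteq> r" "i \<noteq> p" by blast
  then show ?thesis
  proof cases
    case 3
    from others[OF assms 3(1)] show ?thesis
    proof
      assume "e i \<le> u"
      with 3 assms show ?thesis by (intro that(1)) (auto simp: K_def W_def)
    next
      assume "u + 5 \<le> e i"
      with 3 assms show ?thesis by (intro that(4)) (auto simp: K_def W_def)
    qed
  qed (use that in auto)
qed

lemma sum_split: "(\<Sum>j<\<alpha>. g j) = (\<Sum>j\<in>K. g j) + g p + g r + (\<Sum>j\<in>W. g j)"
  for g :: "nat \<Rightarrow> 'b :: comm_monoid_add"
proof -
  have "{..<\<alpha>} = insert p (insert r (K \<union> W))"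
  proof (intro equalityI subsetI)
    fix i assume "i \<in> {..<\<alpha>}"
    then have "i < \<alpha>" by simp
    then show "i \<in> insert p (insert r (K \<union> W))" by (cases rule: index_cases) auto
  qed (use p r in \<open>auto simp: K_def W_def\<close>)
  then show ?thesis
    using pr by (simp add: sum.union_disjoint ac_simps)
qed

lemma T_le: "i < \<alpha> \<Longrightarrow> j < \<alpha> \<Longrightarrow> tdeg_le (int (e i) + 1 - int (e j)) [:T i j:]"
  and \<delta>_le: "i < \<alpha> \<Longrightarrow> tdeg_le (int (e i) + 1 - int \<alpha>) [:\<delta> i:]"
  using fits by (auto simp: fits_def)

text \<open>This turns the gaps between the degrees into zeros of T.\<close>

lemma T_eq_0: "i < \<alpha> \<Longrightarrow> j < \<alpha> \<Longrightarrow> e i + 1 < e j \<Longrightarrow> T i j = 0"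
  using tdeg_le_neg[OF T_le, of i j] by simp

text \<open>Rows outside W have degree at most u + 3 and columns in W at least u + 5. The absence of
  u + 4 is decisive for row r.\<close>

lemma T_W: "i < \<alpha> \<Longrightarrow> i \<notin> W \<Longrightarrow> j \<in> W \<Longrightarrow> T i j = 0"
  using r p by (auto intro!: T_eq_0 simp: W_def elim!: index_cases[of i])

lemma T_r: "i < \<alpha> \<Longrightarrow> e i \<le> u \<Longrightarrow> T i r = 0"
  using r by (intro T_eq_0) auto

lemma TT_W: "i < \<alpha> \<Longrightarrow> i \<notin> W \<Longrightarrow> j \<in> W \<Longrightarrow> TT \<tau> i j = 0"
  using pr p r T_W[of i j] T_W[of p j] T_W[of r j] by (auto simp: TT_def)

lemma \<alpha>_le: "i < \<alpha> \<Longrightarrow> \<alpha> \<le> e i" using adaptedD(4)[OF ad] .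

lemma tdeg_le_lin: "tdeg_le d [:b:] \<Longrightarrow> tdeg_le (d + 1) [:lin * b:]" for b
  using tdeg_le_mult[OF tdeg_le_y[of 1 "- a" 1], of d "[:b:]"] by (simp add: add.commute lin_def)

lemma tdeg_le_smult: "tdeg_le d [:b:] \<Longrightarrow> tdeg_le d [:Polynomial.smult c b:]" for b :: "'k poly"
  by (auto simp: tdeg_le_const)

lemma tdeg_le_cadd: "tdeg_le d [:b:] \<Longrightarrow> tdeg_le d [:c:] \<Longrightarrow> tdeg_le d [:b + c:]" for b c :: "'k poly"
  using tdeg_le_add[of d "[:b:]" "[:c:]"] by simp

lemma tdeg_le_cdiff: "tdeg_le d [:b:] \<Longrightarrow> tdeg_le d [:c:] \<Longrightarrow> tdeg_le d [:b - c:]" for b c :: "'k poly"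
  using tdeg_le_diff[of d "[:b:]" "[:c:]"] by simp

lemma tdeg_le_sd: "tdeg_le (d + 1) [:b:] \<Longrightarrow> tdeg_le d [:sd b:]"
  using tdeg_le_synthetic_div[of "d + 1" b a] by simp

text \<open>Raising \<open>e p\<close> and lowering \<open>e r\<close> by one relaxes row p and
  column r by one degree and tightens row r and column p by one. This matches a factor
  \<open>lin\<close> in row p and column r, one division by \<open>lin\<close> in row r and column
  p, and two in the entry (r, p). The entry (p, r) may be exactly a constant.\<close>

lemma TT_le:
  assumes i: "i < \<alpha>" and j: "j < \<alpha>"
  shows "tdeg_le (int (e' i) + 1 - int (e' j)) [:TT \<tau> i j:]"
proof -
  note T = tdeg_le_mono[OF T_le]
  note rules = tdeg_le_cadd tdeg_le_cdiff tdeg_le_smult tdeg_le_sd tdeg_le_scalar T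
    tdeg_le_mono[OF tdeg_le_lin[OF T_le]]
  show ?thesis
  proof (cases rule: index_cases[OF i])
    case 1
    show ?thesis
      by (cases rule: index_cases[OF j])
        (insert 1 i j p r pr, auto simp: TT_def e'_def intro!: tdeg_le_sd T)
  next
    case 2
    show ?thesis
    proof (cases rule: index_cases[OF j])
      case 4
      then show ?thesis using TT_W[of p j] p pr 2 by simp
    qed (insert 2 i j p r pr, auto simp: TT_def e'_def intro!: tdeg_le_cadd tdeg_le_scalar T
        tdeg_le_mono[OF tdeg_le_lin[OF T_le]])
  next
    case 3
    show ?thesis
    proof (cases rule: index_cases[OF j])
      case 4
      then show ?thesis using TT_W[of r j] r pr 3 by simp
    next
      case 2
      have "tdeg_le 1 [:T p p - T r r:]"
        using p r by (intro tdeg_le_cdiff T) auto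
      moreover have "tdeg_le 4 [:T r p:]" using p r by (intro T) auto
      ultimately have "tdeg_le 2 [:sd (T p p - T r r):]" "tdeg_le 2 [:sd (sd (T r p)):]"
        by (auto intro!: tdeg_le_sd elim: tdeg_le_mono)
      then show ?thesis
        using 2 3 pr by (auto simp: TT_def e'_def intro!: tdeg_le_cdiff tdeg_le_smult)
    qed (insert 3 i j p r pr, auto simp: TT_def e'_def intro!: tdeg_le_cdiff tdeg_le_smult tdeg_le_sd T)
  next
    case 4
    show ?thesis
      by (cases rule: index_cases[OF j])
        (insert 4 i j p r pr, auto simp: TT_def e'_def intro!: rules)
  qed
qed

lemma \<delta>\<delta>_le:
  assumes i: "i < \<alpha>"
  shows "tdeg_le (int (e' i) + 1 - int \<alpha>) [:\<delta>\<delta> \<tau> i:]"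
proof -
  have "\<alpha> \<le> u" using \<alpha>_le[OF p(1)] p by simp
  then show ?thesis
    by (cases rule: index_cases[OF i])
      (insert i p r pr, auto simp: \<delta>\<delta>_def e'_def intro!: tdeg_le_cadd tdeg_le_cdiff tdeg_le_smult tdeg_le_sd
        tdeg_le_scalar tdeg_le_mono[OF \<delta>_le] tdeg_le_mono[OF tdeg_le_lin[OF \<delta>_le]])
qed

lemma fits': "fits \<alpha> e' (TT \<tau>) (\<delta>\<delta> \<tau>)"
  using TT_le \<delta>\<delta>_le by (auto simp: fits_def)

lemma poly_family_TT: "poly_family (\<lambda>\<tau>. [:TT \<tau> i j:])"
proof -
  have smult: "poly_family (\<lambda>\<tau>. [:Polynomial.smult \<tau> b:])" for b :: "'k poly"
    using poly_family_mult[OF poly_family_param poly_family_const[of "[:b:]"]] by simp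
  have scal: "poly_family (\<lambda>\<tau>. [:[:\<tau> * c:]:])" for c :: 'k
    using poly_family_mult[OF poly_family_param poly_family_const[of "[:[:c:]:]"]] by simp
  have add: "poly_family (\<lambda>\<tau>. [:F \<tau> + G \<tau>:])" "poly_family (\<lambda>\<tau>. [:F \<tau> - G \<tau>:])"
    if "poly_family (\<lambda>\<tau>. [:F \<tau>:])" "poly_family (\<lambda>\<tau>. [:G \<tau>:])" for F G :: "'k \<Rightarrow> 'k poly"
    using poly_family_add[OF that] poly_family_diff[OF that] by simp_all
  show ?thesis
    unfolding TT_def
    by (cases "i \<in> W"; cases "j \<in> W"; cases "i = p"; cases "i = r"; cases "j = p"; cases "j = r")
      (simp_all only: if_True if_False simp_thms smult scal add poly_family_const poly_family_param)
qed

lemma poly_family_\<delta>\<delta>: "poly_family (\<lambda>\<tau>. [:\<delta>\<delta> \<tau> i:])"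
proof -
  have smult: "poly_family (\<lambda>\<tau>. [:Polynomial.smult \<tau> b:])" for b :: "'k poly"
    using poly_family_mult[OF poly_family_param poly_family_const[of "[:b:]"]] by simp
  have scal: "poly_family (\<lambda>\<tau>. [:[:\<tau> * c:]:])" for c :: 'k
    using poly_family_mult[OF poly_family_param poly_family_const[of "[:[:c:]:]"]] by simp
  have add: "poly_family (\<lambda>\<tau>. [:F \<tau> + G \<tau>:])" "poly_family (\<lambda>\<tau>. [:F \<tau> - G \<tau>:])"
    if "poly_family (\<lambda>\<tau>. [:F \<tau>:])" "poly_family (\<lambda>\<tau>. [:G \<tau>:])" for F G :: "'k \<Rightarrow> 'k poly"
    using poly_family_add[OF that] poly_family_diff[OF that] by simp_all
  show ?thesis
    unfolding \<delta>\<delta>_def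
    by (cases "i \<in> W"; cases "i = p"; cases "i = r")
      (simp_all only: if_True if_False simp_thms smult scal add poly_family_const poly_family_param)
qed

lemma poly_family_ff: "poly_family ff"
  unfolding ff_def by (rule poly_family_char_pol[OF poly_family_TT])

lemma poly_family_ss: "poly_family (\<lambda>\<tau>. ss \<tau> i)"
  unfolding ss_def by (rule poly_family_char_sol[OF poly_family_TT poly_family_\<delta>\<delta>])

lemma f_eq: "f = char_pol \<alpha> T"
  using adapted_char_pol(1)[OF ad com] p by auto

text \<open>
  The matrices are block triangular for the blocks \<open>K \<union> {p}\<close>, \<open>{r}\<close>, \<open>W\<close>, and the diagonal blocks
  agree up to conjugation of the first one with the diagonal matrix that has \<open>lin\<close> at \<open>p\<close>.
\<close>
lemma ff_0: "ff 0 = f"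
proof -
  define bl where "bl i = (if i = r then 1 else if i \<in> W then 2 else 0 :: nat)" for i
  have bl: "bl p = 0" "bl r = 1" "\<And>i. i \<in> K \<Longrightarrow> bl i = 0" "\<And>i. i \<in> W \<Longrightarrow> bl i = 2"
    using pr by (auto simp: bl_def)
  \<comment> \<open>Scaling row p on one side and column p on the other expresses the conjugation
    without fractions; the common factor \<open>lin\<close> is cancelled at the end.\<close>
  let ?A = "multrow p [:lin:] (char_mat \<alpha> T)" and ?B = "multcol p [:lin:] (char_mat \<alpha> (TT 0))"
  have "det ?A = det ?B"
  proof (rule det_cong_blocks[of _ \<alpha> _ bl])
    fix i j assume ij: "i < \<alpha>" "j < \<alpha>"
    have A: "?A $$ (i, j) = (if i = p then [:lin:] else 1) * ((if i = j then outer else 0) - cst (T i j))"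
      using ij by (simp add: char_mat_index outer_def cst_def)
    have B: "?B $$ (i, j) = (if j = p then [:lin:] else 1) * ((if i = j then outer else 0) - cst (TT 0 i j))"
      using ij by (simp add: char_mat_index outer_def cst_def)
    show "?A $$ (i, j) = ?B $$ (i, j)" if eq: "bl i = bl j"
    proof -
      have lin_sd: "[:lin:] * cst (sd (T i p)) = cst (T i p)" if "i \<in> K"
      proof -
        have "T i p = lin * sd (T i p)"
          using decomp[of "T i p"] col[of i] that by (simp add: K_def)
        then have "cst (T i p) = cst lin * cst (sd (T i p))" by (metis cst_ring(3))
        then show ?thesis by (simp add: cst_def)
      qed
      show ?thesis
        
      proof (cases rule: index_cases[OF ij(1)])
        case 1
        show ?thesis unfolding A B
          by (cases rule: index_cases[OF ij(2)]) (use 1 ij eq bl p r T_r[OF ij(1)] pr lin_sd in \<open>auto simp: TT_def cst_ring right_diff_distrib\<close>)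
      next
        case 2
        show ?thesis unfolding A B
          by (cases rule: index_cases[OF ij(2)]) (use 2 ij eq bl p r T_r[OF ij(1)] pr in \<open>auto simp: TT_def cst_ring right_diff_distrib cst_def\<close>)
      next
        case 3
        show ?thesis unfolding A B
          by (cases rule: index_cases[OF ij(2)]) (use 3 ij eq bl p r T_r[OF ij(1)] pr in \<open>auto simp: TT_def\<close>)
      next
        case 4
        show ?thesis unfolding A B
          by (cases rule: index_cases[OF ij(2)]) (use 4 ij eq bl p r T_r[OF ij(1)] pr in \<open>auto simp: TT_def\<close>)
      qed
    qed
    show "?A $$ (i, j) = 0 \<and> ?B $$ (i, j) = 0" if less: "bl i < bl j"
    proof -
      have "i \<noteq> j" using less by auto
      moreover have "T i j = 0 \<and> TT 0 i j = 0"
        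
      proof (cases rule: index_cases[OF ij(2)])
        case 3
        with less bl have i: "i \<notin> W" "i \<noteq> r" by auto
        show ?thesis
          by (cases rule: index_cases[OF ij(1)]) (use i ij 3 pr p T_r[OF ij(1)] in \<open>auto simp: TT_def\<close>)
      next
        case 4
        with less bl have "i \<notin> W" by auto
        with 4 ij(1) show ?thesis by (simp add: T_W TT_W)
      qed (use less bl in auto)
      ultimately show ?thesis unfolding A B by (simp add: cst_ring)
    qed
  qed auto
  moreover have "det ?A = [:lin:] * f"
    using p by (simp add: det_multrow[of _ \<alpha>] f_eq char_pol_def)
  moreover have "det ?B = [:lin:] * ff 0"
  proof -
    have "?B = char_mat \<alpha> (TT 0) * multrow_mat \<alpha> p [:lin:]"
      by (rule multcol_mat[of _ \<alpha>]) simp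
    then show ?thesis
      using p by (simp add: det_mult[of _ \<alpha>] det_multrow_mat ff_def char_pol_def mult.commute)
  qed
  ultimately have "[:lin:] * f = [:lin:] * ff 0" by (simp only:)
  moreover have "[:lin:] \<noteq> 0" by (simp add: lin_def)
  ultimately have "f = ff 0" by (simp only: mult_left_cancel simp_thms)
  then show ?thesis by (rule sym)
qed


section \<open>The linear system of the family and its solution at 0\<close>

abbreviation par :: "'k \<Rightarrow> 'k poly poly" where "par c \<equiv> cst [:c:]"

lemma par_0 [simp]: "par 0 = 0" by (simp add: cst_def)

lemma companion_ss: "i < \<alpha> \<Longrightarrow>
    outer * ss \<tau> i = (\<Sum>j<\<alpha>. cst (TT \<tau> i j) * ss \<tau> j) + cst (\<delta>\<delta> \<tau> i) * ff \<tau>"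
  using companion_char_sol[of \<alpha> "TT \<tau>" "\<delta>\<delta> \<tau>"] unfolding companion_cst ss_def ff_def by blast

lemma companion_q: "i < \<alpha> \<Longrightarrow> outer * q i = (\<Sum>j<\<alpha>. cst (T i j) * q j) + cst (\<delta> i) * f"
  using com unfolding companion_cst by blast

lemma par_lam_cancel: "par lam * par (c / lam) = par c"
  using lam by (simp add: cst_def)

text \<open>The remainder is written with the factor \<open>lam\<close> so that multiplying by
  \<open>q p\<close> expresses \<open>b q_p\<close> through the limits \<open>lin q_p\<close> and
  \<open>lam q_p\<close> of the two generators. All entries \<open>sd\<close> and
  \<open>ev / lam\<close> of \<open>TT\<close> come from this splitting.\<close>

lemma cst_decomp: "cst b = cst lin * cst (sd b) + par lam * par (ev b / lam)"
  using decomp[of b] by (metis cst_ring(1,3) par_lam_cancel)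

lemma cst_T_pp: "cst (T p p) = cst (T r r) + cst lin * cst (sd (T p p - T r r))"
  using decomp[of "T p p - T r r"] diag by (simp flip: cst_ring(1,3))

text \<open>Taylor expansion at a up to second order, with constant term \<open>lam\<close> squared.
  The two divisions by \<open>lin\<close> are what the degree bound for the entry (r, p)
  requires.\<close>

lemma cst_T_rp: "cst (T r p) = par lam * par lam +
    cst lin * (cst lin * cst (sd (sd (T r p))) + par lam * par (ev (sd (T r p)) / lam))"
proof -
  have "T r p = lin * sd (T r p) + [:lam * lam:]"
    using decomp[of "T r p"] lam by (simp add: power2_eq_square)
  then have "cst (T r p) = cst lin * cst (sd (T r p)) + par lam * par lam"
    by (metis cst_ring(1,3,7))
  also note cst_decomp[of "sd (T r p)"]
  finally show ?thesis by (simp only: ac_simps)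
qed

lemma cst_T_col: "i < \<alpha> \<Longrightarrow> e i \<le> u \<Longrightarrow> i \<noteq> p \<Longrightarrow> cst (T i p) = cst lin * cst (sd (T i p))"
  using decomp[of "T i p"] col[of i] by (simp flip: cst_ring(3))

lemma K_D: "i \<in> K \<Longrightarrow> i < \<alpha>" "i \<in> K \<Longrightarrow> i \<noteq> p" "i \<in> K \<Longrightarrow> i \<noteq> r" "i \<in> K \<Longrightarrow> i \<notin> W"
  "i \<in> K \<Longrightarrow> e i \<le> u"
  using pr by (auto simp: K_def)

lemma W_D: "i \<in> W \<Longrightarrow> i < \<alpha>" "i \<in> W \<Longrightarrow> i \<noteq> p" "i \<in> W \<Longrightarrow> i \<noteq> r" "i \<in> W \<Longrightarrow> i \<notin> K"
  "i \<in> W \<Longrightarrow> u + 5 \<le> e i"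
  using pr by (auto simp: W_def)

lemma TT_simps:
  "i \<in> K \<Longrightarrow> TT \<tau> i p = sd (T i p)" "i \<in> K \<Longrightarrow> TT \<tau> i r = 0" "i \<in> K \<Longrightarrow> \<delta>\<delta> \<tau> i = \<delta> i"
  "TT \<tau> p p = T p p + [:\<tau> * (ev (sd (T r p)) / lam):]" "TT \<tau> p r = [:\<tau>:]"
  "\<delta>\<delta> \<tau> p = lin * \<delta> p + [:\<tau> * (ev (\<delta> r) / lam):]"
  "TT \<tau> r p = Polynomial.smult lam (sd (T p p - T r r)) - Polynomial.smult \<tau> (sd (sd (T r p)))"
  "TT \<tau> r r = T r r" "\<delta>\<delta> \<tau> r = Polynomial.smult lam (\<delta> p) - Polynomial.smult \<tau> (sd (\<delta> r))"
  "i \<in> W \<Longrightarrow> TT \<tau> i p = Polynomial.smult \<tau> (sd (T i p)) + Polynomial.smult lam (T i r)"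
  "i \<in> W \<Longrightarrow> TT \<tau> i r = [:\<tau> * (ev (T i p) / lam):] - lin * T i r"
  "i \<in> W \<Longrightarrow> \<delta>\<delta> \<tau> i = Polynomial.smult \<tau> (\<delta> i)"
  using pr K_D[of i] by (auto simp: TT_def \<delta>\<delta>_def)

lemma TT_simps_sum:
  "i \<in> K \<Longrightarrow> j \<in> K \<Longrightarrow> TT \<tau> i j = T i j"
  "j \<in> K \<Longrightarrow> TT \<tau> p j = lin * T p j + [:\<tau> * (ev (T r j) / lam):]"
  "j \<in> K \<Longrightarrow> TT \<tau> r j = Polynomial.smult lam (T p j) - Polynomial.smult \<tau> (sd (T r j))"
  "i \<in> W \<Longrightarrow> j \<in> K \<Longrightarrow> TT \<tau> i j = Polynomial.smult \<tau> (T i j)"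
  "i \<in> W \<Longrightarrow> j \<in> W \<Longrightarrow> TT \<tau> i j = T i j"
  using pr K_D[of i] K_D[of j] by (auto simp: TT_def)

lemma sum_K_cong: "(\<And>j. j \<in> K \<Longrightarrow> g j = h j) \<Longrightarrow> (\<Sum>j\<in>K. g j) = (\<Sum>j\<in>K. h j)"
  and sum_W_cong: "(\<And>j. j \<in> W \<Longrightarrow> g j = h j) \<Longrightarrow> (\<Sum>j\<in>W. g j) = (\<Sum>j\<in>W. h j)"
  for g h :: "nat \<Rightarrow> 'k poly poly"
  by simp_all

lemma sum_W_0: "i < \<alpha> \<Longrightarrow> i \<notin> W \<Longrightarrow> (\<Sum>j\<in>W. cst (TT \<tau> i j) * g j) = 0"
  "i < \<alpha> \<Longrightarrow> i \<notin> W \<Longrightarrow> (\<Sum>j\<in>W. cst (T i j) * g j) = 0"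
  using TT_W T_W by (auto intro!: sum.neutral simp: cst_ring)

lemma row_K:
  assumes "i \<in> K"
  shows "outer * ss \<tau> i = (\<Sum>j\<in>K. cst (T i j) * ss \<tau> j) + cst (sd (T i p)) * ss \<tau> p + cst (\<delta> i) * ff \<tau>"
proof -
  have "(\<Sum>j\<in>K. cst (TT \<tau> i j) * ss \<tau> j) = (\<Sum>j\<in>K. cst (T i j) * ss \<tau> j)"
    using assms by (intro sum_K_cong) (simp only: TT_simps_sum)
  then show ?thesis
    using assms
    by (simp only: companion_ss K_D sum_split TT_simps sum_W_0 cst_ring mult_zero_left add_0_right not_False_eq_True)
qed

lemma row_p:
  "outer * ss \<tau> p = cst lin * (\<Sum>j\<in>K. cst (T p j) * ss \<tau> j)
    + par \<tau> * (\<Sum>j\<in>K. par (ev (T r j) / lam) * ss \<tau> j)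
    + (cst (T p p) + par \<tau> * par (ev (sd (T r p)) / lam)) * ss \<tau> p + par \<tau> * ss \<tau> r
    + (cst lin * cst (\<delta> p) + par \<tau> * par (ev (\<delta> r) / lam)) * ff \<tau>"
proof -
  have "(\<Sum>j\<in>K. cst (TT \<tau> p j) * ss \<tau> j) = (\<Sum>j\<in>K. cst lin * (cst (T p j) * ss \<tau> j)
      + par \<tau> * (par (ev (T r j) / lam) * ss \<tau> j))"
    by (intro sum_K_cong) (simp only: TT_simps_sum cst_ring distrib_right mult.assoc)
  then show ?thesis
    by (simp only: companion_ss[OF p(1)] sum_split TT_simps sum_W_0[OF p(1) pr(2)] cst_ring
        add_0_right sum.distrib sum_distrib_left)
qed

lemma row_r:
  "outer * ss \<tau> r = par lam * (\<Sum>j\<in>K. cst (T p j) * ss \<tau> j)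
    - par \<tau> * (\<Sum>j\<in>K. cst (sd (T r j)) * ss \<tau> j)
    + (par lam * cst (sd (T p p - T r r)) - par \<tau> * cst (sd (sd (T r p)))) * ss \<tau> p
    + cst (T r r) * ss \<tau> r
    + (par lam * cst (\<delta> p) - par \<tau> * cst (sd (\<delta> r))) * ff \<tau>"
proof -
  have "(\<Sum>j\<in>K. cst (TT \<tau> r j) * ss \<tau> j) = (\<Sum>j\<in>K. par lam * (cst (T p j) * ss \<tau> j)
      - par \<tau> * (cst (sd (T r j)) * ss \<tau> j))"
    by (intro sum_K_cong) (simp only: TT_simps_sum cst_ring left_diff_distrib mult.assoc)
  then have "outer * ss \<tau> r = (par lam * (\<Sum>j\<in>K. cst (T p j) * ss \<tau> j)
    - par \<tau> * (\<Sum>j\<in>K. cst (sd (T r j)) * ss \<tau> j))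
    + cst (TT \<tau> r p) * ss \<tau> p + cst (T r r) * ss \<tau> r + cst (\<delta>\<delta> \<tau> r) * ff \<tau>"
    by (simp only: companion_ss[OF r(1)] sum_split TT_simps(8) sum_W_0[OF r(1) pr(3)]
        add_0_right sum_subtractf sum_distrib_left)
  then show ?thesis by (simp only: TT_simps cst_ring)
qed

lemma row_W:
  assumes "i \<in> W"
  shows "outer * ss \<tau> i = par \<tau> * (\<Sum>j\<in>K. cst (T i j) * ss \<tau> j)
    + (par \<tau> * cst (sd (T i p)) + par lam * cst (T i r)) * ss \<tau> p
    + (par \<tau> * par (ev (T i p) / lam) - cst lin * cst (T i r)) * ss \<tau> r
    + (\<Sum>j\<in>W. cst (T i j) * ss \<tau> j) + par \<tau> * cst (\<delta> i) * ff \<tau>"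
proof -
  have "(\<Sum>j\<in>K. cst (TT \<tau> i j) * ss \<tau> j) = (\<Sum>j\<in>K. par \<tau> * (cst (T i j) * ss \<tau> j))"
    using assms by (intro sum_K_cong) (simp only: TT_simps_sum cst_ring mult.assoc)
  moreover have "(\<Sum>j\<in>W. cst (TT \<tau> i j) * ss \<tau> j) = (\<Sum>j\<in>W. cst (T i j) * ss \<tau> j)"
    using assms by (intro sum_W_cong) (simp only: TT_simps_sum)
  ultimately show ?thesis
    using assms by (simp only: companion_ss W_D sum_split TT_simps cst_ring sum_distrib_left)
qed

definition v0 :: "nat \<Rightarrow> 'k poly poly" where
  "v0 i = (if i \<in> W then 0 else if i = p then cst lin * q p else if i = r then par lam * q p else q i)"

lemma v0_simps: "i \<in> K \<Longrightarrow> v0 i = q i" "v0 p = cst lin * q p" "v0 r = par lam * q p" "i \<in> W \<Longrightarrow> v0 i = 0"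
  using pr K_D[of i] by (auto simp: v0_def)

text \<open>Since \<open>ff 0 = f\<close>, both sides solve the same inhomogeneous system at \<tau>
  = 0, and its solution is unique.\<close>

lemma ss_0: "i < \<alpha> \<Longrightarrow> ss 0 i = v0 i"
proof (rule companion_unique_cst[OF companion_ss])
  fix i assume i: "i < \<alpha>"
  have W: "(\<Sum>j\<in>W. h j * v0 j) = 0" for h :: "nat \<Rightarrow> 'k poly poly"
    by (intro sum.neutral) (simp add: v0_simps)
  have row: "outer * q i = (\<Sum>j\<in>K. cst (T i j) * q j) + cst (T i p) * q p + cst (\<delta> i) * f"
    if "i < \<alpha>" "e i \<le> u" for i
  proof -
    have "i \<notin> W" using that by (simp add: W_def)
    then show ?thesis using that
      by (simp only: companion_q sum_split T_r sum_W_0 cst_ring mult_zero_left add_0_right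
          not_False_eq_True)
  qed
  show "outer * v0 i = (\<Sum>j<\<alpha>. cst (TT 0 i j) * v0 j) + cst (\<delta>\<delta> 0 i) * ff 0"
    using i
  proof (cases rule: index_cases)
    case 1
    have "(\<Sum>j\<in>K. cst (TT 0 i j) * v0 j) = (\<Sum>j\<in>K. cst (T i j) * q j)"
      using 1 by (intro sum_K_cong) (simp only: TT_simps_sum v0_simps)
    then have "(\<Sum>j<\<alpha>. cst (TT 0 i j) * v0 j) + cst (\<delta>\<delta> 0 i) * ff 0
        = (\<Sum>j\<in>K. cst (T i j) * q j) + cst (sd (T i p)) * (cst lin * q p) + cst (\<delta> i) * f"
      using 1 by (simp only: sum_split W v0_simps TT_simps ff_0 cst_ring mult_zero_left add_0_right)
    then show ?thesis
      using 1 by (simp only: v0_simps row[OF i] cst_T_col[OF i 1(5) 1(2)] ac_simps)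
  next
    case 2
    have "(\<Sum>j\<in>K. cst (TT 0 p j) * v0 j) = (\<Sum>j\<in>K. cst lin * (cst (T p j) * q j))"
      by (intro sum_K_cong) (simp only: TT_simps_sum v0_simps cst_ring mult_zero_left add_0_right par_0 mult.assoc)
    then have "(\<Sum>j<\<alpha>. cst (TT 0 p j) * v0 j) + cst (\<delta>\<delta> 0 p) * ff 0 = cst lin * (outer * q p)"
      by (simp only: row[OF p(1)] p order.refl sum_split W v0_simps TT_simps ff_0 cst_ring par_0
          mult_zero_left add_0_right sum_distrib_left[symmetric])
        (simp only: algebra_simps add_0_left add_0_right)
    then show ?thesis using 2 by (simp only: v0_simps mult.left_commute)
  next
    case 3
    have "(\<Sum>j\<in>K. cst (TT 0 r j) * v0 j) = (\<Sum>j\<in>K. par lam * (cst (T p j) * q j))"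
      by (intro sum_K_cong) (simp only: TT_simps_sum v0_simps cst_ring mult_zero_left diff_0_right par_0 mult.assoc)
    \<comment> \<open>By \<open>diag\<close>, \<open>T p p\<close> is \<open>T r r\<close> plus a
      multiple of \<open>lin\<close>. Hence \<open>lam * T p p * q p\<close> splits into
      \<open>T r r\<close> times the r-th limit and a multiple of the p-th one.\<close>
    then have "(\<Sum>j<\<alpha>. cst (TT 0 r j) * v0 j) + cst (\<delta>\<delta> 0 r) * ff 0 = par lam * (outer * q p)"
      by (simp only: row[OF p(1)] p order.refl cst_T_pp sum_split W v0_simps TT_simps ff_0 cst_ring par_0
          mult_zero_left add_0_right diff_0_right sum_distrib_left[symmetric])
        (simp only: algebra_simps add_0_left add_0_right)
    then show ?thesis using 3 by (simp only: v0_simps mult.left_commute)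
  next
    case 4
    have "(\<Sum>j\<in>K. cst (TT 0 i j) * v0 j) = 0"
      using 4 by (intro sum.neutral) (simp add: TT_simps_sum cst_ring)
    then have "(\<Sum>j<\<alpha>. cst (TT 0 i j) * v0 j) + cst (\<delta>\<delta> 0 i) * ff 0
        = par lam * cst (T i r) * (cst lin * q p) - cst lin * cst (T i r) * (par lam * q p)"
      using 4 by (simp only: sum_split W v0_simps TT_simps cst_ring par_0 mult_zero_left mult_zero_right
          add_0_left add_0_right diff_0 minus_mult_left[symmetric] add_uminus_conv_diff)
    also have "\<dots> = 0" by (simp only: ac_simps diff_self)
    finally show ?thesis using 4 by (simp only: v0_simps mult_zero_right)
  qed
qed

section \<open>Division by the parameter and the limits of the quotients\<close>

definition gg :: "'k \<Rightarrow> 'k poly poly" where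
  "gg = (SOME G. poly_family G \<and> (\<forall>\<tau>. par lam * ss \<tau> p - cst lin * ss \<tau> r = par \<tau> * G \<tau>))"

lemma gg: "poly_family gg" "par lam * ss \<tau> p - cst lin * ss \<tau> r = par \<tau> * gg \<tau>"
proof -
  have "poly_family (\<lambda>\<tau>. par lam * ss \<tau> p - cst lin * ss \<tau> r)"
    by (intro poly_family_diff poly_family_mult poly_family_const poly_family_ss)
  moreover have "par lam * ss 0 p - cst lin * ss 0 r = 0"
    using pr p r by (simp add: ss_0 v0_def)
  ultimately have "\<exists>G. poly_family G \<and> (\<forall>\<tau>. par lam * ss \<tau> p - cst lin * ss \<tau> r = par \<tau> * G \<tau>)"
    by (rule poly_family_divide) (auto simp: cst_def)
  from someI_ex[OF this] show "poly_family gg" "par lam * ss \<tau> p - cst lin * ss \<tau> r = par \<tau> * gg \<tau>"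
    unfolding gg_def by blast+
qed

definition quot :: "nat \<Rightarrow> 'k \<Rightarrow> 'k poly poly" where
  "quot i = (SOME G. poly_family G \<and> (\<forall>\<tau>. ss \<tau> i = par \<tau> * G \<tau>))"

definition ww :: "'k \<Rightarrow> nat \<Rightarrow> 'k poly poly" where
  "ww \<tau> i = (if i \<in> W then quot i \<tau> else ss \<tau> i)"

lemma ww: "poly_family (\<lambda>\<tau>. ww \<tau> i)" "i \<in> W \<Longrightarrow> ss \<tau> i = par \<tau> * ww \<tau> i"
proof -
  have *: "poly_family (\<lambda>\<tau>. ww \<tau> i) \<and> (\<forall>\<tau>. ss \<tau> i = par \<tau> * ww \<tau> i)" if i: "i \<in> W"
  proof -
    have "ss 0 i = 0" using i by (simp add: ss_0 v0_def W_def)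
    with poly_family_ss[of i] have "\<exists>G. poly_family G \<and> (\<forall>\<tau>. ss \<tau> i = par \<tau> * G \<tau>)"
      by (rule poly_family_divide) (auto simp: cst_def)
    from someI_ex[OF this, folded quot_def] show ?thesis using i by (simp add: ww_def)
  qed
  show "poly_family (\<lambda>\<tau>. ww \<tau> i)"
    using * poly_family_ss[of i] by (cases "i \<in> W") (simp_all add: ww_def)
  show "i \<in> W \<Longrightarrow> ss \<tau> i = par \<tau> * ww \<tau> i" using * by blast
qed

lemma ww_eq_ss: "i \<notin> W \<Longrightarrow> ww \<tau> i = ss \<tau> i"
  by (simp add: ww_def)

lemmas family_intros = poly_family_add poly_family_diff poly_family_mult poly_family_sum
  poly_family_const poly_family_ss poly_family_ff gg(1) ww(1)

lemma par_cancel: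
  "poly_family F \<Longrightarrow> poly_family G \<Longrightarrow> (\<And>\<tau>. par \<tau> * F \<tau> = par \<tau> * G \<tau>) \<Longrightarrow> F \<tau> = G \<tau>"
  unfolding cst_def by (rule poly_family_cancel)

text \<open>This is \<open>lam\<close> times row p minus \<open>lin\<close> times row r. Here l, m,
  t, b, k stand for \<open>lam\<close>, \<open>lin\<close>, \<tau>, \<open>T r r\<close> and the
  quotient of \<open>T p p - T r r\<close>. Terms without t cancel, except b times the combination
  itself.\<close>

lemma elimination_identity:
  fixes l m t b k z z' S S1 S2 y y' d d1 d2 F :: "'b :: comm_ring_1"
  shows "l * (m * S + t * S1 + (b + m * k + t * z) * y + t * y' + (m * d + t * d1) * F)
      - m * (l * S - t * S2 + (l * k - t * z') * y + b * y' + (l * d - t * d2) * F)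
    = t * (l * S1 + m * S2 + (l * z + m * z') * y + l * y' + (m * d2 + l * d1) * F)
      + b * (l * y - m * y')"
  by (simp add: algebra_simps)

text \<open>Rows p and r are combined and \<tau> is cancelled. The terms of first order in
  \<open>TT\<close> reassemble each coefficient as \<open>lam\<close> times its value part plus
  \<open>lin\<close> times its quotient, so that \<tau> = 0 gives row r of the original
  system.\<close>

lemma outer_gg:
  "outer * gg \<tau> = (\<Sum>j\<in>K. cst (T r j) * ss \<tau> j)
    + (par lam * par (ev (sd (T r p)) / lam) + cst lin * cst (sd (sd (T r p)))) * ss \<tau> p
    + par lam * ss \<tau> r + cst (T r r) * gg \<tau> + cst (\<delta> r) * ff \<tau>"
proof (rule par_cancel[of "\<lambda>\<tau>. outer * gg \<tau>" "\<lambda>\<tau>. (\<Sum>j\<in>K. cst (T r j) * ss \<tau> j)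
    + (par lam * par (ev (sd (T r p)) / lam) + cst lin * cst (sd (sd (T r p)))) * ss \<tau> p
    + par lam * ss \<tau> r + cst (T r r) * gg \<tau> + cst (\<delta> r) * ff \<tau>" \<tau>])
  fix \<tau>
  define S where "S = (\<Sum>j\<in>K. cst (T p j) * ss \<tau> j)"
  define S1 where "S1 = (\<Sum>j\<in>K. par (ev (T r j) / lam) * ss \<tau> j)"
  define S2 where "S2 = (\<Sum>j\<in>K. cst (sd (T r j)) * ss \<tau> j)"
  have "(\<Sum>j\<in>K. cst (T r j) * ss \<tau> j) = (\<Sum>j\<in>K. par lam * (par (ev (T r j) / lam) * ss \<tau> j)
      + cst lin * (cst (sd (T r j)) * ss \<tau> j))"
    by (intro sum_K_cong, subst cst_decomp) (simp only: algebra_simps)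
  then have S: "(\<Sum>j\<in>K. cst (T r j) * ss \<tau> j) = par lam * S1 + cst lin * S2"
    by (simp add: S1_def S2_def sum.distrib sum_distrib_left)
  have g: "par lam * ss \<tau> p - cst lin * ss \<tau> r = par \<tau> * gg \<tau>" by (rule gg)
  have d: "cst (\<delta> r) = cst lin * cst (sd (\<delta> r)) + par lam * par (ev (\<delta> r) / lam)"
    by (rule cst_decomp)
  note rows = row_p[of \<tau>, folded S_def S1_def] row_r[of \<tau>, folded S_def S2_def]
  have "par \<tau> * (outer * gg \<tau>) = outer * (par lam * ss \<tau> p - cst lin * ss \<tau> r)"
    unfolding g by (rule mult.left_commute)
  also have "\<dots> = par lam * (outer * ss \<tau> p) - cst lin * (outer * ss \<tau> r)"
    by (simp only: algebra_simps)
  also have "\<dots> = par \<tau> * (par lam * S1 + cst lin * S2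
    + (par lam * par (ev (sd (T r p)) / lam) + cst lin * cst (sd (sd (T r p)))) * ss \<tau> p
    + par lam * ss \<tau> r + cst (\<delta> r) * ff \<tau>) + cst (T r r) * (par \<tau> * gg \<tau>)"
    unfolding rows d cst_T_pp g[symmetric] by (rule elimination_identity)
  also have "\<dots> = par \<tau> * (par lam * S1 + cst lin * S2
    + (par lam * par (ev (sd (T r p)) / lam) + cst lin * cst (sd (sd (T r p)))) * ss \<tau> p
    + par lam * ss \<tau> r + cst (T r r) * gg \<tau> + cst (\<delta> r) * ff \<tau>)"
    by (simp only: algebra_simps)
  finally show "par \<tau> * (outer * gg \<tau>) = par \<tau> * ((\<Sum>j\<in>K. cst (T r j) * ss \<tau> j)
    + (par lam * par (ev (sd (T r p)) / lam) + cst lin * cst (sd (sd (T r p)))) * ss \<tau> p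
    + par lam * ss \<tau> r + cst (T r r) * gg \<tau> + cst (\<delta> r) * ff \<tau>)"
    unfolding S .
qed (intro family_intros)+

text \<open>The terms of order zero in rows of W combine to \<open>T i r\<close> times
  \<open>lam ss_p - lin ss_r\<close>, which is \<tau> times \<open>T i r * gg\<close>. The whole row
  is therefore divisible by \<tau>.\<close>

lemma outer_ww:
  assumes i: "i \<in> W"
  shows "outer * ww \<tau> i = (\<Sum>j\<in>K. cst (T i j) * ss \<tau> j) + cst (sd (T i p)) * ss \<tau> p
    + par (ev (T i p) / lam) * ss \<tau> r + cst (T i r) * gg \<tau>
    + (\<Sum>j\<in>W. cst (T i j) * ww \<tau> j) + cst (\<delta> i) * ff \<tau>"
proof (rule par_cancel[of "\<lambda>\<tau>. outer * ww \<tau> i" "\<lambda>\<tau>. (\<Sum>j\<in>K. cst (T i j) * ss \<tau> j)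
    + cst (sd (T i p)) * ss \<tau> p + par (ev (T i p) / lam) * ss \<tau> r + cst (T i r) * gg \<tau>
    + (\<Sum>j\<in>W. cst (T i j) * ww \<tau> j) + cst (\<delta> i) * ff \<tau>" \<tau>])
  fix \<tau>
  have "(\<Sum>j\<in>W. cst (T i j) * ss \<tau> j) = (\<Sum>j\<in>W. par \<tau> * (cst (T i j) * ww \<tau> j))"
    using ww(2) by (intro sum.cong) auto
  then have S: "(\<Sum>j\<in>W. cst (T i j) * ss \<tau> j) = par \<tau> * (\<Sum>j\<in>W. cst (T i j) * ww \<tau> j)"
    by (simp add: sum_distrib_left)
  have "par \<tau> * (outer * ww \<tau> i) = outer * ss \<tau> i"
    unfolding ww(2)[OF i] by (rule mult.left_commute)
  also have "\<dots> = par \<tau> * ((\<Sum>j\<in>K. cst (T i j) * ss \<tau> j) + cst (sd (T i p)) * ss \<tau> p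
    + par (ev (T i p) / lam) * ss \<tau> r + cst (T i r) * gg \<tau>
    + (\<Sum>j\<in>W. cst (T i j) * ww \<tau> j) + cst (\<delta> i) * ff \<tau>)"
  proof -
    have g: "par lam * (cst (T i r) * ss \<tau> p) = cst lin * (cst (T i r) * ss \<tau> r) + par \<tau> * (cst (T i r) * gg \<tau>)"
      using arg_cong[OF gg(2)[of \<tau>], of "\<lambda>x. cst (T i r) * x"] by (simp add: algebra_simps)
    show ?thesis unfolding row_W[OF i] S by (simp add: algebra_simps g)
  qed
  finally show "par \<tau> * (outer * ww \<tau> i) = par \<tau> * ((\<Sum>j\<in>K. cst (T i j) * ss \<tau> j)
    + cst (sd (T i p)) * ss \<tau> p + par (ev (T i p) / lam) * ss \<tau> r + cst (T i r) * gg \<tau>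
    + (\<Sum>j\<in>W. cst (T i j) * ww \<tau> j) + cst (\<delta> i) * ff \<tau>)" .
qed (intro family_intros)+

definition w0 :: "nat \<Rightarrow> 'k poly poly" where
  "w0 i = (if i = p then q p else if i = r then gg 0 else ww 0 i)"

text \<open>At \<tau> = 0 the divided relations are the original system for T and f, so uniqueness
  identifies the limits with the \<open>q i\<close>.\<close>

lemma w0_eq_q: "i < \<alpha> \<Longrightarrow> w0 i = q i"
proof (rule companion_unique_cst[OF _ companion_q])
  fix i assume i: "i < \<alpha>"
  have K: "(\<Sum>j\<in>K. cst (T k j) * w0 j) = (\<Sum>j\<in>K. cst (T k j) * ss 0 j)" for k
    using K_D by (intro sum_K_cong) (simp add: w0_def ww_eq_ss)
  have W: "(\<Sum>j\<in>W. cst (T k j) * w0 j) = (\<Sum>j\<in>W. cst (T k j) * ww 0 j)" for k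
    using W_D by (intro sum_W_cong) (simp add: w0_def)
  have sp: "ss 0 p = cst lin * q p" and sr: "ss 0 r = par lam * q p"
    using pr p r by (simp_all add: ss_0 v0_def)
  have Kq: "(\<Sum>j\<in>K. cst (T k j) * ss 0 j) = (\<Sum>j\<in>K. cst (T k j) * q j)" for k
    using K_D by (intro sum_K_cong) (simp add: ss_0 v0_simps)
  have w0: "w0 p = q p" "w0 r = gg 0" using pr by (simp_all add: w0_def)
  show "outer * w0 i = (\<Sum>j<\<alpha>. cst (T i j) * w0 j) + cst (\<delta> i) * f"
    using i
  proof (cases rule: index_cases)
    case 1
    have wi: "w0 i = ss 0 i" using 1 by (simp add: w0_def ww_eq_ss)
    show ?thesis
      using 1(5) by (simp only: sum_split K W sum_W_0(2)[OF i 1(4)] w0 wi row_K[OF 1(1)] T_r[OF i]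
          cst_T_col[OF i 1(5) 1(2)] sp ff_0 cst_ring mult_zero_left add_0_right add_0_left ac_simps)
  next
    case 2
    have "e p \<le> u" using p by simp
    then show ?thesis
      unfolding 2
      by (simp only: sum_split K W Kq w0 companion_q[OF p(1)] sum_W_0(2)[OF p(1) pr(2)] T_r[OF p(1)]
          cst_ring mult_zero_left add_0_right)
  next
    case 3
    show ?thesis
      unfolding 3 w0
      by (simp only: sum_split K W w0 sum_W_0(2)[OF r(1) pr(3)] cst_T_rp outer_gg[of 0] sp sr ff_0
          add_0_right) (simp only: algebra_simps)
  next
    case 4
    have wi: "w0 i = ww 0 i" using 4 by (simp add: w0_def)
    have "outer * ww 0 i = (\<Sum>j\<in>K. cst (T i j) * ss 0 j)
        + (cst lin * cst (sd (T i p)) + par lam * par (ev (T i p) / lam)) * q p + cst (T i r) * gg 0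
        + (\<Sum>j\<in>W. cst (T i j) * ww 0 j) + cst (\<delta> i) * f"
      unfolding outer_ww[OF 4(1)] sp sr ff_0 by (simp only: algebra_simps)
    then show ?thesis
      unfolding cst_decomp[symmetric] by (simp only: sum_split K W w0 wi)
  qed
qed

end

section \<open>Leading forms and lifts in the family\<close>

context type_zero_data begin

lemma par_inverse: "\<tau> \<noteq> 0 \<Longrightarrow> par (1 / \<tau>) * (par \<tau> * x) = x"
  by (simp add: cst_def pCons_one)

lemma lead_par: "lead d (par c * x) j = c * lead d x j"
  unfolding cst_def by (rule lead_scalar)

lemma gg_eq: "\<tau> \<noteq> 0 \<Longrightarrow> gg \<tau> = par (1 / \<tau>) * (par lam * ss \<tau> p - cst lin * ss \<tau> r)"
  unfolding gg(2) par_inverse ..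

lemma ww_eq: "\<tau> \<noteq> 0 \<Longrightarrow> i \<in> W \<Longrightarrow> ww \<tau> i = par (1 / \<tau>) * ss \<tau> i"
  unfolding ww(2) par_inverse ..

text \<open>For fixed nonzero \<tau> the poles in the rows of W are harmless. They are the reason
  why the polynomial matrix \<open>TT\<close> has \<tau> times \<open>ww\<close> as its solution in
  these rows.\<close>

lemma companion_ww:
  assumes \<tau>: "\<tau> \<noteq> 0"
  shows "companion \<alpha> (ff \<tau>) (ww \<tau>)
    (\<lambda>i j. if i \<in> W then
        if j = p then sd (T i p) + Polynomial.smult (lam / \<tau>) (T i r)
        else if j = r then [:ev (T i p) / lam:] - Polynomial.smult (1 / \<tau>) (lin * T i r)
        else T i j
      else TT \<tau> i j)
    (\<lambda>i. if i \<in> W then \<delta> i else \<delta>\<delta> \<tau> i)" (is "companion _ _ _ ?T ?\<delta>")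
  unfolding companion_cst
proof (intro allI impI)
  fix i assume i: "i < \<alpha>"
  show "outer * ww \<tau> i = (\<Sum>j<\<alpha>. cst (?T i j) * ww \<tau> j) + cst (?\<delta> i) * ff \<tau>"
  proof (cases "i \<in> W")
    case False
    have "cst (TT \<tau> i j) * ss \<tau> j = cst (TT \<tau> i j) * ww \<tau> j" for j
      using TT_W[OF i False, of j] by (cases "j \<in> W") (simp_all add: ww_eq_ss cst_ring)
    then have "(\<Sum>j<\<alpha>. cst (TT \<tau> i j) * ss \<tau> j) = (\<Sum>j<\<alpha>. cst (TT \<tau> i j) * ww \<tau> j)"
      by (rule sum.cong[OF refl])
    then show ?thesis
      using companion_ss[OF i, of \<tau>] False by (simp add: ww_eq_ss)
  next
    case True
    have "(\<Sum>j\<in>K. cst (?T i j) * ww \<tau> j) = (\<Sum>j\<in>K. cst (T i j) * ss \<tau> j)"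
      using True K_D by (intro sum_K_cong) (simp add: ww_eq_ss)
    moreover have "(\<Sum>j\<in>W. cst (?T i j) * ww \<tau> j) = (\<Sum>j\<in>W. cst (T i j) * ww \<tau> j)"
      using True W_D by (intro sum_W_cong) simp
    moreover have "cst (?T i p) * ww \<tau> p + cst (?T i r) * ww \<tau> r
        = cst (sd (T i p)) * ss \<tau> p + par (ev (T i p) / lam) * ss \<tau> r + cst (T i r) * gg \<tau>"
    proof -
      have "par (lam / \<tau>) = par (1 / \<tau>) * par lam" by (simp add: cst_def)
      then have Tp: "cst (?T i p) = cst (sd (T i p)) + par (1 / \<tau>) * par lam * cst (T i r)"
        using True by (simp add: cst_ring)
      have Tr: "cst (?T i r) = par (ev (T i p) / lam) - par (1 / \<tau>) * cst lin * cst (T i r)"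
        using True pr by (simp add: cst_ring)
      show ?thesis
        unfolding Tp Tr ww_eq_ss[OF pr(2)] ww_eq_ss[OF pr(3)] gg_eq[OF \<tau>]
        by (simp add: algebra_simps)
    qed
    ultimately show ?thesis
      unfolding sum_split outer_ww[OF True] using True by (simp add: algebra_simps)
  qed
qed

lemma tdeg_le_ss: "i < \<alpha> \<Longrightarrow> tdeg_le (int (e' i)) (ss \<tau> i)"
  unfolding ss_def by (rule tdeg_le_char_sol[OF fits'])

lemma tdeg_le_par_mult: "tdeg_le d x \<Longrightarrow> tdeg_le d (par c * x)"
  using tdeg_le_mult[OF tdeg_le_scalar[of 0 c], of d x] by (simp add: cst_def)

lemma e'_simps: "e' p = u + 1" "e' r = u + 2" "i \<noteq> p \<Longrightarrow> i \<noteq> r \<Longrightarrow> e' i = e i"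
  using pr by (simp_all add: e'_def)

lemma tdeg_le_gg:
  assumes "\<tau> \<noteq> 0"
  shows "tdeg_le (int u + 3) (gg \<tau>)"
proof -
  have "tdeg_le (int u + 3) (ss \<tau> p)"
    by (rule tdeg_le_mono[OF tdeg_le_ss[OF p(1)]]) (simp add: e'_simps)
  moreover have "tdeg_le (int u + 3) (cst lin * ss \<tau> r)"
    using tdeg_le_mult[OF tdeg_le_y[of 1 "- a" 1] tdeg_le_ss[OF r(1), of \<tau>]]
    by (simp add: e'_simps cst_def lin_def add.commute)
  ultimately show ?thesis
    unfolding gg_eq[OF assms] by (intro tdeg_le_par_mult tdeg_le_diff)
qed

text \<open>Compare the forms of degree u + 3 in \<open>lam ss_p - lin ss_r = \<tau> gg\<close>: the
  first term has degree at most u + 1, and \<open>lin\<close> is monic in y.\<close>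

lemma lead_ss_r:
  assumes "\<tau> \<noteq> 0"
  shows "lead (u + 2) (ss \<tau> r) j = - \<tau> * lead (u + 3) (gg \<tau>) j"
proof -
  have "lead (u + 3) (ss \<tau> p) j = 0"
    by (rule lead_eq_0[OF tdeg_le_ss[OF p(1)]]) (simp add: e'_simps)
  moreover have "lead (Suc (u + 2)) ([:[:- a, 1:]:] * ss \<tau> r) j = lead (u + 2) (ss \<tau> r) j"
    using tdeg_le_ss[OF r(1), of \<tau>] by (intro lead_y_mult) (simp add: e'_simps)
  then have "lead (u + 3) (cst lin * ss \<tau> r) j = lead (u + 2) (ss \<tau> r) j"
    by (simp only: cst_def lin_def numeral_eq_Suc pred_numeral_simps add_Suc_right One_nat_def)
  moreover have "lead (u + 3) (par lam * ss \<tau> p - cst lin * ss \<tau> r) j = lead (u + 3) (par \<tau> * gg \<tau>) j"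
    unfolding gg(2) ..
  ultimately have "- lead (u + 2) (ss \<tau> r) j = \<tau> * lead (u + 3) (gg \<tau>) j"
    by (simp add: lead_diff lead_par)
  then show ?thesis by (metis minus_minus mult_minus_left)
qed

text \<open>At \<tau> = 0 the form of degree u + 2 of \<open>ss r\<close> vanishes, so openness does
  not apply to \<open>ww\<close> directly. It is applied with \<open>gg\<close>, in degree u + 3, in
  place of \<open>ss r\<close>; there the leading vectors at 0 are those of the \<open>q i\<close>.
  For nonzero \<tau>, exchanging \<open>gg\<close> for \<open>ss r\<close> costs only the factor
  -\<tau>.\<close>

lemma lead_independent_ww: "\<forall>\<^sub>F \<tau> in cofinite. lead_independent \<alpha> e' (ww \<tau>)"
proof -
  define ee where "ee = e(p := u + 1)"
  define w where "w \<tau> i = (if i = r then gg \<tau> else ww \<tau> i)" for \<tau> i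
  have "lead (ee i) (w 0 i) j = lead (e i) (q i) j" if i: "i < \<alpha>" for i j
  proof (cases "i = p")
    case True
    have "w 0 p = cst lin * q p"
      using pr p by (simp add: w_def ww_eq_ss ss_0 v0_simps)
    moreover have "lead (Suc u) ([:[:- a, 1:]:] * q p) j = lead u (q p) j"
      using adaptedD(6)[OF ad p(1)] p by (intro lead_y_mult) simp
    ultimately show ?thesis using True p by (simp add: ee_def cst_def lin_def)
  next
    case False
    then show ?thesis using w0_eq_q[OF i] by (simp add: ee_def w_def w0_def)
  qed
  then have "lead_independent \<alpha> ee (w 0)"
    using ad lead_independent_cong[of \<alpha> ee "w 0" e q] by (simp add: adapted_def)
  moreover have "poly_family (\<lambda>\<tau>. w \<tau> i)" for i
    unfolding w_def using gg(1) ww(1) by (cases "i = r") simp_all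
  ultimately have "\<forall>\<^sub>F \<tau> in cofinite. lead_independent \<alpha> ee (w \<tau>)"
    by (intro lead_independent_cofinite)
  moreover have "\<forall>\<^sub>F \<tau> in cofinite. \<tau> \<noteq> 0"
    by (simp add: eventually_cofinite)
  ultimately show ?thesis
  proof eventually_elim
    case (elim \<tau>)
    show ?case
      unfolding lead_independent_def
    proof (intro allI impI)
      fix \<beta> i assume 0: "\<forall>j<\<alpha>. (\<Sum>i<\<alpha>. \<beta> i * lead (e' i) (ww \<tau> i) j) = 0" and i: "i < \<alpha>"
      define \<gamma> where "\<gamma> i = (if i = r then - \<tau> * \<beta> r else \<beta> i)" for i
      have "\<gamma> i * lead (ee i) (w \<tau> i) j = \<beta> i * lead (e' i) (ww \<tau> i) j" for i j
        using pr r lead_ss_r[OF elim(2), of j]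
        by (simp add: \<gamma>_def ee_def w_def e'_def ww_eq_ss)
      with 0 have "\<forall>j<\<alpha>. (\<Sum>i<\<alpha>. \<gamma> i * lead (ee i) (w \<tau> i) j) = 0" by simp
      with elim(1) have "\<gamma> i = 0" using i unfolding lead_independent_def by blast
      then show "\<beta> i = 0" using elim(2) by (auto simp: \<gamma>_def split: if_splits)
    qed
  qed
qed

lemma adapted_ww: "\<forall>\<^sub>F \<tau> in cofinite. adapted \<alpha> e' (ff \<tau>) (ww \<tau>) \<and>
    (\<exists>T' \<delta>'. companion \<alpha> (ff \<tau>) (ww \<tau>) T' \<delta>')"
proof -
  have "\<forall>\<^sub>F \<tau> in cofinite. \<tau> \<noteq> (0 :: 'k)"
    by (simp add: eventually_cofinite)
  with lead_independent_ww show ?thesis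
  proof eventually_elim
    case (elim \<tau>)
    have deg: "degree (ss \<tau> i) < \<alpha>" if "i < \<alpha>" for i
      unfolding ss_def by (rule degree_char_sol[OF that])
    have "degree (ww \<tau> i) < \<alpha> \<and> tdeg_le (int (e' i)) (ww \<tau> i)" if i: "i < \<alpha>" for i
    proof (cases "i \<in> W")
      case True
      have "degree (par (1 / \<tau>) * ss \<tau> i) \<le> degree (ss \<tau> i)"
        by (simp add: cst_def degree_smult_le)
      with True i deg[OF i] tdeg_le_ss[OF i, of \<tau>] show ?thesis
        by (simp add: ww_eq[OF elim(2)] tdeg_le_par_mult)
    qed (use deg i tdeg_le_ss in \<open>auto simp: ww_eq_ss\<close>)
    moreover have "\<alpha> \<le> e' i" if "i < \<alpha>" for i
      using \<alpha>_le[OF that] \<alpha>_le[OF p(1)] p by (simp add: e'_def)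
    moreover have "tdeg_le (int \<alpha>) (ff \<tau>)"
      unfolding ff_def by (rule tdeg_le_char_pol[OF fits'])
    ultimately have "adapted \<alpha> e' (ff \<tau>) (ww \<tau>)"
      using elim(1) by (simp add: adapted_def ff_def char_pol_monic)
    with companion_ww[OF elim(2)] show ?case by blast
  qed
qed

text \<open>A multiple \<open>b q_p\<close> is lifted by splitting b at a. The value of b then
  multiplies \<open>ss r\<close>, which has degree up to u + 2 even where \<open>b q_p\<close> has
  degree u; hence the bound on n.\<close>

lemma deforms_ww:
  assumes n: "u + 2 \<le> n"
  shows "deforms n (gen_ideal \<alpha> f q) (\<lambda>\<tau>. gen_ideal \<alpha> (ff \<tau>) (ww \<tau>))"
  unfolding deforms_def
proof (intro ballI impI)
  fix x assume "x \<in> gen_ideal \<alpha> f q" and xn: "tdeg_le (int n) x"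
  then obtain A b where x: "x = A * f + (\<Sum>i<\<alpha>. [:b i:] * q i)"
    by (auto simp: gen_ideal_def)
  have A: "tdeg_le (int n - int \<alpha>) A" and b: "\<And>i. i < \<alpha> \<Longrightarrow> tdeg_le (int n - int (e i)) (cst (b i))"
    using adapted_tdeg_le[OF ad, of "int n" A b] xn x by (auto simp: cst_def)
  define F where "F \<tau> = A * ff \<tau> + (\<Sum>j\<in>K. cst (b j) * ss \<tau> j)
    + (cst (sd (b p)) * ss \<tau> p + par (ev (b p) / lam) * ss \<tau> r) + cst (b r) * gg \<tau>
    + (\<Sum>j\<in>W. cst (b j) * ww \<tau> j)" for \<tau>
  have "poly_family F"
    unfolding F_def by (intro family_intros)
  moreover have "F 0 = x"
  proof -
    have "(\<Sum>j\<in>K. cst (b j) * ss 0 j) = (\<Sum>j\<in>K. cst (b j) * q j)"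
      using K_D by (intro sum_K_cong) (simp add: ss_0 v0_simps)
    moreover have "(\<Sum>j\<in>W. cst (b j) * ww 0 j) = (\<Sum>j\<in>W. cst (b j) * q j)"
    proof (intro sum_W_cong)
      fix j assume "j \<in> W"
      then show "cst (b j) * ww 0 j = cst (b j) * q j"
        using w0_eq_q[of j] W_D[of j] by (simp add: w0_def)
    qed
    moreover have "gg 0 = q r"
      using w0_eq_q[OF r(1)] pr by (simp add: w0_def)
    moreover have "cst (sd (b p)) * ss 0 p + par (ev (b p) / lam) * ss 0 r = cst (b p) * q p"
      unfolding cst_decomp[of "b p"] using p r by (simp add: ss_0 v0_simps algebra_simps)
    moreover have "x = A * f + (\<Sum>i<\<alpha>. cst (b i) * q i)"
      unfolding x cst_def ..
    ultimately show ?thesis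
      unfolding F_def sum_split ff_0 by (simp add: add.assoc)
  qed
  moreover have "\<forall>\<^sub>F \<tau> in cofinite. F \<tau> \<in> gen_ideal \<alpha> (ff \<tau>) (ww \<tau>) \<and> tdeg_le (int n) (F \<tau>)"
  proof -
    have *: "F \<tau> \<in> gen_ideal \<alpha> (ff \<tau>) (ww \<tau>) \<and> tdeg_le (int n) (F \<tau>)" if \<tau>: "\<tau> \<noteq> 0" for \<tau>
    proof
      let ?I = "gen_ideal \<alpha> (ff \<tau>) (ww \<tau>)"
      have mult: "y \<in> ?I \<Longrightarrow> cst c * y \<in> ?I" for c y
        unfolding cst_def by (rule gen_ideal_const_mult)
      have gen: "ww \<tau> i \<in> ?I" if "i < \<alpha>" for i
        by (rule gen_ideal_gen[OF that])
      have s: "ss \<tau> i \<in> ?I" if "i < \<alpha>" "i \<notin> W" for i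
        using gen[OF that(1)] that(2) by (simp add: ww_eq_ss)
      have g: "gg \<tau> \<in> ?I"
      proof -
        have "par (1 / \<tau>) * (par lam * ss \<tau> p + cst (- lin) * ss \<tau> r) \<in> ?I"
          using p r pr by (intro mult gen_ideal_add s) auto
        then show ?thesis unfolding gg_eq[OF \<tau>] by (simp add: cst_def)
      qed
      show "F \<tau> \<in> ?I"
        unfolding F_def using p r pr K_D W_D
        by (intro gen_ideal_add gen_ideal_sum mult gen_ideal_f s g gen) auto
      show "tdeg_le (int n) (F \<tau>)"
        unfolding F_def
      proof (intro tdeg_le_add tdeg_le_sum)
        show "tdeg_le (int n) (A * ff \<tau>)"
          using tdeg_le_mult[OF A tdeg_le_char_pol[OF fits', of \<tau>]] by (simp add: ff_def)
        show "tdeg_le (int n) (cst (b j) * ss \<tau> j)" if "j \<in> K" for j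
          using tdeg_le_mult[OF b tdeg_le_ss, of j j \<tau>] K_D[OF that] by (simp add: e'_simps)
        show "tdeg_le (int n) (cst (b j) * ww \<tau> j)" if "j \<in> W" for j
        proof -
          have eq: "cst (b j) * ww \<tau> j = par (1 / \<tau>) * (cst (b j) * ss \<tau> j)"
            by (simp only: ww_eq[OF \<tau> that] mult.left_commute)
          have "tdeg_le (int n) (cst (b j) * ss \<tau> j)"
            using tdeg_le_mult[OF b tdeg_le_ss, of j j \<tau>] W_D[OF that] by (simp add: e'_simps)
          then show ?thesis unfolding eq by (rule tdeg_le_par_mult)
        qed
        show "tdeg_le (int n) (cst (b r) * gg \<tau>)"
          using tdeg_le_mult[OF b tdeg_le_gg[OF \<tau>], of r] r by simp
        have "tdeg_le (int n - int u - 1) (cst (sd (b p)))"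
          unfolding cst_def using b[OF p(1)] p by (intro tdeg_le_sd) (simp add: cst_def)
        from tdeg_le_mult[OF this tdeg_le_ss[OF p(1), of \<tau>]]
        show "tdeg_le (int n) (cst (sd (b p)) * ss \<tau> p)" by (simp add: e'_simps)
        have "tdeg_le (int n) (ss \<tau> r)"
          using n by (intro tdeg_le_mono[OF tdeg_le_ss[OF r(1)]]) (simp add: e'_simps)
        then show "tdeg_le (int n) (par (ev (b p) / lam) * ss \<tau> r)"
          by (rule tdeg_le_par_mult)
      qed
    qed
    have "\<forall>\<^sub>F \<tau> in cofinite. \<tau> \<noteq> (0 :: 'k)"
      by (simp add: eventually_cofinite)
    then show ?thesis by (rule eventually_mono) (rule *)
  qed
  ultimately show "\<exists>F. poly_family F \<and> F 0 = x \<and>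
      (\<forall>\<^sub>F \<tau> in cofinite. F \<tau> \<in> gen_ideal \<alpha> (ff \<tau>) (ww \<tau>) \<and> tdeg_le (int n) (F \<tau>))"
    by blast
qed

end

section \<open>Polynomials as functions and their homogeneous parts\<close>

lemma mpoly_decomp: "f = (\<Sum>t\<in>Poly_Mapping.keys f. Poly_Mapping.single t (Poly_Mapping.lookup f t))"
  for f :: "'t \<Rightarrow>\<^sub>0 'b :: comm_monoid_add"
  by (rule poly_mapping_eqI)
    (simp add: lookup_sum lookup_single when_def in_keys_iff)

lemma mpoly_induct [case_names zero single add]:
  fixes f :: "'t \<Rightarrow>\<^sub>0 'b :: comm_monoid_add"
  assumes "P 0" "\<And>t c. P (Poly_Mapping.single t c)" "\<And>f g. P f \<Longrightarrow> P g \<Longrightarrow> P (f + g)"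
  shows "P f"
proof -
  have "finite S \<Longrightarrow> P (\<Sum>t\<in>S. Poly_Mapping.single t (Poly_Mapping.lookup f t))" for S
    by (induction S rule: finite_induct) (auto intro: assms)
  then show ?thesis by (subst mpoly_decomp) simp
qed

definition mon_eval :: "('v \<Rightarrow> 'a :: comm_ring_1) \<Rightarrow> 'v mon \<Rightarrow> 'a" where
  "mon_eval p t = (\<Prod>v\<in>Poly_Mapping.keys t. p v ^ Poly_Mapping.lookup t v)"

lemma mon_eval_superset:
  assumes "finite S" "Poly_Mapping.keys t \<subseteq> S"
  shows "mon_eval p t = (\<Prod>v\<in>S. p v ^ Poly_Mapping.lookup t v)"
  unfolding mon_eval_def using assms
  by (intro prod.mono_neutral_left) (auto simp: in_keys_iff)

lemma mon_eval_0 [simp]: "mon_eval p 0 = 1"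
  by (simp add: mon_eval_def)

lemma mon_eval_add: "mon_eval p (s + t) = mon_eval p s * mon_eval p t"
proof -
  let ?S = "Poly_Mapping.keys s \<union> Poly_Mapping.keys t"
  have "mon_eval p (s + t) = (\<Prod>v\<in>?S. p v ^ Poly_Mapping.lookup (s + t) v)"
    using keys_add[of s t] by (intro mon_eval_superset) auto
  also have "\<dots> = (\<Prod>v\<in>?S. p v ^ Poly_Mapping.lookup s v) * (\<Prod>v\<in>?S. p v ^ Poly_Mapping.lookup t v)"
    by (simp add: lookup_add power_add prod.distrib)
  also have "\<dots> = mon_eval p s * mon_eval p t"
    by (simp add: mon_eval_superset[of ?S])
  finally show ?thesis .
qed

lemma mon_eval_single: "mon_eval p (Poly_Mapping.single v n) = p v ^ n"
  by (cases "n = 0") (simp_all add: mon_eval_def)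

lemma mon_degree_superset:
  assumes "finite S" "Poly_Mapping.keys t \<subseteq> S"
  shows "mon_degree t = (\<Sum>v\<in>S. Poly_Mapping.lookup t v)"
  unfolding mon_degree_def using assms
  by (intro sum.mono_neutral_left) (auto simp: in_keys_iff)

lemma mon_degree_0 [simp]: "mon_degree 0 = 0"
  by (simp add: mon_degree_def)

lemma mon_degree_add: "mon_degree (s + t) = mon_degree s + mon_degree t"
proof -
  let ?S = "Poly_Mapping.keys s \<union> Poly_Mapping.keys t"
  have "mon_degree (s + t) = (\<Sum>v\<in>?S. Poly_Mapping.lookup (s + t) v)"
    using keys_add[of s t] by (intro mon_degree_superset) auto
  also have "\<dots> = mon_degree s + mon_degree t"
    by (simp add: mon_degree_superset[of ?S] lookup_add sum.distrib)
  finally show ?thesis .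
qed

lemma mon_degree_single: "mon_degree (Poly_Mapping.single v n) = n"
  by (cases "n = 0") (simp_all add: mon_degree_def)

lemma mon_degree_eq_0: "mon_degree t = 0 \<longleftrightarrow> t = 0"
  by (auto simp: mon_degree_def in_keys_iff intro!: poly_mapping_eqI)

text \<open>Substitution along a coefficient map. The identity gives evaluation at a point, and the
  embedding of k into \<open>k[x,y]\<close> gives affine coordinates, so both share one set of
  rules.\<close>

definition mpoly_hom :: "('k :: field \<Rightarrow> 'a :: comm_ring_1) \<Rightarrow> ('v \<Rightarrow> 'a) \<Rightarrow> ('v, 'k) mpoly \<Rightarrow> 'a" where
  "mpoly_hom h p f = (\<Sum>t\<in>Poly_Mapping.keys f. h (Poly_Mapping.lookup f t) * mon_eval p t)"

lemma mpoly_eval_eq_hom: "mpoly_eval p f = mpoly_hom id p f"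
  by (simp add: mpoly_eval_def mpoly_hom_def mon_eval_def)

lemma mpoly_scale_single: "mpoly_scale c (Poly_Mapping.single t d) = Poly_Mapping.single t (c * d)"
  by (simp add: mpoly_scale_def mult_single)

lemma lookup_mpoly_scale: "Poly_Mapping.lookup (mpoly_scale c f) t = c * Poly_Mapping.lookup f t"
proof (induction f rule: mpoly_induct)
  case (add f g)
  then show ?case by (simp add: kvec.scale_right_distrib lookup_add distrib_left)
qed (simp_all add: mpoly_scale_single lookup_single when_def)

context
  fixes h :: "'k :: field \<Rightarrow> 'a :: comm_ring_1"
  assumes h: "comm_ring_hom h"
begin

interpretation comm_ring_hom h by (rule h)

lemma mpoly_hom_superset:
  assumes "finite S" "Poly_Mapping.keys f \<subseteq> S"
  shows "mpoly_hom h p f = (\<Sum>t\<in>S. h (Poly_Mapping.lookup f t) * mon_eval p t)"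
  unfolding mpoly_hom_def using assms
  by (intro sum.mono_neutral_left) (auto simp: in_keys_iff)

lemma mpoly_hom_0: "mpoly_hom h p 0 = 0"
  by (simp add: mpoly_hom_def)

lemma mpoly_hom_single: "mpoly_hom h p (Poly_Mapping.single t c) = h c * mon_eval p t"
  by (subst mpoly_hom_superset[of "{t}"]) auto

lemma mpoly_hom_add: "mpoly_hom h p (f + g) = mpoly_hom h p f + mpoly_hom h p g"
proof -
  let ?S = "Poly_Mapping.keys f \<union> Poly_Mapping.keys g"
  have "mpoly_hom h p (f + g) = (\<Sum>t\<in>?S. h (Poly_Mapping.lookup (f + g) t) * mon_eval p t)"
    using keys_add[of f g] by (intro mpoly_hom_superset) auto
  then show ?thesis
    by (simp add: mpoly_hom_superset[of ?S] lookup_add hom_add distrib_right sum.distrib)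
qed

lemma mpoly_hom_1: "mpoly_hom h p 1 = 1"
  using mpoly_hom_single[of p 0 1] by simp

lemma mpoly_hom_var: "mpoly_hom h p (mpoly_var v) = p v"
  by (simp add: mpoly_var_def mpoly_hom_single mon_eval_single)

lemma mpoly_hom_mult: "mpoly_hom h p (f * g) = mpoly_hom h p f * mpoly_hom h p g"
proof (induction f rule: mpoly_induct)
  case zero
  then show ?case by (simp add: mpoly_hom_0)
next
  case (add f f')
  then show ?case by (simp add: distrib_right mpoly_hom_add)
next
  case (single t c)
  show ?case
  proof (induction g rule: mpoly_induct)
    case zero
    then show ?case by (simp add: mpoly_hom_0)
  next
    case (add g g')
    then show ?case by (simp add: distrib_left mpoly_hom_add)
  next
    case (single s d)
    show ?case by (simp add: mult_single mpoly_hom_single mon_eval_add hom_mult algebra_simps)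
  qed
qed

lemma mpoly_hom_scale: "mpoly_hom h p (mpoly_scale c f) = h c * mpoly_hom h p f"
  unfolding mpoly_scale_def mpoly_hom_mult mpoly_hom_single by simp

lemma mpoly_hom_sum: "mpoly_hom h p (sum g A) = (\<Sum>i\<in>A. mpoly_hom h p (g i))"
  by (induction A rule: infinite_finite_induct) (simp_all add: mpoly_hom_0 mpoly_hom_add)

lemma mpoly_hom_diff: "mpoly_hom h p (f - g) = mpoly_hom h p f - mpoly_hom h p g"
  using mpoly_hom_add[of p "f - g" g] by simp

lemma mpoly_hom_power: "mpoly_hom h p (f ^ n) = mpoly_hom h p f ^ n"
  by (induction n) (simp_all add: mpoly_hom_1 mpoly_hom_mult)

end

section \<open>Graded parts and homogeneous components\<close>

lemma homogeneous_partD: "f \<in> homogeneous_part m \<Longrightarrow> t \<in> Poly_Mapping.keys f \<Longrightarrow> mon_degree t = m"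
  by (simp add: homogeneous_part_def)

lemma homogeneous_part_0: "0 \<in> homogeneous_part m"
  by (simp add: homogeneous_part_def)

lemma homogeneous_part_add:
  "f \<in> homogeneous_part m \<Longrightarrow> g \<in> homogeneous_part m \<Longrightarrow> f + g \<in> homogeneous_part m"
  using keys_add[of f g] by (auto simp: homogeneous_part_def)

lemma homogeneous_part_mult:
  "f \<in> homogeneous_part m \<Longrightarrow> g \<in> homogeneous_part n \<Longrightarrow> f * g \<in> homogeneous_part (m + n)"
  using keys_mult[of f g] by (force simp: homogeneous_part_def mon_degree_add)

lemma single_in_homogeneous_part: "Poly_Mapping.single t c \<in> homogeneous_part (mon_degree t)"
  by (simp add: homogeneous_part_def)

lemma homogeneous_part_scale:
  "f \<in> homogeneous_part m \<Longrightarrow> mpoly_scale c f \<in> homogeneous_part m"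
  by (auto simp: homogeneous_part_def in_keys_iff lookup_mpoly_scale)

lemma homogeneous_part_sum:
  "(\<And>i. i \<in> A \<Longrightarrow> g i \<in> homogeneous_part m) \<Longrightarrow> sum g A \<in> homogeneous_part m"
  by (induction A rule: infinite_finite_induct) (auto intro: homogeneous_part_add homogeneous_part_0)

lemma subspace_homogeneous_part: "kvec.subspace (homogeneous_part m)"
  by (intro kvec.subspaceI homogeneous_part_0 homogeneous_part_add homogeneous_part_scale)

lemma homogeneous_part_var: "mpoly_var v \<in> homogeneous_part 1"
  using single_in_homogeneous_part[of "Poly_Mapping.single v 1" 1]
  by (simp add: mpoly_var_def mon_degree_single)

lemma homogeneous_part_1: "1 \<in> homogeneous_part 0"
  using single_in_homogeneous_part[of 0 1] by simp

lemma homogeneous_part_power: "f \<in> homogeneous_part m \<Longrightarrow> f ^ n \<in> homogeneous_part (n * m)"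
  by (induction n) (auto intro: homogeneous_part_1 homogeneous_part_mult)

lemma lookup_homogeneous_component:
  "Poly_Mapping.lookup (homogeneous_component d f) t = (if mon_degree t = d then Poly_Mapping.lookup f t else 0)"
proof -
  have "finite {t \<in> Poly_Mapping.keys f. mon_degree t = d}" by simp
  then show ?thesis
    unfolding homogeneous_component_def lookup_sum
    by (auto simp: lookup_single when_def in_keys_iff sum.delta)
qed

lemma homogeneous_component_in: "homogeneous_component d f \<in> homogeneous_part d"
  by (auto simp: homogeneous_part_def in_keys_iff lookup_homogeneous_component split: if_splits)

lemma homogeneous_component_eq:
  "f \<in> homogeneous_part m \<Longrightarrow> homogeneous_component d f = (if d = m then f else 0)"
  by (rule poly_mapping_eqI) (auto simp: lookup_homogeneous_component homogeneous_part_def in_keys_iff)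

lemma homogeneous_component_add:
  "homogeneous_component d (f + g) = homogeneous_component d f + homogeneous_component d g"
  by (rule poly_mapping_eqI) (simp add: lookup_homogeneous_component lookup_add)

lemma homogeneous_component_mult:
  assumes g: "g \<in> homogeneous_part m"
  shows "homogeneous_component (d + m) (f * g) = homogeneous_component d f * g"
proof (induction f rule: mpoly_induct)
  case (single t c)
  have *: "Poly_Mapping.single t c * g \<in> homogeneous_part (mon_degree t + m)"
    by (rule homogeneous_part_mult[OF single_in_homogeneous_part g])
  show ?case
    by (simp add: homogeneous_component_eq[OF *] homogeneous_component_eq[OF single_in_homogeneous_part])
qed (simp_all add: homogeneous_component_add distrib_right, simp add: homogeneous_component_def)

lemma homogeneous_component_sum:
  obtains N where "\<And>d. N < d \<Longrightarrow> homogeneous_component d f = 0"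
    "f = (\<Sum>d\<le>N. homogeneous_component d f)"
proof -
  define N where "N = Max (insert 0 (mon_degree ` Poly_Mapping.keys f))"
  have N: "mon_degree t \<le> N" if "t \<in> Poly_Mapping.keys f" for t
    using that unfolding N_def by (intro Max_ge) auto
  have "homogeneous_component d f = 0" if "N < d" for d
    using that N by (intro poly_mapping_eqI) (force simp: lookup_homogeneous_component in_keys_iff)
  moreover have "f = (\<Sum>d\<le>N. homogeneous_component d f)"
    using N by (intro poly_mapping_eqI)
      (auto simp: lookup_sum lookup_homogeneous_component in_keys_iff not_le[symmetric])
  ultimately show ?thesis using that by blast
qed

section \<open>Affine coordinates\<close>

lemma UNIV_var: "(UNIV :: var set) = {VX, VY, VZ}"
  using var.exhaust by auto

lemma sum_var: "(\<Sum>v\<in>UNIV. g v) = g VX + g VY + g VZ" for g :: "var \<Rightarrow> 'a :: comm_monoid_add"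
  by (simp add: UNIV_var add.assoc)

abbreviation scal :: "'k :: field \<Rightarrow> 'k poly poly" where "scal c \<equiv> [:[:c:]:]"

lemma scal_hom: "comm_ring_hom (scal :: 'k :: field \<Rightarrow> 'k poly poly)"
  by unfold_locales (simp_all add: one_pCons)

lemma id_hom: "comm_ring_hom (id :: 'k :: field \<Rightarrow> 'k)"
  by unfold_locales simp_all

lemma mpoly_hom_comp:
  assumes h: "comm_ring_hom h" and g: "comm_ring_hom g"
  shows "g (mpoly_hom h p f) = mpoly_hom (\<lambda>c. g (h c)) (\<lambda>v. g (p v)) f"
proof -
  interpret g: comm_ring_hom g by (rule g)
  show ?thesis
    by (simp add: mpoly_hom_def mon_eval_def g.hom_sum g.hom_mult g.hom_prod g.hom_power)
qed

text \<open>Exponents of the monomials in x, y of degree at most m, and equally of the forms of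
  degree m in \<open>l1\<close>, \<open>l2\<close>, \<open>l3\<close>, where \<open>l3\<close>
  receives the exponent m - i - j.\<close>

definition triangle :: "nat \<Rightarrow> (nat \<times> nat) set" where
  "triangle m = {(i, j). i + j \<le> m}"

lemma finite_triangle [simp]: "finite (triangle m)"
proof -
  have "triangle m \<subseteq> {..m} \<times> {..m}" by (auto simp: triangle_def)
  then show ?thesis by (rule finite_subset) simp
qed

lemma coeff_outer_mult: "coeff (coeff ([:0, 1:] * p) i) j = (if i = 0 then 0 else coeff (coeff p (i - 1)) j)"
  for p :: "'k :: comm_ring_1 poly poly"
  by (simp add: coeff_pCons split: nat.splits)

lemma coeff_inner_mult: "coeff (coeff ([:[:0, 1:]:] * p) i) j = (if j = 0 then 0 else coeff (coeff p i) (j - 1))"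
  for p :: "'k :: comm_ring_1 poly poly"
  by (simp add: coeff_pCons split: nat.splits)

lemma coeff_xy_power:
  "coeff (coeff (([:0, 1:] :: 'k :: comm_ring_1 poly poly) ^ i * [:[:0, 1:]:] ^ j) i') j' =
    (if i' = i \<and> j' = j then 1 else 0)"
proof -
  have y: "[:[:0, 1 :: 'k:]:] ^ j = [:Polynomial.monom 1 j:]"
    by (induction j) (simp_all add: pCons_one monom_0 monom_Suc)
  have x: "[:0, 1 :: 'k poly:] ^ i = Polynomial.monom 1 i"
    by (induction i) (simp_all add: pCons_one monom_0 monom_Suc)
  show ?thesis unfolding x y by simp
qed

lemma poly_poly_expand:
  fixes p :: "'k :: field poly poly"
  assumes "tdeg_le (int m) p"
  shows "p = (\<Sum>(i, j)\<in>triangle m. scal (coeff (coeff p i) j) * ([:0, 1:] ^ i * [:[:0, 1:]:] ^ j))"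
    (is "p = ?r")
proof (intro poly_eqI)
  fix i' j'
  have "coeff (coeff ?r i') j' = (\<Sum>(i, j)\<in>triangle m. coeff (coeff p i) j * (if i' = i \<and> j' = j then 1 else 0))"
    by (simp add: coeff_sum case_prod_beta coeff_xy_power)
  also have "\<dots> = (\<Sum>ij\<in>triangle m. if ij = (i', j') then coeff (coeff p i') j' else 0)"
    by (intro sum.cong) (auto split: if_splits)
  also have "\<dots> = (if (i', j') \<in> triangle m then coeff (coeff p i') j' else 0)"
    by (simp add: sum.delta)
  also have "\<dots> = coeff (coeff p i') j'"
    using tdeg_le_coeff_eq_0[OF assms] by (auto simp: triangle_def not_le)
  finally show "coeff (coeff p i') j' = coeff (coeff ?r i') j'" by simp
qed

definition pairing :: "(var \<Rightarrow> 'k :: field) \<Rightarrow> (var \<Rightarrow> 'k) \<Rightarrow> 'k" where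
  "pairing l p = (\<Sum>v\<in>UNIV. l v * p v)"

definition lin_form :: "(var \<Rightarrow> 'k :: field) \<Rightarrow> 'k coord_ring" where
  "lin_form l = (\<Sum>v\<in>UNIV. mpoly_scale (l v) (mpoly_var v))"

lemma lin_form_homogeneous: "lin_form l \<in> homogeneous_part 1"
  unfolding lin_form_def by (intro homogeneous_part_sum homogeneous_part_scale homogeneous_part_var)

lemma mpoly_hom_lin_form:
  assumes h: "comm_ring_hom h"
  shows "mpoly_hom h p (lin_form l) = (\<Sum>v\<in>UNIV. h (l v) * p v)"
  by (simp add: lin_form_def mpoly_hom_sum[OF h] mpoly_hom_scale[OF h] mpoly_hom_var[OF h])

lemma mpoly_eval_lin_form: "mpoly_eval p (lin_form l) = pairing l p"
  by (simp add: mpoly_eval_eq_hom mpoly_hom_lin_form[OF id_hom] pairing_def)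

text \<open>
  A basis \<open>o1, o2, o3\<close> of \<open>k\<^sup>3\<close> with dual basis \<open>l1, l2, l3\<close>, that is, a choice of affine coordinates
  \<open>l1 / l3\<close>, \<open>l2 / l3\<close> on the complement of the line \<open>l3 = 0\<close>.
\<close>
locale frame =
  fixes o1 o2 o3 l1 l2 l3 :: "var \<Rightarrow> 'k :: field"
  assumes dual: "pairing l1 o1 = 1" "pairing l1 o2 = 0" "pairing l1 o3 = 0"
      "pairing l2 o1 = 0" "pairing l2 o2 = 1" "pairing l2 o3 = 0"
      "pairing l3 o1 = 0" "pairing l3 o2 = 0" "pairing l3 o3 = 1"
    and complete: "o1 v * l1 w + o2 v * l2 w + o3 v * l3 w = (if v = w then 1 else 0)"
begin

text \<open>The general affine point \<open>x o1 + y o2 + o3\<close>, on which \<open>l1\<close>,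
  \<open>l2\<close>, \<open>l3\<close> take the values x, y, 1.\<close>

definition pt :: "var \<Rightarrow> 'k poly poly" where
  "pt v = [:[:o3 v, o2 v:], [:o1 v:]:]"

definition dehom :: "'k coord_ring \<Rightarrow> 'k poly poly" where
  "dehom f = mpoly_hom scal pt f"

text \<open>Homogenization to degree m. Coefficients outside the triangle are dropped, so it inverts
  \<open>dehom\<close> only on total degree at most m.\<close>

definition hom :: "nat \<Rightarrow> 'k poly poly \<Rightarrow> 'k coord_ring" where
  "hom m p = (\<Sum>(i, j)\<in>triangle m. mpoly_scale (coeff (coeff p i) j)
      (lin_form l1 ^ i * lin_form l2 ^ j * lin_form l3 ^ (m - i - j)))"

lemma pt_eq: "pt v = scal (o1 v) * [:0, 1:] + scal (o2 v) * [:[:0, 1:]:] + scal (o3 v)"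
  by (simp add: pt_def)

lemmas dehom_simps =
  mpoly_hom_0[OF scal_hom, of pt, folded dehom_def] mpoly_hom_add[OF scal_hom, of pt, folded dehom_def]
  mpoly_hom_mult[OF scal_hom, of pt, folded dehom_def] mpoly_hom_1[OF scal_hom, of pt, folded dehom_def]
  mpoly_hom_scale[OF scal_hom, of pt, folded dehom_def] mpoly_hom_sum[OF scal_hom, of pt, folded dehom_def]
  mpoly_hom_diff[OF scal_hom, of pt, folded dehom_def] mpoly_hom_power[OF scal_hom, of pt, folded dehom_def]
  mpoly_hom_var[OF scal_hom, of pt, folded dehom_def]

lemma dehom_lin_form: "dehom (lin_form l)
    = scal (pairing l o1) * [:0, 1:] + scal (pairing l o2) * [:[:0, 1:]:] + scal (pairing l o3)"
  by (simp add: dehom_def mpoly_hom_lin_form[OF scal_hom] pt_def sum_var pairing_def)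

lemma dehom_coords: "dehom (lin_form l1) = [:0, 1:]" "dehom (lin_form l2) = [:[:0, 1:]:]" "dehom (lin_form l3) = 1"
  by (simp_all add: dehom_lin_form dual one_pCons)

lemma tdeg_le_dehom:
  assumes "f \<in> homogeneous_part m"
  shows "tdeg_le (int m) (dehom f)"
  unfolding dehom_def mpoly_hom_def
proof (rule tdeg_le_sum)
  fix t assume "t \<in> Poly_Mapping.keys f"
  then have t: "mon_degree t = m" using homogeneous_partD[OF assms] by blast
  have pt: "tdeg_le 1 (pt v)" for v
    unfolding pt_eq by (intro tdeg_le_add tdeg_le_scalar)
      (auto simp: tdeg_le_def coeff_pCons split: nat.splits if_splits)
  have "tdeg_le (int n) (pt v ^ n)" for v n
    using tdeg_le_mult[OF pt[of v]] by (induction n) (auto simp: tdeg_le_1)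
  then have "tdeg_le (\<Sum>v\<in>Poly_Mapping.keys t. int (Poly_Mapping.lookup t v)) (mon_eval pt t)"
    unfolding mon_eval_def by (intro tdeg_le_prod)
  then have "tdeg_le (int m) (mon_eval pt t)"
    using t by (simp add: mon_degree_def flip: of_nat_sum)
  from tdeg_le_mult[OF tdeg_le_scalar this, of 0]
  show "tdeg_le (int m) (scal (Poly_Mapping.lookup f t) * mon_eval pt t)"
    by (simp only: add_0 order.refl)
qed

lemma hom_homogeneous: "hom m p \<in> homogeneous_part m"
  unfolding hom_def
proof (rule homogeneous_part_sum)
  fix ij assume "ij \<in> triangle m"
  then obtain i j where ij: "ij = (i, j)" "i + j \<le> m" by (auto simp: triangle_def)
  have "lin_form l1 ^ i * lin_form l2 ^ j * lin_form l3 ^ (m - i - j) \<in> homogeneous_part (i * 1 + j * 1 + (m - i - j) * 1)"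
    by (intro homogeneous_part_mult homogeneous_part_power lin_form_homogeneous)
  with ij show "(case ij of (i, j) \<Rightarrow> mpoly_scale (coeff (coeff p i) j)
      (lin_form l1 ^ i * lin_form l2 ^ j * lin_form l3 ^ (m - i - j))) \<in> homogeneous_part m"
    by (auto intro: homogeneous_part_scale)
qed

lemma dehom_hom: "tdeg_le (int m) p \<Longrightarrow> dehom (hom m p) = p"
proof -
  assume p: "tdeg_le (int m) p"
  have "dehom (hom m p) = (\<Sum>(i, j)\<in>triangle m. scal (coeff (coeff p i) j) * ([:0, 1:] ^ i * [:[:0, 1:]:] ^ j))"
    unfolding hom_def case_prod_beta dehom_simps dehom_coords by (simp only: power_one mult_1_right)
  then show "dehom (hom m p) = p" using poly_poly_expand[OF p] by (simp only:)
qed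

lemma hom_0 [simp]: "hom m 0 = 0"
  by (simp add: hom_def)

lemma hom_add: "hom m (p + q) = hom m p + hom m q"
  by (simp add: hom_def kvec.scale_left_distrib sum.distrib case_prod_beta)

lemma hom_scal: "hom m (scal c * p) = mpoly_scale c (hom m p)"
  by (simp add: hom_def kvec.scale_sum_right case_prod_beta)

lemma hom_sum: "hom m (sum g A) = (\<Sum>i\<in>A. hom m (g i))"
  by (induction A rule: infinite_finite_induct) (simp_all add: hom_add)

lemma hom_1: "hom 0 1 = 1"
proof -
  have "triangle 0 = {(0, 0)}" by (auto simp: triangle_def)
  then show ?thesis by (simp add: hom_def)
qed

lemma mpoly_scale_mult: "mpoly_scale c (f * g) = f * mpoly_scale c g" for f :: "('v, 'k) mpoly"
  by (simp add: mpoly_scale_def ac_simps)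

lemma hom_x: "hom (Suc m) ([:0, 1:] * p) = lin_form l1 * hom m p"
proof -
  have "hom (Suc m) ([:0, 1:] * p) = (\<Sum>(i, j)\<in>(\<lambda>(i, j). (Suc i, j)) ` triangle m.
      mpoly_scale (coeff (coeff ([:0, 1:] * p) i) j)
      (lin_form l1 ^ i * lin_form l2 ^ j * lin_form l3 ^ (Suc m - i - j)))"
    unfolding hom_def
  proof (rule sum.mono_neutral_right)
    show "\<forall>i\<in>triangle (Suc m) - (\<lambda>(i, j). (Suc i, j)) ` triangle m.
       (case i of (i, j) \<Rightarrow> mpoly_scale (coeff (coeff ([:0, 1:] * p) i) j)
          (lin_form l1 ^ i * lin_form l2 ^ j * lin_form l3 ^ (Suc m - i - j))) = 0"
    proof (clarify)
      fix i j assume "(i, j) \<in> triangle (Suc m)" "(i, j) \<notin> (\<lambda>(i, j). (Suc i, j)) ` triangle m"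
      then have "i = 0" by (cases i) (auto simp: triangle_def image_iff)
      then show "mpoly_scale (coeff (coeff ([:0, 1:] * p) i) j)
          (lin_form l1 ^ i * lin_form l2 ^ j * lin_form l3 ^ (Suc m - i - j)) = 0"
        by (simp only: coeff_outer_mult if_True simp_thms kvec.scale_zero_left)
    qed
  qed (simp, auto simp: triangle_def)
  also have "\<dots> = (\<Sum>(i, j)\<in>triangle m. lin_form l1 * mpoly_scale (coeff (coeff p i) j)
      (lin_form l1 ^ i * lin_form l2 ^ j * lin_form l3 ^ (m - i - j)))"
    by (subst sum.reindex) (auto simp: inj_on_def case_prod_beta mpoly_scale_mult[symmetric] mult.assoc)
  finally show ?thesis by (simp add: hom_def sum_distrib_left case_prod_beta)
qed

lemma hom_y: "hom (Suc m) ([:[:0, 1:]:] * p) = lin_form l2 * hom m p"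
proof -
  have "hom (Suc m) ([:[:0, 1:]:] * p) = (\<Sum>(i, j)\<in>(\<lambda>(i, j). (i, Suc j)) ` triangle m.
      mpoly_scale (coeff (coeff ([:[:0, 1:]:] * p) i) j)
      (lin_form l1 ^ i * lin_form l2 ^ j * lin_form l3 ^ (Suc m - i - j)))"
    unfolding hom_def
  proof (rule sum.mono_neutral_right)
    show "\<forall>i\<in>triangle (Suc m) - (\<lambda>(i, j). (i, Suc j)) ` triangle m.
       (case i of (i, j) \<Rightarrow> mpoly_scale (coeff (coeff ([:[:0, 1:]:] * p) i) j)
          (lin_form l1 ^ i * lin_form l2 ^ j * lin_form l3 ^ (Suc m - i - j))) = 0"
    proof (clarify)
      fix i j assume "(i, j) \<in> triangle (Suc m)" "(i, j) \<notin> (\<lambda>(i, j). (i, Suc j)) ` triangle m"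
      then have "j = 0" by (cases j) (auto simp: triangle_def image_iff)
      then show "mpoly_scale (coeff (coeff ([:[:0, 1:]:] * p) i) j)
          (lin_form l1 ^ i * lin_form l2 ^ j * lin_form l3 ^ (Suc m - i - j)) = 0"
        by (simp only: coeff_inner_mult if_True simp_thms kvec.scale_zero_left)
    qed
  qed (simp, auto simp: triangle_def)
  also have "\<dots> = (\<Sum>(i, j)\<in>triangle m. lin_form l2 * mpoly_scale (coeff (coeff p i) j)
      (lin_form l1 ^ i * lin_form l2 ^ j * lin_form l3 ^ (m - i - j)))"
    by (subst sum.reindex)
      (auto simp: inj_on_def case_prod_beta mpoly_scale_mult[symmetric] ac_simps intro!: sum.cong)
  finally show ?thesis by (simp add: hom_def sum_distrib_left case_prod_beta)
qed

lemma hom_Suc: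
  assumes "tdeg_le (int m) p"
  shows "hom (Suc m) p = lin_form l3 * hom m p"
proof -
  have "hom (Suc m) p = (\<Sum>(i, j)\<in>triangle m. mpoly_scale (coeff (coeff p i) j)
      (lin_form l1 ^ i * lin_form l2 ^ j * lin_form l3 ^ (Suc m - i - j)))"
    unfolding hom_def
  proof (rule sum.mono_neutral_right)
    show "\<forall>i\<in>triangle (Suc m) - triangle m.
       (case i of (i, j) \<Rightarrow> mpoly_scale (coeff (coeff p i) j)
          (lin_form l1 ^ i * lin_form l2 ^ j * lin_form l3 ^ (Suc m - i - j))) = 0"
    proof clarify
      fix i j assume "(i, j) \<in> triangle (Suc m)" "(i, j) \<notin> triangle m"
      then have "coeff (coeff p i) j = 0"
        by (intro tdeg_le_coeff_eq_0[OF assms]) (simp add: triangle_def)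
      then show "mpoly_scale (coeff (coeff p i) j)
          (lin_form l1 ^ i * lin_form l2 ^ j * lin_form l3 ^ (Suc m - i - j)) = 0" by simp
    qed
  qed (simp, auto simp: triangle_def)
  also have "\<dots> = (\<Sum>(i, j)\<in>triangle m. lin_form l3 * mpoly_scale (coeff (coeff p i) j)
      (lin_form l1 ^ i * lin_form l2 ^ j * lin_form l3 ^ (m - i - j)))"
  proof (rule sum.cong[OF refl])
    fix ij assume "ij \<in> triangle m"
    then obtain i j where ij: "ij = (i, j)" "i + j \<le> m" by (auto simp: triangle_def)
    then have "Suc m - i - j = Suc (m - i - j)" by simp
    then show "(case ij of (i, j) \<Rightarrow> mpoly_scale (coeff (coeff p i) j)
        (lin_form l1 ^ i * lin_form l2 ^ j * lin_form l3 ^ (Suc m - i - j)))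
      = (case ij of (i, j) \<Rightarrow> lin_form l3 * mpoly_scale (coeff (coeff p i) j)
        (lin_form l1 ^ i * lin_form l2 ^ j * lin_form l3 ^ (m - i - j)))"
      unfolding ij by (simp add: mpoly_scale_mult[symmetric] ac_simps)
  qed
  finally show ?thesis by (simp add: hom_def sum_distrib_left case_prod_beta)
qed

lemma var_eq: "mpoly_var v = mpoly_scale (o1 v) (lin_form l1) + mpoly_scale (o2 v) (lin_form l2)
    + mpoly_scale (o3 v) (lin_form l3)"
proof -
  have "mpoly_scale (o1 v) (lin_form l1) + mpoly_scale (o2 v) (lin_form l2) + mpoly_scale (o3 v) (lin_form l3)
      = (\<Sum>w\<in>UNIV. mpoly_scale (o1 v * l1 w + o2 v * l2 w + o3 v * l3 w) (mpoly_var w))"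
    by (simp add: lin_form_def kvec.scale_sum_right kvec.scale_left_distrib sum.distrib)
  also have "\<dots> = mpoly_var v"
    unfolding complete by (cases v) (simp_all add: sum_var)
  finally show ?thesis by simp
qed

text \<open>Split off one variable and expand it in \<open>l1\<close>, \<open>l2\<close>,
  \<open>l3\<close>; multiplication by x, by y and raising the degree correspond to these three
  forms.\<close>

lemma hom_dehom_monomial: "mon_degree t = m \<Longrightarrow> hom m (dehom (Poly_Mapping.single t 1)) = Poly_Mapping.single t 1"
proof (induction m arbitrary: t)
  case 0
  then have "t = 0" by (simp add: mon_degree_eq_0)
  then show ?case by (simp add: dehom_simps hom_1)
next
  case (Suc m)
  then have "t \<noteq> 0" by auto
  then obtain v where v: "v \<in> Poly_Mapping.keys t" by (metis ex_in_conv keys_eq_empty)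
  define s where "s = t - Poly_Mapping.single v 1"
  have t: "t = Poly_Mapping.single v 1 + s"
    using v by (intro poly_mapping_eqI) (auto simp: s_def lookup_add lookup_minus lookup_single when_def in_keys_iff)
  then have s: "mon_degree s = m"
    using Suc.prems by (simp add: mon_degree_add mon_degree_single)
  have st: "Poly_Mapping.single t 1 = mpoly_var v * Poly_Mapping.single s (1 :: 'k)"
    by (simp add: t mpoly_var_def mult_single)
  let ?P = "dehom (Poly_Mapping.single s 1)"
  have P: "tdeg_le (int m) ?P" and hP: "hom m ?P = Poly_Mapping.single s 1"
    using Suc.IH[OF s] s tdeg_le_dehom single_in_homogeneous_part by blast+
  have "dehom (Poly_Mapping.single t 1) = scal (o1 v) * ([:0, 1:] * ?P) + scal (o2 v) * ([:[:0, 1:]:] * ?P)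
      + scal (o3 v) * ?P"
    unfolding st dehom_simps pt_eq by (simp only: distrib_right mult.assoc)
  then have "hom (Suc m) (dehom (Poly_Mapping.single t 1)) = mpoly_var v * Poly_Mapping.single s 1"
    unfolding var_eq[of v]
    by (simp only: hom_add hom_scal hom_x hom_y hom_Suc[OF P] hP distrib_right mpoly_scale_def mult.assoc)
  then show ?case by (simp add: st)
qed

lemma hom_dehom: "f \<in> homogeneous_part m \<Longrightarrow> hom m (dehom f) = f"
proof -
  assume f: "f \<in> homogeneous_part m"
  have f_eq: "f = (\<Sum>t\<in>Poly_Mapping.keys f. mpoly_scale (Poly_Mapping.lookup f t) (Poly_Mapping.single t 1))"
    using mpoly_decomp[of f] by (simp add: mpoly_scale_single)
  have "hom m (dehom f) = (\<Sum>t\<in>Poly_Mapping.keys f. mpoly_scale (Poly_Mapping.lookup f t)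
      (hom m (dehom (Poly_Mapping.single t 1))))"
    by (subst f_eq) (simp only: dehom_simps hom_sum hom_scal)
  also have "\<dots> = (\<Sum>t\<in>Poly_Mapping.keys f. mpoly_scale (Poly_Mapping.lookup f t) (Poly_Mapping.single t 1))"
    using homogeneous_partD[OF f] by (simp add: hom_dehom_monomial)
  also note f_eq[symmetric]
  finally show ?thesis .
qed

lemma dehom_inj: "f \<in> homogeneous_part m \<Longrightarrow> g \<in> homogeneous_part m \<Longrightarrow> dehom f = dehom g \<Longrightarrow> f = g"
  using hom_dehom by metis

lemma dehom_eq_0: "f \<in> homogeneous_part m \<Longrightarrow> dehom f = 0 \<Longrightarrow> f = 0"
  using hom_dehom by fastforce

lemma eval_dehom: "mpoly_eval (\<lambda>v. a * o1 v + b * o2 v + o3 v) f = poly (poly (dehom f) [:a:]) b"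
proof -
  have "comm_ring_hom (\<lambda>P :: 'k poly poly. poly (poly P [:a:]) b)"
    by unfold_locales simp_all
  from mpoly_hom_comp[OF scal_hom this, of pt f]
  have "poly (poly (dehom f) [:a:]) b = mpoly_hom (\<lambda>c. c) (\<lambda>v. a * o1 v + b * o2 v + o3 v) f"
    by (simp add: dehom_def pt_def algebra_simps)
  then show ?thesis by (simp add: mpoly_eval_eq_hom id_def)
qed

text \<open>On the line \<open>l3 = 0\<close> only terms with m - i - j = 0 survive, that is, the
  form of degree m of the affine polynomial.\<close>

lemma eval_line:
  assumes f: "f \<in> homogeneous_part m"
  shows "mpoly_eval (\<lambda>v. a * o1 v + b * o2 v) f
    = (\<Sum>j\<le>m. coeff (coeff (dehom f) j) (m - j) * a ^ j * b ^ (m - j))"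
proof -
  let ?p = "\<lambda>v. a * o1 v + b * o2 v"
  have lin: "pairing l ?p = a * pairing l o1 + b * pairing l o2" for l
    by (simp add: pairing_def sum_var algebra_simps)
  have l: "mpoly_eval ?p (lin_form l1) = a" "mpoly_eval ?p (lin_form l2) = b" "mpoly_eval ?p (lin_form l3) = 0"
    by (simp_all add: mpoly_eval_lin_form lin dual)
  have "mpoly_eval ?p f = mpoly_eval ?p (hom m (dehom f))"
    by (simp add: hom_dehom[OF f])
  also have "\<dots> = (\<Sum>(i, j)\<in>triangle m. coeff (coeff (dehom f) i) j * (a ^ i * b ^ j * 0 ^ (m - i - j)))"
    using l unfolding hom_def mpoly_eval_eq_hom
    by (simp add: mpoly_hom_sum[OF id_hom] case_prod_beta mpoly_hom_scale[OF id_hom]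
        mpoly_hom_mult[OF id_hom] mpoly_hom_power[OF id_hom])
  also have "\<dots> = (\<Sum>(i, j)\<in>(\<lambda>i. (i, m - i)) ` {..m}. coeff (coeff (dehom f) i) j * (a ^ i * b ^ j * 0 ^ (m - i - j)))"
  proof (rule sum.mono_neutral_right)
    show "\<forall>i\<in>triangle m - (\<lambda>i. (i, m - i)) ` {..m}.
       (case i of (i, j) \<Rightarrow> coeff (coeff (dehom f) i) j * (a ^ i * b ^ j * 0 ^ (m - i - j))) = 0"
    proof clarify
      fix i j assume "(i, j) \<in> triangle m" "(i, j) \<notin> (\<lambda>i. (i, m - i)) ` {..m}"
      then have "m - i - j \<noteq> 0" by (auto simp: triangle_def image_iff)
      then show "coeff (coeff (dehom f) i) j * (a ^ i * b ^ j * 0 ^ (m - i - j)) = 0" by simp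
    qed
  qed (simp, auto simp: triangle_def)
  also have "\<dots> = (\<Sum>j\<le>m. coeff (coeff (dehom f) j) (m - j) * a ^ j * b ^ (m - j))"
    by (subst sum.reindex) (auto simp: inj_on_def mult.assoc)
  finally show ?thesis .
qed

end

section \<open>Homogenized ideals and dimension counts\<close>

lemma homogeneous_component_mult_less:
  assumes g: "g \<in> homogeneous_part m" and d: "d < m"
  shows "homogeneous_component d (f * g) = 0"
proof (induction f rule: mpoly_induct)
  case (single t c)
  have *: "Poly_Mapping.single t c * g \<in> homogeneous_part (mon_degree t + m)"
    by (rule homogeneous_part_mult[OF single_in_homogeneous_part g])
  show ?case using d by (simp add: homogeneous_component_eq[OF *])
qed (simp_all add: homogeneous_component_add distrib_right, simp add: homogeneous_component_def)

lemma homogeneous_component_0: "homogeneous_component d 0 = 0"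
  by (simp add: homogeneous_component_def)

text \<open>In each term of the binomial expansion the exponent of g is at least M or that of h is
  at least M'.\<close>

lemma ideal_power_add:
  fixes H :: "'a :: comm_ring_1 set"
  assumes H: "ideal.subspace H" and g: "g ^ M * f \<in> H" and h: "h ^ M' * f \<in> H"
  shows "(g + h) ^ (M + M') * f \<in> H"
proof -
  have "of_nat ((M + M') choose k) * g ^ k * h ^ (M + M' - k) * f \<in> H" for k
  proof (cases "M \<le> k")
    case True
    then have "g ^ k = g ^ M * g ^ (k - M)" by (simp flip: power_add)
    then have "of_nat ((M + M') choose k) * g ^ k * h ^ (M + M' - k) * f
        = (of_nat ((M + M') choose k) * g ^ (k - M) * h ^ (M + M' - k)) * (g ^ M * f)"
      by (simp only: ac_simps)
    then show ?thesis using ideal.subspace_scale[OF H g] by (simp only:)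
  next
    case False
    then have "M + M' - k = M' + (M - k)" by simp
    then have "h ^ (M + M' - k) = h ^ M' * h ^ (M - k)" by (simp only: power_add)
    then have "of_nat ((M + M') choose k) * g ^ k * h ^ (M + M' - k) * f
        = (of_nat ((M + M') choose k) * g ^ k * h ^ (M - k)) * (h ^ M' * f)"
      by (simp only: ac_simps)
    then show ?thesis using ideal.subspace_scale[OF H h] by (simp only:)
  qed
  then show ?thesis
    unfolding binomial_ring sum_distrib_right by (intro ideal.subspace_sum[OF H])
qed

lemma dim_eq_card_family:
  fixes g :: "'i \<Rightarrow> ('v, 'k :: field) mpoly"
  assumes I: "finite I" and S: "kvec.subspace S" and gS: "\<And>i. i \<in> I \<Longrightarrow> g i \<in> S"
    and ind: "\<And>c. (\<Sum>i\<in>I. mpoly_scale (c i) (g i)) = 0 \<Longrightarrow> \<forall>i\<in>I. c i = 0"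
    and span: "\<And>x. x \<in> S \<Longrightarrow> \<exists>c. x = (\<Sum>i\<in>I. mpoly_scale (c i) (g i))"
  shows "kvec.dim S = card I"
proof -
  have inj: "inj_on g I"
  proof (rule inj_onI, rule ccontr)
    fix i j assume ij: "i \<in> I" "j \<in> I" "g i = g j" "i \<noteq> j"
    define c where "c k = (if k = i then 1 else if k = j then - 1 else (0 :: 'k))" for k
    have "(\<Sum>k\<in>I. mpoly_scale (c k) (g k)) = (\<Sum>k\<in>{i, j}. mpoly_scale (c k) (g k))"
      using I ij by (intro sum.mono_neutral_right) (auto simp: c_def)
    also have "\<dots> = 0" using ij by (simp add: c_def)
    finally show False using ind[of c] ij by (auto simp: c_def)
  qed
  have "kvec.independent (g ` I)"
    unfolding kvec.dependent_finite[OF finite_imageI[OF I]]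
  proof (safe)
    fix u v assume sum: "(\<Sum>v\<in>g ` I. mpoly_scale (u v) v) = 0" and i: "v \<in> I" and u: "u (g v) \<noteq> 0"
    have "(\<Sum>i\<in>I. mpoly_scale (u (g i)) (g i)) = 0"
      using sum by (simp add: sum.reindex[OF inj])
    from ind[OF this] i u show False by auto
  qed
  moreover have "S \<subseteq> kvec.span (g ` I)"
  proof
    fix x assume "x \<in> S"
    from span[OF this] obtain c where x: "x = (\<Sum>i\<in>I. mpoly_scale (c i) (g i))" ..
    show "x \<in> kvec.span (g ` I)"
      unfolding x by (intro kvec.span_sum kvec.span_scale kvec.span_base imageI)
  qed
  ultimately show ?thesis
    using gS inj by (intro kvec.dim_unique[of "g ` I"]) (auto simp: card_image)
qed

definition xy :: "nat \<Rightarrow> nat \<Rightarrow> 'k :: field poly poly" where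
  "xy i j = [:0, 1:] ^ i * [:[:0, 1:]:] ^ j"

lemma tdeg_le_xy: "int i + int j \<le> d \<Longrightarrow> tdeg_le d (xy i j)"
  by (auto simp: tdeg_le_def xy_def coeff_xy_power split: if_splits)

lemma sum_xy_triangle_eq_0:
  assumes "(\<Sum>(i, j)\<in>triangle m. scal (c i j) * xy i j) = 0" "(i, j) \<in> triangle m"
  shows "c i j = 0"
proof -
  have "coeff (coeff (\<Sum>(i, j)\<in>triangle m. scal (c i j) * xy i j) i) j
      = (\<Sum>(i', j')\<in>triangle m. c i' j' * (if i = i' \<and> j = j' then 1 else 0))"
    by (simp add: coeff_sum case_prod_beta xy_def coeff_xy_power)
  also have "\<dots> = (\<Sum>ij\<in>triangle m. if ij = (i, j) then c i j else 0)"
    by (intro sum.cong) (auto split: if_splits)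
  also have "\<dots> = c i j" using assms(2) by (simp add: sum.delta)
  finally show ?thesis using assms(1) by simp
qed

lemma card_triangle_Suc: "card (triangle (Suc m)) = card (triangle m) + (m + 2)"
proof -
  have "triangle (Suc m) = triangle m \<union> (\<lambda>i. (i, Suc m - i)) ` {..Suc m}"
    by (auto simp: triangle_def image_iff)
  moreover have "triangle m \<inter> (\<lambda>i. (i, Suc m - i)) ` {..Suc m} = {}"
    by (auto simp: triangle_def)
  ultimately show ?thesis
    by (simp add: card_Un_disjoint card_image inj_on_def)
qed

lemma card_triangle_0: "card (triangle 0) = 1"
proof -
  have "triangle 0 = {(0, 0)}" by (auto simp: triangle_def)
  then show ?thesis by simp
qed

context frame begin

text \<open>The ideal of the closure in the plane of the affine scheme defined by \<aa>. Testing
  every homogeneous component makes it homogeneous by construction.\<close>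

definition hom_ideal :: "'k poly poly set \<Rightarrow> 'k coord_ring set" where
  "hom_ideal \<aa> = {f. \<forall>m. dehom (homogeneous_component m f) \<in> \<aa>}"

lemma hom_ideal_homogeneous:
  assumes "ideal.subspace \<aa>" "f \<in> homogeneous_part m"
  shows "f \<in> hom_ideal \<aa> \<longleftrightarrow> dehom f \<in> \<aa>"
  using ideal.subspace_0[OF assms(1)]
  by (auto simp: hom_ideal_def homogeneous_component_eq[OF assms(2)] dehom_simps)

lemma ideal_hom_ideal:
  assumes \<aa>: "ideal.subspace \<aa>"
  shows "ideal.subspace (hom_ideal \<aa>)"
proof (rule ideal.subspaceI)
  show "0 \<in> hom_ideal \<aa>"
    by (simp add: hom_ideal_def homogeneous_component_0 dehom_simps ideal.subspace_0[OF \<aa>])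
  show add: "x + y \<in> hom_ideal \<aa>" if "x \<in> hom_ideal \<aa>" "y \<in> hom_ideal \<aa>" for x y
    using that by (simp add: hom_ideal_def homogeneous_component_add dehom_simps ideal.subspace_add[OF \<aa>])
  show "g * x \<in> hom_ideal \<aa>" if x: "x \<in> hom_ideal \<aa>" for g x
  proof (induction g rule: mpoly_induct)
    case zero
    show ?case using \<open>0 \<in> hom_ideal \<aa>\<close> by simp
  next
    case (add f g)
    then show ?case by (simp add: distrib_right \<open>\<And>y x. x \<in> hom_ideal \<aa> \<Longrightarrow> y \<in> hom_ideal \<aa> \<Longrightarrow> x + y \<in> hom_ideal \<aa>\<close>)
  next
    case (single t c)
    let ?s = "Poly_Mapping.single t c" and ?d = "mon_degree t"
    have "dehom (homogeneous_component m (x * ?s)) \<in> \<aa>" for m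
    proof (cases "m < ?d")
      case True
      then show ?thesis
        by (simp add: homogeneous_component_mult_less[OF single_in_homogeneous_part]
            dehom_simps ideal.subspace_0[OF \<aa>])
    next
      case False
      then have "homogeneous_component m (x * ?s) = homogeneous_component (m - ?d) x * ?s"
        using homogeneous_component_mult[OF single_in_homogeneous_part[of t c], of "m - ?d" x] by simp
      then have "dehom (homogeneous_component m (x * ?s))
          = dehom ?s * dehom (homogeneous_component (m - ?d) x)"
        by (simp add: dehom_simps mult.commute)
      moreover have "dehom (homogeneous_component (m - ?d) x) \<in> \<aa>"
        using x by (simp add: hom_ideal_def)
      ultimately show ?thesis by (simp only: ideal.subspace_scale[OF \<aa>])
    qed
    then show ?case by (simp add: hom_ideal_def mult.commute)
  qed
qed

lemma homogeneous_hom_ideal: "ideal.subspace \<aa> \<Longrightarrow> homogeneous_ideal (hom_ideal \<aa>)"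
  unfolding homogeneous_ideal_def
proof (intro conjI ballI allI ideal_hom_ideal)
  fix f d assume \<aa>: "ideal.subspace \<aa>" and "f \<in> hom_ideal \<aa>"
  then show "homogeneous_component d f \<in> hom_ideal \<aa>"
    using hom_ideal_homogeneous[OF \<aa> homogeneous_component_in] by (auto simp: hom_ideal_def)
qed

text \<open>Powers of the variables that carry f into the ideal yield such a power of the linear
  form \<open>l3\<close>, and \<open>l3\<close> becomes 1 in affine coordinates.\<close>

lemma saturation_hom_ideal:
  assumes \<aa>: "ideal.subspace \<aa>"
  shows "saturation (hom_ideal \<aa>) = hom_ideal \<aa>"
proof (intro equalityI subsetI)
  note H = ideal_hom_ideal[OF \<aa>]
  fix f assume "f \<in> hom_ideal \<aa>"
  then have "mpoly_var v ^ 0 * f \<in> hom_ideal \<aa>" for v by simp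
  then show "f \<in> saturation (hom_ideal \<aa>)" unfolding saturation_def by blast
next
  note H = ideal_hom_ideal[OF \<aa>]
  fix f assume "f \<in> saturation (hom_ideal \<aa>)"
  then have ex: "\<exists>N. mpoly_var v ^ N * f \<in> hom_ideal \<aa>" for v by (simp add: saturation_def)
  have scale: "\<exists>N. mpoly_scale c (mpoly_var v) ^ N * f \<in> hom_ideal \<aa>" for c v
  proof -
    obtain N where N: "mpoly_var v ^ N * f \<in> hom_ideal \<aa>" using ex by blast
    have "mpoly_scale c (mpoly_var v) ^ N * f = Poly_Mapping.single 0 c ^ N * (mpoly_var v ^ N * f)"
      by (simp add: mpoly_scale_def power_mult_distrib mult.assoc)
    then show ?thesis using ideal.subspace_scale[OF H N] by metis
  qed
  obtain N1 N2 N3 where N: "mpoly_scale (l3 VX) (mpoly_var VX) ^ N1 * f \<in> hom_ideal \<aa>"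
      "mpoly_scale (l3 VY) (mpoly_var VY) ^ N2 * f \<in> hom_ideal \<aa>"
      "mpoly_scale (l3 VZ) (mpoly_var VZ) ^ N3 * f \<in> hom_ideal \<aa>"
    using scale by meson
  define M where "M = N1 + N2 + N3"
  have "lin_form l3 ^ M * f \<in> hom_ideal \<aa>"
    unfolding lin_form_def sum_var M_def by (intro ideal_power_add[OF H] N)
  then have *: "f * lin_form l3 ^ M \<in> hom_ideal \<aa>" by (simp add: mult.commute)
  have "lin_form l3 ^ M \<in> homogeneous_part M"
    using homogeneous_part_power[OF lin_form_homogeneous, of l3 M] by simp
  then have "homogeneous_component (m + M) (f * lin_form l3 ^ M) = homogeneous_component m f * lin_form l3 ^ M" for m
    by (rule homogeneous_component_mult)
  then have "dehom (homogeneous_component m f) = dehom (homogeneous_component (m + M) (f * lin_form l3 ^ M))" for m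
    by (simp add: dehom_simps dehom_coords)
  with * show "f \<in> hom_ideal \<aa>" by (simp add: hom_ideal_def)
qed

lemma hom_ideal_part:
  assumes "ideal.subspace \<aa>"
  shows "hom_ideal \<aa> \<inter> homogeneous_part m = hom m ` {p \<in> \<aa>. tdeg_le (int m) p}"
proof (intro equalityI subsetI)
  fix f assume "f \<in> hom_ideal \<aa> \<inter> homogeneous_part m"
  then have "f = hom m (dehom f)" "dehom f \<in> \<aa>" "tdeg_le (int m) (dehom f)"
    using hom_ideal_homogeneous[OF assms, of f m] by (auto simp: hom_dehom tdeg_le_dehom)
  then show "f \<in> hom m ` {p \<in> \<aa>. tdeg_le (int m) p}" by blast
next
  fix f assume "f \<in> hom m ` {p \<in> \<aa>. tdeg_le (int m) p}"
  then obtain p where "p \<in> \<aa>" "tdeg_le (int m) p" "f = hom m p" by auto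
  then show "f \<in> hom_ideal \<aa> \<inter> homogeneous_part m"
    using hom_ideal_homogeneous[OF assms hom_homogeneous, of m p] by (simp add: dehom_hom hom_homogeneous)
qed

lemma hom_eq_0: "tdeg_le (int m) p \<Longrightarrow> hom m p = 0 \<Longrightarrow> p = 0"
  using dehom_hom[of m p] by (simp add: dehom_simps)

lemma dim_homogeneous_part: "kvec.dim (homogeneous_part m :: 'k coord_ring set) = card (triangle m)"
proof (rule dim_eq_card_family[where g = "\<lambda>(i, j). hom m (xy i j)"])
  have tdeg: "tdeg_le (int m) (\<Sum>(i, j)\<in>triangle m. scal (c i j) * xy i j)" for c :: "nat \<Rightarrow> nat \<Rightarrow> 'k"
  proof (rule tdeg_le_sum)
    fix ij assume "ij \<in> triangle m"
    then have "tdeg_le (0 + int m) (scal (c (fst ij) (snd ij)) * xy (fst ij) (snd ij))"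
      by (intro tdeg_le_mult tdeg_le_scalar tdeg_le_xy) (auto simp: triangle_def)
    then show "tdeg_le (int m) (case ij of (i, j) \<Rightarrow> scal (c i j) * xy i j)"
      by (simp add: case_prod_beta)
  qed
  show "\<forall>i\<in>triangle m. c i = 0"
    if "(\<Sum>i\<in>triangle m. mpoly_scale (c i) (case i of (i, j) \<Rightarrow> hom m (xy i j))) = 0" for c
  proof -
    have "hom m (\<Sum>(i, j)\<in>triangle m. scal (c (i, j)) * xy i j) = 0"
      using that unfolding hom_sum case_prod_beta hom_scal by simp
    from hom_eq_0[OF tdeg this] show ?thesis
      using sum_xy_triangle_eq_0[of "\<lambda>i j. c (i, j)" m] by auto
  qed
  show "\<exists>c. x = (\<Sum>i\<in>triangle m. mpoly_scale (c i) (case i of (i, j) \<Rightarrow> hom m (xy i j)))"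
    if x: "x \<in> homogeneous_part m" for x
  proof -
    have "x = hom m (dehom x)" by (simp add: hom_dehom[OF x])
    also have "dehom x = (\<Sum>(i, j)\<in>triangle m. scal (coeff (coeff (dehom x) i) j) * xy i j)"
      unfolding xy_def by (rule poly_poly_expand[OF tdeg_le_dehom[OF x]])
    finally have "x = (\<Sum>ij\<in>triangle m. mpoly_scale ((\<lambda>(i, j). coeff (coeff (dehom x) i) j) ij)
        (case ij of (i, j) \<Rightarrow> hom m (xy i j)))"
      by (simp only: hom_sum case_prod_beta hom_scal)
    then show ?thesis by (rule exI[of _ "\<lambda>(i, j). coeff (coeff (dehom x) i) j"])
  qed
qed (auto simp: hom_homogeneous subspace_homogeneous_part)

lemma subspace_ideal_part:
  fixes J :: "'k coord_ring set"
  assumes "ideal.subspace J"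
  shows "kvec.subspace (J \<inter> homogeneous_part m)"
proof (rule kvec.subspaceI)
  show "0 \<in> J \<inter> homogeneous_part m"
    by (simp add: ideal.subspace_0[OF assms] homogeneous_part_0)
  show "x + y \<in> J \<inter> homogeneous_part m" if "x \<in> J \<inter> homogeneous_part m" "y \<in> J \<inter> homogeneous_part m" for x y
    using that by (simp add: ideal.subspace_add[OF assms] homogeneous_part_add)
  show "mpoly_scale c x \<in> J \<inter> homogeneous_part m" if "x \<in> J \<inter> homogeneous_part m" for c x
    using that by (simp add: mpoly_scale_def ideal.subspace_scale[OF assms])
      (use homogeneous_part_scale[of x m c] in \<open>simp add: mpoly_scale_def\<close>)
qed

end

section \<open>Hilbert functions of ideals with adapted generators\<close>

lemma ideal_gen_ideal: "companion \<alpha> f q T \<delta> \<Longrightarrow> ideal.subspace (gen_ideal \<alpha> f q)"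
  by (rule ideal.subspaceI) (auto intro: gen_ideal_0 gen_ideal_add gen_ideal_mult)

text \<open>Together with \<open>q_index\<close> this indexes the products \<open>x^i y^j f\<close>
  and \<open>y^j q_i\<close> of formal degree at most m.\<close>

definition f_index :: "nat \<Rightarrow> nat \<Rightarrow> (nat \<times> nat) set" where
  "f_index \<alpha> m = {(i, j). i + j + \<alpha> \<le> m}"

definition q_index :: "nat \<Rightarrow> (nat \<Rightarrow> nat) \<Rightarrow> nat \<Rightarrow> (nat \<times> nat) set" where
  "q_index \<alpha> e m = (SIGMA i:{..<\<alpha>}. {j. j + e i \<le> m})"

lemma f_index_eq: "f_index \<alpha> m = (if \<alpha> \<le> m then triangle (m - \<alpha>) else {})"
  by (auto simp: f_index_def triangle_def)

lemma finite_f_index: "finite (f_index \<alpha> m)"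
  by (simp add: f_index_eq)

lemma set_shift: "{j. j + d \<le> m} = (if d \<le> m then {..m - d} else {})" for d m :: nat
  by auto

lemma finite_q_index: "finite (q_index \<alpha> e m)"
  unfolding q_index_def by (intro finite_SigmaI) (simp_all add: set_shift)

lemma card_f_index_Suc:
  "card (f_index \<alpha> (Suc m)) = card (f_index \<alpha> m) + (if \<alpha> \<le> Suc m then Suc m - \<alpha> + 1 else 0)"
proof (cases "\<alpha> \<le> m")
  case True
  then have "Suc m - \<alpha> = Suc (m - \<alpha>)" by simp
  with True show ?thesis by (simp add: f_index_eq card_triangle_Suc)
next
  case False
  then show ?thesis by (cases "\<alpha> = Suc m") (auto simp: f_index_eq card_triangle_0)
qed

lemma card_q_index_Suc:
  "card (q_index \<alpha> e (Suc m)) = card (q_index \<alpha> e m) + card {i. i < \<alpha> \<and> e i \<le> Suc m}"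
proof -
  have "card (q_index \<alpha> e m) = (\<Sum>i<\<alpha>. card {j. j + e i \<le> m})" for m
    unfolding q_index_def by (subst card_SigmaI) (simp_all add: set_shift)
  moreover have "card {j. j + e i \<le> Suc m} = card {j. j + e i \<le> m} + (if e i \<le> Suc m then 1 else 0)" for i
    by (auto simp: set_shift Suc_diff_le)
  moreover have "(\<Sum>i<\<alpha>. if e i \<le> Suc m then 1 else 0) = card {i. i < \<alpha> \<and> e i \<le> Suc m}"
    by (subst sum.If_cases) (auto simp: Int_def)
  ultimately show ?thesis by (simp add: sum.distrib)
qed

lemma card_q_index_0: "card (q_index \<alpha> e 0) = card {i. i < \<alpha> \<and> e i \<le> 0}"
proof -
  have "q_index \<alpha> e 0 = {i. i < \<alpha> \<and> e i \<le> 0} \<times> {0}"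
    by (auto simp: q_index_def)
  then show ?thesis by (simp add: card_cartesian_product)
qed

context frame begin

lemma finite_basis_of_part:
  assumes S: "kvec.subspace S" "S \<subseteq> (homogeneous_part m :: 'k coord_ring set)"
  obtains B where "B \<subseteq> S" "kvec.independent B" "S \<subseteq> kvec.span B" "finite B" "card B = kvec.dim S"
proof -
  obtain T where T: "T \<subseteq> homogeneous_part m" "kvec.independent T"
      "(homogeneous_part m :: 'k coord_ring set) \<subseteq> kvec.span T" "card T = kvec.dim (homogeneous_part m :: 'k coord_ring set)"
    using kvec.basis_exists .
  have "(0, 0) \<in> triangle m" by (simp add: triangle_def)
  then have "card (triangle m) > 0" using finite_triangle card_gt_0_iff by blast
  then have "finite T" using T(4) dim_homogeneous_part[of m] by (metis card_gt_0_iff)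
  obtain B where B: "B \<subseteq> S" "kvec.independent B" "S \<subseteq> kvec.span B" "card B = kvec.dim S"
    using kvec.basis_exists .
  have "B \<subseteq> kvec.span T" using B(1) S(2) T(3) by blast
  then have "finite B" using kvec.independent_span_bound[OF \<open>finite T\<close> B(2)] by blast
  with B that show ?thesis by blast
qed

lemma dim_part_le:
  assumes S: "kvec.subspace S" "S \<subseteq> (homogeneous_part m :: 'k coord_ring set)"
  shows "kvec.dim S \<le> kvec.dim (homogeneous_part m :: 'k coord_ring set)"
proof -
  obtain T where T: "kvec.independent T" "(homogeneous_part m :: 'k coord_ring set) \<subseteq> kvec.span T"
      "finite T" "card T = kvec.dim (homogeneous_part m :: 'k coord_ring set)"
    using finite_basis_of_part[OF subspace_homogeneous_part order.refl] .
  obtain B where B: "B \<subseteq> S" "kvec.independent B" "card B = kvec.dim S"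
    using finite_basis_of_part[OF S] .
  have "B \<subseteq> kvec.span T" using B(1) S(2) T(2) by blast
  then show ?thesis
    using kvec.independent_span_bound[OF T(3) B(2)] B(3) T(4) by simp
qed

text \<open>The homogenized products \<open>x^i y^j f\<close> and \<open>y^j q_i\<close> form a
  basis. They span because, by \<open>adapted_tdeg_le\<close>, an element of degree at most m uses
  only multiples of degree at most m.\<close>

lemma dim_gen_ideal:
  assumes ad: "adapted \<alpha> e f q" and com: "companion \<alpha> f q T \<delta>"
  shows "kvec.dim (hom_ideal (gen_ideal \<alpha> f q) \<inter> homogeneous_part m)
    = card (f_index \<alpha> m) + card (q_index \<alpha> e m)"
proof -
  note id = ideal_gen_ideal[OF com]
  define G where "G x = (case x of Inl (i, j) \<Rightarrow> xy i j * f | Inr (i, j) \<Rightarrow> xy 0 j * q i)" for x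
  let ?I = "f_index \<alpha> m <+> q_index \<alpha> e m"
  define A where "A c = (\<Sum>(i, j)\<in>f_index \<alpha> m. scal (c (Inl (i, j))) * xy i j)"
    for c :: "(nat \<times> nat) + (nat \<times> nat) \<Rightarrow> 'k"
  define b where "b c i = (\<Sum>j\<in>{j. j + e i \<le> m}. Polynomial.monom (c (Inr (i, j))) j)"
    for c :: "(nat \<times> nat) + (nat \<times> nat) \<Rightarrow> 'k" and i
  have monom: "[:Polynomial.monom a j:] = scal a * xy 0 j" for a :: 'k and j
    by (intro poly_eqI) (auto simp: xy_def coeff_pCons coeff_xy_power[of 0, simplified] split: nat.splits)
  have sum_mon: "[:\<Sum>j\<in>J. g j:] = (\<Sum>j\<in>J. [:g j:])" for g :: "nat \<Rightarrow> 'k poly" and J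
    by (rule poly_eqI) (auto simp: coeff_sum coeff_pCons split: nat.splits)
  have sum: "(\<Sum>x\<in>?I. scal (c x) * G x) = A c * f + (\<Sum>i<\<alpha>. [:b c i:] * q i)" for c
  proof -
    have "(\<Sum>x\<in>?I. scal (c x) * G x) = (\<Sum>x\<in>f_index \<alpha> m. scal (c (Inl x)) * G (Inl x))
        + (\<Sum>x\<in>q_index \<alpha> e m. scal (c (Inr x)) * G (Inr x))"
      by (subst sum.Plus[OF finite_f_index finite_q_index]) (simp only: o_def)
    also have "(\<Sum>x\<in>f_index \<alpha> m. scal (c (Inl x)) * G (Inl x)) = A c * f"
      unfolding A_def sum_distrib_right
      by (intro sum.cong refl) (simp only: G_def sum.case case_prod_beta prod.collapse mult.assoc)
    also have "(\<Sum>x\<in>q_index \<alpha> e m. scal (c (Inr x)) * G (Inr x))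
        = (\<Sum>i<\<alpha>. \<Sum>j\<in>{j. j + e i \<le> m}. scal (c (Inr (i, j))) * G (Inr (i, j)))"
      unfolding q_index_def by (subst sum.Sigma) (simp_all add: set_shift case_prod_beta)
    also have "\<dots> = (\<Sum>i<\<alpha>. [:b c i:] * q i)"
      unfolding b_def sum_mon monom sum_distrib_right
      by (intro sum.cong refl) (simp only: G_def sum.case prod.case mult.assoc)
    finally show ?thesis .
  qed
  have hom_sum': "(\<Sum>x\<in>?I. mpoly_scale (c x) (hom m (G x))) = hom m (A c * f + (\<Sum>i<\<alpha>. [:b c i:] * q i))" for c
    unfolding sum[symmetric] by (simp only: hom_sum hom_scal)
  have coeff_b: "coeff (b c i) j = (if j + e i \<le> m then c (Inr (i, j)) else 0)" for c i j
    unfolding b_def by (auto simp: coeff_sum set_shift sum.delta)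
  have G_le: "tdeg_le (int m) (G x)" if x: "x \<in> ?I" for x
  proof (cases x)
    case (Inl y)
    then obtain i j where y: "x = Inl (i, j)" "i + j + \<alpha> \<le> m"
      using x by (cases y) (auto simp: f_index_def)
    have "tdeg_le ((int i + int j) + int \<alpha>) (xy i j * f)"
      by (intro tdeg_le_mult tdeg_le_xy adaptedD(3)[OF ad]) simp
    then show ?thesis using y by (auto simp: G_def elim: tdeg_le_mono)
  next
    case (Inr y)
    then obtain i j where y: "x = Inr (i, j)" "i < \<alpha>" "j + e i \<le> m"
      using x by (cases y) (auto simp: q_index_def)
    have "tdeg_le (int j + int (e i)) (xy 0 j * q i)"
      using y by (intro tdeg_le_mult tdeg_le_xy adaptedD(6)[OF ad]) simp_all
    then show ?thesis using y by (auto simp: G_def elim: tdeg_le_mono)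
  qed
  have scal_le: "tdeg_le (int m) (scal c * p)" if "tdeg_le (int m) p" for c :: 'k and p
    using tdeg_le_mult[OF tdeg_le_scalar[of 0 c] that] by (simp only: add_0 order.refl)
  have "kvec.dim (hom_ideal (gen_ideal \<alpha> f q) \<inter> homogeneous_part m) = card ?I"
  proof (rule dim_eq_card_family[where g = "\<lambda>x. hom m (G x)"])
    show "finite ?I" by (intro finite_Plus finite_f_index finite_q_index)
    show "kvec.subspace (hom_ideal (gen_ideal \<alpha> f q) \<inter> homogeneous_part m)"
      by (rule subspace_ideal_part[OF ideal_hom_ideal[OF id]])
    fix x assume x: "x \<in> ?I"
    have "G x \<in> gen_ideal \<alpha> f q"
      using x by (auto simp: G_def q_index_def intro!: gen_ideal_f gen_ideal_mult[OF com] gen_ideal_gen)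
    then show "hom m (G x) \<in> hom_ideal (gen_ideal \<alpha> f q) \<inter> homogeneous_part m"
      unfolding hom_ideal_part[OF id] using G_le[OF x] by blast
  next
    fix c assume "(\<Sum>x\<in>?I. mpoly_scale (c x) (hom m (G x))) = 0"
    then have "hom m (A c * f + (\<Sum>i<\<alpha>. [:b c i:] * q i)) = 0" by (simp only: hom_sum')
    moreover have "tdeg_le (int m) (A c * f + (\<Sum>i<\<alpha>. [:b c i:] * q i))"
      unfolding sum[symmetric] by (intro tdeg_le_sum scal_le G_le)
    ultimately have 0: "A c * f + (\<Sum>i<\<alpha>. [:b c i:] * q i) = 0" by (rule hom_eq_0[rotated])
    have "c (Inl (i, j)) = 0" if "(i, j) \<in> f_index \<alpha> m" for i j
      using adapted_independent(1)[OF ad 0] that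
        sum_xy_triangle_eq_0[of "\<lambda>i j. c (Inl (i, j))" "m - \<alpha>" i j]
      unfolding A_def f_index_eq by (auto split: if_splits)
    moreover have "c (Inr (i, j)) = 0" if "(i, j) \<in> q_index \<alpha> e m" for i j
      using adapted_independent(2)[OF ad 0, of i] coeff_b[of c i j] that by (auto simp: q_index_def)
    ultimately show "\<forall>x\<in>?I. c x = 0" by auto
  next
    fix x assume "x \<in> hom_ideal (gen_ideal \<alpha> f q) \<inter> homogeneous_part m"
    then obtain p where p: "p \<in> gen_ideal \<alpha> f q" "tdeg_le (int m) p" "x = hom m p"
      unfolding hom_ideal_part[OF id] by blast
    then obtain A' b' where p_eq: "p = A' * f + (\<Sum>i<\<alpha>. [:b' i:] * q i)"
      by (auto simp: gen_ideal_def)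
    have A': "tdeg_le (int m - int \<alpha>) A'" and b': "\<And>i. i < \<alpha> \<Longrightarrow> tdeg_le (int m - int (e i)) [:b' i:]"
      using adapted_tdeg_le[OF ad, of "int m" A' b'] p(2) p_eq by auto
    define c where "c x = (case x of Inl (i, j) \<Rightarrow> coeff (coeff A' i) j | Inr (i, j) \<Rightarrow> coeff (b' i) j)" for x
    have "A c = A'"
    proof (cases "\<alpha> \<le> m")
      case True
      then have "tdeg_le (int (m - \<alpha>)) A'" using A' by (simp add: of_nat_diff)
      from poly_poly_expand[OF this] show ?thesis
        using True by (simp add: A_def c_def f_index_eq xy_def)
    next
      case False
      then have "A' = 0" using A' by (intro tdeg_le_neg) auto
      with False show ?thesis by (simp add: A_def f_index_eq)
    qed
    moreover have "b c i = b' i" if i: "i < \<alpha>" for i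
    proof (rule poly_eqI)
      fix j show "coeff (b c i) j = coeff (b' i) j"
        using b'[OF i] unfolding coeff_b tdeg_le_const by (force simp: c_def)
    qed
    ultimately have "x = (\<Sum>x\<in>?I. mpoly_scale (c x) (hom m (G x)))"
      unfolding hom_sum' p(3) p_eq by simp
    then show "\<exists>c. x = (\<Sum>x\<in>?I. mpoly_scale (c x) (hom m (G x)))" by blast
  qed
  then show ?thesis by (simp add: card_Plus finite_f_index finite_q_index)
qed

text \<open>First differences of the dimension count: passing to degree m adds m + 1 monomials, m -
  \<alpha> + 1 multiples of f, and one multiple of each \<open>q i\<close> with e i at most
  m.\<close>

lemma castelnuovo_gen_ideal:
  assumes ad: "adapted \<alpha> e f q" and com: "companion \<alpha> f q T \<delta>" and \<alpha>: "0 < \<alpha>"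
  shows "castelnuovo (hilbert_function (hom_ideal (gen_ideal \<alpha> f q))) m
    = int (m + 1) - (if \<alpha> \<le> m then int (m - \<alpha> + 1) else 0) - int (card {i. i < \<alpha> \<and> e i \<le> m})"
proof -
  let ?H = "hilbert_function (hom_ideal (gen_ideal \<alpha> f q))"
  have "card (f_index \<alpha> m) + card (q_index \<alpha> e m) \<le> card (triangle m)" for m
    using dim_part_le[OF subspace_ideal_part[OF ideal_hom_ideal[OF ideal_gen_ideal[OF com]]], of m]
    unfolding dim_gen_ideal[OF ad com] dim_homogeneous_part by simp
  then have H: "int (?H m) = int (card (triangle m)) - int (card (f_index \<alpha> m)) - int (card (q_index \<alpha> e m))" for m
    unfolding hilbert_function_def dim_gen_ideal[OF ad com] dim_homogeneous_part
    by (simp add: of_nat_diff)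
  show ?thesis
  proof (cases m)
    case 0
    then show ?thesis
      using \<alpha> unfolding castelnuovo_def H by (simp add: card_triangle_0 f_index_eq card_q_index_0)
  next
    case (Suc k)
    then show ?thesis
      unfolding castelnuovo_def H by (simp add: card_triangle_Suc card_f_index_Suc card_q_index_Suc)
  qed
qed

end

lemma castelnuovo_inject:
  assumes "\<And>m. castelnuovo \<phi> m = castelnuovo \<psi> m"
  shows "\<phi> = \<psi>"
proof
  fix m show "\<phi> m = \<psi> m"
  proof (induction m)
    case 0
    then show ?case using assms[of 0] by (simp add: castelnuovo_def)
  next
    case (Suc m)
    then show ?case using assms[of "Suc m"] by (simp add: castelnuovo_def)
  qed
qed

section \<open>Curves in the Grassmannian\<close>

abbreviation linear_fun :: "(('v, 'k :: field) mpoly \<Rightarrow> 'k) \<Rightarrow> bool" where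
  "linear_fun \<equiv> Vector_Spaces.linear mpoly_scale (*)"

lemma vector_space_mult: "vector_space ((*) :: 'k :: field \<Rightarrow> 'k \<Rightarrow> 'k)"
  by unfold_locales (simp_all add: algebra_simps)

lemma linear_fun_iff: "linear_fun l \<longleftrightarrow>
    (\<forall>x y. l (x + y) = l x + l y) \<and> (\<forall>c x. l (mpoly_scale c x) = c * l x)"
  unfolding Vector_Spaces.linear_iff using kvec.vector_space_axioms vector_space_mult by blast

lemma linear_fun_sum:
  assumes "linear_fun l"
  shows "l (\<Sum>i\<in>A. mpoly_scale (c i) (g i)) = (\<Sum>i\<in>A. c i * l (g i))"
proof -
  have "l 0 = 0" using assms unfolding linear_fun_iff by (metis kvec.scale_zero_left mult_zero_left)
  then show ?thesis
    using assms by (induction A rule: infinite_finite_induct) (simp_all add: linear_fun_iff)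
qed

lemma linear_fun_combination:
  assumes "\<And>i. i \<in> A \<Longrightarrow> linear_fun (l i)"
  shows "linear_fun (\<lambda>x. \<Sum>i\<in>A. c i * l i x)"
  using assms unfolding linear_fun_iff
  by (auto simp: distrib_left sum.distrib sum_distrib_left mult.left_commute intro!: sum.cong)

text \<open>Tested against all linear forms, so that no basis of the infinite-dimensional polynomial
  ring has to be fixed.\<close>

definition poly_curve :: "('k :: field \<Rightarrow> ('v, 'k) mpoly) \<Rightarrow> bool" where
  "poly_curve F \<longleftrightarrow> (\<forall>l. linear_fun l \<longrightarrow> poly_fun (\<lambda>\<tau>. l (F \<tau>)))"

lemma poly_fun_mpoly_eval:
  assumes "\<And>x. poly_fun (\<lambda>\<tau>. p \<tau> x)"
  shows "poly_fun (\<lambda>\<tau>. mpoly_eval (p \<tau>) F)"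
  unfolding mpoly_eval_def
  by (intro poly_fun_sum poly_fun_mult poly_fun_const poly_fun_prod poly_fun_power assms)

text \<open>The adjugate instead of the inverse keeps solutions of linear systems polynomial in the
  parameter.\<close>

lemma poly_fun_adj_mat_mult:
  assumes E: "\<And>\<tau>. E \<tau> \<in> carrier_mat N N" and v: "v \<in> carrier_vec N" and k: "k < N"
    and fam: "\<And>i j. i < N \<Longrightarrow> j < N \<Longrightarrow> poly_fun (\<lambda>\<tau>. E \<tau> $$ (i, j))"
  shows "poly_fun (\<lambda>\<tau>. (adj_mat (E \<tau>) *\<^sub>v v) $ k)"
proof -
  have "poly_fun (\<lambda>\<tau>. det (replace_col (E \<tau>) v k))"
  proof (rule poly_fun_det)
    show "replace_col (E \<tau>) v k \<in> carrier_mat N N" for \<tau>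
      using E[of \<tau>] by (auto simp: replace_col_def)
    show "poly_fun (\<lambda>\<tau>. replace_col (E \<tau>) v k $$ (i, j))" if "i < N" "j < N" for i j
    proof -
      have "replace_col (E \<tau>) v k $$ (i, j) = (if j = k then v $ i else E \<tau> $$ (i, j))" for \<tau>
        using E[of \<tau>] that by (auto simp: replace_col_def)
      then show ?thesis using fam[OF that] by (cases "j = k") auto
    qed
  qed
  then show ?thesis by (simp only: det_replace_col[OF E v k])
qed

section \<open>Pluecker coordinates along a curve\<close>

context frame begin

lemma subspace_subset_span:
  fixes W :: "'k coord_ring set"
  assumes W: "kvec.subspace W" "W \<subseteq> homogeneous_part m" "kvec.dim W = card I"
    and I: "finite I" and g: "\<And>i. i \<in> I \<Longrightarrow> g i \<in> W"
    and ind: "\<And>c. (\<Sum>i\<in>I. mpoly_scale (c i) (g i)) = 0 \<Longrightarrow> \<forall>i\<in>I. c i = 0"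
  shows "W = {\<Sum>i\<in>I. mpoly_scale (c i) (g i) | c. True}" (is "W = ?S")
proof (rule ccontr)
  assume neq: "W \<noteq> ?S"
  have S_sub: "kvec.subspace ?S"
  proof (rule kvec.subspaceI)
    show "0 \<in> ?S" by (auto intro!: exI[of _ "\<lambda>_. 0"])
    fix x y assume "x \<in> ?S" "y \<in> ?S"
    then obtain c d where "x = (\<Sum>i\<in>I. mpoly_scale (c i) (g i))" "y = (\<Sum>i\<in>I. mpoly_scale (d i) (g i))"
      by blast
    then have "x + y = (\<Sum>i\<in>I. mpoly_scale (c i + d i) (g i))"
      by (simp add: kvec.scale_left_distrib sum.distrib)
    then show "x + y \<in> ?S" by (intro CollectI exI[of _ "\<lambda>i. c i + d i"]) simp
  next
    fix a x assume "x \<in> ?S"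
    then obtain c where "x = (\<Sum>i\<in>I. mpoly_scale (c i) (g i))" by blast
    then have "mpoly_scale a x = (\<Sum>i\<in>I. mpoly_scale (a * c i) (g i))"
      by (simp add: kvec.scale_sum_right)
    then show "mpoly_scale a x \<in> ?S" by (intro CollectI exI[of _ "\<lambda>i. a * c i"]) simp
  qed
  have SW: "?S \<subseteq> W"
    using g W(1) by (auto intro!: kvec.subspace_sum kvec.subspace_scale)
  have gS: "g i \<in> ?S" if "i \<in> I" for i
  proof -
    have "g i = (\<Sum>j\<in>I. mpoly_scale (if j = i then 1 else 0) (g j))"
      using I that by (simp add: if_distrib[of "\<lambda>c. mpoly_scale c _"] cong: if_cong)
    then show ?thesis by (intro CollectI exI[of _ "\<lambda>j. if j = i then 1 else 0"]) simp
  qed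
  have dimS: "kvec.dim ?S = card I"
    by (rule dim_eq_card_family[OF I S_sub gS ind]) blast+
  obtain w where w: "w \<in> W" "w \<notin> ?S" using neq SW by blast
  obtain B where B: "B \<subseteq> ?S" "kvec.independent B" "?S \<subseteq> kvec.span B" "finite B" "card B = kvec.dim ?S"
    using finite_basis_of_part[OF S_sub order.trans[OF SW W(2)]] .
  obtain C where "C \<subseteq> W" "kvec.independent C" and C: "W \<subseteq> kvec.span C" "finite C" "card C = kvec.dim W"
    using finite_basis_of_part[OF W(1,2)] .
  have "w \<notin> kvec.span B"
    using kvec.span_minimal[OF B(1) S_sub] w(2) by blast
  then have "kvec.independent (insert w B)" and wB: "w \<notin> B"
    using B(2) kvec.span_base[of w B] by (auto simp: kvec.independent_insert)
  moreover have "insert w B \<subseteq> kvec.span C"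
    using B(1) SW w(1) C(1) by blast
  ultimately have "card (insert w B) \<le> card C"
    using kvec.independent_span_bound[OF C(2)] by blast
  then show False using wB B(4,5) C(3) dimS W(3) by simp
qed

text \<open>A basis of W0 is lifted and completed by fixed vectors to a moving basis of the forms of
  degree m. The coordinates along the fixed vectors, multiplied by the determinant, are polynomial
  in \<tau> and vanish on the lifts. They are recombined so that at 0 they become the given forms
  \<open>l i\<close>, which yields P 0 = p exactly and not only up to a factor.\<close>

lemma plucker_curve:
  fixes W :: "'k \<Rightarrow> 'k coord_ring set" and W0 :: "'k coord_ring set"
  assumes W0: "W0 \<in> grassmannian n m" and p: "plucker_coords n m W0 p"
    and W: "\<forall>\<^sub>F \<tau> in cofinite. W \<tau> \<in> grassmannian n m"
    and lift: "\<And>f. f \<in> W0 \<Longrightarrow> \<exists>F. poly_curve F \<and> F 0 = f \<and> (\<forall>\<^sub>F \<tau> in cofinite. F \<tau> \<in> W \<tau>)"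
  obtains P where "\<And>x. poly_fun (\<lambda>\<tau>. P \<tau> x)" "P 0 = p"
    "\<forall>\<^sub>F \<tau> in cofinite. plucker_coords n m (W \<tau>) (P \<tau>)"
proof -
  let ?A = "homogeneous_part m :: 'k coord_ring set"
  have W0': "kvec.subspace W0" "W0 \<subseteq> ?A" "kvec.dim ?A = kvec.dim W0 + n"
    using W0 by (auto simp: grassmannian_def)
  define r where "r = kvec.dim W0"
  obtain B where B: "B \<subseteq> W0" "kvec.independent B" "W0 \<subseteq> kvec.span B" "finite B" "card B = r"
    using finite_basis_of_part[OF W0'(1,2)] unfolding r_def .
  obtain D where D: "B \<subseteq> D" "D \<subseteq> ?A" "kvec.independent D" "?A \<subseteq> kvec.span D"
    using kvec.maximal_independent_subset_extend[of B ?A] B(1,2) W0'(2) by (metis order.trans)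
  have cardD: "card D = r + n"
    using kvec.dim_unique[OF D(2,4,3) refl] W0'(3) r_def by simp
  have finD: "finite D"
  proof -
    obtain T where "T \<subseteq> ?A" "kvec.independent T" "?A \<subseteq> kvec.span T" "finite T" "card T = kvec.dim ?A"
      using finite_basis_of_part[OF subspace_homogeneous_part order.refl] .
    then show ?thesis
      using kvec.independent_span_bound[of T D] D(2,3) by blast
  qed
  have "card (D - B) = n" using cardD B(4,5) D(1) by (simp add: card_Diff_subset)
  obtain b1 where b1: "bij_betw b1 {0..<r} B" using ex_bij_betw_nat_finite[OF B(4)] B(5) by auto
  obtain b2 where b2: "bij_betw b2 {0..<n} (D - B)"
    using ex_bij_betw_nat_finite[of "D - B"] finD \<open>card (D - B) = n\<close> by auto
  define N where "N = r + n"
  define bas where "bas k = (if k < r then b1 k else b2 (k - r))" for k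
  have bas_B: "bas k \<in> B" if "k < r" for k
    using that b1 by (auto simp: bas_def bij_betw_def)
  have bas_D: "bas k \<in> D" if "k < N" for k
  proof (cases "k < r")
    case True
    then show ?thesis using bas_B D(1) by blast
  next
    case False
    then have "k - r \<in> {0..<n}" using that by (auto simp: N_def)
    then show ?thesis using False b2 by (auto simp: bas_def bij_betw_def)
  qed
  have bas_img: "bas ` {..<N} = D"
  proof
    show "bas ` {..<N} \<subseteq> D" using bas_D by blast
    show "D \<subseteq> bas ` {..<N}"
    proof
      fix d assume d: "d \<in> D"
      show "d \<in> bas ` {..<N}"
      proof (cases "d \<in> B")
        case True
        then obtain k where "k < r" "d = b1 k" using b1 by (auto simp: bij_betw_def)
        then show ?thesis by (intro image_eqI[of _ _ k]) (auto simp: bas_def N_def)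
      next
        case False
        then have "d \<in> b2 ` {0..<n}" using b2 d by (auto simp: bij_betw_def)
        then obtain k where "k < n" "d = b2 k" by auto
        then show ?thesis by (intro image_eqI[of _ _ "r + k"]) (auto simp: bas_def N_def)
      qed
    qed
  qed
  have bas_inj: "inj_on bas {..<N}"
    using cardD finD bas_img by (intro eq_card_imp_inj_on) (auto simp: N_def)
  define X where "X = kvec.extend_basis D"
  have X: "kvec.independent X" "kvec.span X = UNIV" "D \<subseteq> X"
    using kvec.independent_extend_basis[OF D(3)] kvec.span_extend_basis[OF D(3)]
      kvec.extend_basis_superset[OF D(3)] by (auto simp: X_def)
  define co where "co k f = kvec.representation X f (bas k)" for k f
  have co_lin: "linear_fun (co k)" for k
    unfolding co_def by (rule kvec.linear_representation[OF X(1,2)])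
  have co_bas: "co i (bas k) = (if i = k then 1 else 0)" if "i < N" "k < N" for i k
  proof -
    have "bas i = bas k \<longleftrightarrow> i = k"
      using inj_on_eq_iff[OF bas_inj, of i k] that by simp
    moreover have "bas k \<in> X" using bas_D[OF that(2)] X(3) by blast
    ultimately show ?thesis
      unfolding co_def by (simp add: kvec.representation_basis[OF X(1)])
  qed
  have co_sum: "f = (\<Sum>k<N. mpoly_scale (co k f) (bas k))" if f: "f \<in> ?A" for f
  proof -
    have fD: "f \<in> kvec.span D" using f D(4) by blast
    have "(\<Sum>k<N. mpoly_scale (co k f) (bas k)) = (\<Sum>d\<in>D. mpoly_scale (kvec.representation X f d) d)"
      unfolding co_def bas_img[symmetric] by (simp add: sum.reindex[OF bas_inj])
    also have "\<dots> = (\<Sum>d\<in>D. mpoly_scale (kvec.representation D f d) d)"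
      by (simp add: kvec.representation_extend[OF X(1) fD X(3)])
    also have "\<dots> = f"
      by (rule kvec.sum_representation_eq[OF D(3) fD finD order.refl])
    finally show ?thesis by simp
  qed
  have "\<forall>k. \<exists>F. k < r \<longrightarrow> poly_curve F \<and> F 0 = bas k \<and> (\<forall>\<^sub>F \<tau> in cofinite. F \<tau> \<in> W \<tau>)"
    using lift bas_B B(1) by blast
  then obtain fam where fam: "\<And>k. k < r \<Longrightarrow> poly_curve (fam k)" "\<And>k. k < r \<Longrightarrow> fam k 0 = bas k"
      "\<And>k. k < r \<Longrightarrow> \<forall>\<^sub>F \<tau> in cofinite. fam k \<tau> \<in> W \<tau>"
    by metis
  \<comment> \<open>The columns are the coordinates of the lifts, followed by those of the fixed
    complement.\<close>
  define E where "E \<tau> = mat N N (\<lambda>(i, k). co i (if k < r then fam k \<tau> else bas k))" for \<tau>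
  have E: "E \<tau> \<in> carrier_mat N N" for \<tau> by (simp add: E_def)
  have E_fun: "poly_fun (\<lambda>\<tau>. E \<tau> $$ (i, j))" if "i < N" "j < N" for i j
    using fam(1)[of j] co_lin[of i] that by (cases "j < r") (auto simp: E_def poly_curve_def)
  have E0: "E 0 = 1\<^sub>m N"
    using fam(2) by (intro eq_matI) (auto simp: E_def co_bas)
  define cv where "cv f = vec N (\<lambda>i. co i f)" for f
  \<comment> \<open>The last n coordinates with respect to the moving basis, times
    \<open>det (E \<tau>)\<close>.\<close>
  define \<gamma> where "\<gamma> j \<tau> f = (adj_mat (E \<tau>) *\<^sub>v cv f) $ (r + j)" for j \<tau> f
  have \<gamma>_eq: "\<gamma> j \<tau> f = (\<Sum>i<N. adj_mat (E \<tau>) $$ (r + j, i) * co i f)" if "j < n" for j \<tau> f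
    using that adj_mat(1)[OF E[of \<tau>]]
    by (simp add: \<gamma>_def cv_def N_def scalar_prod_def lessThan_atLeast0)
  have \<gamma>_lin: "linear_fun (\<gamma> j \<tau>)" if "j < n" for j \<tau>
  proof -
    have "\<gamma> j \<tau> = (\<lambda>f. \<Sum>i<N. adj_mat (E \<tau>) $$ (r + j, i) * co i f)"
      by (rule ext) (rule \<gamma>_eq[OF that])
    then show ?thesis using linear_fun_combination[of "{..<N}" co] co_lin by simp
  qed
  have \<gamma>_fun: "poly_fun (\<lambda>\<tau>. \<gamma> j \<tau> f)" if "j < n" for j f
    unfolding \<gamma>_def using that by (intro poly_fun_adj_mat_mult[OF E]) (auto simp: cv_def N_def E_fun)
  have \<gamma>0: "\<gamma> j 0 f = co (r + j) f" if "j < n" for j f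
  proof -
    have "adj_mat (E 0) = 1\<^sub>m N"
      using adj_mat(3)[OF E[of 0]] adj_mat(1)[OF E[of 0]] by (simp add: E0) (auto intro: eq_matI)
    then show ?thesis using that by (simp add: \<gamma>_def cv_def N_def)
  qed
  obtain l where l: "\<And>i. i < n \<Longrightarrow> linear_fun (l i)" "W0 = {f \<in> ?A. \<forall>i<n. l i f = 0}"
    "p = (\<lambda>ts. if length ts = n \<and> (\<forall>t\<in>set ts. mon_degree t = m)
                  then Determinant.det (mat n n (\<lambda>(i, j). l i (Poly_Mapping.single (ts ! j) 1)))
                  else 0)"
    using p unfolding plucker_coords_def by blast
  \<comment> \<open>Each \<open>l i\<close> vanishes on W0, so it is determined on the forms of
    degree m by its values on the complement.\<close>
  define L where "L \<tau> i f = (\<Sum>j<n. l i (bas (r + j)) * \<gamma> j \<tau> f)" for \<tau> i f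
  have L_lin: "linear_fun (L \<tau> i)" for \<tau> i
    unfolding L_def using \<gamma>_lin by (intro linear_fun_combination) auto
  have L_fun: "poly_fun (\<lambda>\<tau>. L \<tau> i f)" for i f
    unfolding L_def using \<gamma>_fun by (intro poly_fun_sum poly_fun_mult poly_fun_const) auto
  have l_bas: "l i (bas k) = 0" if "i < n" "k < r" for i k
    using bas_B[OF that(2)] B(1) l(2) that(1) by auto
  have split: "(\<Sum>k<N. h k) = (\<Sum>k<r. h k) + (\<Sum>j<n. h (r + j))" for h :: "nat \<Rightarrow> 'b :: comm_monoid_add"
    unfolding N_def lessThan_atLeast0 by (subst sum.atLeastLessThan_concat[of 0 r "r + n", symmetric])
      (simp_all add: sum.shift_bounds_nat_ivl[of h 0 r n, simplified add_0, simplified] add.commute)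
  have L0: "L 0 i f = l i f" if f: "f \<in> ?A" and i: "i < n" for i f
  proof -
    have "l i f = (\<Sum>k<N. co k f * l i (bas k))"
      using linear_fun_sum[OF l(1)[OF i], of "\<lambda>k. co k f" bas "{..<N}"] co_sum[OF f] by simp
    also have "\<dots> = (\<Sum>j<n. co (r + j) f * l i (bas (r + j)))"
      unfolding split using l_bas[OF i] by simp
    also have "\<dots> = L 0 i f"
      unfolding L_def by (intro sum.cong) (auto simp: \<gamma>0 mult.commute)
    finally show ?thesis by simp
  qed
  define P where "P \<tau> ts = (if length ts = n \<and> (\<forall>t\<in>set ts. mon_degree t = m)
      then Determinant.det (mat n n (\<lambda>(i, j). L \<tau> i (Poly_Mapping.single (ts ! j) 1))) else 0)" for \<tau> ts
  have "poly_fun (\<lambda>\<tau>. P \<tau> x)" for x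
  proof (cases "length x = n \<and> (\<forall>t\<in>set x. mon_degree t = m)")
    case True
    then have "(\<lambda>\<tau>. P \<tau> x) = (\<lambda>\<tau>. Determinant.det (mat n n (\<lambda>(i, j). L \<tau> i (Poly_Mapping.single (x ! j) 1))))"
      by (simp add: P_def)
    moreover have "poly_fun (\<lambda>\<tau>. Determinant.det (mat n n (\<lambda>(i, j). L \<tau> i (Poly_Mapping.single (x ! j) 1))))"
      by (rule poly_fun_det[of _ n]) (simp_all add: L_fun)
    ultimately show ?thesis by simp
  next
    case False
    then have "P \<tau> x = 0" for \<tau> by (simp only: P_def if_False)
    then show ?thesis by auto
  qed
  moreover have "P 0 = p"
  proof
    fix ts
    have "L 0 i (Poly_Mapping.single (ts ! j) 1) = l i (Poly_Mapping.single (ts ! j) 1)"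
      if "length ts = n" "\<forall>t\<in>set ts. mon_degree t = m" "i < n" "j < n" for i j
      using that single_in_homogeneous_part[of "ts ! j" "1 :: 'k"] by (intro L0) auto
    then show "P 0 ts = p ts"
      unfolding P_def l(3) by (auto intro!: arg_cong[of _ _ Determinant.det] eq_matI)
  qed
  moreover have "\<forall>\<^sub>F \<tau> in cofinite. plucker_coords n m (W \<tau>) (P \<tau>)"
  proof -
    have "poly_fun (\<lambda>\<tau>. det (E \<tau>))"
      by (rule poly_fun_det[OF E E_fun])
    from poly_fun_cofinite[OF this, of 0] have "\<forall>\<^sub>F \<tau> in cofinite. det (E \<tau>) \<noteq> 0"
      by (simp add: E0)
    moreover have "\<forall>\<^sub>F \<tau> in cofinite. \<forall>k\<in>{..<r}. fam k \<tau> \<in> W \<tau>"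
      using fam(3) by (intro eventually_ball_finite) auto
    ultimately show ?thesis
      using W
    proof eventually_elim
      case (elim \<tau>)
      have W\<tau>: "kvec.subspace (W \<tau>)" "W \<tau> \<subseteq> ?A" "kvec.dim (W \<tau>) = r"
        using elim(3) W0'(3) by (auto simp: grassmannian_def r_def)
      have famA: "fam k \<tau> \<in> ?A" if "k < r" for k using elim(2) W\<tau>(2) that by auto
      have adj: "adj_mat (E \<tau>) \<in> carrier_mat N N" by (rule adj_mat(1)[OF E])
      have adj_0: "adj_mat (E \<tau>) *\<^sub>v 0\<^sub>v N = 0\<^sub>v N"
        using adj by (intro eq_vecI) (auto simp: scalar_prod_def)
      have cv_lin: "cv (\<Sum>k<r. mpoly_scale (c k) (fam k \<tau>)) = E \<tau> *\<^sub>v vec N (\<lambda>k. if k < r then c k else 0)" for c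
      proof (rule eq_vecI)
        fix i assume "i < dim_vec (E \<tau> *\<^sub>v vec N (\<lambda>k. if k < r then c k else 0))"
        then have i: "i < N" using E[of \<tau>] by simp
        have "(E \<tau> *\<^sub>v vec N (\<lambda>k. if k < r then c k else 0)) $ i
            = (\<Sum>k<N. E \<tau> $$ (i, k) * (if k < r then c k else 0))"
          using i E[of \<tau>] by (simp add: scalar_prod_def lessThan_atLeast0)
        also have "\<dots> = (\<Sum>k<r. c k * co i (fam k \<tau>))"
          unfolding split using i by (auto simp: E_def N_def mult.commute intro!: sum.cong)
        also have "\<dots> = cv (\<Sum>k<r. mpoly_scale (c k) (fam k \<tau>)) $ i"
          using i by (simp add: cv_def linear_fun_sum[OF co_lin])
        finally show "cv (\<Sum>k<r. mpoly_scale (c k) (fam k \<tau>)) $ i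
            = (E \<tau> *\<^sub>v vec N (\<lambda>k. if k < r then c k else 0)) $ i" by simp
      qed (use E[of \<tau>] in \<open>simp add: cv_def\<close>)
      have adj_E: "adj_mat (E \<tau>) *\<^sub>v (E \<tau> *\<^sub>v v) = det (E \<tau>) \<cdot>\<^sub>v v"
          and E_adj: "E \<tau> *\<^sub>v (adj_mat (E \<tau>) *\<^sub>v v) = det (E \<tau>) \<cdot>\<^sub>v v"
        if v: "v \<in> carrier_vec N" for v
      proof -
        have 1: "(det (E \<tau>) \<cdot>\<^sub>m 1\<^sub>m N) *\<^sub>v v = det (E \<tau>) \<cdot>\<^sub>v v"
        proof -
          have "det (E \<tau>) \<cdot>\<^sub>v (1\<^sub>m N *\<^sub>v v) = (det (E \<tau>) \<cdot>\<^sub>m 1\<^sub>m N) *\<^sub>v v" using v by auto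
          then show ?thesis using v by simp
        qed
        show "adj_mat (E \<tau>) *\<^sub>v (E \<tau> *\<^sub>v v) = det (E \<tau>) \<cdot>\<^sub>v v"
          using assoc_mult_mat_vec[OF adj E[of \<tau>] v] adj_mat(3)[OF E[of \<tau>]] 1 by simp
        show "E \<tau> *\<^sub>v (adj_mat (E \<tau>) *\<^sub>v v) = det (E \<tau>) \<cdot>\<^sub>v v"
          using assoc_mult_mat_vec[OF E[of \<tau>] adj v] adj_mat(2)[OF E[of \<tau>]] 1 by simp
      qed
      have "\<forall>k\<in>{..<r}. c k = 0" if 0: "(\<Sum>k<r. mpoly_scale (c k) (fam k \<tau>)) = 0" for c
      proof -
        have "co i 0 = 0" for i using linear_fun_sum[OF co_lin, of i "\<lambda>_. 0" "\<lambda>_. 0" "{}"] by simp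
        then have "cv 0 = 0\<^sub>v N" by (auto simp: cv_def)
        then have "E \<tau> *\<^sub>v vec N (\<lambda>k. if k < r then c k else 0) = 0\<^sub>v N" using cv_lin[of c] 0 by simp
        then have 1: "det (E \<tau>) \<cdot>\<^sub>v vec N (\<lambda>k. if k < r then c k else 0) = 0\<^sub>v N"
          using adj_E[of "vec N (\<lambda>k. if k < r then c k else 0)"] adj_0 by simp
        have "c k = 0" if "k < r" for k
          using arg_cong[OF 1, of "\<lambda>v. v $ k"] that elim(1) by (simp add: N_def)
        then show ?thesis by blast
      qed
      then have W_span: "W \<tau> = {\<Sum>k<r. mpoly_scale (c k) (fam k \<tau>) | c. True}"
        using elim(2) W\<tau> by (intro subspace_subset_span) auto
      have "W \<tau> = {f \<in> ?A. \<forall>i<n. L \<tau> i f = 0}"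
      proof (intro equalityI subsetI)
        fix f assume f: "f \<in> W \<tau>"
        then obtain c where c: "f = (\<Sum>k<r. mpoly_scale (c k) (fam k \<tau>))" using W_span by blast
        have "\<gamma> j \<tau> f = 0" if "j < n" for j
          using that adj_E[of "vec N (\<lambda>k. if k < r then c k else 0)"] cv_lin[of c] c
          by (simp add: \<gamma>_def N_def)
        then show "f \<in> {f \<in> ?A. \<forall>i<n. L \<tau> i f = 0}"
          using f W\<tau>(2) by (auto simp: L_def)
      next
        fix f assume "f \<in> {f \<in> ?A. \<forall>i<n. L \<tau> i f = 0}"
        then have f: "f \<in> ?A" "\<And>i. i < n \<Longrightarrow> L \<tau> i f = 0" by auto
        \<comment> \<open>If all \<open>L \<tau> i\<close> vanish at f, then g lies in W0 and in the
          span of the complement. Hence g = 0 and all coordinates \<open>\<gamma> j\<close> of f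
          vanish.\<close>
        define g where "g = (\<Sum>j<n. mpoly_scale (\<gamma> j \<tau> f) (bas (r + j)))"
        have gA: "g \<in> ?A"
          unfolding g_def using bas_D D(2) by (intro homogeneous_part_sum homogeneous_part_scale) (auto simp: N_def)
        have "l i g = 0" if "i < n" for i
          using f(2)[OF that] unfolding g_def linear_fun_sum[OF l(1)[OF that]] L_def by (simp add: mult.commute)
        then have "g \<in> W0" using gA l(2) by simp
        then have "g \<in> kvec.span B" using B(3) by blast
        then have rep: "kvec.representation X g = kvec.representation B g"
          using D(1) X(3) by (intro kvec.representation_extend[OF X(1)]) auto
        have "\<gamma> j \<tau> f = 0" if j: "j < n" for j
        proof -
          have "bas (r + j) \<notin> B"
            using j b2 by (auto simp: bas_def bij_betw_def)
          then have "co (r + j) g = 0"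
            unfolding co_def rep using kvec.representation_ne_zero[of B g "bas (r + j)"] by blast
          moreover have "co (r + j) g = \<gamma> j \<tau> f"
            unfolding g_def linear_fun_sum[OF co_lin] using j
            by (simp add: co_bas N_def if_distrib[of "\<lambda>x. _ * x"] cong: if_cong)
          ultimately show ?thesis by simp
        qed
        define y where "y = adj_mat (E \<tau>) *\<^sub>v cv f"
        have y: "y \<in> carrier_vec N" using adj unfolding y_def by (rule mult_mat_vec_carrier) (simp add: cv_def)
        have y0: "y $ (r + j) = 0" if "j < n" for j
          using \<open>\<And>j. j < n \<Longrightarrow> \<gamma> j \<tau> f = 0\<close>[OF that] by (simp add: \<gamma>_def y_def)
        have "y = vec N (\<lambda>k. if k < r then y $ k else 0)"
        proof (rule eq_vecI)
          fix k assume "k < dim_vec (vec N (\<lambda>k. if k < r then y $ k else 0))"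
          then show "y $ k = vec N (\<lambda>k. if k < r then y $ k else 0) $ k"
            using y0[of "k - r"] by (auto simp: N_def)
        qed (use y in simp)
        then have "cv (\<Sum>k<r. mpoly_scale (y $ k) (fam k \<tau>)) = E \<tau> *\<^sub>v y"
          unfolding cv_lin by simp
        also have "\<dots> = det (E \<tau>) \<cdot>\<^sub>v cv f"
          unfolding y_def by (rule E_adj) (simp add: cv_def)
        finally have cv_eq: "cv (\<Sum>k<r. mpoly_scale (y $ k) (fam k \<tau>)) = det (E \<tau>) \<cdot>\<^sub>v cv f" .
        have "mpoly_scale (det (E \<tau>)) f = (\<Sum>k<r. mpoly_scale (y $ k) (fam k \<tau>))" (is "_ = ?h")
        proof -
          have hA: "?h \<in> ?A" using famA by (intro homogeneous_part_sum homogeneous_part_scale) auto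
          have "co k ?h = det (E \<tau>) * co k f" if "k < N" for k
            using arg_cong[OF cv_eq, of "\<lambda>v. v $ k"] that by (simp add: cv_def)
          then have "?h = (\<Sum>k<N. mpoly_scale (det (E \<tau>) * co k f) (bas k))"
            using co_sum[OF hA] by simp
          also have "\<dots> = mpoly_scale (det (E \<tau>)) (\<Sum>k<N. mpoly_scale (co k f) (bas k))"
            by (simp add: kvec.scale_sum_right)
          also have "\<dots> = mpoly_scale (det (E \<tau>)) f" using co_sum[OF f(1)] by simp
          finally show ?thesis by simp
        qed
        then have "mpoly_scale (det (E \<tau>)) f \<in> W \<tau>" unfolding W_span by blast
        then have "mpoly_scale (inverse (det (E \<tau>))) (mpoly_scale (det (E \<tau>)) f) \<in> W \<tau>"
          by (rule kvec.subspace_scale[OF W\<tau>(1)])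
        then show "f \<in> W \<tau>" using elim(1) by simp
      qed
      then show ?case
        unfolding plucker_coords_def using L_lin
        by (intro exI[of _ "L \<tau>"]) (auto simp: P_def[abs_def])
    qed
  qed
  ultimately show ?thesis using that by blast
qed

text \<open>The constant polynomial 1 provides a basic open set, so it suffices to produce Pluecker
  coordinates; these come from the coordinate forms of a completed basis.\<close>

lemma grassmannian_topspace:
  fixes U :: "'k coord_ring set"
  assumes U: "U \<in> grassmannian n m"
  shows "U \<in> topspace (grassmannian_topology n m)"
proof -
  define basis where "basis = {{W \<in> grassmannian n m. \<exists>p. plucker_coords n m W p \<and> mpoly_eval p F \<noteq> 0}
      | F :: (var mon list, 'k) mpoly. \<exists>d. F \<in> homogeneous_part d}"
  obtain p where p: "plucker_coords n m U p"
  proof -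
    let ?A = "homogeneous_part m :: 'k coord_ring set"
    have W0': "kvec.subspace U" "U \<subseteq> ?A" "kvec.dim ?A = kvec.dim U + n"
      using U by (auto simp: grassmannian_def)
    obtain B where B: "B \<subseteq> U" "kvec.independent B" "U \<subseteq> kvec.span B" "finite B" "card B = kvec.dim U"
      using finite_basis_of_part[OF W0'(1,2)] .
    obtain D where D: "B \<subseteq> D" "D \<subseteq> ?A" "kvec.independent D" "?A \<subseteq> kvec.span D"
      using kvec.maximal_independent_subset_extend[of B ?A] B(1,2) W0'(2) by (metis order.trans)
    have finD: "finite D"
    proof -
      obtain T where "T \<subseteq> ?A" "kvec.independent T" "?A \<subseteq> kvec.span T" "finite T" "card T = kvec.dim ?A"
        using finite_basis_of_part[OF subspace_homogeneous_part order.refl] .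
      then show ?thesis
        using kvec.independent_span_bound[of T D] D(2,3) by blast
    qed
    have "card (D - B) = n"
      using kvec.dim_unique[OF D(2,4,3) refl] W0'(3) B(4,5) D(1) by (simp add: card_Diff_subset)
    then obtain b where b: "bij_betw b {0..<n} (D - B)"
      using ex_bij_betw_nat_finite[of "D - B"] finD by auto
    define Z where "Z = kvec.extend_basis D"
    have Z: "kvec.independent Z" "kvec.span Z = UNIV" "D \<subseteq> Z"
      using kvec.independent_extend_basis[OF D(3)] kvec.span_extend_basis[OF D(3)]
        kvec.extend_basis_superset[OF D(3)] by (auto simp: Z_def)
    define l where "l i f = kvec.representation Z f (b i)" for i f
    have lin: "linear_fun (l i)" for i
      unfolding l_def by (rule kvec.linear_representation[OF Z(1,2)])
    have "U = {f \<in> ?A. \<forall>i<n. l i f = 0}"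
    proof (intro equalityI subsetI)
      fix f assume f: "f \<in> U"
      then have fB: "f \<in> kvec.span B" using B(3) by blast
      have "l i f = 0" if "i < n" for i
      proof -
        have "b i \<notin> B" using b that by (auto simp: bij_betw_def)
        moreover have "kvec.representation Z f = kvec.representation B f"
          using D(1) Z(3) by (intro kvec.representation_extend[OF Z(1) fB]) auto
        ultimately show ?thesis
          unfolding l_def using kvec.representation_ne_zero[of B f "b i"] by metis
      qed
      with f W0'(2) show "f \<in> {f \<in> ?A. \<forall>i<n. l i f = 0}" by auto
    next
      fix f assume "f \<in> {f \<in> ?A. \<forall>i<n. l i f = 0}"
      then have f: "f \<in> ?A" "\<And>i. i < n \<Longrightarrow> l i f = 0" by auto
      have fD: "f \<in> kvec.span D" using f(1) D(4) by blast
      have rep: "kvec.representation D f d = 0" if d: "d \<in> D - B" for d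
      proof -
        have "d \<in> b ` {0..<n}" using d b by (simp add: bij_betw_def)
        then obtain i where "i < n" "d = b i" by auto
        with f(2)[of i] show ?thesis
          unfolding l_def kvec.representation_extend[OF Z(1) fD Z(3)] by simp
      qed
      have "f = (\<Sum>d\<in>D. mpoly_scale (kvec.representation D f d) d)"
        using kvec.sum_representation_eq[OF D(3) fD finD order.refl] by simp
      also have "\<dots> = (\<Sum>d\<in>B. mpoly_scale (kvec.representation D f d) d)"
        using D(1) finD rep by (intro sum.mono_neutral_right) auto
      also have "\<dots> \<in> U"
        using B(1) W0'(1) by (intro kvec.subspace_sum kvec.subspace_scale) auto
      finally show "f \<in> U" .
    qed
    note U_eq = this
    have "\<exists>p. plucker_coords n m U p"
      unfolding plucker_coords_def
      by (rule exI, rule exI[of _ l], intro conjI allI impI, rule lin, rule U_eq, rule refl)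
    with that show ?thesis by blast
  qed
  have "mpoly_eval p (1 :: (var mon list, 'k) mpoly) \<noteq> 0"
    by (simp add: mpoly_eval_eq_hom mpoly_hom_1[OF id_hom])
  with p U have "U \<in> {W \<in> grassmannian n m. \<exists>p. plucker_coords n m W p \<and>
      mpoly_eval p (1 :: (var mon list, 'k) mpoly) \<noteq> 0}" by blast
  moreover have "{W \<in> grassmannian n m. \<exists>p. plucker_coords n m W p \<and>
      mpoly_eval p (1 :: (var mon list, 'k) mpoly) \<noteq> 0} \<in> basis"
    unfolding basis_def using homogeneous_part_1 by blast
  ultimately show ?thesis
    unfolding grassmannian_topology_def basis_def topology_generated_by_topspace by (rule UnionI[rotated])
qed

text \<open>Every neighbourhood of X contains almost all \<open>Y \<tau>\<close>, because a form
  that does not vanish at the Pluecker coordinates of X vanishes at finitely many points of the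
  curve only. The \<open>Y \<tau>\<close> need only lie in the closure of S; this permits several
  deformations in succession.\<close>

lemma in_closure_of_family:
  fixes X :: "'k coord_ring set" and Y :: "'k \<Rightarrow> 'k coord_ring set"
  assumes inf: "infinite (UNIV :: 'k set)"
    and X: "X \<in> Hilb n" "X \<inter> homogeneous_part n \<in> grassmannian n n"
    and Y: "\<forall>\<^sub>F \<tau> in cofinite. Y \<tau> \<in> Hilb n \<and> Y \<tau> \<inter> homogeneous_part n \<in> grassmannian n n \<and>
      Y \<tau> \<in> Hilb_topology n closure_of S"
    and lift: "\<And>f. f \<in> X \<inter> homogeneous_part n \<Longrightarrow>
      \<exists>F. poly_curve F \<and> F 0 = f \<and> (\<forall>\<^sub>F \<tau> in cofinite. F \<tau> \<in> Y \<tau> \<inter> homogeneous_part n)"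
  shows "X \<in> Hilb_topology n closure_of S"
proof -
  let ?U = "X \<inter> homogeneous_part n" and ?W = "\<lambda>\<tau>. Y \<tau> \<inter> homogeneous_part n"
  define basis where "basis = {{W \<in> grassmannian n n. \<exists>p. plucker_coords n n W p \<and> mpoly_eval p F \<noteq> 0}
      | F :: (var mon list, 'k) mpoly. \<exists>d. F \<in> homogeneous_part d}"
  have G: "grassmannian_topology n n = topology_generated_by basis"
    by (simp add: grassmannian_topology_def basis_def)
  have gW: "\<forall>\<^sub>F \<tau> in cofinite. ?W \<tau> \<in> grassmannian n n"
    using Y by (rule eventually_mono) blast
  have near: "\<forall>\<^sub>F \<tau> in cofinite. ?W \<tau> \<in> V" if "generate_topology_on basis V" "?U \<in> V" for V
    using that
  proof (induction rule: generate_topology_on.induct)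
    case (Int a b)
    then show ?case by (simp add: eventually_conj_iff)
  next
    case (UN K)
    then obtain k where "k \<in> K" "?U \<in> k" by blast
    with UN.IH have "\<forall>\<^sub>F \<tau> in cofinite. ?W \<tau> \<in> k" by blast
    then show ?case by (rule eventually_mono) (use \<open>k \<in> K\<close> in blast)
  next
    case (Basis V)
    then obtain F p where V: "V = {W \<in> grassmannian n n. \<exists>p. plucker_coords n n W p \<and> mpoly_eval p F \<noteq> 0}"
      and p: "plucker_coords n n ?U p" "mpoly_eval p F \<noteq> 0"
      by (auto simp: basis_def)
    obtain P where P: "\<And>x. poly_fun (\<lambda>\<tau>. P \<tau> x)" "P 0 = p"
        "\<forall>\<^sub>F \<tau> in cofinite. plucker_coords n n (?W \<tau>) (P \<tau>)"
      using plucker_curve[OF X(2) p(1) gW lift] by blast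
    have "\<forall>\<^sub>F \<tau> in cofinite. mpoly_eval (P \<tau>) F \<noteq> 0"
      using poly_fun_cofinite[OF poly_fun_mpoly_eval[of P F], of 0] P(1,2) p(2) by simp
    with P(3) gW show ?case
      by eventually_elim (auto simp: V)
  qed simp
  have W0_top: "?U \<in> topspace (grassmannian_topology n n)"
    by (rule grassmannian_topspace[OF X(2)])
  have "X \<in> Hilb_topology n closure_of (Hilb_topology n closure_of S)"
  proof (rule in_closure_of[THEN iffD2], intro conjI allI impI)
    show "X \<in> topspace (Hilb_topology n)"
      unfolding Hilb_topology_def topspace_pullback_topology using X(1) W0_top by simp
    fix T assume T: "X \<in> T \<and> openin (Hilb_topology n) T"
    then obtain V where V: "openin (grassmannian_topology n n) V"
        "T = (\<lambda>I. I \<inter> homogeneous_part n) -` V \<inter> Hilb n"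
      unfolding Hilb_topology_def openin_pullback_topology by blast
    then have "generate_topology_on basis V" "?U \<in> V"
      using T openin_topology_generated_by unfolding G by auto
    from near[OF this] Y have "\<forall>\<^sub>F \<tau> in cofinite. Y \<tau> \<in> T \<and> Y \<tau> \<in> Hilb_topology n closure_of S"
      by eventually_elim (auto simp: V(2))
    moreover have "(cofinite :: 'k filter) \<noteq> bot" using inf by (simp add: cofinite_bot)
    ultimately have "\<exists>\<tau>. Y \<tau> \<in> T \<and> Y \<tau> \<in> Hilb_topology n closure_of S"
      using eventually_happens' by blast
    then show "\<exists>y. y \<in> Hilb_topology n closure_of S \<and> y \<in> T" by blast
  qed
  then show ?thesis by simp
qed

end

section \<open>Existence of adapted generators\<close>

lemma monic_division:
  fixes p f :: "'a :: idom poly"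
  assumes f: "degree f = \<alpha>" "coeff f \<alpha> = 1" and \<alpha>: "0 < \<alpha>"
  obtains s r where "p = s * f + r" "degree r < \<alpha>"
proof -
  have f0: "f \<noteq> 0" using f by auto
  obtain s r where sr: "pseudo_divmod p f = (s, r)" by fastforce
  have "Polynomial.smult (coeff f (degree f) ^ (Suc (degree p) - degree f)) p = f * s + r"
       "r = 0 \<or> degree r < degree f"
    using pseudo_divmod[OF f0 sr] by auto
  then show ?thesis using that[of s r] f \<alpha> by (auto simp: mult.commute)
qed

lemma lead_monom_mult:
  fixes p :: "'k :: comm_ring_1 poly poly"
  shows "lead (d + k) ([:monom c k:] * p) j = c * lead d p j"
  by (auto simp: lead_def coeff_monom_mult)

lemma tdeg_le_monom_mult:
  fixes p :: "'k :: comm_ring_1 poly poly"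
  assumes "tdeg_le (int d) p"
  shows "tdeg_le (int (d + k)) ([:monom c k:] * p)"
proof -
  have "tdeg_le (int k) [:monom c k:]" by (simp add: tdeg_le_const)
  from tdeg_le_mult[OF this assms] show ?thesis by (simp add: add.commute)
qed

lemma tdeg_le_dec:
  assumes p: "tdeg_le (int (Suc d)) p" and l: "\<And>j. lead (Suc d) p j = 0"
  shows "tdeg_le (int d) p"
  unfolding tdeg_le_def
proof (intro allI impI)
  fix i j assume nz: "coeff (coeff p i) j \<noteq> 0"
  with tdeg_leD[OF p] have "int i + int j \<le> int (Suc d)" by blast
  moreover have "i + j \<noteq> Suc d"
  proof
    assume "i + j = Suc d"
    then have "i \<le> Suc d" "Suc d - i = j" by linarith+
    then have "lead (Suc d) p i = coeff (coeff p i) j" by (simp add: lead_def)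
    with l nz show False by simp
  qed
  ultimately show "int i + int j \<le> int d" by linarith
qed

lemma ex_tdeg_le: "\<exists>m. tdeg_le (int m) r" for r :: "'k :: zero poly poly"
proof -
  have "tdeg_le (int (degree r + (\<Sum>i\<le>degree r. degree (coeff r i)))) r"
    unfolding tdeg_le_def
  proof (intro allI impI)
    fix i j assume nz: "coeff (coeff r i) j \<noteq> 0"
    then have "i \<le> degree r" by (intro le_degree) auto
    moreover have "j \<le> degree (coeff r i)" using nz by (rule le_degree)
    moreover have "degree (coeff r i) \<le> (\<Sum>i\<le>degree r. degree (coeff r i))"
      using \<open>i \<le> degree r\<close> by (intro member_le_sum) auto
    ultimately show "int i + int j \<le> int (degree r + (\<Sum>i\<le>degree r. degree (coeff r i)))" by linarith
  qed
  then show ?thesis by blast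
qed

lemma ideal_subspaceD:
  assumes "ideal.subspace (\<aa> :: 'a :: comm_ring_1 set)"
  shows "0 \<in> \<aa>" "s \<in> \<aa> \<Longrightarrow> t \<in> \<aa> \<Longrightarrow> s + t \<in> \<aa>" "s \<in> \<aa> \<Longrightarrow> t \<in> \<aa> \<Longrightarrow> s - t \<in> \<aa>" "s \<in> \<aa> \<Longrightarrow> c * s \<in> \<aa>"
  using ideal.subspace_0[OF assms] ideal.subspace_add[OF assms] ideal.subspace_diff[OF assms]
    ideal.subspace_scale[OF assms] by blast+

text \<open>Among the terms of degree m, \<open>x^j y^(m-j)\<close> is the one with the highest
  power of x, with coefficient 1.\<close>

definition lead_at :: "nat \<Rightarrow> nat \<Rightarrow> 'k :: field poly poly \<Rightarrow> bool" where
  "lead_at m j r \<longleftrightarrow> tdeg_le (int m) r \<and> lead m r j = 1 \<and> (\<forall>i>j. lead m r i = 0)"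

text \<open>A standard basis argument. For each j < \<alpha> take e j minimal such that an element
  of x-degree below \<alpha> has leading term \<open>x^j y^(e j - j)\<close>; multiplication by y
  keeps j, so one element for each j suffices. The hypothesis \<open>min\<close> yields \<alpha>
  \<le> e j.\<close>

lemma adapted_basis:
  fixes \<aa> :: "'k :: field poly poly set"
  assumes \<aa>: "ideal.subspace \<aa>" and \<alpha>: "0 < \<alpha>"
    and f: "f \<in> \<aa>" "degree f = \<alpha>" "coeff f \<alpha> = 1" "tdeg_le (int \<alpha>) f"
    and min: "\<And>p. p \<in> \<aa> \<Longrightarrow> tdeg_le (int \<alpha> - 1) p \<Longrightarrow> p = 0"
    and large: "\<And>j. j < \<alpha> \<Longrightarrow> \<exists>m. \<exists>p\<in>\<aa>. lead_at m j p"
  obtains e q T \<delta> where "adapted \<alpha> e f q" "companion \<alpha> f q T \<delta>" "fits \<alpha> e T \<delta>" "\<aa> = gen_ideal \<alpha> f q"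
proof -
  note \<aa>D = ideal_subspaceD[OF \<aa>]
  define ok where "ok j m r \<longleftrightarrow> r \<in> \<aa> \<and> degree r < \<alpha> \<and> lead_at m j r" for j m r
  have ex: "\<exists>m r. ok j m r" if j: "j < \<alpha>" for j
  proof -
    obtain m p where p: "p \<in> \<aa>" "lead_at m j p" using large[OF j] by blast
    obtain s r where sr: "p = s * f + r" "degree r < \<alpha>" using monic_division[OF f(2,3) \<alpha>] .
    \<comment> \<open>By \<open>lead_at\<close>, the terms of p of x-degree at least \<alpha> have
      total degree below m. Dividing by f therefore leaves the form of degree m unchanged.\<close>
    have "tdeg_le (int m - 1 - int \<alpha>) s"
    proof (rule tdeg_le_monic_mult[OF f(2-4)])
      fix i l assume i: "\<alpha> \<le> i" and nz: "coeff (coeff (s * f) i) l \<noteq> 0"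
      have "coeff r i = 0" using i sr(2) by (intro coeff_eq_0) linarith
      then have c: "coeff (coeff p i) l \<noteq> 0" using nz by (simp add: sr(1))
      with p(2) have "int i + int l \<le> int m" unfolding lead_at_def by (blast dest: tdeg_leD)
      moreover have "i + l \<noteq> m"
      proof
        assume "i + l = m"
        then have "lead m p i = coeff (coeff p i) l" by (auto simp: lead_def)
        with p(2) c i j show False by (simp add: lead_at_def)
      qed
      ultimately show "int i + int l \<le> int m - 1" by linarith
    qed
    then have sf: "tdeg_le (int m - 1) (s * f)"
      using tdeg_le_mult[of "int m - 1 - int \<alpha>" s "int \<alpha>" f] f(4) by simp
    then have "lead m (s * f) i = 0" for i by (rule lead_eq_0) simp
    then have "lead m p i = lead m r i" for i by (simp add: sr(1) lead_add)
    moreover have "r = p - s * f" by (simp add: sr(1))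
    then have "tdeg_le (int m) r" "r \<in> \<aa>"
      using p tdeg_le_diff[of "int m" p "s * f"] tdeg_le_mono[OF sf, of "int m"] \<aa>D f(1)
      by (auto simp: lead_at_def)
    ultimately have "ok j m r" using p(2) sr(2) by (auto simp: ok_def lead_at_def)
    then show ?thesis by blast
  qed
  define e where "e j = (LEAST m. \<exists>r. ok j m r)" for j
  have "\<forall>j. \<exists>r. j < \<alpha> \<longrightarrow> ok j (e j) r"
    unfolding e_def using LeastI_ex[OF ex] by blast
  then obtain q where q: "\<And>j. j < \<alpha> \<Longrightarrow> ok j (e j) (q j)" by metis
  have e_le: "e j \<le> m" if "ok j m r" for j m r
    unfolding e_def using that by (intro Least_le) blast
  have qD: "q j \<in> \<aa>" "degree (q j) < \<alpha>" "tdeg_le (int (e j)) (q j)" "lead (e j) (q j) j = 1"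
      "\<And>i. j < i \<Longrightarrow> lead (e j) (q j) i = 0" if "j < \<alpha>" for j
    using q[OF that] by (auto simp: ok_def lead_at_def)
  have "lead_independent \<alpha> e q"
    unfolding lead_independent_def
  proof (intro allI impI, rule ccontr)
    fix \<beta> i assume 0: "\<forall>j<\<alpha>. (\<Sum>i<\<alpha>. \<beta> i * lead (e i) (q i) j) = 0" and i: "i < \<alpha>" "\<beta> i \<noteq> 0"
    define l where "l = Max {i. i < \<alpha> \<and> \<beta> i \<noteq> 0}"
    have fin: "finite {i. i < \<alpha> \<and> \<beta> i \<noteq> 0}" by simp
    have "l \<in> {i. i < \<alpha> \<and> \<beta> i \<noteq> 0}" unfolding l_def using i by (intro Max_in[OF fin]) blast
    then have l: "l < \<alpha>" "\<beta> l \<noteq> 0" by blast+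
    have big: "\<beta> k = 0" if "l < k" "k < \<alpha>" for k
      using Max_ge[OF fin, of k] that unfolding l_def[symmetric] by force
    have "(\<Sum>k<\<alpha>. \<beta> k * lead (e k) (q k) l) = (\<Sum>k<\<alpha>. if k = l then \<beta> l else 0)"
    proof (rule sum.cong[OF refl])
      fix k assume "k \<in> {..<\<alpha>}"
      then show "\<beta> k * lead (e k) (q k) l = (if k = l then \<beta> l else 0)"
        using qD(4,5)[of k] big[of k] l(1) by (cases k l rule: linorder_cases) auto
    qed
    also have "\<dots> = \<beta> l" using l(1) by simp
    finally show False using 0 l by simp
  qed
  moreover have "\<alpha> \<le> e i" if i: "i < \<alpha>" for i
  proof (rule ccontr)
    assume "\<not> \<alpha> \<le> e i"
    then have "tdeg_le (int \<alpha> - 1) (q i)" by (intro tdeg_le_mono[OF qD(3)[OF i]]) linarith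
    with min qD(1)[OF i] have "q i = 0" by blast
    with qD(4)[OF i] show False by (simp add: lead_def split: if_splits)
  qed
  ultimately have ad: "adapted \<alpha> e f q"
    using f qD(2,3) by (auto simp: adapted_def)
  \<comment> \<open>Induction on the degree m and, inside it, on a bound j for the x-degree of the
    leading form. By minimality of e j the leading term can be removed by a multiple
    \<open>c y^k q_j\<close>.\<close>
  have span: "\<exists>b. r = (\<Sum>i<\<alpha>. [:b i:] * q i)" if "r \<in> \<aa>" "degree r < \<alpha>" "tdeg_le (int m) r" for r m
  proof -
    have "\<exists>b. r = (\<Sum>i<\<alpha>. [:b i:] * q i)"
      if "r \<in> \<aa>" "degree r < \<alpha>" "tdeg_le (int m) r" "\<forall>i\<ge>j. lead m r i = 0" "j \<le> \<alpha>" for r m j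
      using that
    proof (induction m arbitrary: r j)
      case 0
      have ?case if "r = 0" using that by (intro exI[of _ "\<lambda>_. 0"]) simp
      moreover have "r = 0" using min[OF 0(1) tdeg_le_mono[OF 0(3)]] \<alpha> by simp
      ultimately show ?case by blast
    next
      case (Suc m)
      from Suc.prems show ?case
      proof (induction j arbitrary: r)
        case 0
        then have "tdeg_le (int m) r" using tdeg_le_dec[of m r] by simp
        moreover have "\<forall>i\<ge>\<alpha>. lead m r i = 0" using 0(2) by (auto simp: lead_def coeff_eq_0)
        ultimately show ?case using Suc.IH[of r \<alpha>] 0 by blast
      next
        case (Suc j)
        define c where "c = lead (Suc m) r j"
        have j: "j < \<alpha>" using Suc.prems by simp
        show ?case
        proof (cases "c = 0")
          case True
          then have "\<forall>i\<ge>j. lead (Suc m) r i = 0"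
            using Suc.prems(4) by (metis c_def le_eq_less_or_eq Suc_leI)
          with Suc.IH[of r] Suc.prems j show ?thesis by simp
        next
          case False
          have "ok j (Suc m) ([:[:inverse c:]:] * r)"
            unfolding ok_def lead_at_def lead_scalar
          proof (intro conjI allI impI)
            show "degree ([:[:inverse c:]:] * r) < \<alpha>"
              using Suc.prems(2) degree_mult_le[of "[:[:inverse c:]:]" r] by simp
            show "tdeg_le (int (Suc m)) ([:[:inverse c:]:] * r)"
              using tdeg_le_mult[OF tdeg_le_scalar[of 0 "inverse c"] Suc.prems(3)] by simp
            show "[:[:inverse c:]:] * r \<in> \<aa>" using \<aa>D(4) Suc.prems(1) by blast
          qed (use Suc.prems False in \<open>auto simp: c_def\<close>)
          then have le: "e j \<le> Suc m" by (rule e_le)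
          define k where "k = Suc m - e j"
          have k: "Suc m = e j + k" using le by (simp add: k_def)
          define r' where "r' = r - [:monom c k:] * q j"
          have "degree ([:monom c k:] * q j) < \<alpha>"
            using qD(2)[OF j] degree_mult_le[of "[:monom c k:]" "q j"] by simp
          then have "degree r' < \<alpha>" unfolding r'_def using Suc.prems(2) by (rule degree_diff_less[rotated])
          moreover have "r' \<in> \<aa>" unfolding r'_def using \<aa>D Suc.prems(1) qD(1)[OF j] by blast
          moreover have "tdeg_le (int (Suc m)) r'"
            unfolding r'_def k using tdeg_le_monom_mult[OF qD(3)[OF j]] Suc.prems(3) k
            by (intro tdeg_le_diff) simp_all
          moreover have "lead (Suc m) r' i = lead (Suc m) r i - c * lead (e j) (q j) i" for i
            unfolding r'_def lead_diff using lead_monom_mult[of "e j" k c "q j" i] k by simp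
          then have "\<forall>i\<ge>j. lead (Suc m) r' i = 0"
            using Suc.prems(4) qD(4,5)[OF j] unfolding c_def
            by (metis Suc_leI diff_self le_eq_less_or_eq mult.right_neutral mult_zero_right)
          ultimately obtain b where b: "r' = (\<Sum>i<\<alpha>. [:b i:] * q i)"
            using Suc.IH[of r'] j by auto
          have "r = (\<Sum>i<\<alpha>. [:b i:] * q i) + [:monom c k:] * q j" unfolding b[symmetric] r'_def by simp
          also have "\<dots> = (\<Sum>i<\<alpha>. [:b i:] * q i) + (\<Sum>i<\<alpha>. if i = j then [:monom c k:] * q i else 0)"
            using j by (simp only: sum.delta finite_lessThan lessThan_iff if_True)
          also have "\<dots> = (\<Sum>i<\<alpha>. [:(if i = j then b i + monom c k else b i):] * q i)"
            unfolding sum.distrib[symmetric]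
            by (rule sum.cong) (auto simp: distrib_right simp flip: smult_add_left)
          finally show ?thesis by (rule exI[of _ "\<lambda>i. if i = j then b i + monom c k else b i"])
        qed
      qed
    qed
    from this[of r m \<alpha>] that show ?thesis by (auto simp: lead_def coeff_eq_0)
  qed
  have span': "\<exists>b. r = (\<Sum>i<\<alpha>. [:b i:] * q i)" if "r \<in> \<aa>" "degree r < \<alpha>" for r
    using span[OF that] ex_tdeg_le by blast
  have gen: "\<aa> = gen_ideal \<alpha> f q"
  proof (intro equalityI subsetI)
    fix p assume p: "p \<in> \<aa>"
    obtain s r where sr: "p = s * f + r" "degree r < \<alpha>" using monic_division[OF f(2,3) \<alpha>] .
    then have "r = p - s * f" by simp
    then have "r \<in> \<aa>" using p f(1) \<aa>D by blast
    from span'[OF this sr(2)] show "p \<in> gen_ideal \<alpha> f q" unfolding sr(1) using gen_idealI by blast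
  next
    fix p assume "p \<in> gen_ideal \<alpha> f q"
    then obtain s b where p: "p = s * f + (\<Sum>i<\<alpha>. [:b i:] * q i)" by (auto simp: gen_ideal_def)
    have "(\<Sum>i<\<alpha>. [:b i:] * q i) \<in> \<aa>"
      by (rule ideal.subspace_sum[OF \<aa>], rule \<aa>D(4), rule qD(1)) simp
    then show "p \<in> \<aa>" unfolding p using f(1) \<aa>D by blast
  qed
  have "\<forall>i. \<exists>d t. i < \<alpha> \<longrightarrow> [:0, 1:] * q i = (\<Sum>j<\<alpha>. [:t j:] * q j) + [:d:] * f"
  proof
    fix i
    show "\<exists>d t. i < \<alpha> \<longrightarrow> [:0, 1:] * q i = (\<Sum>j<\<alpha>. [:t j:] * q j) + [:d:] * f"
    proof (cases "i < \<alpha>")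
      case True
      \<comment> \<open>Multiplication by x can reach x-degree \<alpha>; subtracting d times the
        monic f brings the element back below \<alpha>.\<close>
      define d where "d = coeff (q i) (\<alpha> - 1)"
      define r where "r = [:0, 1:] * q i - [:d:] * f"
      have "coeff r k = 0" if "\<alpha> \<le> k" for k
      proof (cases "k = \<alpha>")
        case True
        then show ?thesis using f(3) \<alpha> by (simp add: r_def d_def coeff_pCons split: nat.splits)
      next
        case False
        with that have "coeff f k = 0" "coeff (q i) (k - 1) = 0"
          using f(2) qD(2)[OF True] by (auto intro!: coeff_eq_0)
        then show ?thesis using that \<alpha> by (cases k) (simp_all add: r_def coeff_pCons)
      qed
      then have "degree r < \<alpha>"
          using \<alpha> leading_coeff_0_iff[of r] by (cases "degree r < \<alpha>") (force simp: not_less)+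
      moreover have "r \<in> \<aa>" unfolding r_def using \<aa>D qD(1)[OF True] f(1) by blast
      ultimately obtain b where "r = (\<Sum>i<\<alpha>. [:b i:] * q i)" using span' by blast
      then have "[:0, 1:] * q i = (\<Sum>j<\<alpha>. [:b j:] * q j) + [:d:] * f"
        unfolding r_def by (simp only: diff_eq_eq)
      then show ?thesis by blast
    qed auto
  qed
  from choice[OF this] obtain \<delta> where
    "\<forall>i. \<exists>t. i < \<alpha> \<longrightarrow> [:0, 1:] * q i = (\<Sum>j<\<alpha>. [:t j:] * q j) + [:\<delta> i:] * f" ..
  from choice[OF this] obtain T where
    "\<forall>i. i < \<alpha> \<longrightarrow> [:0, 1:] * q i = (\<Sum>j<\<alpha>. [:T i j:] * q j) + [:\<delta> i:] * f" ..
  then have com: "companion \<alpha> f q T \<delta>"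
    unfolding companion_def by blast
  have "fits \<alpha> e T \<delta>"
    unfolding fits_def
  proof (intro allI impI)
    fix i assume i: "i < \<alpha>"
    have eq: "[:\<delta> i:] * f + (\<Sum>j<\<alpha>. [:T i j:] * q j) = [:0, 1:] * q i"
      using com i by (simp add: companion_def)
    have "tdeg_le (int (e i) + 1) ([:0, 1:] * q i)"
      using tdeg_le_mult[OF tdeg_le_x[of 1] qD(3)[OF i]] by (simp add: add.commute)
    then have "tdeg_le (int (e i) + 1) ([:\<delta> i:] * f + (\<Sum>j<\<alpha>. [:T i j:] * q j))" by (simp only: eq)
    from adapted_tdeg_le[OF ad this]
    show "(\<forall>j<\<alpha>. tdeg_le (int (e i) + 1 - int (e j)) [:T i j:]) \<and> tdeg_le (int (e i) + 1 - int \<alpha>) [:\<delta> i:]"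
      by blast
  qed
  then show ?thesis using that ad com gen by blast
qed

section \<open>Lines disjoint from a finite scheme\<close>

lemma nonzero_poly_value:
  fixes F :: "'k :: field_char_0 poly poly"
  assumes "F \<noteq> 0"
  obtains a b where "poly (poly F [:a:]) b \<noteq> 0"
proof -
  have "finite {r. poly F r = 0}" using assms by (rule poly_roots_finite)
  then have "finite ((\<lambda>a. [:a:]) -` {r. poly F r = 0})" by (rule finite_vimageI) (simp add: inj_def)
  then obtain a where "poly F [:a:] \<noteq> 0"
    using ex_new_if_finite[OF infinite_UNIV_char_0[where 'a = 'k]] by auto
  then have "finite {b. poly (poly F [:a:]) b = 0}" by (rule poly_roots_finite)
  then obtain b where "poly (poly F [:a:]) b \<noteq> 0"
    using ex_new_if_finite[OF infinite_UNIV_char_0[where 'a = 'k]] by auto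
  then show ?thesis by (rule that)
qed

text \<open>An element of least degree divides all others, so a root of it would be a common zero;
  hence it is a constant.\<close>

lemma ideal_univariate_no_root:
  fixes D :: "'k :: alg_closed_field poly set"
  assumes D: "ideal.subspace D" and d: "d0 \<in> D" "d0 \<noteq> 0"
    and root: "\<And>a. \<exists>d\<in>D. poly d a \<noteq> 0"
  shows "1 \<in> D"
proof -
  note DD = ideal_subspaceD[OF D]
  obtain d where d: "d \<in> D" "d \<noteq> 0" and min: "\<And>d'. d' \<in> D \<Longrightarrow> d' \<noteq> 0 \<Longrightarrow> degree d \<le> degree d'"
    using ex_has_least_nat[of "\<lambda>d. d \<in> D \<and> d \<noteq> 0" d0 degree] d by blast
  have dvd: "d dvd g" if g: "g \<in> D" for g
  proof -
    have "g mod d = g - (g div d) * d" by (simp add: minus_div_mult_eq_mod)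
    then have "g mod d \<in> D" using DD g d(1) by metis
    then have "g mod d = 0"
      using min[of "g mod d"] degree_mod_less[OF d(2), of g] by (metis not_less)
    then show ?thesis by auto
  qed
  have "degree d = 0"
  proof (rule ccontr)
    assume "degree d \<noteq> 0"
    then obtain a where "poly d a = 0" using alg_closed_imp_poly_has_root[of d] by auto
    moreover obtain g where "g \<in> D" "poly g a \<noteq> 0" using root by blast
    ultimately show False using dvd[of g] by (auto elim!: dvdE)
  qed
  then obtain c where c: "d = [:c:]" by (rule degree_eq_zeroE)
  then have "[:inverse c:] * d = 1" using d(2) by (simp add: one_pCons)
  with DD(4)[OF d(1), of "[:inverse c:]"] show ?thesis by simp
qed

definition unit :: "var \<Rightarrow> var \<Rightarrow> 'k :: field" where
  "unit v w = (if v = w then 1 else 0)"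

text \<open>The form of degree m with y = 1: the restriction to the line at infinity in its chart
  away from \<open>o1\<close>.\<close>

definition top_form :: "nat \<Rightarrow> 'k :: field poly poly \<Rightarrow> 'k poly" where
  "top_form m p = (\<Sum>j\<le>m. monom (lead m p j) j)"

lemma coeff_top_form: "coeff (top_form m p) j = lead m p j"
  by (simp add: top_form_def coeff_sum lead_def if_distrib[of "\<lambda>x. monom x _"] cong: if_cong)

lemma lead_x_mult: "lead (Suc d) ([:0, 1:] * p) j = (if j = 0 then 0 else lead d p (j - 1))"
  for p :: "'k :: comm_ring_1 poly poly"
  by (cases j) (simp_all add: lead_def)

lemma lead_x_power_mult: "lead (i + d) ([:0, 1:] ^ i * p) j = (if j < i then 0 else lead d p (j - i))"
  for p :: "'k :: comm_ring_1 poly poly"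
proof (induction i arbitrary: j)
  case (Suc i)
  have "lead (Suc i + d) ([:0, 1:] ^ Suc i * p) j = lead (Suc (i + d)) ([:0, 1:] * ([:0, 1:] ^ i * p)) j"
    by (simp only: add_Suc power_Suc mult.assoc)
  also have "\<dots> = (if j < Suc i then 0 else lead d p (j - Suc i))"
    unfolding lead_x_mult Suc.IH by (cases j) auto
  finally show ?case .
qed simp

lemma top_form_add: "top_form m (p + q) = top_form m p + top_form m q"
  by (rule poly_eqI) (simp add: coeff_top_form lead_add)

lemma top_form_y_mult: "top_form (m + k) ([:monom 1 k:] * p) = top_form m p"
  by (rule poly_eqI) (simp only: coeff_top_form lead_monom_mult mult_1)

lemma top_form_x_mult: "top_form (Suc m) ([:0, 1:] * p) = pCons 0 (top_form m p)"
  by (rule poly_eqI) (simp only: coeff_top_form lead_x_mult coeff_pCons split: nat.splits, auto)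

lemma top_form_scalar: "top_form m (scal c * p) = Polynomial.smult c (top_form m p)"
  by (rule poly_eqI) (simp only: coeff_top_form lead_scalar coeff_smult)

lemma monom_y: "[:monom 1 k:] = ([:[:0, 1:]:] :: 'k :: field poly poly) ^ k"
proof (induction k)
  case (Suc k)
  have "[:[:0, 1:]:] ^ Suc k = [:[:0, 1:]:] * ([:monom 1 k:] :: 'k poly poly)"
    by (simp only: power_Suc Suc.IH)
  then show ?case by (simp add: monom_Suc)
qed (simp add: monom_0 one_pCons)

lemma card_triangle_ge: "m + 1 \<le> card (triangle m)"
  by (induction m) (simp_all add: card_triangle_Suc card_triangle_0)

lemma homogeneous_part_0_const:
  assumes "f \<in> homogeneous_part 0" "f \<noteq> 0"
  obtains c where "c \<noteq> 0" "mpoly_scale c f = 1"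
proof -
  have keys: "Poly_Mapping.keys f \<subseteq> {0}" using assms(1) by (auto simp: homogeneous_part_def mon_degree_eq_0)
  have f: "f = Poly_Mapping.single 0 (Poly_Mapping.lookup f 0)"
  proof (rule poly_mapping_eqI)
    fix t
    show "Poly_Mapping.lookup f t = Poly_Mapping.lookup (Poly_Mapping.single 0 (Poly_Mapping.lookup f 0)) t"
      using keys by (cases "t = 0") (auto simp: lookup_single in_keys_iff)
  qed
  have nz: "Poly_Mapping.lookup f 0 \<noteq> 0" using f assms(2) by force
  have "mpoly_scale (inverse (Poly_Mapping.lookup f 0)) f = 1"
    by (subst f) (simp add: mpoly_scale_single nz)
  with nz show ?thesis by (intro that[of "inverse (Poly_Mapping.lookup f 0)"]) auto
qed

lemma pairing_unit: "pairing (unit v) p = p v" "pairing p (unit v) = p v"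
  by (cases v; simp add: pairing_def sum_var unit_def)+

lemma pairing_diff: "pairing (\<lambda>v. l v - c * l' v) p = pairing l p - c * pairing l' p"
  and pairing_add: "pairing l (\<lambda>v. p v + c * p' v) = pairing l p + c * pairing l p'"
  by (simp_all add: pairing_def sum_var algebra_simps)

lemma HilbD:
  assumes "J \<in> Hilb n"
  shows "homogeneous_ideal J" "ideal.subspace J" "saturation J = J"
    "f \<in> J \<Longrightarrow> homogeneous_component d f \<in> J"
    "\<exists>m0. \<forall>m\<ge>m0. hilbert_function J m = n"
  using assms by (auto simp: Hilb_def homogeneous_ideal_def)

lemma component_nonzero_value:
  assumes "mpoly_eval p f \<noteq> 0"
  obtains m where "mpoly_eval p (homogeneous_component m f) \<noteq> 0"
proof -
  obtain N where f: "f = (\<Sum>d\<le>N. homogeneous_component d f)" by (rule homogeneous_component_sum)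
  have "mpoly_eval p f = (\<Sum>d\<le>N. mpoly_eval p (homogeneous_component d f))"
    by (subst f) (simp only: mpoly_eval_eq_hom mpoly_hom_sum[OF id_hom])
  with assms obtain d where "mpoly_eval p (homogeneous_component d f) \<noteq> 0"
    by (metis (no_types, lifting) sum.neutral)
  then show ?thesis by (rule that)
qed

section \<open>The choice of a line that misses X\<close>

context frame begin

text \<open>Independence of g modulo W lets a basis of W be enlarged by the
  \<open>g i\<close>.\<close>

lemma dim_part_add_card_le:
  fixes W :: "'k coord_ring set" and g :: "'i \<Rightarrow> 'k coord_ring"
  assumes W: "kvec.subspace W" "W \<subseteq> homogeneous_part m" and S: "finite S"
    and g: "\<And>i. i \<in> S \<Longrightarrow> g i \<in> homogeneous_part m"
    and ind: "\<And>c. (\<Sum>i\<in>S. mpoly_scale (c i) (g i)) \<in> W \<Longrightarrow> \<forall>i\<in>S. c i = 0"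
  shows "kvec.dim W + card S \<le> kvec.dim (homogeneous_part m :: 'k coord_ring set)"
proof -
  obtain B where B: "B \<subseteq> W" "kvec.independent B" "W \<subseteq> kvec.span B" "finite B" "card B = kvec.dim W"
    using finite_basis_of_part[OF W] .
  obtain C where C: "C \<subseteq> homogeneous_part m" "kvec.independent C"
      "(homogeneous_part m :: 'k coord_ring set) \<subseteq> kvec.span C" "finite C"
      "card C = kvec.dim (homogeneous_part m :: 'k coord_ring set)"
    using finite_basis_of_part[OF subspace_homogeneous_part order.refl] .
  have single: "(\<Sum>i\<in>S. mpoly_scale (if i = j then c else 0) (g i)) = mpoly_scale c (g j)" if "j \<in> S" for c j
  proof -
    have "(\<Sum>i\<in>S. mpoly_scale (if i = j then c else 0) (g i)) = (\<Sum>i\<in>S. if i = j then mpoly_scale c (g i) else 0)"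
      by (rule sum.cong) auto
    then show ?thesis using S that by simp
  qed
  have inj: "inj_on g S"
  proof (rule inj_onI, rule ccontr)
    fix i j assume ij: "i \<in> S" "j \<in> S" "g i = g j" "i \<noteq> j"
    have "(\<Sum>k\<in>S. mpoly_scale ((if k = i then 1 else 0) + (if k = j then - 1 else 0)) (g k)) = 0"
      unfolding kvec.scale_left_distrib sum.distrib single[OF ij(1)] single[OF ij(2)] ij(3) by simp
    from ind[of "\<lambda>k. (if k = i then 1 else 0) + (if k = j then - 1 else 0)", unfolded this]
      kvec.subspace_0[OF W(1)] ij
    show False by (auto dest: bspec[of _ _ i])
  qed
  have disj: "B \<inter> g ` S = {}"
  proof (rule ccontr)
    assume "B \<inter> g ` S \<noteq> {}"
    then obtain j where j: "j \<in> S" "g j \<in> W" using B(1) by blast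
    with ind[of "\<lambda>k. if k = j then 1 else 0"] show False by (auto simp: single dest: bspec[of _ _ j])
  qed
  have "kvec.independent (B \<union> g ` S)"
  proof
    assume "kvec.dependent (B \<union> g ` S)"
    then obtain c where c: "\<exists>v\<in>B \<union> g ` S. c v \<noteq> 0" "(\<Sum>v\<in>B \<union> g ` S. mpoly_scale (c v) v) = 0"
      using kvec.dependent_finite[of "B \<union> g ` S"] B(4) S by auto
    have s: "(\<Sum>v\<in>B. mpoly_scale (c v) v) + (\<Sum>i\<in>S. mpoly_scale (c (g i)) (g i)) = 0"
      using c(2) B(4) S disj by (simp add: sum.union_disjoint sum.reindex[OF inj])
    then have "(\<Sum>i\<in>S. mpoly_scale (c (g i)) (g i)) = - (\<Sum>v\<in>B. mpoly_scale (c v) v)"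
      by (simp add: eq_neg_iff_add_eq_0 add.commute)
    also have "\<dots> \<in> W"
      using B(1) by (intro kvec.subspace_neg[OF W(1)] kvec.subspace_sum[OF W(1)] kvec.subspace_scale[OF W(1)]) auto
    finally have "\<forall>i\<in>S. c (g i) = 0" by (rule ind)
    moreover from this s have "(\<Sum>v\<in>B. mpoly_scale (c v) v) = 0" by simp
    then have "\<forall>v\<in>B. c v = 0"
      using kvec.independentD[OF B(2,4) order.refl] by blast
    ultimately show False using c(1) by auto
  qed
  moreover have "B \<union> g ` S \<subseteq> kvec.span C" using B(1) W(2) g C(3) by blast
  ultimately have "card (B \<union> g ` S) \<le> card C" using kvec.independent_span_bound[OF C(4)] by blast
  moreover have "card (B \<union> g ` S) = kvec.dim W + card S"
    using card_Un_disjoint[OF B(4) finite_imageI[OF S] disj] B(5) by (simp add: card_image[OF inj])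
  ultimately show ?thesis using C(5) by simp
qed

text \<open>
  If every line through \<open>o1\<close> met the zero set of \<open>J\<close> in a further point, then \<open>n + 1\<close> such points
  on different lines would impose independent conditions on forms of large degree.
\<close>
lemma exists_line_without_zeros:
  assumes J: "J \<in> Hilb n" and inf: "infinite (UNIV :: 'k set)"
  obtains t where "\<And>a. \<exists>f\<in>J. poly (poly (dehom f) [:a:]) t \<noteq> 0"
proof (rule ccontr)
  assume "\<not> thesis"
  then have "\<forall>t. \<exists>a. \<forall>f\<in>J. poly (poly (dehom f) [:a:]) t = 0" using that by blast
  from choice[OF this] obtain A where A: "\<And>t f. f \<in> J \<Longrightarrow> poly (poly (dehom f) [:A t:]) t = 0" by blast
  obtain S :: "'k set" where S: "finite S" "card S = n + 1"
    using infinite_arbitrarily_large[OF inf] by blast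
  obtain m0 where m0: "\<And>m. m0 \<le> m \<Longrightarrow> hilbert_function J m = n" using HilbD(5)[OF J] by blast
  define m where "m = max m0 n"
  \<comment> \<open>Lagrange polynomials for the n + 1 lines y = s. Their degree is n, which is why
    m is taken to be at least n.\<close>
  define L where "L t = (\<Prod>s\<in>S - {t}. [:- s, 1:])" for t
  have L: "poly (L t) s = 0 \<longleftrightarrow> s \<noteq> t" if "s \<in> S" for s t
    using S(1) that by (auto simp: L_def poly_prod)
  define g where "g t = hom m [:L t:]" for t
  have tdegL: "tdeg_le (int m) [:L t:]" if "t \<in> S" for t
    unfolding tdeg_le_const
  proof (intro allI impI)
    fix j assume "coeff (L t) j \<noteq> 0"
    then have "j \<le> degree (L t)" by (rule le_degree)
    also have "degree (L t) \<le> (\<Sum>s\<in>S - {t}. degree [:- s, 1:])"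
      using degree_prod_sum_le[of "S - {t}" "\<lambda>s. [:- s, 1:]"] S(1) by (simp add: L_def o_def)
    also have "\<dots> = n" using S that by simp
    finally show "int j \<le> int m" by (simp add: m_def)
  qed
  let ?W = "J \<inter> homogeneous_part m"
  have W: "kvec.subspace ?W" using HilbD(2)[OF J] by (rule subspace_ideal_part)
  have "kvec.dim ?W + card S \<le> kvec.dim (homogeneous_part m :: 'k coord_ring set)"
  proof (rule dim_part_add_card_le[OF W _ S(1), where g = g])
    fix c assume c: "(\<Sum>i\<in>S. mpoly_scale (c i) (g i)) \<in> ?W"
    show "\<forall>i\<in>S. c i = 0"
    proof
      fix i assume i: "i \<in> S"
      have "dehom (\<Sum>i\<in>S. mpoly_scale (c i) (g i)) = (\<Sum>t\<in>S. scal (c t) * [:L t:])"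
        unfolding dehom_simps g_def by (intro sum.cong refl) (simp add: dehom_hom[OF tdegL])
      then have "0 = poly (poly (\<Sum>t\<in>S. scal (c t) * [:L t:]) [:A i:]) i"
        using A[of "\<Sum>i\<in>S. mpoly_scale (c i) (g i)" i] c by simp
      also have "\<dots> = (\<Sum>t\<in>S. c t * poly (L t) i)" by (simp add: poly_sum)
      also have "\<dots> = (\<Sum>t\<in>S. if t = i then c i * poly (L i) i else 0)"
        using i L by (intro sum.cong) auto
      also have "\<dots> = c i * poly (L i) i" using i S(1) by simp
      finally show "c i = 0" using L[OF i, of i] by simp
    qed
  qed (auto simp: g_def hom_homogeneous)
  moreover have "kvec.dim (homogeneous_part m :: 'k coord_ring set) - kvec.dim ?W = n"
    using m0[of m] by (simp add: hilbert_function_def m_def)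
  ultimately show False using S(2) by linarith
qed

end

lemma frame_unit: "frame (unit VX) (unit VY) (unit VZ) (unit VX) (unit VY) (unit VZ :: var \<Rightarrow> 'k :: field)"
proof
  fix v w :: var
  show "unit VX v * unit VX w + unit VY v * unit VY w + unit VZ v * unit VZ w = (if v = w then 1 else (0 :: 'k))"
    by (cases v; cases w) (simp_all add: unit_def)
qed (simp_all add: pairing_unit, simp_all add: unit_def)

lemma frame_first_vector:
  fixes p :: "var \<Rightarrow> 'k :: field"
  assumes "p VZ = 1"
  shows "frame p (unit VX) (unit VY) (unit VZ)
    (\<lambda>v. unit VX v - p VX * unit VZ v) (\<lambda>v. unit VY v - p VY * unit VZ v)"
proof
  fix v w :: var
  show "p v * unit VZ w + unit VX v * (unit VX w - p VX * unit VZ w)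
      + unit VY v * (unit VY w - p VY * unit VZ w) = (if v = w then 1 else 0)"
    using assms by (cases v; cases w) (simp_all add: unit_def)
qed (simp_all add: pairing_diff pairing_unit assms, simp_all add: unit_def)

text \<open>The line through \<open>o1\<close> given by y = t in the old coordinates becomes the
  line at infinity.\<close>

lemma (in frame) frame_pencil:
  "frame o1 (\<lambda>v. o3 v + t * o2 v) o2 l1 l3 (\<lambda>v. l2 v - t * l3 v)"
proof
  fix v w :: var
  show "o1 v * l1 w + (o3 v + t * o2 v) * l3 w + o2 v * (l2 w - t * l3 w) = (if v = w then 1 else 0)"
    using complete[of v w] by (simp add: algebra_simps)
qed (simp_all add: pairing_diff pairing_add dual)

text \<open>The line at infinity has no zeros of J away from \<open>o1\<close>, by the choice of t
  in the pencil through \<open>o1\<close>. The point \<open>o1\<close> itself is handled by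
  \<open>f0\<close>, which does not vanish there.\<close>

lemma exists_frame:
  fixes J :: "'k :: field_char_0 coord_ring set"
  assumes J: "J \<in> Hilb n" and f0: "f0 \<in> homogeneous_part \<alpha>" "f0 \<noteq> 0"
  obtains o1 o2 o3 l1 l2 l3 where "frame o1 o2 o3 l1 l2 l3" "mpoly_eval o1 f0 \<noteq> 0"
    "\<And>a. \<exists>f\<in>J. mpoly_eval (\<lambda>v. a * o1 v + o2 v) f \<noteq> 0"
proof -
  interpret std: frame "unit VX" "unit VY" "unit VZ" "unit VX" "unit VY" "unit VZ :: var \<Rightarrow> 'k"
    by (rule frame_unit)
  have "std.dehom f0 \<noteq> 0" using f0 std.dehom_eq_0 by blast
  then obtain a b where "poly (poly (std.dehom f0) [:a:]) b \<noteq> 0" by (rule nonzero_poly_value)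
  then have nz: "mpoly_eval (\<lambda>v. a * unit VX v + b * unit VY v + unit VZ v) f0 \<noteq> 0"
    unfolding std.eval_dehom .
  define p where "p v = a * unit VX v + b * unit VY v + unit VZ v" for v
  have "p VZ = 1" by (simp add: p_def unit_def)
  from frame_first_vector[of p, OF this] interpret F: frame p "unit VX" "unit VY" "unit VZ"
    "\<lambda>v. unit VX v - p VX * unit VZ v" "\<lambda>v. unit VY v - p VY * unit VZ v" .
  obtain t where t: "\<And>a. \<exists>f\<in>J. poly (poly (F.dehom f) [:a:]) t \<noteq> 0"
    using F.exists_line_without_zeros[OF J infinite_UNIV_char_0] by blast
  show ?thesis
  proof (rule that[OF F.frame_pencil[of t]])
    show "mpoly_eval p f0 \<noteq> 0" using nz by (simp add: p_def[abs_def])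
    fix a
    show "\<exists>f\<in>J. mpoly_eval (\<lambda>v. a * p v + (unit VY v + t * unit VX v)) f \<noteq> 0"
      using t[of a] unfolding F.eval_dehom[symmetric] by (simp add: ac_simps)
  qed
qed

section \<open>The ideal of X in general coordinates\<close>

context frame begin

lemma eval_line_top_form:
  assumes "f \<in> homogeneous_part m"
  shows "mpoly_eval (\<lambda>v. a * o1 v + o2 v) f = poly (top_form m (dehom f)) a"
  using eval_line[OF assms, of a 1] by (simp add: top_form_def poly_sum poly_monom lead_def)

lemma hom_mult:
  assumes "tdeg_le (int m) p" "tdeg_le (int m') q"
  shows "hom (m + m') (p * q) = hom m p * hom m' q"
proof (rule dehom_inj)
  have "tdeg_le (int (m + m')) (p * q)" using tdeg_le_mult[OF assms] by simp
  then show "dehom (hom (m + m') (p * q)) = dehom (hom m p * hom m' q)"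
    using assms by (simp add: dehom_simps dehom_hom)
qed (auto intro: hom_homogeneous homogeneous_part_mult)

end

text \<open>The coefficient condition says \<open>f0 = 1\<close> at \<open>o1\<close> and makes its
  affine form monic in x. Together with \<open>no_zero\<close> it expresses that X does not meet the
  line at infinity.\<close>

locale general_frame = frame o1 o2 o3 l1 l2 l3
  for o1 o2 o3 l1 l2 l3 :: "var \<Rightarrow> 'k :: alg_closed_field" +
  fixes n :: nat and J :: "'k coord_ring set" and \<alpha> :: nat and f0 :: "'k coord_ring"
  assumes J: "J \<in> Hilb n"
    and f0: "f0 \<in> J" "f0 \<in> homogeneous_part \<alpha>" "coeff (coeff (dehom f0) \<alpha>) 0 = 1"
    and no_zero: "\<And>a. \<exists>f\<in>J. mpoly_eval (\<lambda>v. a * o1 v + o2 v) f \<noteq> 0"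
begin

lemmas ideal_J = HilbD(2)[OF J]
lemmas JD = ideal_subspaceD[OF HilbD(2)[OF J]]

lemma J_scale: "f \<in> J \<Longrightarrow> mpoly_scale c f \<in> J"
  unfolding mpoly_scale_def by (rule JD(4))

definition F :: "'k poly poly" where "F = dehom f0"

lemma F: "degree F = \<alpha>" "coeff F \<alpha> = 1" "tdeg_le (int \<alpha>) F"
proof -
  show td: "tdeg_le (int \<alpha>) F" unfolding F_def by (rule tdeg_le_dehom[OF f0(2)])
  show 1: "coeff F \<alpha> = 1"
  proof (rule poly_eqI)
    fix j show "coeff (coeff F \<alpha>) j = coeff 1 j"
      using f0(3) tdeg_le_coeff_eq_0[OF td, of \<alpha> j] by (cases j) (auto simp: F_def)
  qed
  have "coeff F i = 0" if "\<alpha> < i" for i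
    using tdeg_le_coeff_eq_0[OF td, of i] that by (intro poly_eqI) auto
  then have "degree F \<le> \<alpha>" by (intro degree_le) auto
  moreover have "\<alpha> \<le> degree F" using 1 by (intro le_degree) auto
  ultimately show "degree F = \<alpha>" by simp
qed

text \<open>The ideal of the intersection of X with the line at infinity, in the chart y = 1 of that
  line.\<close>

definition top_ideal :: "'k poly set" where
  "top_ideal = {top_form m (dehom f) | m f. f \<in> J \<and> f \<in> homogeneous_part m}"

lemma top_idealI: "f \<in> J \<Longrightarrow> f \<in> homogeneous_part m \<Longrightarrow> top_form m (dehom f) \<in> top_ideal"
  by (auto simp: top_ideal_def)

lemma dehom_l2_power_mult: "dehom (lin_form l2 ^ k * f) = [:monom 1 k:] * dehom f"
  by (simp add: dehom_simps dehom_coords monom_y del: mult_pCons_left)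

lemma lin_power_mult_in: "f \<in> homogeneous_part m \<Longrightarrow> lin_form l ^ k * f \<in> homogeneous_part (m + k)"
  using homogeneous_part_mult[OF homogeneous_part_power[OF lin_form_homogeneous[of l], of k], of f m]
  by (simp add: add.commute)

text \<open>Forms of different degrees are brought to a common degree by powers of
  \<open>l2\<close>, which is 1 in the chart.\<close>

lemma ideal_top_ideal: "ideal.subspace top_ideal"
proof -
  have add: "s + t \<in> top_ideal" if "s \<in> top_ideal" "t \<in> top_ideal" for s t
  proof -
    obtain m f where f: "s = top_form m (dehom f)" "f \<in> J" "f \<in> homogeneous_part m"
      using \<open>s \<in> top_ideal\<close> by (auto simp: top_ideal_def)
    obtain m' g where g: "t = top_form m' (dehom g)" "g \<in> J" "g \<in> homogeneous_part m'"
      using \<open>t \<in> top_ideal\<close> by (auto simp: top_ideal_def)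
    let ?f = "lin_form l2 ^ m' * f" and ?g = "lin_form l2 ^ m * g"
    have "top_form (m + m') (dehom (?f + ?g)) \<in> top_ideal"
      using f(2,3) g(2,3) lin_power_mult_in[of g m' l2 m]
      by (intro top_idealI homogeneous_part_add JD(2,4) lin_power_mult_in) (simp_all add: add.commute)
    also have "top_form (m + m') (dehom (?f + ?g)) = s + t"
      unfolding dehom_simps(2) top_form_add dehom_l2_power_mult
      using top_form_y_mult[of m m' "dehom f"] top_form_y_mult[of m' m "dehom g"]
      by (simp add: f(1) g(1) add.commute)
    finally show ?thesis .
  qed
  have zero: "0 \<in> top_ideal"
    using top_idealI[OF JD(1) homogeneous_part_0[of 0]] by (simp add: dehom_simps top_form_def lead_def)
  have x: "pCons 0 s \<in> top_ideal" if s: "s \<in> top_ideal" for s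
  proof -
    obtain m f where f: "s = top_form m (dehom f)" "f \<in> J" "f \<in> homogeneous_part m"
      using s by (auto simp: top_ideal_def)
    have "top_form (Suc m) (dehom (lin_form l1 * f)) \<in> top_ideal"
      using f(2,3) homogeneous_part_mult[OF lin_form_homogeneous f(3)] by (intro top_idealI JD(4)) auto
    then show ?thesis by (simp only: dehom_simps(3) dehom_coords top_form_x_mult f(1))
  qed
  have scal: "Polynomial.smult c s \<in> top_ideal" if s: "s \<in> top_ideal" for c s
  proof -
    obtain m f where f: "s = top_form m (dehom f)" "f \<in> J" "f \<in> homogeneous_part m"
      using s by (auto simp: top_ideal_def)
    have "top_form m (dehom (mpoly_scale c f)) \<in> top_ideal"
      using f(2,3) by (intro top_idealI J_scale homogeneous_part_scale)
    then show ?thesis by (simp only: dehom_simps(5) top_form_scalar f(1))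
  qed
  have "c * s \<in> top_ideal" if s: "s \<in> top_ideal" for c s
  proof (induction c)
    case (pCons a c)
    have "pCons a c * s = Polynomial.smult a s + pCons 0 (c * s)" by simp
    then show ?case using add scal[OF s] x pCons.IH by metis
  qed (simp add: zero)
  with zero add show ?thesis by (intro ideal.subspaceI) auto
qed

lemma top_ideal_1: "1 \<in> top_ideal"
proof (rule ideal_univariate_no_root[OF ideal_top_ideal])
  show "top_form \<alpha> (dehom f0) \<in> top_ideal" using f0 by (intro top_idealI)
  have "coeff (top_form \<alpha> (dehom f0)) \<alpha> = 1" using f0(3) by (simp add: coeff_top_form lead_def)
  then show "top_form \<alpha> (dehom f0) \<noteq> 0" by auto
  fix a
  obtain f where f: "f \<in> J" "mpoly_eval (\<lambda>v. a * o1 v + o2 v) f \<noteq> 0" using no_zero by blast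
  obtain m where m: "mpoly_eval (\<lambda>v. a * o1 v + o2 v) (homogeneous_component m f) \<noteq> 0"
    using component_nonzero_value[OF f(2)] by blast
  then have "poly (top_form m (dehom (homogeneous_component m f))) a \<noteq> 0"
    by (simp add: eval_line_top_form[OF homogeneous_component_in])
  moreover have "top_form m (dehom (homogeneous_component m f)) \<in> top_ideal"
    using HilbD(4)[OF J f(1)] homogeneous_component_in by (intro top_idealI)
  ultimately show "\<exists>d\<in>top_ideal. poly d a \<noteq> 0" by blast
qed

lemma alpha_pos:
  assumes "1 \<notin> J"
  shows "0 < \<alpha>"
proof (rule ccontr)
  assume "\<not> 0 < \<alpha>"
  moreover have "f0 \<noteq> 0" using f0(3) by (auto simp: dehom_simps)
  ultimately obtain c where "mpoly_scale c f0 = 1"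
    using homogeneous_part_0_const[of f0] f0(2) by auto
  with J_scale[OF f0(1), of c] assms show False by simp
qed

text \<open>Modulo \<open>l3\<close>, J contains \<open>y^N\<close>, because 1 lies in
  \<open>top_ideal\<close>, and a form \<open>x^\<alpha> + ...\<close>; these generate all forms of
  large degree. Hence multiplication by \<open>l3\<close> maps \<open>A/J\<close> in degree m onto
  its part of degree m + 1.\<close>

lemma exists_reduction:
  assumes \<alpha>: "0 < \<alpha>"
  shows "\<exists>M. \<forall>m\<ge>M. \<forall>f\<in>homogeneous_part (Suc m).
    \<exists>h. h \<in> homogeneous_part m \<and> f - lin_form l3 * h \<in> J"
proof -
  obtain N g where g: "g \<in> J" "g \<in> homogeneous_part N" "top_form N (dehom g) = 1"
    using top_ideal_1 by (auto simp: top_ideal_def)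
  define G where "G = dehom g"
  have G: "tdeg_le (int N) G" unfolding G_def by (rule tdeg_le_dehom[OF g(2)])
  have leadG: "lead N G j = (if j = 0 then 1 else 0)" for j
    using arg_cong[OF g(3), of "\<lambda>p. coeff p j"] by (simp add: coeff_top_form G_def)
  show ?thesis
  proof (intro exI[of _ "N + \<alpha>"] allI impI ballI)
    fix m :: nat and f :: "'k coord_ring" assume m: "N + \<alpha> \<le> m" and f: "f \<in> homogeneous_part (Suc m)"
    let ?m = "Suc m"
    obtain s r where sr: "dehom f = s * F + r" "degree r < \<alpha>" using monic_division[OF F(1,2) \<alpha>] .
    have tf: "tdeg_le (int ?m) (dehom f)" by (rule tdeg_le_dehom[OF f])
    have "tdeg_le (int ?m - int \<alpha>) s"
    proof (rule tdeg_le_monic_mult[OF F])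
      fix i l assume i: "\<alpha> \<le> i" and nz: "coeff (coeff (s * F) i) l \<noteq> 0"
      have "coeff r i = 0" using i sr(2) by (intro coeff_eq_0) linarith
      then have "coeff (coeff (dehom f) i) l \<noteq> 0" using nz by (simp add: sr(1))
      with tf show "int i + int l \<le> int ?m" by (rule tdeg_leD)
    qed
    then have s: "tdeg_le (int (?m - \<alpha>)) s" using m by (simp add: of_nat_diff)
    have tsF: "tdeg_le (int ?m) (s * F)"
      using tdeg_le_mult[OF s F(3)] m by (simp add: of_nat_diff)
    have "r = dehom f - s * F" by (simp add: sr(1))
    then have r: "tdeg_le (int ?m) r" using tf tsF by (simp add: tdeg_le_diff)
    define k where "k i = ?m - N - i" for i
    \<comment> \<open>The leading form of \<open>x^i y^(k i) G\<close> is
      \<open>x^i y^(m + 1 - i)\<close>, so \<open>E i\<close> cancels the i-th coefficient of the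
      leading form of r.\<close>
    define E where "E i = [:0, 1:] ^ i * ([:monom (lead ?m r i) (k i):] * G)" for i
    have k: "?m = i + (N + k i)" if "i < \<alpha>" for i using that m by (simp add: k_def)
    define e where "e i = lin_form l1 ^ i * (mpoly_scale (lead ?m r i) (lin_form l2 ^ k i * g))" for i
    have e: "e i \<in> J" "e i \<in> homogeneous_part ?m" "dehom (e i) = E i" if "i < \<alpha>" for i
    proof -
      show "e i \<in> J" unfolding e_def using g(1) by (intro JD(4) J_scale)
      show "e i \<in> homogeneous_part ?m"
        unfolding e_def using lin_power_mult_in[OF homogeneous_part_scale[OF lin_power_mult_in[OF g(2)]], of l1 i "lead ?m r i" l2 "k i"]
          k[OF that] by (simp add: ac_simps)
      have split: "[:monom (lead ?m r i) (k i):] = scal (lead ?m r i) * [:monom 1 (k i):]"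
        by (simp add: smult_monom)
      show "dehom (e i) = E i"
        unfolding e_def E_def split dehom_simps G_def dehom_coords monom_y by (simp only: mult.assoc)
    qed
    have leadE: "lead ?m (E i) j = (if i = j then lead ?m r j else 0)" if "i < \<alpha>" for i j
      unfolding E_def using lead_x_power_mult[of i "N + k i" "[:monom (lead ?m r i) (k i):] * G" j]
      by (simp only: k[OF that, symmetric] lead_monom_mult leadG) auto
    define r' where "r' = r - (\<Sum>i<\<alpha>. E i)"
    have lead_sum: "lead d (sum g A) j = (\<Sum>i\<in>A. lead d (g i) j)" for d j and g :: "nat \<Rightarrow> 'k poly poly" and A
      by (simp add: lead_def coeff_sum)
    have "lead ?m r' j = 0" for j
    proof -
      have "lead ?m r' j = lead ?m r j - (\<Sum>i<\<alpha>. if i = j then lead ?m r j else 0)"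
        unfolding r'_def lead_diff lead_sum by (simp add: leadE)
      also have "\<dots> = 0"
        using sr(2) by (auto simp: lead_def coeff_eq_0)
      finally show ?thesis .
    qed
    moreover have E_tdeg: "tdeg_le (int ?m) (E i)" if "i < \<alpha>" for i
      using tdeg_le_dehom[OF e(2)[OF that]] e(3)[OF that] by simp
    then have "tdeg_le (int ?m) r'"
      unfolding r'_def using r by (intro tdeg_le_diff tdeg_le_sum) auto
    ultimately have r': "tdeg_le (int m) r'" by (intro tdeg_le_dec[of m]) auto
    define f' where "f' = hom (?m - \<alpha>) s * f0 + (\<Sum>i<\<alpha>. e i)"
    have f'J: "f' \<in> J"
      unfolding f'_def using f0(1) e(1) by (intro JD(2) JD(4) ideal.subspace_sum[OF ideal_J]) auto
    have f'm: "f' \<in> homogeneous_part ?m"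
      unfolding f'_def
    proof (intro homogeneous_part_add homogeneous_part_sum)
      show "hom (?m - \<alpha>) s * f0 \<in> homogeneous_part ?m"
        using homogeneous_part_mult[OF hom_homogeneous f0(2), of "?m - \<alpha>" s] m by simp
    qed (use e(2) in auto)
    have df': "dehom f' = s * F + (\<Sum>i<\<alpha>. E i)"
      unfolding f'_def dehom_simps using e(3) dehom_hom[OF s] by (simp add: F_def)
    have "f - lin_form l3 * hom m r' = f'"
    proof (rule dehom_inj[OF _ f'm])
      have "lin_form l3 * hom m r' \<in> homogeneous_part ?m"
        using homogeneous_part_mult[OF lin_form_homogeneous hom_homogeneous, of l3 m r'] by simp
      then have "f + mpoly_scale (- 1) (lin_form l3 * hom m r') \<in> homogeneous_part ?m"
        by (intro homogeneous_part_add[OF f] homogeneous_part_scale)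
      then show "f - lin_form l3 * hom m r' \<in> homogeneous_part ?m" by simp
      show "dehom (f - lin_form l3 * hom m r') = dehom f'"
        unfolding df' dehom_simps dehom_coords dehom_hom[OF r'] sr(1) by (simp add: r'_def)
    qed
    then show "\<exists>h. h \<in> homogeneous_part m \<and> f - lin_form l3 * h \<in> J"
      using f'J hom_homogeneous by auto
  qed
qed

text \<open>Multiplication by \<open>l3\<close> is onto between two spaces of the same dimension n,
  hence injective.\<close>

lemma nonzerodivisor_large:
  assumes \<alpha>: "0 < \<alpha>"
  shows "\<exists>M. \<forall>m\<ge>M. \<forall>h\<in>homogeneous_part m. lin_form l3 * h \<in> J \<longrightarrow> h \<in> J"
proof -
  obtain M where M: "\<And>m f. M \<le> m \<Longrightarrow> f \<in> homogeneous_part (Suc m) \<Longrightarrow>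
    \<exists>h. h \<in> homogeneous_part m \<and> f - lin_form l3 * h \<in> J"
    using exists_reduction[OF \<alpha>] by blast
  obtain m0 where m0: "\<And>m. m0 \<le> m \<Longrightarrow> hilbert_function J m = n" using HilbD(5)[OF J] by blast
  show ?thesis
  proof (intro exI[of _ "max M m0"] allI impI ballI, rule ccontr)
    fix m :: nat and h :: "'k coord_ring"
    assume m: "max M m0 \<le> m" and h: "h \<in> homogeneous_part m" "lin_form l3 * h \<in> J" "h \<notin> J"
    let ?A = "\<lambda>m. homogeneous_part m :: 'k coord_ring set"
    note sub = subspace_ideal_part[OF ideal_J]
    obtain B where B: "B \<subseteq> J \<inter> ?A m" "kvec.independent B" "J \<inter> ?A m \<subseteq> kvec.span B" "finite B"
        "card B = kvec.dim (J \<inter> ?A m)"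
      using finite_basis_of_part[OF sub Int_lower2] .
    obtain B' where B': "B' \<subseteq> J \<inter> ?A (Suc m)" "J \<inter> ?A (Suc m) \<subseteq> kvec.span B'" "finite B'"
        "card B' = kvec.dim (J \<inter> ?A (Suc m))"
      using finite_basis_of_part[OF sub Int_lower2, of "Suc m"] by metis
    have "kvec.span B \<subseteq> J \<inter> ?A m" using B(1) by (rule kvec.span_minimal) (rule sub)
    then have "h \<notin> kvec.span B" using h(3) by blast
    then have ind: "kvec.independent (insert h B)" and hB: "h \<notin> B"
      using kvec.independent_insertI[OF _ B(2)] kvec.span_base[of h B] by blast+
    have "insert h B \<subseteq> ?A m" using B(1) h(1) by blast
    then obtain D where D: "insert h B \<subseteq> D" "D \<subseteq> ?A m" "kvec.independent D" "?A m \<subseteq> kvec.span D"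
      by (rule kvec.maximal_independent_subset_extend[OF _ ind])
    obtain C where C: "?A m \<subseteq> kvec.span C" "finite C"
      using finite_basis_of_part[OF subspace_homogeneous_part order.refl] by metis
    have finD: "finite D"
      using kvec.independent_span_bound[OF C(2) D(3)] D(2) C(1) by blast
    have cardD: "card D = kvec.dim (?A m)" using kvec.dim_unique[OF D(2,4,3) refl] by simp
    \<comment> \<open>Besides the basis B of J also h would be sent into J, so that D contributes
      one generator too few in degree m + 1.\<close>
    let ?E = "B' \<union> (*) (lin_form l3) ` (D - insert h B)"
    have l3_J: "lin_form l3 * b \<in> kvec.span ?E" if "b \<in> D" for b
    proof (cases "b \<in> insert h B")
      case True
      then have "lin_form l3 * b \<in> J" using h(2) B(1) JD(4) by blast
      moreover have "lin_form l3 * b \<in> ?A (Suc m)"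
        using homogeneous_part_mult[OF lin_form_homogeneous, of b m l3] that D(2) by auto
      ultimately show ?thesis using B'(2) kvec.span_mono[of B' ?E] by blast
    next
      case False
      with that show ?thesis by (intro kvec.span_base) blast
    qed
    have "?A (Suc m) \<subseteq> kvec.span ?E"
    proof
      fix f assume f: "f \<in> ?A (Suc m)"
      obtain g where g: "g \<in> ?A m" "f - lin_form l3 * g \<in> J" using M[OF _ f] m by auto
      have "lin_form l3 * g \<in> ?A (Suc m)"
        using homogeneous_part_mult[OF lin_form_homogeneous g(1), of l3] by simp
      then have "f - lin_form l3 * g \<in> J \<inter> ?A (Suc m)"
        using g(2) kvec.subspace_diff[OF subspace_homogeneous_part f] by blast
      then have 1: "f - lin_form l3 * g \<in> kvec.span ?E" using B'(2) kvec.span_mono[of B' ?E] by blast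
      have "g = (\<Sum>d\<in>D. mpoly_scale (kvec.representation D g d) d)"
        using kvec.sum_representation_eq[OF D(3) _ finD order.refl] g(1) D(4) by auto
      then have "lin_form l3 * g = (\<Sum>d\<in>D. mpoly_scale (kvec.representation D g d) (lin_form l3 * d))"
        by (metis (no_types, lifting) mpoly_scale_mult sum.cong sum_distrib_left)
      also have "\<dots> \<in> kvec.span ?E"
        using l3_J by (intro kvec.span_sum kvec.span_scale)
      finally have "(f - lin_form l3 * g) + lin_form l3 * g \<in> kvec.span ?E" by (rule kvec.span_add[OF 1])
      then show "f \<in> kvec.span ?E" by simp
    qed
    then have "kvec.dim (?A (Suc m)) \<le> card ?E"
      using B'(3) finD by (intro kvec.dim_le_card) auto
    also have "\<dots> \<le> card B' + card (D - insert h B)"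
      using card_Un_le[of B' "(*) (lin_form l3) ` (D - insert h B)"] card_image_le[of "D - insert h B" "(*) (lin_form l3)"] finD
      by simp
    also have "card (D - insert h B) = card D - (card B + 1)"
      using D(1) finD B(4) hB by (simp add: card_Diff_subset)
    finally have le: "kvec.dim (?A (Suc m)) \<le> kvec.dim (J \<inter> ?A (Suc m)) + (kvec.dim (?A m) - (kvec.dim (J \<inter> ?A m) + 1))"
      using cardD B(5) B'(4) by simp
    have "card B + 1 \<le> card D" using card_mono[OF finD D(1)] hB B(4) by simp
    then have "kvec.dim (J \<inter> ?A m) + 1 \<le> kvec.dim (?A m)" using cardD B(5) by simp
    moreover have "kvec.dim (J \<inter> ?A (Suc m)) \<le> kvec.dim (?A (Suc m))"
      by (rule dim_part_le[OF sub Int_lower2])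
    moreover have "kvec.dim (?A m) - kvec.dim (J \<inter> ?A m) = n"
      "kvec.dim (?A (Suc m)) - kvec.dim (J \<inter> ?A (Suc m)) = n"
      using m0[of m] m0[of "Suc m"] m by (simp_all add: hilbert_function_def)
    ultimately show False using le by linarith
  qed
qed

text \<open>Powers of the variables move h into large degrees, and saturatedness of J brings it
  back.\<close>

lemma nonzerodivisor:
  assumes \<alpha>: "0 < \<alpha>" and h: "h \<in> homogeneous_part m" "lin_form l3 * h \<in> J"
  shows "h \<in> J"
proof -
  obtain M where M: "\<And>m h. M \<le> m \<Longrightarrow> h \<in> homogeneous_part m \<Longrightarrow> lin_form l3 * h \<in> J \<Longrightarrow> h \<in> J"
    using nonzerodivisor_large[OF \<alpha>] by blast
  have "mpoly_var v ^ M * h \<in> J" for v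
  proof (rule M[of "M + m"])
    show "mpoly_var v ^ M * h \<in> homogeneous_part (M + m)"
      using homogeneous_part_mult[OF homogeneous_part_power[OF homogeneous_part_var] h(1), of v M] by simp
    show "lin_form l3 * (mpoly_var v ^ M * h) \<in> J"
      unfolding mult.left_commute[of "lin_form l3"] by (rule JD(4)[OF h(2)])
  qed simp
  then have "h \<in> saturation J" by (auto simp: saturation_def)
  then show ?thesis using HilbD(3)[OF J] by simp
qed

lemma nonzerodivisor_power:
  assumes \<alpha>: "0 < \<alpha>" and h: "h \<in> homogeneous_part m" "lin_form l3 ^ k * h \<in> J"
  shows "h \<in> J"
  using h(2)
proof (induction k)
  case (Suc k)
  have "lin_form l3 ^ k * h \<in> J"
    using Suc.prems by (intro nonzerodivisor[OF \<alpha> lin_power_mult_in[OF h(1)]]) (simp add: mult.assoc)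
  then show ?case by (rule Suc.IH)
qed simp

lemma hom_add_degree:
  "tdeg_le (int m) p \<Longrightarrow> hom (m + k) p = lin_form l3 ^ k * hom m p"
proof (induction k)
  case (Suc k)
  have "tdeg_le (int (m + k)) p" using Suc.prems by (rule tdeg_le_mono) simp
  then show ?case using hom_Suc[of "m + k" p] Suc by (simp add: mult.assoc)
qed simp

section \<open>The affine ideal of X and its adapted generators\<close>

definition affine_ideal :: "'k poly poly set" where
  "affine_ideal = {p. \<exists>m. tdeg_le (int m) p \<and> hom m p \<in> J}"

lemma hom_in_mono:
  assumes "tdeg_le (int m) p" "hom m p \<in> J" "m \<le> m'"
  shows "tdeg_le (int m') p" "hom m' p \<in> J"
proof -
  show "tdeg_le (int m') p" using assms(1,3) by (intro tdeg_le_mono[OF assms(1)]) simp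
  show "hom m' p \<in> J"
    using hom_add_degree[OF assms(1), of "m' - m"] assms(3) JD(4)[OF assms(2)] by simp
qed

lemma ideal_affine_ideal: "ideal.subspace affine_ideal"
proof (rule ideal.subspaceI)
  show "0 \<in> affine_ideal" using JD(1) by (auto simp: affine_ideal_def)
  fix p p' assume "p \<in> affine_ideal" "p' \<in> affine_ideal"
  then obtain m m' where m: "tdeg_le (int m) p" "hom m p \<in> J" "tdeg_le (int m') p'" "hom m' p' \<in> J"
    by (auto simp: affine_ideal_def)
  have "tdeg_le (int (max m m')) (p + p')" "hom (max m m') (p + p') \<in> J"
    using hom_in_mono[OF m(1,2), of "max m m'"] hom_in_mono[OF m(3,4), of "max m m'"] JD(2)
    by (auto simp: tdeg_le_add hom_add)
  then show "p + p' \<in> affine_ideal" by (auto simp: affine_ideal_def)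
next
  fix c p :: "'k poly poly" assume "p \<in> affine_ideal"
  then obtain m where m: "tdeg_le (int m) p" "hom m p \<in> J" by (auto simp: affine_ideal_def)
  obtain d where d: "tdeg_le (int d) c" using ex_tdeg_le by blast
  have "tdeg_le (int (d + m)) (c * p)" using tdeg_le_mult[OF d m(1)] by simp
  moreover have "hom (d + m) (c * p) \<in> J" unfolding hom_mult[OF d m(1)] using m(2) by (rule JD(4))
  ultimately show "c * p \<in> affine_ideal" unfolding affine_ideal_def by blast
qed

text \<open>If a homogenization of larger degree lies in J, the surplus power of \<open>l3\<close>
  may be cancelled.\<close>

lemma hom_affine_ideal:
  assumes \<alpha>: "0 < \<alpha>" and p: "p \<in> affine_ideal" "tdeg_le (int m) p"
  shows "hom m p \<in> J"
proof -
  obtain m' where m': "tdeg_le (int m') p" "hom m' p \<in> J" using p(1) by (auto simp: affine_ideal_def)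
  show ?thesis
  proof (cases "m' \<le> m")
    case True
    with m' show ?thesis by (rule hom_in_mono(2))
  next
    case False
    then have "lin_form l3 ^ (m' - m) * hom m p \<in> J"
      using hom_add_degree[OF p(2), of "m' - m"] m'(2) by simp
    then show ?thesis by (rule nonzerodivisor_power[OF \<alpha> hom_homogeneous])
  qed
qed

lemma hom_ideal_affine_ideal:
  assumes \<alpha>: "0 < \<alpha>"
  shows "hom_ideal affine_ideal = J"
proof -
  have eq: "dehom f \<in> affine_ideal \<longleftrightarrow> f \<in> J" if "f \<in> homogeneous_part m" for f m
    using hom_affine_ideal[OF \<alpha>, of "dehom f" m] tdeg_le_dehom[OF that] hom_dehom[OF that]
    by (auto simp: affine_ideal_def)
  show ?thesis
  proof (intro equalityI subsetI)
    fix f assume "f \<in> J"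
    then show "f \<in> hom_ideal affine_ideal"
      using eq[OF homogeneous_component_in] HilbD(4)[OF J] by (auto simp: hom_ideal_def)
  next
    fix f assume "f \<in> hom_ideal affine_ideal"
    then have "homogeneous_component d f \<in> J" for d
      using eq[OF homogeneous_component_in] by (auto simp: hom_ideal_def)
    moreover obtain N where "f = (\<Sum>d\<le>N. homogeneous_component d f)" by (rule homogeneous_component_sum)
    ultimately show "f \<in> J"
      using ideal.subspace_sum[OF ideal_J, of "{..N}" "\<lambda>d. homogeneous_component d f"] by simp
  qed
qed

lemma exists_adapted:
  assumes \<alpha>: "0 < \<alpha>" and min: "\<And>m f. m < \<alpha> \<Longrightarrow> f \<in> J \<Longrightarrow> f \<in> homogeneous_part m \<Longrightarrow> f = 0"
  obtains e q T \<delta> where "adapted \<alpha> e F q" "companion \<alpha> F q T \<delta>" "fits \<alpha> e T \<delta>"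
    "J = hom_ideal (gen_ideal \<alpha> F q)"
proof -
  have FJ: "F \<in> affine_ideal"
    unfolding affine_ideal_def F_def using tdeg_le_dehom[OF f0(2)] hom_dehom[OF f0(2)] f0(1) by auto
  have small: "p = 0" if "p \<in> affine_ideal" "tdeg_le (int \<alpha> - 1) p" for p
  proof -
    have td: "tdeg_le (int (\<alpha> - 1)) p" using that(2) \<alpha> by (simp add: of_nat_diff)
    have "hom (\<alpha> - 1) p = 0"
      using \<alpha> hom_affine_ideal[OF \<alpha> that(1) td] by (intro min[of "\<alpha> - 1"] hom_homogeneous) simp_all
    then show ?thesis using hom_eq_0[OF td] by blast
  qed
  have large: "\<exists>m. \<exists>p\<in>affine_ideal. lead_at m j p" if "j < \<alpha>" for j
  proof -
    obtain M where M: "\<And>m f. M \<le> m \<Longrightarrow> f \<in> homogeneous_part (Suc m) \<Longrightarrow>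
      \<exists>h. h \<in> homogeneous_part m \<and> f - lin_form l3 * h \<in> J"
      using exists_reduction[OF \<alpha>] by blast
    define m where "m = M + \<alpha>"
    define x where "x = ([:0, 1:] :: 'k poly poly) ^ j * ([:monom 1 (Suc m - j):] * 1)"
    have jm: "Suc m = j + (0 + (Suc m - j))" using that by (simp add: m_def)
    have "tdeg_le (int j) (([:0, 1:] :: 'k poly poly) ^ j)"
      using tdeg_le_xy[of j 0 "int j"] by (simp add: xy_def)
    moreover have "tdeg_le (int (0 + (Suc m - j))) ([:monom 1 (Suc m - j):] * (1 :: 'k poly poly))"
      using tdeg_le_monom_mult[of 0 "1 :: 'k poly poly"] tdeg_le_1 by simp
    ultimately have x: "tdeg_le (int (Suc m)) x"
      unfolding x_def using tdeg_le_mult[of "int j"] jm by (metis of_nat_add)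
    have lx: "lead (Suc m) x i = (if i = j then 1 else 0)" for i
      unfolding x_def using lead_x_power_mult[of j "0 + (Suc m - j)" "[:monom 1 (Suc m - j):] * (1 :: 'k poly poly)" i]
      by (simp only: jm[symmetric] lead_monom_mult) (auto simp: lead_def)
    \<comment> \<open>Modulo J the monomial of degree m + 1 is a multiple of \<open>l3\<close>,
      which has smaller degree in affine coordinates. The difference is an element of the ideal with
      exactly this monomial as leading form.\<close>
    obtain h where h: "h \<in> homogeneous_part m" "hom (Suc m) x - lin_form l3 * h \<in> J"
      using M[OF _ hom_homogeneous, of m x] by (auto simp: m_def)
    define p where "p = x - dehom h"
    have th: "tdeg_le (int m) (dehom h)" by (rule tdeg_le_dehom[OF h(1)])
    then have tp: "tdeg_le (int (Suc m)) p"
      unfolding p_def using x tdeg_le_mono[OF th] by (intro tdeg_le_diff) auto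
    have "hom (Suc m) p + hom (Suc m) (dehom h) = hom (Suc m) x"
      unfolding hom_add[symmetric] by (simp add: p_def)
    then have "hom (Suc m) p = hom (Suc m) x - lin_form l3 * h"
      using hom_Suc[OF th] hom_dehom[OF h(1)] by (simp add: eq_diff_eq)
    then have "p \<in> affine_ideal" unfolding affine_ideal_def using tp h(2) by (intro CollectI exI[of _ "Suc m"]) simp
    moreover have "lead (Suc m) p i = (if i = j then 1 else 0)" for i
      unfolding p_def lead_diff lx using lead_eq_0[OF th] by simp
    ultimately show ?thesis
      unfolding lead_at_def using tp by (intro exI[of _ "Suc m"] bexI[of _ p]) simp_all
  qed
  obtain e q T \<delta> where "adapted \<alpha> e F q" "companion \<alpha> F q T \<delta>" "fits \<alpha> e T \<delta>"
      "affine_ideal = gen_ideal \<alpha> F q"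
    using adapted_basis[OF ideal_affine_ideal \<alpha> FJ F small large] .
  moreover from this have "J = hom_ideal (gen_ideal \<alpha> F q)" using hom_ideal_affine_ideal[OF \<alpha>] by simp
  ultimately show ?thesis by (intro that)
qed

end

section \<open>Closures of strata\<close>

text \<open>If the difference is nonzero at m, it is at least 1 in all degrees up to m, so \<phi> m
  is at least m + 1, while \<phi> never exceeds n. Thus \<phi> is constant from degree n on, the
  degree in which the Grassmannian is taken.\<close>

lemma castelnuovo_eventually:
  assumes nonneg: "\<And>m. 0 \<le> castelnuovo \<phi> m"
    and zero: "\<And>m. castelnuovo \<phi> m = 0 \<Longrightarrow> castelnuovo \<phi> (Suc m) = 0"
    and ev: "\<exists>m0. \<forall>m\<ge>m0. \<phi> m = n"
  shows "castelnuovo \<phi> m \<noteq> 0 \<Longrightarrow> m < n" and "\<phi> n = n"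
proof -
  have step: "int (\<phi> (Suc m)) = int (\<phi> m) + castelnuovo \<phi> (Suc m)" for m by (simp add: castelnuovo_def)
  have "\<phi> m \<le> \<phi> (Suc m)" for m using step[of m] nonneg[of "Suc m"] by linarith
  then have mono: "\<phi> m \<le> \<phi> m'" if "m \<le> m'" for m m' using that by (rule lift_Suc_mono_le)
  obtain m0 where m0: "\<And>m. m0 \<le> m \<Longrightarrow> \<phi> m = n" using ev by blast
  have le: "\<phi> m \<le> n" for m using mono[of m "max m m0"] m0[of "max m m0"] by simp
  have grow: "m + 1 \<le> \<phi> m" if "castelnuovo \<phi> m \<noteq> 0" for m
    using that
  proof (induction m)
    case 0
    then show ?case using nonneg[of 0] by (simp add: castelnuovo_def)
  next
    case (Suc m)
    then have "m + 1 \<le> \<phi> m" using zero by blast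
    then show ?case using step[of m] Suc.prems nonneg[of "Suc m"] by linarith
  qed
  show less: "m < n" if "castelnuovo \<phi> m \<noteq> 0" for m using grow[OF that] le[of m] by simp
  have "\<phi> (n + k) = \<phi> n" for k
  proof (induction k)
    case (Suc k)
    have "castelnuovo \<phi> (Suc (n + k)) = 0" using less[of "Suc (n + k)"] by auto
    with step[of "n + k"] Suc show ?case by simp
  qed simp
  from this[of m0] show "\<phi> n = n" using m0[of "n + m0"] by simp
qed

section \<open>Points and closures in terms of adapted generators\<close>

definition adapted_ideal :: "nat \<Rightarrow> (nat \<Rightarrow> nat) \<Rightarrow> 'k :: field poly poly set \<Rightarrow> bool" where
  "adapted_ideal \<alpha> e \<aa> \<longleftrightarrow>
    (\<exists>f q T \<delta>. adapted \<alpha> e f q \<and> companion \<alpha> f q T \<delta> \<and> \<aa> = gen_ideal \<alpha> f q)"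

definition below :: "nat \<Rightarrow> (nat \<Rightarrow> nat) \<Rightarrow> nat \<Rightarrow> nat" where
  "below \<alpha> e m = card {i. i < \<alpha> \<and> e i \<le> m}"

lemma below_Suc: "below \<alpha> e (Suc m) = below \<alpha> e m + card {i. i < \<alpha> \<and> e i = Suc m}"
proof -
  have "{i. i < \<alpha> \<and> e i \<le> Suc m} = {i. i < \<alpha> \<and> e i \<le> m} \<union> {i. i < \<alpha> \<and> e i = Suc m}" by auto
  moreover have "{i. i < \<alpha> \<and> e i \<le> m} \<inter> {i. i < \<alpha> \<and> e i = Suc m} = {}" by auto
  ultimately show ?thesis unfolding below_def by (simp add: card_Un_disjoint)
qed

lemma below_le: "below \<alpha> e m \<le> \<alpha>"
  using card_mono[of "{..<\<alpha>}" "{i. i < \<alpha> \<and> e i \<le> m}"] by (auto simp: below_def)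

lemma below_mono: "below \<alpha> e m \<le> below \<alpha> e (Suc m)"
  by (simp add: below_Suc)

context frame begin

lemma adapted_ideal_castelnuovo:
  assumes "adapted_ideal \<alpha> e \<aa>" "0 < \<alpha>"
  shows "castelnuovo (hilbert_function (hom_ideal \<aa>)) m
    = int (m + 1) - (if \<alpha> \<le> m then int (m - \<alpha> + 1) else 0) - int (below \<alpha> e m)"
  using assms castelnuovo_gen_ideal by (auto simp: adapted_ideal_def below_def)

text \<open>The Castelnuovo function is m + 1 below \<alpha> and \<alpha> -
  \<open>below \<alpha> e m\<close> from there on. So it is nonnegative and remains 0 once it is 0,
  as \<open>castelnuovo_eventually\<close> requires.\<close>

lemma adapted_ideal_point:
  assumes \<aa>: "adapted_ideal \<alpha> e \<aa>" and \<alpha>: "0 < \<alpha>"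
    and ev: "\<exists>m0. \<forall>m\<ge>m0. hilbert_function (hom_ideal \<aa>) m = n"
  shows "hom_ideal \<aa> \<in> Hilb n" "hom_ideal \<aa> \<inter> homogeneous_part n \<in> grassmannian n n"
    "hom_ideal \<aa> \<in> topspace (Hilb_topology n)"
    "castelnuovo (hilbert_function (hom_ideal \<aa>)) m \<noteq> 0 \<Longrightarrow> m < n"
proof -
  obtain f q T \<delta> where gen: "adapted \<alpha> e f q" "companion \<alpha> f q T \<delta>" "\<aa> = gen_ideal \<alpha> f q"
    using \<aa> by (auto simp: adapted_ideal_def)
  have id: "ideal.subspace \<aa>" using ideal_gen_ideal[OF gen(2)] gen(3) by simp
  show H: "hom_ideal \<aa> \<in> Hilb n"
    using homogeneous_hom_ideal[OF id] saturation_hom_ideal[OF id] ev by (simp add: Hilb_def)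
  note cas = adapted_ideal_castelnuovo[OF \<aa> \<alpha>]
  have 0: "below \<alpha> e m = 0" if "m < \<alpha>" for m
    using adaptedD(4)[OF gen(1)] that by (force simp: below_def)
  have nonneg: "0 \<le> castelnuovo (hilbert_function (hom_ideal \<aa>)) m" for m
    using 0[of m] below_le[of \<alpha> e m] unfolding cas by (cases "\<alpha> \<le> m") auto
  have zero: "castelnuovo (hilbert_function (hom_ideal \<aa>)) (Suc m) = 0"
    if "castelnuovo (hilbert_function (hom_ideal \<aa>)) m = 0" for m
    using that nonneg[of "Suc m"] 0[of m] below_mono[of \<alpha> e m] unfolding cas
    by (cases "\<alpha> \<le> m") auto
  show "castelnuovo (hilbert_function (hom_ideal \<aa>)) m \<noteq> 0 \<Longrightarrow> m < n"
    by (rule castelnuovo_eventually(1)[OF nonneg zero ev])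
  have n: "hilbert_function (hom_ideal \<aa>) n = n"
    by (rule castelnuovo_eventually(2)[OF nonneg zero ev])
  have sub: "kvec.subspace (hom_ideal \<aa> \<inter> homogeneous_part n)"
    by (rule subspace_ideal_part[OF ideal_hom_ideal[OF id]])
  then have "kvec.dim (hom_ideal \<aa> \<inter> homogeneous_part n) \<le> kvec.dim (homogeneous_part n :: 'k coord_ring set)"
    by (intro dim_part_le) auto
  with n sub show G: "hom_ideal \<aa> \<inter> homogeneous_part n \<in> grassmannian n n"
    by (simp add: grassmannian_def hilbert_function_def)
  show "hom_ideal \<aa> \<in> topspace (Hilb_topology n)"
    unfolding Hilb_topology_def topspace_pullback_topology using H grassmannian_topspace[OF G] by simp
qed

lemma poly_curve_hom:
  assumes "poly_family G"
  shows "poly_curve (\<lambda>\<tau>. hom m (G \<tau>))"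
  unfolding poly_curve_def
proof (intro allI impI)
  fix l :: "'k coord_ring \<Rightarrow> 'k" assume l: "linear_fun l"
  let ?w = "\<lambda>(i, j). lin_form l1 ^ i * lin_form l2 ^ j * lin_form l3 ^ (m - i - j)"
  have "l (hom m (G \<tau>)) = (\<Sum>x\<in>triangle m. (case x of (i, j) \<Rightarrow> coeff (coeff (G \<tau>) i) j) * l (?w x))" for \<tau>
    using linear_fun_sum[OF l, of "\<lambda>(i, j). coeff (coeff (G \<tau>) i) j" ?w "triangle m"]
    by (simp add: hom_def case_prod_unfold)
  moreover have "poly_fun (\<lambda>\<tau>. \<Sum>x\<in>triangle m. (case x of (i, j) \<Rightarrow> coeff (coeff (G \<tau>) i) j) * l (?w x))"
    by (intro poly_fun_sum poly_fun_mult poly_fun_const) (auto intro: poly_fun_coeff[OF assms] simp: case_prod_unfold)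
  ultimately show "poly_fun (\<lambda>\<tau>. l (hom m (G \<tau>)))" by simp
qed

text \<open>The degrees e' of the family may differ from e: the lemma serves both for perturbations
  of T, where they agree, and for the passage to \<psi>.\<close>

lemma closure_step:
  fixes \<aa> :: "'k poly poly set"
  assumes inf: "infinite (UNIV :: 'k set)" and \<alpha>: "0 < \<alpha>"
    and \<aa>: "adapted_ideal \<alpha> e \<aa>" "\<exists>m0. \<forall>m\<ge>m0. hilbert_function (hom_ideal \<aa>) m = n"
    and \<bb>: "\<forall>\<^sub>F \<tau> in cofinite. adapted_ideal \<alpha> e' (\<bb> \<tau>) \<and>
      (\<exists>m0. \<forall>m\<ge>m0. hilbert_function (hom_ideal (\<bb> \<tau>)) m = n) \<and>
      hom_ideal (\<bb> \<tau>) \<in> Hilb_topology n closure_of S"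
    and def: "deforms n \<aa> \<bb>"
  shows "hom_ideal \<aa> \<in> Hilb_topology n closure_of S"
proof (rule in_closure_of_family[OF inf adapted_ideal_point(1,2)[OF \<aa>(1) \<alpha> \<aa>(2)]])
  show "\<forall>\<^sub>F \<tau> in cofinite. hom_ideal (\<bb> \<tau>) \<in> Hilb n \<and>
      hom_ideal (\<bb> \<tau>) \<inter> homogeneous_part n \<in> grassmannian n n \<and>
      hom_ideal (\<bb> \<tau>) \<in> Hilb_topology n closure_of S"
    using \<bb> by (rule eventually_mono) (use adapted_ideal_point(1,2)[OF _ \<alpha>] in blast)
  have id: "ideal.subspace \<aa>" "\<forall>\<^sub>F \<tau> in cofinite. ideal.subspace (\<bb> \<tau>)"
    using \<aa>(1) \<bb> by (auto simp: adapted_ideal_def intro: ideal_gen_ideal elim!: eventually_mono)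
  fix f assume "f \<in> hom_ideal \<aa> \<inter> homogeneous_part n"
  then obtain p where p: "p \<in> \<aa>" "tdeg_le (int n) p" "f = hom n p"
    unfolding hom_ideal_part[OF id(1)] by auto
  then obtain G where G: "poly_family G" "G 0 = p" "\<forall>\<^sub>F \<tau> in cofinite. G \<tau> \<in> \<bb> \<tau> \<and> tdeg_le (int n) (G \<tau>)"
    using def unfolding deforms_def by blast
  have "\<forall>\<^sub>F \<tau> in cofinite. hom n (G \<tau>) \<in> hom_ideal (\<bb> \<tau>) \<inter> homogeneous_part n"
    using G(3) id(2)
  proof eventually_elim
    case (elim \<tau>)
    then show ?case unfolding hom_ideal_part[OF elim(2)] by blast
  qed
  with poly_curve_hom[OF G(1)] show "\<exists>F. poly_curve F \<and> F 0 = f \<and>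
      (\<forall>\<^sub>F \<tau> in cofinite. F \<tau> \<in> hom_ideal (\<bb> \<tau>) \<inter> homogeneous_part n)"
    using G(2) p(3) by (intro exI[of _ "\<lambda>\<tau>. hom n (G \<tau>)"]) simp
qed

end

lemma below_move:
  assumes "p < \<alpha>" "r < \<alpha>" "e p = u" "e r = u + 3"
  shows "int (below \<alpha> (e(p := u + 1, r := u + 2)) m)
    = int (below \<alpha> e m) - (if m = u then 1 else 0) + (if m = u + 2 then 1 else 0)"
proof -
  have pr: "p \<noteq> r" using assms by auto
  have b: "int (below \<alpha> e m) = (\<Sum>i<\<alpha>. if e i \<le> m then 1 else 0)" for e
    unfolding below_def by (simp add: sum.If_cases Int_def)
  have split: "(\<Sum>i<\<alpha>. g i) = (\<Sum>i\<in>{..<\<alpha>} - {p, r}. g i) + (g p + g r)" for g :: "nat \<Rightarrow> int"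
    using sum.subset_diff[of "{p, r}" "{..<\<alpha>}" g] assms(1,2) pr by simp
  have "(\<Sum>i\<in>{..<\<alpha>} - {p, r}. if (e(p := u + 1, r := u + 2)) i \<le> m then 1 else 0)
      = (\<Sum>i\<in>{..<\<alpha>} - {p, r}. if e i \<le> m then 1 else (0 :: int))"
    by (rule sum.cong) auto
  then show ?thesis unfolding b split using assms(3,4) pr by auto
qed

text \<open>For almost all \<tau> the matrix \<open>P = B + \<tau>\<close> is invertible, and the
  kernel condition becomes an eigenvalue problem for \<open>adj P * A\<close>, solvable over an
  algebraically closed field. An eigenvalue x gives \<open>a = - x / det P\<close>. For \<tau> = 0
  the determinant of \<open>A + a B\<close> could be a nonzero constant in a.\<close>

lemma exists_pencil_kernel:
  fixes A B :: "nat \<Rightarrow> nat \<Rightarrow> 'k :: {alg_closed_field, field_char_0}"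
  assumes E: "finite E" "E \<noteq> {}"
  shows "\<forall>\<^sub>F \<tau> in cofinite. \<exists>a v. (\<exists>i\<in>E. v i \<noteq> 0) \<and>
    (\<forall>i\<in>E. (\<Sum>j\<in>E. (A i j + a * (B i j + (if i = j then \<tau> else 0))) * v j) = 0)"
proof -
  define c where "c = card E"
  have c: "0 < c" using E by (simp add: c_def card_gt_0_iff)
  obtain h where h: "bij_betw h {0..<c} E" using ex_bij_betw_nat_finite[OF E(1)] by (auto simp: c_def)
  have hE: "h i \<in> E" if "i < c" for i using h that by (auto simp: bij_betw_def)
  have h_inj: "h i = h j \<longleftrightarrow> i = j" if "i < c" "j < c" for i j
    using h that by (auto simp: bij_betw_def inj_on_def)
  define M where "M = mat c c (\<lambda>(i, j). A (h i) (h j))"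
  define N where "N = mat c c (\<lambda>(i, j). B (h i) (h j))"
  have M: "M \<in> carrier_mat c c" and N: "N \<in> carrier_mat c c" by (simp_all add: M_def N_def)
  have "char_poly N \<noteq> 0" using degree_monic_char_poly[OF N] by auto
  then have "finite {x. poly (char_poly N) x = 0}" by (rule poly_roots_finite)
  then have "finite (uminus -` {x. poly (char_poly N) x = 0})" by (rule finite_vimageI) (simp add: inj_def)
  then have "\<forall>\<^sub>F \<tau> in cofinite. poly (char_poly N) (- \<tau>) \<noteq> 0"
    by (simp add: eventually_cofinite vimage_def)
  then show ?thesis
  proof (rule eventually_mono)
    fix \<tau> assume \<tau>: "poly (char_poly N) (- \<tau>) \<noteq> 0"
    define P where "P = N + \<tau> \<cdot>\<^sub>m 1\<^sub>m c"
    have P: "P \<in> carrier_mat c c" using N by (simp add: P_def)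
    have "char_matrix N (- \<tau>) = P" using N by (simp add: char_matrix_def P_def)
    then have det: "det P \<noteq> 0"
      using \<tau> eigenvalue_root_char_poly[OF N, of "- \<tau>"] eigenvalue_det[OF N, of "- \<tau>"] by simp
    define C where "C = adj_mat P * M"
    have adj: "adj_mat P \<in> carrier_mat c c" by (rule adj_mat(1)[OF P])
    have C: "C \<in> carrier_mat c c" using adj M by (simp add: C_def)
    have "degree (char_poly C) > 0" using degree_monic_char_poly[OF C] c by simp
    then obtain x where "poly (char_poly C) x = 0" using alg_closed_imp_poly_has_root by blast
    then obtain w where "eigenvector C w x"
      using eigenvalue_root_char_poly[OF C] by (auto simp: eigenvalue_def)
    then have w: "w \<in> carrier_vec c" "w \<noteq> 0\<^sub>v c" "C *\<^sub>v w = x \<cdot>\<^sub>v w"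
      using C by (auto simp: eigenvector_def)
    have "P *\<^sub>v (C *\<^sub>v w) = det P \<cdot>\<^sub>v (M *\<^sub>v w)"
    proof -
      have "P *\<^sub>v (C *\<^sub>v w) = P *\<^sub>v (adj_mat P *\<^sub>v (M *\<^sub>v w))"
        using assoc_mult_mat_vec[OF adj M w(1)] by (simp add: C_def)
      also have "\<dots> = (P * adj_mat P) *\<^sub>v (M *\<^sub>v w)"
        using assoc_mult_mat_vec[OF P adj, of "M *\<^sub>v w"] M w(1) by simp
      also have "\<dots> = (det P \<cdot>\<^sub>m 1\<^sub>m c) *\<^sub>v (M *\<^sub>v w)" using adj_mat(2)[OF P] by simp
      also have "\<dots> = det P \<cdot>\<^sub>v (1\<^sub>m c *\<^sub>v (M *\<^sub>v w))" using M w(1) by auto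
      also have "\<dots> = det P \<cdot>\<^sub>v (M *\<^sub>v w)" using M w(1) by simp
      finally show ?thesis .
    qed
    then have eq: "det P \<cdot>\<^sub>v (M *\<^sub>v w) = P *\<^sub>v (x \<cdot>\<^sub>v w)" by (simp add: w(3))
    define g where "g = the_inv_into {0..<c} h"
    have g: "g (h i) = i" if "i < c" for i
      unfolding g_def using h that by (intro the_inv_into_f_f) (auto simp: bij_betw_def)
    define v where "v j = w $ (g j)" for j
    define a where "a = - (x / det P)"
    have sumE: "(\<Sum>j\<in>E. F j) = (\<Sum>j=0..<c. F (h j))" for F :: "nat \<Rightarrow> 'k"
      using sum.reindex_bij_betw[OF h, of F] by simp
    obtain k where k: "k < c" "w $ k \<noteq> 0" using w(1,2) by (metis carrier_vecD eq_vecI index_zero_vec)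
    have "\<exists>i\<in>E. v i \<noteq> 0" using k hE g by (intro bexI[of _ "h k"]) (auto simp: v_def)
    moreover have "(\<Sum>j\<in>E. (A i j + a * (B i j + (if i = j then \<tau> else 0))) * v j) = 0" if i: "i \<in> E" for i
    proof -
      obtain l where l: "l < c" "i = h l" using i h by (auto simp: bij_betw_def)
      have "det P * (\<Sum>j=0..<c. A (h l) (h j) * w $ j) = (\<Sum>j=0..<c. (B (h l) (h j) + (if j = l then \<tau> else 0)) * (x * w $ j))"
        using arg_cong[OF eq, of "\<lambda>u. u $ l"] l(1) M P w(1) N
        by (simp add: scalar_prod_def M_def P_def N_def if_distrib[of "\<lambda>x. _ * x"] cong: if_cong)
      also have "\<dots> = x * (\<Sum>j=0..<c. (B (h l) (h j) + (if j = l then \<tau> else 0)) * w $ j)"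
        unfolding sum_distrib_left by (rule sum.cong) (simp_all add: algebra_simps)
      finally have 1: "(\<Sum>j=0..<c. A (h l) (h j) * w $ j) = x / det P * (\<Sum>j=0..<c. (B (h l) (h j) + (if j = l then \<tau> else 0)) * w $ j)"
        using det by (simp add: field_simps)
      have "(\<Sum>j\<in>E. (A i j + a * (B i j + (if i = j then \<tau> else 0))) * v j)
          = (\<Sum>j=0..<c. (A (h l) (h j) + a * (B (h l) (h j) + (if j = l then \<tau> else 0))) * w $ j)"
        unfolding sumE l(2) by (rule sum.cong) (auto simp: v_def g h_inj l(1))
      also have "\<dots> = (\<Sum>j=0..<c. A (h l) (h j) * w $ j)
          + a * (\<Sum>j=0..<c. (B (h l) (h j) + (if j = l then \<tau> else 0)) * w $ j)"
        unfolding sum_distrib_left sum.distrib[symmetric] by (rule sum.cong) (simp_all add: algebra_simps)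
      also have "\<dots> = 0" unfolding 1 by (simp add: a_def)
      finally show ?thesis .
    qed
    ultimately show "\<exists>a v. (\<exists>i\<in>E. v i \<noteq> 0) \<and>
      (\<forall>i\<in>E. (\<Sum>j\<in>E. (A i j + a * (B i j + (if i = j then \<tau> else 0))) * v j) = 0)" by blast
  qed
qed

section \<open>Change of generators within one degree\<close>

lemma tdeg_le_const_diff:
  fixes b b' :: "'k :: field poly"
  assumes "tdeg_le d [:b:]" "c \<noteq> 0 \<Longrightarrow> tdeg_le d [:b':]"
  shows "tdeg_le d [:b - Polynomial.smult c b':]"
  unfolding tdeg_le_const
proof (intro allI impI)
  fix j assume "coeff (b - Polynomial.smult c b') j \<noteq> 0"
  then have "coeff b j \<noteq> 0 \<or> c \<noteq> 0 \<and> coeff b' j \<noteq> 0" by auto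
  then show "int j \<le> d" using assms by (auto simp: tdeg_le_const)
qed

lemma tdeg_le_const_sum:
  fixes b :: "nat \<Rightarrow> 'k :: field poly"
  assumes "\<And>i. i \<in> A \<Longrightarrow> c i \<noteq> 0 \<Longrightarrow> tdeg_le d [:b i:]"
  shows "tdeg_le d [:\<Sum>i\<in>A. Polynomial.smult (c i) (b i):]"
  unfolding tdeg_le_const
proof (intro allI impI)
  fix j assume "coeff (\<Sum>i\<in>A. Polynomial.smult (c i) (b i)) j \<noteq> 0"
  then obtain i where "i \<in> A" "c i \<noteq> 0" "coeff (b i) j \<noteq> 0"
    by (auto simp: coeff_sum elim: sum.not_neutral_contains_not_neutral)
  then show "int j \<le> d" using assms[of i] by (simp add: tdeg_le_const)
qed

lemma gen_ideal_subset:
  assumes "\<And>i. i < \<alpha> \<Longrightarrow> q' i \<in> gen_ideal \<alpha> f q"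
  shows "gen_ideal \<alpha> f q' \<subseteq> gen_ideal \<alpha> f q"
proof
  fix x assume "x \<in> gen_ideal \<alpha> f q'"
  then obtain a b where x: "x = a * f + (\<Sum>i<\<alpha>. [:b i:] * q' i)" by (auto simp: gen_ideal_def)
  show "x \<in> gen_ideal \<alpha> f q"
    unfolding x by (rule gen_ideal_add[OF gen_ideal_f gen_ideal_sum], rule gen_ideal_const_mult, rule assms) simp
qed

lemma adapted_cong:
  assumes "adapted \<alpha> e f q" "\<And>i. i < \<alpha> \<Longrightarrow> q' i = q i"
  shows "adapted \<alpha> e f q'"
proof -
  have "lead_independent \<alpha> e q' \<longleftrightarrow> lead_independent \<alpha> e q"
    by (rule lead_independent_cong) (simp add: assms(2))
  with assms show ?thesis by (simp add: adapted_def)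
qed

text \<open>Because \<open>w p = 0\<close>, one has \<open>q' p = q p\<close> and
  \<open>q l = q' l + w l q' p\<close>. The matrix S accounts for the new left-hand sides, and the
  second substitution adds the other columns to column p. Only generators of the degree of
  \<open>q p\<close> are altered, so all degree bounds persist.\<close>

lemma base_change:
  fixes q :: "nat \<Rightarrow> 'k :: field poly poly"
  assumes ad: "adapted \<alpha> e f q" and com: "companion \<alpha> f q T \<delta>" and fits: "fits \<alpha> e T \<delta>"
    and p: "p < \<alpha>" "w p = 0" and w: "\<And>i. w i \<noteq> 0 \<Longrightarrow> i < \<alpha> \<and> e i = e p"
  defines "q' \<equiv> \<lambda>i. q i - scal (w i) * q p"
    and "S \<equiv> \<lambda>i j. T i j - Polynomial.smult (w i) (T p j)"
    and "\<delta>' \<equiv> \<lambda>i. \<delta> i - Polynomial.smult (w i) (\<delta> p)"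
  defines "T' \<equiv> \<lambda>i j. S i j + (if j = p then \<Sum>l<\<alpha>. Polynomial.smult (w l) (S i l) else 0)"
  shows "adapted \<alpha> e f q'" "companion \<alpha> f q' T' \<delta>'" "fits \<alpha> e T' \<delta>'"
    "gen_ideal \<alpha> f q' = gen_ideal \<alpha> f q"
proof -
  note adD = adaptedD[OF ad]
  have q': "q i = q' i + scal (w i) * q' p" for i by (simp add: q'_def p(2))
  have deg: "degree (q' i) < \<alpha>" if "i < \<alpha>" for i
  proof -
    have "degree (scal (w i) * q p) < \<alpha>"
      using adD(5)[OF p(1)] degree_mult_le[of "scal (w i)" "q p"] by simp
    with adD(5)[OF that] show ?thesis unfolding q'_def by (rule degree_diff_less)
  qed
  have td: "tdeg_le (int (e i)) (q' i)" if "i < \<alpha>" for i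
  proof (cases "w i = 0")
    case True
    with adD(6)[OF that] show ?thesis by (simp add: q'_def)
  next
    case False
    then have "tdeg_le (int (e i)) (scal (w i) * q p)"
      using tdeg_le_mult[OF tdeg_le_scalar[of 0 "w i"] adD(6)[OF p(1)]] w by simp
    with adD(6)[OF that] show ?thesis unfolding q'_def by (rule tdeg_le_diff)
  qed
  have lead: "lead (e i) (q' i) j = lead (e i) (q i) j - w i * lead (e p) (q p) j" for i j
    unfolding q'_def lead_diff lead_scalar using w[of i] by (cases "w i = 0") auto
  have "lead_independent \<alpha> e q'"
    unfolding lead_independent_def
  proof (intro allI impI)
    fix \<beta> i assume 0: "\<forall>j<\<alpha>. (\<Sum>i<\<alpha>. \<beta> i * lead (e i) (q' i) j) = 0" and i: "i < \<alpha>"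
    define \<gamma> where "\<gamma> i = \<beta> i - (if i = p then \<Sum>l<\<alpha>. \<beta> l * w l else 0)" for i
    have "(\<Sum>i<\<alpha>. \<gamma> i * lead (e i) (q i) j) = 0" if "j < \<alpha>" for j
    proof -
      have "(\<Sum>i<\<alpha>. \<gamma> i * lead (e i) (q i) j) = (\<Sum>i<\<alpha>. \<beta> i * lead (e i) (q i) j)
          - (\<Sum>i<\<alpha>. if i = p then (\<Sum>l<\<alpha>. \<beta> l * w l) * lead (e i) (q i) j else 0)"
        unfolding sum_subtractf[symmetric] by (rule sum.cong) (auto simp: \<gamma>_def left_diff_distrib)
      also have "\<dots> = (\<Sum>i<\<alpha>. \<beta> i * lead (e i) (q i) j) - (\<Sum>l<\<alpha>. \<beta> l * w l) * lead (e p) (q p) j"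
        using p(1) by simp
      also have "\<dots> = (\<Sum>i<\<alpha>. \<beta> i * lead (e i) (q' i) j)"
        unfolding lead sum_distrib_right sum_subtractf[symmetric] by (rule sum.cong) (simp_all add: algebra_simps)
      finally show ?thesis using 0 that by simp
    qed
    then have \<gamma>: "\<gamma> i = 0" if "i < \<alpha>" for i using adD(7)[of \<gamma>] that by blast
    have other: "\<beta> i = 0" if "i < \<alpha>" "i \<noteq> p" for i using \<gamma>[OF that(1)] that(2) by (simp add: \<gamma>_def)
    have "(\<Sum>l<\<alpha>. \<beta> l * w l) = 0"
      using other p(2) by (intro sum.neutral) (metis lessThan_iff mult_eq_0_iff)
    then have "\<beta> p = 0" using \<gamma>[OF p(1)] by (simp add: \<gamma>_def)
    with other i show "\<beta> i = 0" by blast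
  qed
  then show ad': "adapted \<alpha> e f q'"
    using adD deg td by (auto simp: adapted_def)
  show "companion \<alpha> f q' T' \<delta>'"
    unfolding companion_def
  proof (intro allI impI)
    fix i assume i: "i < \<alpha>"
    have x: "[:0, 1:] * q k = (\<Sum>j<\<alpha>. [:T k j:] * q j) + [:\<delta> k:] * f" if "k < \<alpha>" for k
      using com that by (auto simp: companion_def)
    have c: "scal c * [:b:] = [:Polynomial.smult c b:]" for c :: 'k and b by simp
    have "[:0, 1:] * q' i = [:0, 1:] * q i - scal (w i) * ([:0, 1:] * q p)"
      unfolding q'_def by (simp only: right_diff_distrib mult.left_commute)
    also have "\<dots> = ((\<Sum>j<\<alpha>. [:T i j:] * q j) - (\<Sum>j<\<alpha>. [:Polynomial.smult (w i) (T p j):] * q j))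
        + ([:\<delta> i:] - [:Polynomial.smult (w i) (\<delta> p):]) * f"
      unfolding x[OF i] x[OF p(1)] distrib_left left_diff_distrib sum_distrib_left
      by (simp only: mult.assoc[symmetric] c) simp
    also have "\<dots> = (\<Sum>j<\<alpha>. [:S i j:] * q j) + [:\<delta>' i:] * f"
      unfolding sum_subtractf[symmetric] left_diff_distrib[symmetric] by (simp add: S_def \<delta>'_def)
    also have "(\<Sum>j<\<alpha>. [:S i j:] * q j)
        = (\<Sum>j<\<alpha>. [:S i j:] * q' j) + (\<Sum>j<\<alpha>. [:Polynomial.smult (w j) (S i j):]) * q' p"
      unfolding sum_distrib_right sum.distrib[symmetric]
    proof (rule sum.cong[OF refl])
      fix j
      have "[:S i j:] * q j = [:S i j:] * q' j + ([:S i j:] * scal (w j)) * q' p"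
        by (subst q') (simp only: distrib_left mult.assoc)
      then show "[:S i j:] * q j = [:S i j:] * q' j + [:Polynomial.smult (w j) (S i j):] * q' p"
        by (simp add: mult.commute)
    qed
    also have "(\<Sum>j<\<alpha>. [:Polynomial.smult (w j) (S i j):]) = [:\<Sum>j<\<alpha>. Polynomial.smult (w j) (S i j):]"
      by (induction \<alpha>) simp_all
    also have "[:\<Sum>j<\<alpha>. Polynomial.smult (w j) (S i j):] * q' p
        = (\<Sum>j<\<alpha>. [:if j = p then \<Sum>l<\<alpha>. Polynomial.smult (w l) (S i l) else 0:] * q' j)"
    proof -
      have "(\<Sum>j<\<alpha>. [:if j = p then \<Sum>l<\<alpha>. Polynomial.smult (w l) (S i l) else 0:] * q' j)
          = (\<Sum>j<\<alpha>. if j = p then [:\<Sum>l<\<alpha>. Polynomial.smult (w l) (S i l):] * q' j else 0)"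
        by (rule sum.cong) auto
      then show ?thesis using p(1) by simp
    qed
    also have "(\<Sum>j<\<alpha>. [:S i j:] * q' j) + \<dots> = (\<Sum>j<\<alpha>. [:T' i j:] * q' j)"
      unfolding sum.distrib[symmetric] distrib_right[symmetric] by (simp add: T'_def)
    finally show "[:0, 1:] * q' i = (\<Sum>j<\<alpha>. [:T' i j:] * q' j) + [:\<delta>' i:] * f" .
  qed
  have S: "tdeg_le (int (e i) + 1 - int (e j)) [:S i j:]" if "i < \<alpha>" "j < \<alpha>" for i j
    unfolding S_def using fits that p(1) w[of i] by (intro tdeg_le_const_diff) (auto simp: fits_def)
  show "fits \<alpha> e T' \<delta>'"
    unfolding fits_def
  proof (intro allI impI conjI)
    fix i assume i: "i < \<alpha>"
    show "tdeg_le (int (e i) + 1 - int \<alpha>) [:\<delta>' i:]"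
      unfolding \<delta>'_def using fits i p(1) w[of i] by (intro tdeg_le_const_diff) (auto simp: fits_def)
    fix j assume j: "j < \<alpha>"
    have "tdeg_le (int (e i) + 1 - int (e j)) [:\<Sum>l<\<alpha>. Polynomial.smult (w l) (S i l):]" if "j = p"
      unfolding that using S[OF i] w by (intro tdeg_le_const_sum) (metis)
    with S[OF i j] have "tdeg_le (int (e i) + 1 - int (e j))
        ([:S i j:] + [:if j = p then \<Sum>l<\<alpha>. Polynomial.smult (w l) (S i l) else 0:])"
      by (intro tdeg_le_add) auto
    then show "tdeg_le (int (e i) + 1 - int (e j)) [:T' i j:]" by (simp add: T'_def)
  qed
  show "gen_ideal \<alpha> f q' = gen_ideal \<alpha> f q"
  proof (rule equalityI)
    have "q' i \<in> gen_ideal \<alpha> f q" if "i < \<alpha>" for i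
    proof -
      have "q i + [:- [:w i:]:] * q p \<in> gen_ideal \<alpha> f q"
        by (rule gen_ideal_add[OF gen_ideal_gen[OF that] gen_ideal_const_mult[OF gen_ideal_gen[OF p(1)]]])
      moreover have "[:- [:w i:]:] = - scal (w i)" by simp
      ultimately show ?thesis by (simp only: q'_def mult_minus_left add_uminus_conv_diff)
    qed
    then show "gen_ideal \<alpha> f q' \<subseteq> gen_ideal \<alpha> f q" by (rule gen_ideal_subset)
    have "q' i + scal (w i) * q' p \<in> gen_ideal \<alpha> f q'" if "i < \<alpha>" for i
      by (rule gen_ideal_add[OF gen_ideal_gen[OF that] gen_ideal_const_mult[OF gen_ideal_gen[OF p(1)]]])
    then show "gen_ideal \<alpha> f q \<subseteq> gen_ideal \<alpha> f q'"
      unfolding q'[symmetric] by (rule gen_ideal_subset)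
  qed
qed

text \<open>The staircase data translated into the degrees e, in a fixed frame. The condition
  \<open>no\<close> excludes the degree u - 1.\<close>

locale type_zero_frame = frame o1 o2 o3 l1 l2 l3
  for o1 o2 o3 l1 l2 l3 :: "var \<Rightarrow> 'k :: {alg_closed_field, field_char_0}" +
  fixes n \<alpha> u r :: nat and e \<phi> \<psi> :: "nat \<Rightarrow> nat"
  assumes \<alpha>: "0 < \<alpha>"
    and ev_\<phi>: "\<exists>m0. \<forall>m\<ge>m0. \<phi> m = n" and ev_\<psi>: "\<exists>m0. \<forall>m\<ge>m0. \<psi> m = n"
    and cas_\<phi>: "\<And>m. castelnuovo \<phi> m
      = int (m + 1) - (if \<alpha> \<le> m then int (m - \<alpha> + 1) else 0) - int (below \<alpha> e m)"
    and cas_\<psi>: "\<And>m. castelnuovo \<psi> m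
      = castelnuovo \<phi> m + (if m = u then 1 else 0) - (if m = u + 2 then 1 else 0)"
    and pos: "castelnuovo \<phi> (u + 2) \<noteq> 0"
    and r: "r < \<alpha>" "e r = u + 3"
    and others: "\<And>i. i < \<alpha> \<Longrightarrow> i \<noteq> r \<Longrightarrow> e i \<le> u \<or> u + 5 \<le> e i"
    and no: "\<And>i. i < \<alpha> \<Longrightarrow> e i + 1 \<noteq> u"
    and ex: "\<exists>i<\<alpha>. e i = u"
begin

section \<open>Reduction to general position\<close>

abbreviation "target \<equiv> Hilb_topology n closure_of (Hilb_stratum n \<psi> :: 'k coord_ring set set)"

definition gen :: "(nat \<Rightarrow> nat \<Rightarrow> 'k poly) \<Rightarrow> (nat \<Rightarrow> 'k poly) \<Rightarrow> 'k poly poly set" where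
  "gen T \<delta> = gen_ideal \<alpha> (char_pol \<alpha> T) (char_sol \<alpha> T \<delta>)"

text \<open>By \<open>adapted_char_pol\<close>, T and \<delta> determine the generators, so ideals
  are parametrized by these matrices from here on.\<close>

definition good :: "(nat \<Rightarrow> nat \<Rightarrow> 'k poly) \<Rightarrow> (nat \<Rightarrow> 'k poly) \<Rightarrow> bool" where
  "good T \<delta> \<longleftrightarrow> fits \<alpha> e T \<delta> \<and> adapted \<alpha> e (char_pol \<alpha> T) (char_sol \<alpha> T \<delta>)"

lemma good_of:
  assumes ad: "adapted \<alpha> e f q" and com: "companion \<alpha> f q T \<delta>" and fits: "fits \<alpha> e T \<delta>"
  shows "good T \<delta>" "gen T \<delta> = gen_ideal \<alpha> f q"
proof -
  note f = adapted_char_pol[OF ad com \<alpha>]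
  have "adapted \<alpha> e (char_pol \<alpha> T) (char_sol \<alpha> T \<delta>)"
    using adapted_cong[OF ad, of "char_sol \<alpha> T \<delta>"] f by simp
  with fits show "good T \<delta>" by (simp add: good_def)
  show "gen T \<delta> = gen_ideal \<alpha> f q"
    unfolding gen_def f(1)[symmetric]
  proof (rule equalityI)
    show "gen_ideal \<alpha> f (char_sol \<alpha> T \<delta>) \<subseteq> gen_ideal \<alpha> f q"
      by (rule gen_ideal_subset) (simp add: f(2)[symmetric] gen_ideal_gen)
    show "gen_ideal \<alpha> f q \<subseteq> gen_ideal \<alpha> f (char_sol \<alpha> T \<delta>)"
      by (rule gen_ideal_subset) (simp add: f(2) gen_ideal_gen)
  qed
qed

lemma good_ideal:
  assumes "good T \<delta>"
  shows "adapted_ideal \<alpha> e (gen T \<delta>)" "hilbert_function (hom_ideal (gen T \<delta>)) = \<phi>"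
    "\<exists>m0. \<forall>m\<ge>m0. hilbert_function (hom_ideal (gen T \<delta>)) m = n"
proof -
  show ai: "adapted_ideal \<alpha> e (gen T \<delta>)"
    using assms companion_char_sol[of \<alpha> T \<delta>] unfolding adapted_ideal_def good_def gen_def by blast
  show "hilbert_function (hom_ideal (gen T \<delta>)) = \<phi>"
    by (rule castelnuovo_inject) (simp add: adapted_ideal_castelnuovo[OF ai \<alpha>] cas_\<phi>)
  with ev_\<phi> show "\<exists>m0. \<forall>m\<ge>m0. hilbert_function (hom_ideal (gen T \<delta>)) m = n" by simp
qed

text \<open>Perturbations within the degree bounds keep \<phi>, and closures are closed, so it is
  enough to treat almost all \<tau>. Goodness of the perturbed data holds for almost all \<tau> as
  well and may therefore be assumed.\<close>

lemma perturb:
  assumes good: "good T \<delta>" and T': "fits \<alpha> e T' (\<lambda>_. 0)"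
    and cl: "\<forall>\<^sub>F \<tau> in cofinite. good (\<lambda>i j. T i j + Polynomial.smult \<tau> (T' i j)) \<delta> \<longrightarrow>
      hom_ideal (gen (\<lambda>i j. T i j + Polynomial.smult \<tau> (T' i j)) \<delta>) \<in> target"
  shows "hom_ideal (gen T \<delta>) \<in> target"
proof (rule closure_step[OF infinite_UNIV_char_0 \<alpha> good_ideal(1,3)[OF good]])
  let ?T = "\<lambda>\<tau> i j. T i j + Polynomial.smult \<tau> (T' i j)"
  note P = adapted_deforms[OF _ T', of T \<delta>, simplified smult_0_right add_0_right]
  have fits: "fits \<alpha> e T \<delta>" and ad: "adapted \<alpha> e (char_pol \<alpha> T) (char_sol \<alpha> T \<delta>)"
    using good by (auto simp: good_def)
  have "\<forall>\<^sub>F \<tau> in cofinite. good (?T \<tau>) \<delta>"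
    using P(2)[OF fits ad] P(1)[OF fits ad] by (auto simp: good_def elim: eventually_mono)
  with cl show "\<forall>\<^sub>F \<tau> in cofinite. adapted_ideal \<alpha> e (gen (?T \<tau>) \<delta>) \<and>
      (\<exists>m0. \<forall>m\<ge>m0. hilbert_function (hom_ideal (gen (?T \<tau>) \<delta>)) m = n) \<and>
      hom_ideal (gen (?T \<tau>) \<delta>) \<in> target"
    by eventually_elim (use good_ideal(1,3) in blast)
  show "deforms n (gen T \<delta>) (\<lambda>\<tau>. gen (?T \<tau>) \<delta>)"
    unfolding gen_def by (rule P(3)[OF fits ad])
qed

lemma in_target_final:
  assumes good: "good T \<delta>" and p: "p < \<alpha>" "e p = u"
    and col: "\<And>i. i < \<alpha> \<Longrightarrow> e i \<le> u \<Longrightarrow> i \<noteq> p \<Longrightarrow> poly (T i p) a = 0"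
    and diag: "poly (T p p) a = poly (T r r) a"
    and lam: "lam \<noteq> 0" "lam\<^sup>2 = poly (T r p) a"
  shows "hom_ideal (gen T \<delta>) \<in> target"
proof -
  interpret D: type_zero_data \<alpha> e "char_pol \<alpha> T" "char_sol \<alpha> T \<delta>" T \<delta> u p r a lam
    using good p r others col diag lam companion_char_sol[of \<alpha> T \<delta>]
    by unfold_locales (auto simp: good_def)
  \<comment> \<open>The diagram of \<phi> has squares in column u + 2, and its nonempty columns lie
    below n.\<close>
  have "u + 2 < n"
    using adapted_ideal_point(4)[OF good_ideal(1)[OF good] \<alpha> good_ideal(3)[OF good], of "u + 2"]
      pos good_ideal(2)[OF good] by simp
  then have def: "deforms n (gen T \<delta>) (\<lambda>\<tau>. gen_ideal \<alpha> (D.ff \<tau>) (D.ww \<tau>))"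
    unfolding gen_def by (intro D.deforms_ww) simp
  show ?thesis
  proof (rule closure_step[OF infinite_UNIV_char_0 \<alpha> good_ideal(1,3)[OF good] _ def])
    show "\<forall>\<^sub>F \<tau> in cofinite. adapted_ideal \<alpha> D.e' (gen_ideal \<alpha> (D.ff \<tau>) (D.ww \<tau>)) \<and>
        (\<exists>m0. \<forall>m\<ge>m0. hilbert_function (hom_ideal (gen_ideal \<alpha> (D.ff \<tau>) (D.ww \<tau>))) m = n) \<and>
        hom_ideal (gen_ideal \<alpha> (D.ff \<tau>) (D.ww \<tau>)) \<in> target"
      using D.adapted_ww
    proof eventually_elim
      case (elim \<tau>)
      let ?b = "gen_ideal \<alpha> (D.ff \<tau>) (D.ww \<tau>)"
      have ai: "adapted_ideal \<alpha> D.e' ?b" using elim unfolding adapted_ideal_def by blast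
      have move: "int (below \<alpha> D.e' m)
          = int (below \<alpha> e m) - (if m = u then 1 else 0) + (if m = u + 2 then 1 else 0)" for m
        unfolding D.e'_def by (rule below_move[of p \<alpha> r e u m, OF p(1) r(1) p(2) r(2)])
      have h: "hilbert_function (hom_ideal ?b) = \<psi>"
      proof (rule castelnuovo_inject)
        fix m
        show "castelnuovo (hilbert_function (hom_ideal ?b)) m = castelnuovo \<psi> m"
          using move[of m] unfolding adapted_ideal_castelnuovo[OF ai \<alpha>] cas_\<psi> cas_\<phi> by linarith
      qed
      with ev_\<psi> have ev: "\<exists>m0. \<forall>m\<ge>m0. hilbert_function (hom_ideal ?b) m = n" by simp
      have "hom_ideal ?b \<in> topspace (Hilb_topology n) \<inter> Hilb_stratum n \<psi>"
        using adapted_ideal_point(1,3)[OF ai \<alpha> ev] h by (simp add: Hilb_stratum_def)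
      then have "hom_ideal ?b \<in> target" by (rule subsetD[OF closure_of_subset_Int])
      with ai ev show ?case by blast
    qed
  qed
qed

text \<open>The bound for \<open>T r p\<close> is degree 4, so a constant may be added to make its
  value at a nonzero; the field then contains a square root.\<close>

lemma in_target_of_column:
  assumes good: "good T \<delta>" and p: "p < \<alpha>" "e p = u"
    and col: "\<And>i. i < \<alpha> \<Longrightarrow> e i \<le> u \<Longrightarrow> i \<noteq> p \<Longrightarrow> poly (T i p) a = 0"
    and diag: "poly (T p p) a = poly (T r r) a"
  shows "hom_ideal (gen T \<delta>) \<in> target"
proof (rule perturb[OF good])
  let ?T' = "\<lambda>i j. if i = r \<and> j = p then 1 else 0 :: 'k poly"
  have rp: "r \<noteq> p" using p(2) r(2) by auto
  show "fits \<alpha> e ?T' (\<lambda>_. 0)"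
    unfolding fits_def tdeg_le_const using p(2) r(2) by (auto simp: coeff_1)
  have "\<forall>\<^sub>F \<tau> in cofinite. \<tau> \<noteq> - poly (T r p) a" by (simp add: eventually_cofinite)
  then show "\<forall>\<^sub>F \<tau> in cofinite. good (\<lambda>i j. T i j + Polynomial.smult \<tau> (?T' i j)) \<delta> \<longrightarrow>
      hom_ideal (gen (\<lambda>i j. T i j + Polynomial.smult \<tau> (?T' i j)) \<delta>) \<in> target"
  proof (rule eventually_mono, intro impI)
    fix \<tau> assume \<tau>: "\<tau> \<noteq> - poly (T r p) a"
      and g: "good (\<lambda>i j. T i j + Polynomial.smult \<tau> (?T' i j)) \<delta>"
    obtain lam where lam: "lam\<^sup>2 = poly (T r p) a + \<tau>"
      using nth_root_exists[of 2 "poly (T r p) a + \<tau>"] by auto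
    have "lam \<noteq> 0"
    proof
      assume "lam = 0"
      then have "poly (T r p) a + \<tau> = 0" using lam by simp
      with \<tau> show False by (simp add: add_eq_0_iff)
    qed
    then show "hom_ideal (gen (\<lambda>i j. T i j + Polynomial.smult \<tau> (?T' i j)) \<delta>) \<in> target"
      using lam col diag rp r(2) by (intro in_target_final[OF g p, of a lam]) auto
  qed
qed

text \<open>A change of the generators of degree \<open>u\<close> turns the eigenvector \<open>v\<close> into a unit vector.\<close>
lemma in_target_of_eigenvector:
  assumes good: "good T \<delta>"
    and v: "i0 < \<alpha>" "e i0 = u" "v i0 \<noteq> 0"
    and eigen: "\<And>i. i < \<alpha> \<Longrightarrow> e i = u \<Longrightarrow>
      (\<Sum>j | j < \<alpha> \<and> e j = u. poly (T i j) a * v j) = poly (T r r) a * v i"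
  shows "hom_ideal (gen T \<delta>) \<in> target"
proof -
  let ?p = i0
  let ?E = "{j. j < \<alpha> \<and> e j = u}"
  define V where "V j = v j / v ?p" for j
  define w where "w j = (if j \<in> ?E \<and> j \<noteq> ?p then V j else 0)" for j
  have Vp: "V ?p = 1" using v(3) by (simp add: V_def)
  have eigenV: "(\<Sum>j\<in>?E. V j * poly (T i j) a) = poly (T r r) a * V i" if "i \<in> ?E" for i
    using eigen[of i] that by (simp add: V_def sum_divide_distrib[symmetric] mult.commute)
  have fits: "fits \<alpha> e T \<delta>" and ad: "adapted \<alpha> e (char_pol \<alpha> T) (char_sol \<alpha> T \<delta>)"
    using good by (auto simp: good_def)
  define S where "S i j = T i j - Polynomial.smult (w i) (T ?p j)" for i j
  define T' where "T' i j = S i j + (if j = ?p then \<Sum>l<\<alpha>. Polynomial.smult (w l) (S i l) else 0)" for i j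
  have wp: "w ?p = 0" by (simp add: w_def)
  have wE: "w i \<noteq> 0 \<Longrightarrow> i < \<alpha> \<and> e i = e ?p" for i using v(2) by (auto simp: w_def split: if_splits)
  note bc = base_change[of \<alpha> e "char_pol \<alpha> T" "char_sol \<alpha> T \<delta>" T \<delta> ?p w, OF ad companion_char_sol fits v(1) wp wE, folded S_def, folded T'_def]
  have eq: "gen T' (\<lambda>i. \<delta> i - Polynomial.smult (w i) (\<delta> ?p)) = gen T \<delta>"
    using good_of(2)[OF bc(1-3)] bc(4) by (simp add: gen_def)
  have val: "poly (T' i ?p) a = (\<Sum>j\<in>?E. V j * poly (T i j) a) - w i * (\<Sum>j\<in>?E. V j * poly (T ?p j) a)" for i
  proof -
    have "poly (T' i ?p) a = poly (S i ?p) a + (\<Sum>l<\<alpha>. w l * poly (S i l) a)"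
      by (simp add: T'_def poly_sum)
    also have "(\<Sum>l<\<alpha>. w l * poly (S i l) a) = (\<Sum>l\<in>?E - {?p}. V l * poly (S i l) a)"
      by (rule sum.mono_neutral_cong_right) (auto simp: w_def)
    also have "poly (S i ?p) a + \<dots> = (\<Sum>l\<in>?E. V l * poly (S i l) a)"
      using sum.remove[of ?E ?p "\<lambda>l. V l * poly (S i l) a"] v(1,2) Vp by simp
    also have "\<dots> = (\<Sum>j\<in>?E. V j * poly (T i j) a) - w i * (\<Sum>j\<in>?E. V j * poly (T ?p j) a)"
      unfolding sum_distrib_left sum_subtractf[symmetric]
      by (rule sum.cong) (simp_all add: S_def algebra_simps)
    finally show ?thesis .
  qed
  have val_E: "poly (T' i ?p) a = poly (T r r) a * (V i - w i)" if "i \<in> ?E" for i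
    unfolding val eigenV[OF that] using eigenV[of ?p] v(1,2) Vp by (simp add: algebra_simps)
  have "hom_ideal (gen T' (\<lambda>i. \<delta> i - Polynomial.smult (w i) (\<delta> ?p))) \<in> target"
  proof (rule in_target_of_column[OF good_of(1)[OF bc(1-3)] v(1,2), of a])
    have "w r = 0" "r \<noteq> ?p" using r(2) v(2) by (auto simp: w_def)
    then have "poly (T' r r) a = poly (T r r) a" by (simp add: T'_def S_def)
    moreover have "poly (T' ?p ?p) a = poly (T r r) a" using val_E[of ?p] v(1,2) Vp wp by simp
    ultimately show "poly (T' ?p ?p) a = poly (T' r r) a" by simp
    fix i assume i: "i < \<alpha>" "e i \<le> u" "i \<noteq> ?p"
    show "poly (T' i ?p) a = 0"
    proof (cases "e i = u")
      case True
      with i val_E[of i] show ?thesis by (simp add: w_def)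
    next
      case False
      \<comment> \<open>Here the missing degree u - 1 enters: rows of degree at most u - 2 vanish in
        the columns of degree u.\<close>
      with i no[of i] have "e i + 2 \<le> u" by linarith
      have "T i j = 0" if "j \<in> ?E" for j
      proof -
        have "tdeg_le (int (e i) + 1 - int (e j)) [:T i j:]" using fits i(1) that by (auto simp: fits_def)
        then have "[:T i j:] = 0" by (rule tdeg_le_neg) (use that \<open>e i + 2 \<le> u\<close> in auto)
        then show ?thesis by simp
      qed
      moreover have "w i = 0" using False by (simp add: w_def)
      ultimately show ?thesis unfolding val by simp
    qed
  qed
  then show ?thesis unfolding eq .
qed

text \<open>After adding a multiple of \<open>y\<close> to its diagonal, the pencil of the block of degree \<open>u\<close> has an eigenvector.\<close>
lemma in_target:
  assumes good: "good T \<delta>"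
  shows "hom_ideal (gen T \<delta>) \<in> target"
proof (rule perturb[OF good])
  let ?E = "{j. j < \<alpha> \<and> e j = u}"
  let ?T' = "\<lambda>i j. if i = j \<and> i \<in> ?E then [:0, 1:] else 0 :: 'k poly"
  show "fits \<alpha> e ?T' (\<lambda>_. 0)"
    unfolding fits_def tdeg_le_const by (auto simp: coeff_pCons split: nat.splits)
  have lin: "b = [:coeff b 0, coeff b 1:]" if "tdeg_le 1 [:b:]" for b :: "'k poly"
  proof (rule poly_eqI)
    fix j show "coeff b j = coeff [:coeff b 0, coeff b 1:] j"
      using that[unfolded tdeg_le_const, rule_format, of j] by (auto simp: coeff_pCons split: nat.splits)
  qed
  have fits: "fits \<alpha> e T \<delta>" using good by (simp add: good_def)
  have T_lin: "poly (T i j) a = coeff (T i j) 0 + a * coeff (T i j) 1" if "i < \<alpha>" "j < \<alpha>" "e i = e j" for i j a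
  proof -
    have "tdeg_le (int (e i) + 1 - int (e j)) [:T i j:]" using fits that(1,2) by (auto simp: fits_def)
    then have "tdeg_le 1 [:T i j:]" using that(3) by simp
    from lin[OF this] show ?thesis by (metis poly_pCons poly_0 add.right_neutral mult_zero_right)
  qed
  \<comment> \<open>Entries between equal degrees are at most linear in y. So A + a B is the value
    at y = a of the block of degree u minus \<open>T r r\<close> times the identity.\<close>
  define A where "A i j = coeff (T i j) 0 - (if i = j then coeff (T r r) 0 else 0)" for i j
  define B where "B i j = coeff (T i j) 1 - (if i = j then coeff (T r r) 1 else 0)" for i j
  have E: "finite ?E" "?E \<noteq> {}" using ex by auto
  from exists_pencil_kernel[OF E, of A B]
  show "\<forall>\<^sub>F \<tau> in cofinite. good (\<lambda>i j. T i j + Polynomial.smult \<tau> (?T' i j)) \<delta> \<longrightarrow>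
      hom_ideal (gen (\<lambda>i j. T i j + Polynomial.smult \<tau> (?T' i j)) \<delta>) \<in> target"
  proof (rule eventually_mono, intro impI)
    fix \<tau>
    assume "\<exists>a v. (\<exists>i\<in>?E. v i \<noteq> 0) \<and>
        (\<forall>i\<in>?E. (\<Sum>j\<in>?E. (A i j + a * (B i j + (if i = j then \<tau> else 0))) * v j) = 0)"
      and g: "good (\<lambda>i j. T i j + Polynomial.smult \<tau> (?T' i j)) \<delta>"
    then obtain a v i0 where i0: "i0 < \<alpha>" "e i0 = u" "v i0 \<noteq> 0"
      and ker: "\<And>i. i \<in> ?E \<Longrightarrow> (\<Sum>j\<in>?E. (A i j + a * (B i j + (if i = j then \<tau> else 0))) * v j) = 0"
      by blast
    show "hom_ideal (gen (\<lambda>i j. T i j + Polynomial.smult \<tau> (?T' i j)) \<delta>) \<in> target"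
    proof (rule in_target_of_eigenvector[where v = v and a = a, OF g i0])
      fix i assume i: "i < \<alpha>" "e i = u"
      have "(\<Sum>j\<in>?E. poly (T i j + Polynomial.smult \<tau> (?T' i j)) a * v j)
          = (\<Sum>j\<in>?E. (A i j + a * (B i j + (if i = j then \<tau> else 0))) * v j
              + (if j = i then poly (T r r) a * v i else 0))"
      proof (rule sum.cong[OF refl])
        fix j assume j: "j \<in> ?E"
        have "poly (T i j) a = coeff (T i j) 0 + a * coeff (T i j) 1" using i j by (intro T_lin) auto
        moreover have "poly (T r r) a = coeff (T r r) 0 + a * coeff (T r r) 1" using r by (intro T_lin) auto
        ultimately show "poly (T i j + Polynomial.smult \<tau> (?T' i j)) a * v j
            = (A i j + a * (B i j + (if i = j then \<tau> else 0))) * v j + (if j = i then poly (T r r) a * v i else 0)"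
          using i by (auto simp: A_def B_def algebra_simps)
      qed
      also have "\<dots> = poly (T r r) a * v i" unfolding sum.distrib using ker[of i] i by simp
      also have "poly (T r r) a = poly (T r r + Polynomial.smult \<tau> (?T' r r)) a" using r by simp
      finally show "(\<Sum>j\<in>?E. poly (T i j + Polynomial.smult \<tau> (?T' i j)) a * v j)
          = poly (T r r + Polynomial.smult \<tau> (?T' r r)) a * v i" .
    qed
  qed
qed

end

theorem proposition1p6:
  fixes n :: nat and \<phi> \<psi> :: "nat \<Rightarrow> nat"
  assumes "\<phi> \<in> hilbert_function ` (Hilb n :: 'k :: {alg_closed_field, field_char_0} coord_ring set set)"
    and "\<psi> \<in> hilbert_function ` (Hilb n :: 'k coord_ring set set)"
    and "type_zero \<phi> \<psi>"
  shows "(Hilb_stratum n \<phi> :: 'k coord_ring set set)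
           \<subseteq> Hilb_topology n closure_of Hilb_stratum n \<psi>"
proof
  fix J :: "'k coord_ring set" assume "J \<in> Hilb_stratum n \<phi>"
  then have J: "J \<in> Hilb n" and h: "hilbert_function J = \<phi>" by (auto simp: Hilb_stratum_def)
  have ev_\<phi>: "\<exists>m0. \<forall>m\<ge>m0. \<phi> m = n" and ev_\<psi>: "\<exists>m0. \<forall>m\<ge>m0. \<psi> m = n"
    using assms(1,2) by (auto simp: Hilb_def)
  obtain u :: nat and s :: int where tz: "u \<ge> 2" "s \<ge> 1"
    "castelnuovo \<phi> (u - 2) = castelnuovo \<phi> (u - 1)" "castelnuovo \<phi> (u - 1) \<ge> s + 1"
    "castelnuovo \<phi> u = s" "castelnuovo \<phi> (u + 1) = s" "castelnuovo \<phi> (u + 2) = s"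
    "castelnuovo \<phi> (u + 3) = s - 1" "castelnuovo \<phi> (u + 4) = s - 1"
    "castelnuovo \<psi> u = castelnuovo \<phi> u + 1" "castelnuovo \<psi> (u + 2) = castelnuovo \<phi> (u + 2) - 1"
    "\<And>m. m \<noteq> u \<Longrightarrow> m \<noteq> u + 2 \<Longrightarrow> castelnuovo \<psi> m = castelnuovo \<phi> m"
    using assms(3) unfolding type_zero_def by blast
  note JD = ideal_subspaceD[OF HilbD(2)[OF J]]
  have J1: "1 \<notin> J"
  proof
    assume "1 \<in> J"
    then have "J = UNIV" using JD(4)[of 1] by auto
    then have "\<phi> m = 0" for m by (simp add: h[symmetric] hilbert_function_def)
    then have "castelnuovo \<phi> u = 0" by (simp add: castelnuovo_def)
    with tz(2,5) show False by simp
  qed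
  interpret std: frame "unit VX" "unit VY" "unit VZ" "unit VX" "unit VY" "unit VZ :: var \<Rightarrow> 'k"
    by (rule frame_unit)
  \<comment> \<open>Otherwise \<phi> would count all monomials and exceed n in large
    degrees.\<close>
  have "\<exists>m. \<exists>f\<in>J \<inter> homogeneous_part m. f \<noteq> 0"
  proof (rule ccontr)
    assume no: "\<not> ?thesis"
    obtain m0 where m0: "\<And>m. m0 \<le> m \<Longrightarrow> \<phi> m = n" using ev_\<phi> by blast
    let ?m = "max m0 n"
    have "J \<inter> homogeneous_part ?m \<subseteq> kvec.span {}" using no by auto
    then have "kvec.dim (J \<inter> homogeneous_part ?m) \<le> card ({} :: 'k coord_ring set)"
      by (rule kvec.dim_le_card) simp
    then have "\<phi> ?m = card (triangle ?m)"
      by (simp add: h[symmetric] hilbert_function_def std.dim_homogeneous_part)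
    with m0[of ?m] card_triangle_ge[of ?m] show False by simp
  qed
  then obtain \<alpha> f1 where f1: "f1 \<in> J" "f1 \<in> homogeneous_part \<alpha>" "f1 \<noteq> 0"
    and min: "\<And>m f. m < \<alpha> \<Longrightarrow> f \<in> J \<Longrightarrow> f \<in> homogeneous_part m \<Longrightarrow> f = 0"
    using exists_least_iff[of "\<lambda>m. \<exists>f\<in>J \<inter> homogeneous_part m. f \<noteq> 0"] by blast
  obtain o1 o2 o3 l1 l2 l3 where frame: "frame o1 o2 o3 l1 l2 l3" and o1: "mpoly_eval o1 f1 \<noteq> 0"
    and no_zero: "\<And>a. \<exists>f\<in>J. mpoly_eval (\<lambda>v. a * o1 v + o2 v) f \<noteq> 0"
    using exists_frame[OF J f1(2,3)] by blast
  interpret F: frame o1 o2 o3 l1 l2 l3 by (rule frame)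
  define f0 where "f0 = mpoly_scale (inverse (mpoly_eval o1 f1)) f1"
  \<comment> \<open>\<open>o1\<close> is the point a = 1, b = 0 of the line at infinity, at which
    only the coefficient of \<open>x^\<alpha>\<close> survives.\<close>
  have "mpoly_eval o1 f1 = (\<Sum>j\<le>\<alpha>. coeff (coeff (F.dehom f1) j) (\<alpha> - j) * 0 ^ (\<alpha> - j))"
    using F.eval_line[OF f1(2), of 1 0] by simp
  also have "\<dots> = (\<Sum>j\<le>\<alpha>. if j = \<alpha> then coeff (coeff (F.dehom f1) j) 0 else 0)"
    by (rule sum.cong) auto
  also have "\<dots> = coeff (coeff (F.dehom f1) \<alpha>) 0" by simp
  finally have lc: "coeff (coeff (F.dehom f0) \<alpha>) 0 = 1"
    using o1 by (simp add: f0_def F.dehom_simps)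
  interpret G: general_frame o1 o2 o3 l1 l2 l3 n J \<alpha> f0
  proof
    show "f0 \<in> J" unfolding f0_def mpoly_scale_def by (rule JD(4)[OF f1(1)])
    show "f0 \<in> homogeneous_part \<alpha>" unfolding f0_def by (rule homogeneous_part_scale[OF f1(2)])
  qed (fact J lc no_zero)+
  have \<alpha>: "0 < \<alpha>" by (rule G.alpha_pos[OF J1])
  obtain e q T \<delta> where gen: "adapted \<alpha> e G.F q" "companion \<alpha> G.F q T \<delta>" "fits \<alpha> e T \<delta>"
      "J = F.hom_ideal (gen_ideal \<alpha> G.F q)"
    using G.exists_adapted[OF \<alpha> min] .
  have ai: "adapted_ideal \<alpha> e (gen_ideal \<alpha> G.F q)" using gen(1,2) by (auto simp: adapted_ideal_def)
  have cas: "castelnuovo \<phi> m = int (m + 1) - (if \<alpha> \<le> m then int (m - \<alpha> + 1) else 0) - int (below \<alpha> e m)" for m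
    using F.adapted_ideal_castelnuovo[OF ai \<alpha>] gen(4) h by simp
  have b0: "below \<alpha> e m = 0" if "m < \<alpha>" for m
    using adaptedD(4)[OF gen(1)] that by (force simp: below_def)
  have small: "castelnuovo \<phi> m = int (m + 1)" if "m < \<alpha>" for m using b0[OF that] that by (simp add: cas)
  \<comment> \<open>Below \<alpha> the Castelnuovo function is m + 1, hence strictly increasing;
    equal values at u - 2 and u - 1 rule this out.\<close>
  have u\<alpha>: "\<alpha> < u"
  proof (rule ccontr)
    assume "\<not> \<alpha> < u"
    then have "u - 2 < \<alpha>" "u - 1 < \<alpha>" using tz(1) by linarith+
    with tz(1,3) show False using small[of "u - 2"] small[of "u - 1"] by simp
  qed
  \<comment> \<open>The case m = \<alpha> - 1, where both formulas give \<alpha>, is included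
    because u - 2 may be \<alpha> - 1.\<close>
  have large: "castelnuovo \<phi> m = int \<alpha> - int (below \<alpha> e m)" if "\<alpha> \<le> m + 1" for m
    using that b0[of m] by (cases "\<alpha> \<le> m") (auto simp: cas)
  \<comment> \<open>Each drop of the staircase of \<phi> from one column to the next is the number
    of generators of that degree.\<close>
  have below: "below \<alpha> e (u - 2) = below \<alpha> e (u - 1)" "below \<alpha> e (u - 1) < below \<alpha> e u"
      "below \<alpha> e (u + 1) = below \<alpha> e u" "below \<alpha> e (u + 2) = below \<alpha> e (u + 1)"
      "below \<alpha> e (u + 3) = below \<alpha> e (u + 2) + 1" "below \<alpha> e (u + 4) = below \<alpha> e (u + 3)"
    using tz(3-9) large[of "u - 2"] large[of "u - 1"] large[of u] large[of "u + 1"] large[of "u + 2"]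
      large[of "u + 3"] large[of "u + 4"] u\<alpha> tz(1) by auto
  have below_succ: "below \<alpha> e m' = below \<alpha> e m + card {i. i < \<alpha> \<and> e i = m'}" if "m' = Suc m" for m m'
    using below_Suc[of \<alpha> e m] that by simp
  have below_step:
    "below \<alpha> e (u - 1) = below \<alpha> e (u - 2) + card {i. i < \<alpha> \<and> e i = u - 1}"
    "below \<alpha> e (u) = below \<alpha> e (u - 1) + card {i. i < \<alpha> \<and> e i = u}"
    "below \<alpha> e (u + 1) = below \<alpha> e (u) + card {i. i < \<alpha> \<and> e i = u + 1}"
    "below \<alpha> e (u + 2) = below \<alpha> e (u + 1) + card {i. i < \<alpha> \<and> e i = u + 2}"
    "below \<alpha> e (u + 3) = below \<alpha> e (u + 2) + card {i. i < \<alpha> \<and> e i = u + 3}"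
    "below \<alpha> e (u + 4) = below \<alpha> e (u + 3) + card {i. i < \<alpha> \<and> e i = u + 4}"
    by (rule below_succ, use tz(1) in linarith)+
  have cnt: "card {i. i < \<alpha> \<and> e i = u - 1} = 0" "card {i. i < \<alpha> \<and> e i = u} \<noteq> 0"
      "card {i. i < \<alpha> \<and> e i = u + 1} = 0" "card {i. i < \<alpha> \<and> e i = u + 2} = 0"
      "card {i. i < \<alpha> \<and> e i = u + 3} = 1" "card {i. i < \<alpha> \<and> e i = u + 4} = 0"
    using below below_step tz(1) by linarith+
  have none: "e i \<noteq> u - 1" "e i \<noteq> u + 1" "e i \<noteq> u + 2" "e i \<noteq> u + 4" if "i < \<alpha>" for i
    using cnt that by auto
  obtain r where r: "{i. i < \<alpha> \<and> e i = u + 3} = {r}" using cnt(5) by (rule card_1_singletonE)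
  interpret type_zero_frame o1 o2 o3 l1 l2 l3 n \<alpha> u r e \<phi> \<psi>
  proof
    fix i assume i: "i < \<alpha>"
    show "e i + 1 \<noteq> u" using none(1)[OF i] tz(1) by auto
    assume "i \<noteq> r"
    then have "e i \<noteq> u + 3" using r i by blast
    with none[OF i] show "e i \<le> u \<or> u + 5 \<le> e i" by linarith
  next
    have "r \<in> {i. i < \<alpha> \<and> e i = u + 3}" using r by blast
    then show "r < \<alpha>" "e r = u + 3" by blast+
    show "\<exists>i<\<alpha>. e i = u" using cnt(2) by (auto simp: card_eq_0_iff)
    show "castelnuovo \<phi> (u + 2) \<noteq> 0" using tz(2,7) by simp
    fix m
    show "castelnuovo \<psi> m = castelnuovo \<phi> m + (if m = u then 1 else 0) - (if m = u + 2 then 1 else 0)"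
      using tz(10-12) by auto
  qed (fact \<alpha> ev_\<phi> ev_\<psi> cas)+
  show "J \<in> Hilb_topology n closure_of Hilb_stratum n \<psi>"
    using in_target[OF good_of(1)[OF gen(1-3)]] good_of(2)[OF gen(1-3)] gen(4) by simp
qed

end
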